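(* For any interval $I\subseteq[0,\frac{\pi}{4}]$ and any $r,\alpha,\delta>0$, one has $$\varepsilon^r\int_I l_\varepsilon^r(\omega)\,d\omega = c_r\int_I\frac{dx}{\cos^r x}+\begin{cases} O_{r,\delta}\big(\varepsilon^{\frac12-2\alpha-\delta}+|I|\,\varepsilon^{\alpha}\big) & \text{if } r\neq2,\\ O_\delta\big(\varepsilon^{\frac12-\delta}\big) & \text{if } r=2,\end{cases}\qquad\text{as }\varepsilon\to0^+,$$ where $$c_r=\frac{12}{\pi^2}\int_0^{1/2}\left( x\big(x^{r-1}+(1-x)^{r-1}\big)+\frac{1-(1-x)^r}{rx(1-x)}-\frac{1-(1-x)^{r+1}}{(r+1)x(1-x)}\right)dx .$$
   Context: For $0<\varepsilon<\frac12$, let $C_\varepsilon=\big(\{0\}\times[-\varepsilon,\varepsilon]\big)\cup\big([-\varepsilon,\varepsilon]\times\{0\}\big)$ (a cross-like scatterer). For a direction (angle) $\omega$, the free path length of the unit-speed particle starting at the origin with cross-like scatterers placed at all nonzero integer lattice points is $$l_\varepsilon(\omega)=\inf\{\tau>0:(\tau\cos\omega,\tau\sin\omega)\in C_\varepsilon+(\mathbb{Z}^2\setminus\{(0,0)\})\}.$$ $l_\varepsilon^r(\omega)$ means $(l_\varepsilon(\omega))^r$, and $|I|$ is the length of $I$. The notation $F=O_{r,\delta}(G)$ as $\varepsilon\to0^+$ means $|F|\le C\,G$ for all sufficiently small $\varepsilon>0$, where the constant $C$ depends only on the parameters in the subscript. *)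

theory Defs
  imports "HOL-Analysis.Analysis"
begin

definition cross :: "real \<Rightarrow> (real \<times> real) set" where
  "cross \<epsilon> = {0} \<times> {-\<epsilon>..\<epsilon>} \<union> {-\<epsilon>..\<epsilon>} \<times> {0}"

text \<open>The sum of sets is the Minkowski sum. For directions in the first octant the infimum is
  over a nonempty set bounded below (see the lemma below), so it is a genuine real infimum.\<close>

definition free_path :: "real \<Rightarrow> real \<Rightarrow> real" where
  "free_path \<epsilon> \<omega> =
     Inf {\<tau>. \<tau> > 0 \<and> (\<tau> * cos \<omega>, \<tau> * sin \<omega>) \<in> cross \<epsilon> + (\<int> \<times> \<int> - {(0, 0)})}"

lemma free_path_nonempty:
  fixes \<epsilon> \<omega> :: real
  assumes "0 < \<epsilon>" and "\<omega> \<in> {0..pi/4}"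
  shows "{\<tau>. \<tau> > 0 \<and> (\<tau> * cos \<omega>, \<tau> * sin \<omega>) \<in> cross \<epsilon> + (\<int> \<times> \<int> - {(0, 0)})} \<noteq> {}"
proof -
  have c: "cos \<omega> > 0"
    by (rule cos_gt_zero_pi) (use assms(2) pi_gt_zero in \<open>simp_all, linarith+\<close>)
  obtain N :: nat where N: "N > 0" "1 / N < \<epsilon>"
    using assms(1) by (metis nat_approx_posE zero_less_Suc)
  obtain h k where hk: "0 < k" "\<bar>of_int k * tan \<omega> - of_int h\<bar> < 1 / N"
    using Dirichlet_approx[OF N(1)] by metis
  define \<tau> where "\<tau> = of_int k / cos \<omega>"
  have "(\<tau> * cos \<omega>, \<tau> * sin \<omega>) =
      (0, of_int k * tan \<omega> - of_int h) + (of_int k, of_int h)"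
    using c by (simp add: \<tau>_def tan_def)
  moreover have "(0, of_int k * tan \<omega> - of_int h) \<in> cross \<epsilon>"
    using hk(2) N(2) by (auto simp: cross_def)
  moreover have "(of_int k, of_int h) \<in> (\<int> \<times> \<int> - {(0, 0)} :: (real \<times> real) set)"
    using hk(1) by auto
  ultimately have "(\<tau> * cos \<omega>, \<tau> * sin \<omega>) \<in> cross \<epsilon> + (\<int> \<times> \<int> - {(0, 0)})"
    by (metis set_plus_intro)
  moreover have "\<tau> > 0"
    using hk(1) c by (simp add: \<tau>_def)
  ultimately show ?thesis
    by blast
qed

definition moment_const :: "real \<Rightarrow> real" where
  "moment_const r = 12 / pi\<^sup>2 *
     (LBINT x:{0..1/2}.
        x * (x powr (r - 1) + (1 - x) powr (r - 1))
        + (1 - (1 - x) powr r) / (r * x * (1 - x))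
        - (1 - (1 - x) powr (r + 1)) / ((r + 1) * x * (1 - x)))"

end

theory Submission
  imports Defs
    "HOL-Number_Theory.Number_Theory"
    "HOL-Computational_Algebra.Squarefree"
    "HOL-Algebra.Algebraic_Closure_Type"
    "Berlekamp_Zassenhaus.Finite_Field"
begin

text \<open>Put \<open>t = tan \<omega>\<close>. A particle leaving the origin in the direction \<open>\<omega>\<close> meets the vertical line with
abscissa \<open>k\<close> at height \<open>k t\<close>, and a vertical bar stops it there exactly when \<open>k t\<close> is within \<open>\<epsilon>\<close> of an
integer. A horizontal bar can stop it earlier than the first vertical one, but by at most
\<open>\<epsilon> / cos \<omega>\<close>. Hence the free path is \<open>N / cos \<omega>\<close> up to \<open>\<epsilon> / cos \<omega>\<close>, where \<open>N = first_hit \<epsilon> t\<close> is the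
least \<open>k > 0\<close> whose multiple \<open>k t\<close> is \<open>\<epsilon>\<close>-close to an integer (\<open>free_path_bounds\<close>), and the moments of
the free path reduce to integrals of \<open>(\<epsilon> N)\<^sup>r\<close> over \<open>t\<close>.

Let \<open>Q = \<lfloor>1/\<epsilon>\<rfloor>\<close>. The Farey fractions of order \<open>Q\<close> cut \<open>(0, 1)\<close> into tiles \<open>(a/q, b/y)\<close> with
\<open>b q - a y = 1\<close> and \<open>q, y \<le> Q < q + y\<close>. On such a tile \<open>N\<close> equals the smaller denominator on the
part of length \<open>\<epsilon> / min q y\<close> that touches the fraction with this denominator, and the larger
denominator on the remaining part (\<open>first_hit_farey_pair\<close>). So a tile with denominators \<open>q < x\<close>
contributes an explicit amount \<open>tile_mass\<close>, and the integral over \<open>[0, u]\<close> becomes a sum over pairs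
\<open>q < x\<close> of this amount times the number of numerators \<open>a \<le> u q\<close> with \<open>a x \<equiv> -1\<close> or \<open>a x \<equiv> 1\<close> modulo \<open>q\<close>,
up to the one tile that contains \<open>u\<close> (\<open>tile_boundary_error\<close>).

Inverses modulo \<open>q\<close> are equidistributed: the solutions of \<open>c x y \<equiv> 1\<close> modulo \<open>q\<close> in a box number
\<open>\<phi>(q) / q\<^sup>2\<close> times the area of the box, with an error that completion of the sum expresses
through Kloosterman sums (\<open>box_count_bound\<close>). Weil's bound makes this error about \<open>q\<^sup>1\<^sup>/\<^sup>2\<close> for
most \<open>q\<close>. For moduli with a large square factor the elementary estimate used here is weaker, but
these are rare and harmless on average (\<open>sum_box_err\<close>). Replacing the counts by their expected
values costs \<open>\<epsilon> Q\<^sup>1\<^sup>/\<^sup>2\<close> up to small powers, that is \<open>\<epsilon>\<^sup>1\<^sup>/\<^sup>2\<close> up to small powers, for every \<open>r\<close>. In the main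
term \<open>\<phi>(q) / q\<close> has mean value \<open>6 / \<pi>\<^sup>2\<close>, and the sums over \<open>x\<close> and \<open>q\<close> are Riemann sums of the integral
in \<open>moment_const\<close> (\<open>tile_sum_error\<close>). Since \<open>\<epsilon> < 1\<close>, the power \<open>\<epsilon>\<^sup>1\<^sup>/\<^sup>2\<^sup>-\<^sup>\<delta>\<close> is below \<open>\<epsilon>\<^sup>1\<^sup>/\<^sup>2\<^sup>-\<^sup>2\<^sup>\<alpha>\<^sup>-\<^sup>\<delta>\<close>, so one estimate
serves both cases of the theorem.

Finally the substitution \<open>t = tan \<omega>\<close> turns \<open>d\<omega> / cos\<^sup>r \<omega>\<close> into \<open>(1 + t\<^sup>2)\<close> to the power \<open>r/2 - 1\<close> times \<open>dt\<close>. This weight is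
monotone, so the second mean value theorem transfers the estimate from the intervals \<open>[0, u]\<close> to the
weighted integral (\<open>interval_moment\<close>).

Weil's bound for prime moduli is proved from scratch by Stepanov's method. In an algebraically
closed field of characteristic \<open>p\<close> the field with \<open>p\<^sup>n\<close> elements consists of the roots of
\<open>x ^ (p ^ n) = x\<close>. An auxiliary polynomial shows that the trace of \<open>a x + b / x\<close>, for \<open>x\<close> in the field with
\<open>p\<^sup>2\<^sup>m\<close> elements, takes no value much more often than on average (\<open>stepanov_fibre_bound\<close>), so the Kloosterman
sums over these fields are \<open>O(p\<^sup>m)\<close>. The L-function whose logarithmic
derivative generates the sums over all extensions is a polynomial of degree 2, so the sums are equal to \<open>- (\<alpha>\<^sup>n + \<beta>\<^sup>n)\<close> with \<open>\<alpha> \<beta> = p\<close>. The growth bound for even \<open>n\<close> then forces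
\<open>\<alpha>\<close> and \<open>\<beta>\<close> to have absolute value at most the square root of \<open>p\<close> (\<open>weil_bound\<close>).\<close>

(* These names belong to the record-based algebra below the algebraic closure. *)
hide_const (open) Divisibility.prime Polynomials.degree Polynomials.lead_coeff up_ring.coeff up_ring.monom Coset.order Module.smult

section \<open>Polynomials over fields and their roots\<close>

text \<open>This is the dimension count at the heart of Stepanov's method: polynomials whose coefficients
vanish from index \<open>D\<close> on lie in a space of dimension \<open>D\<close>, so more than \<open>D\<close> of them are dependent.
The induction on \<open>D\<close> eliminates the top coefficient with one of the polynomials.\<close>

lemma linear_dependence_poly:
  fixes e :: "'i \<Rightarrow> 'a::field poly"
  assumes "finite I" "card I > D" "\<And>i n. i \<in> I \<Longrightarrow> n \<ge> D \<Longrightarrow> coeff (e i) n = 0"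
  shows "\<exists>s. (\<exists>i\<in>I. s i \<noteq> 0) \<and> (\<Sum>i\<in>I. smult (s i) (e i)) = 0"
  using assms
proof (induction D arbitrary: I e)
  case 0
  then have z: "e i = 0" if "i \<in> I" for i
    using that by (auto simp: poly_eq_iff)
  obtain i where "i \<in> I" using 0(2) by fastforce
  then show ?case using z by (intro exI[of _ "\<lambda>_. 1"]) auto
next
  case (Suc D)
  show ?case
  proof (cases "\<forall>i\<in>I. coeff (e i) D = 0")
    case True
    have "coeff (e i) n = 0" if "i \<in> I" "n \<ge> D" for i n
      using that True Suc.prems(3)[of i n] by (cases "n = D") auto
    then show ?thesis using Suc.IH[of I e] Suc.prems by auto
  next
    case False
    then obtain i0 where i0: "i0 \<in> I" "coeff (e i0) D \<noteq> 0" by auto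
    define c where "c i = coeff (e i) D / coeff (e i0) D" for i
    define e' where "e' i = e i - smult (c i) (e i0)" for i
    have "coeff (e' i) n = 0" if "i \<in> I - {i0}" "n \<ge> D" for i n
      using that i0 Suc.prems(3)[of i n] Suc.prems(3)[of i0 n]
      by (cases "n = D") (auto simp: e'_def c_def)
    moreover have "card (I - {i0}) > D" using Suc.prems i0 by simp
    ultimately obtain s where s: "\<exists>i\<in>I-{i0}. s i \<noteq> 0" "(\<Sum>i\<in>I-{i0}. smult (s i) (e' i)) = 0"
      using Suc.IH[of "I - {i0}" e'] Suc.prems(1) by auto
    define s' where "s' i = (if i = i0 then - (\<Sum>i\<in>I-{i0}. s i * c i) else s i)" for i
    have "(\<Sum>i\<in>I. smult (s' i) (e i)) = smult (s' i0) (e i0) + (\<Sum>i\<in>I-{i0}. smult (s' i) (e i))"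
      using i0 Suc.prems(1) by (simp add: sum.remove)
    also have "(\<Sum>i\<in>I-{i0}. smult (s' i) (e i)) = (\<Sum>i\<in>I-{i0}. smult (s i) (e' i) + smult (s i * c i) (e i0))"
      by (rule sum.cong) (auto simp: s'_def e'_def smult_diff_right)
    also have "\<dots> = smult (\<Sum>i\<in>I-{i0}. s i * c i) (e i0)"
      by (simp only: sum.distrib s(2) smult_sum add_0_left)
    finally have "(\<Sum>i\<in>I. smult (s' i) (e i)) = 0"
      by (simp add: s'_def)
    moreover have "\<exists>i\<in>I. s' i \<noteq> 0" using s(1) by (auto simp: s'_def)
    ultimately show ?thesis by blast
  qed
qed

lemma sum_lessThan_add:
  fixes g :: "nat \<Rightarrow> 'a::comm_monoid_add"
  shows "sum g {..<m + n} = sum g {..<m} + (\<Sum>i<n. g (i + m))"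
  by (induction n) (auto simp: add_ac)

lemma proots_prod_mset_linear:
  fixes A :: "'a::idom multiset"
  shows "proots (\<Prod>x\<in>#A. [:-x, 1:]) = A"
proof (induction A)
  case (add x A)
  have "(\<Prod>x\<in>#A. [:-x, 1:]) \<noteq> 0" by (auto simp: prod_mset_zero_iff)
  then show ?case using add by (simp add: proots_mult del: mult_pCons_left)
qed simp

lemma size_proots_alg_closed:
  fixes h :: "'a::alg_closed_field poly"
  shows "size (proots h) = degree h"
proof (cases "h = 0")
  case False
  obtain A where A: "size A = degree h" "h = smult (lead_coeff h) (\<Prod>x\<in>#A. [:-x, 1:])"
    using alg_closed_imp_factorization[OF False] by blast
  have "proots h = proots (\<Prod>x\<in>#A. [:-x, 1:])"
    using False by (subst A(2)) (simp add: proots_smult)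
  also have "\<dots> = A" by (rule proots_prod_mset_linear)
  finally show ?thesis using A(1) by simp
qed auto

section \<open>Finite fields inside an algebraically closed field\<close>

locale char_p_closed =
  fixes p :: nat and ty :: "'a::alg_closed_field itself"
  assumes prime_p: "prime p" and char_p: "CHAR('a) = p"
begin

text \<open>The fixed points of the \<open>n\<close>-th power of Frobenius, that is the subfield with \<open>p\<^sup>n\<close> elements. Keeping
all finite fields as subsets of one type avoids any construction of field extensions.\<close>

definition fixed_field :: "nat \<Rightarrow> 'a set" where "fixed_field n = {x. x ^ (p ^ n) = x}"

lemma p_gt_1: "p > 1" and p_pos: "p > 0"
  using prime_p prime_gt_1_nat prime_gt_0_nat by auto

lemma frob_add: "(x + y :: 'a) ^ (p ^ n) = x ^ (p ^ n) + y ^ (p ^ n)"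
  using freshmans_dream'[where ?'a = 'a, of "p^n" n x y] prime_p char_p by simp

lemma frob_sum: "(sum g A :: 'a) ^ (p ^ n) = (\<Sum>i\<in>A. g i ^ (p ^ n))"
  using freshmans_dream_sum'[where ?'a = 'a, of "p^n" n g A] prime_p char_p by simp

lemma frob_minus: "(- x :: 'a) ^ (p ^ n) = - (x ^ (p ^ n))"
proof -
  have "(x + (-x)) ^ (p ^ n) = 0" using p_pos by simp
  then show ?thesis unfolding frob_add by (simp add: add_eq_0_iff)
qed

lemma frob_diff: "(x - y :: 'a) ^ (p ^ n) = x ^ (p ^ n) - y ^ (p ^ n)"
  using frob_add[of x "-y" n] frob_minus[of y n] by simp

lemma frob_inj: "(x :: 'a) ^ (p ^ n) = y ^ (p ^ n) \<longleftrightarrow> x = y"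
  using frob_diff[of x y n] p_pos by auto

lemma fixed_field_0: "0 \<in> fixed_field n" and fixed_field_1: "1 \<in> fixed_field n"
  using p_pos by (auto simp: fixed_field_def)

lemma fixed_field_add: "x \<in> fixed_field n \<Longrightarrow> y \<in> fixed_field n \<Longrightarrow> x + y \<in> fixed_field n"
  and fixed_field_minus: "x \<in> fixed_field n \<Longrightarrow> - x \<in> fixed_field n"
  and fixed_field_diff: "x \<in> fixed_field n \<Longrightarrow> y \<in> fixed_field n \<Longrightarrow> x - y \<in> fixed_field n"
  and fixed_field_mult: "x \<in> fixed_field n \<Longrightarrow> y \<in> fixed_field n \<Longrightarrow> x * y \<in> fixed_field n"
  and fixed_field_divide: "x \<in> fixed_field n \<Longrightarrow> y \<in> fixed_field n \<Longrightarrow> x / y \<in> fixed_field n"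
  by (auto simp: fixed_field_def frob_add frob_minus frob_diff power_mult_distrib power_divide)

lemma frob_fixed_field_1: "x \<in> fixed_field 1 \<Longrightarrow> x ^ (p ^ n) = x"
  by (induction n) (auto simp: fixed_field_def power_mult)

lemma fixed_field_periodic: "x \<in> fixed_field n \<Longrightarrow> x ^ (p ^ (i + n)) = x ^ (p ^ i)"
  by (simp add: power_add power_mult fixed_field_def mult.commute[of "p^i"])

text \<open>The derivative of \<open>x ^ (p ^ n) - x\<close> is the constant \<open>-1\<close>, so all its roots are simple.\<close>

lemma card_fixed_field:
  assumes "n > 0" shows "finite (fixed_field n)" "card (fixed_field n) = p ^ n"
proof -
  define h :: "'a poly" where "h = monom 1 (p^n) - monom 1 1"
  have q: "p ^ n > 1" using p_gt_1 assms one_less_power by blast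
  have ch: "coeff h (p^n) = 1" using q by (simp add: h_def)
  then have h0: "h \<noteq> 0" by auto
  have deg: "degree h = p ^ n"
  proof (rule antisym)
    show "degree h \<le> p ^ n" unfolding h_def
      by (rule degree_diff_le) (use q in \<open>auto intro: order_trans[OF degree_monom_le]\<close>)
    show "p ^ n \<le> degree h" using ch by (intro le_degree) simp
  qed
  have roots: "{x. poly h x = 0} = fixed_field n"
    by (auto simp: h_def fixed_field_def poly_monom)
  have "of_nat (p ^ n) = (0::'a)"
    using char_p assms by (simp add: of_nat_eq_0_iff_char_dvd dvd_power)
  then have pd: "pderiv h = - 1"
    by (simp add: h_def pderiv_diff pderiv_monom)
  have ord: "Polynomial.order x h \<le> 1" for x
  proof (rule ccontr)
    assume "\<not> ?thesis"
    then have "[:-x, 1:] ^ 2 dvd h" by (simp add: order_divides)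
    then obtain r where "h = [:-x, 1:] ^ 2 * r" by (elim dvdE)
    then have "h = [:-x, 1:] * ([:-x, 1:] * r)" by (simp only: power2_eq_square mult.assoc)
    then have "poly (pderiv h) x = 0"
      by (simp only: pderiv_mult poly_add poly_mult) simp
    then show False by (simp add: pd)
  qed
  show fin: "finite (fixed_field n)" using poly_roots_finite[OF h0] roots by simp
  have "p ^ n = size (proots h)" by (simp add: size_proots_alg_closed deg)
  also have "\<dots> = (\<Sum>x\<in>fixed_field n. count (proots h) x)"
    using h0 roots by (simp add: size_multiset_overloaded_eq set_count_proots)
  also have "\<dots> = (\<Sum>x\<in>fixed_field n. 1)"
  proof (rule sum.cong)
    fix x assume "x \<in> fixed_field n"
    then have "Polynomial.order x h > 0" using roots h0 by (auto simp: order_gt_0_iff)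
    then show "count (proots h) x = 1" using ord[of x] h0 by (simp add: count_proots)
  qed simp
  finally show "card (fixed_field n) = p ^ n" by simp
qed

text \<open>On \<open>fixed_field n\<close> this is the trace down to the prime field.\<close>

definition Tr :: "nat \<Rightarrow> 'a \<Rightarrow> 'a" where "Tr n x = (\<Sum>i<n. x ^ (p ^ i))"

lemma Tr_fixed_field_1: assumes "x \<in> fixed_field n" shows "Tr n x \<in> fixed_field 1"
proof -
  have "Tr n x ^ (p ^ 1) = (\<Sum>i<n. x ^ (p ^ Suc i))"
    unfolding Tr_def frob_sum by (simp add: power_mult[symmetric] mult.commute)
  also have "\<dots> = Tr n x"
  proof (cases n)
    case (Suc k)
    have "(\<Sum>i<n. x ^ (p ^ Suc i)) = (\<Sum>i<k. x ^ (p ^ Suc i)) + x ^ (p ^ n)"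
      by (simp add: Suc)
    also have "x ^ (p ^ n) = x ^ (p ^ 0)" using assms by (simp add: fixed_field_def)
    finally show ?thesis
      unfolding Tr_def Suc by (subst sum.lessThan_Suc_shift) (simp add: add.commute)
  qed (simp add: Tr_def)
  finally show ?thesis by (simp add: fixed_field_def)
qed

end

section \<open>Stepanov's method for traces of a x + b / x\<close>

locale kloosterman_fun = char_p_closed p ty
  for p :: nat and ty :: "'a::alg_closed_field itself" +
  fixes a b :: 'a
  assumes ab: "a \<in> fixed_field 1" "b \<in> fixed_field 1" "a \<noteq> 0" "b \<noteq> 0"
begin

definition phase :: "'a \<Rightarrow> 'a" where "phase x = a * x + b / x"

lemma frob_phase: "phase x ^ (p ^ i) = a * x ^ (p ^ i) + b / x ^ (p ^ i)"
  by (simp add: phase_def frob_add power_mult_distrib power_divide frob_fixed_field_1[OF ab(1)] frob_fixed_field_1[OF ab(2)])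

lemma frob_phase': "phase x ^ (p ^ i) = phase (x ^ (p ^ i))"
  by (simp add: frob_phase) (simp add: phase_def)

lemma phase_fixed_field: "x \<in> fixed_field n \<Longrightarrow> phase x \<in> fixed_field n"
  using frob_phase'[of x n] by (simp add: fixed_field_def)

text \<open>An average fibre of the trace has about \<open>p ^ (2 * m - 1)\<close> elements, and the bound exceeds this only by
a term of order \<open>p ^ m\<close>. For \<open>x\<close> in \<open>fixed_field (2 * m)\<close> put \<open>y = x ^ l\<close> with \<open>l = p ^ m\<close>; then \<open>x = y ^ l\<close>, and
the trace of \<open>phase x\<close> is \<open>T x + T y\<close> with \<open>T y = Tr m (phase y)\<close>. On the fibre over \<open>c\<close> this gives
\<open>T y = c - T x\<close>, which allows one and the same expression to be read as a polynomial in \<open>x\<close> or in \<open>y\<close>.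
As a polynomial in \<open>x\<close> it has so few coefficients that it can be made to vanish identically by a
nontrivial choice of parameters; as a polynomial \<open>R\<close> in \<open>y\<close> it is then a nonzero polynomial that
vanishes at \<open>x ^ l\<close> for every \<open>x\<close> in the fibre, and its degree bounds the fibre.\<close>

lemma stepanov_fibre_bound:
  assumes m: "m \<ge> 2"
  shows "card {x \<in> fixed_field (2*m) - {0}. Tr (2*m) (phase x) = c} \<le> p ^ m * (p ^ (m - 1) + 3)"
proof -
  define P where "P = p ^ (m - 1)"
  define l where "l = p ^ m"
  \<comment> \<open>With \<open>P\<close> values of \<open>t\<close> and \<open>p * J\<close> values of \<open>k\<close> this choice of \<open>J\<close> gives \<open>l * P + 2 * l\<close> parameters, more than the \<open>l * P + l\<close> coefficients to be killed.\<close>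
  define J where "J = P + 2"
  define Z where "Z = {x \<in> fixed_field (2*m) - {0}. Tr (2*m) (phase x) = c}"
  have lP: "l = p * P" using m by (simp add: l_def P_def power_eq_if)
  have P2: "P \<ge> 2"
  proof -
    have "p ^ 1 \<le> p ^ (m - 1)" using m p_pos by (intro power_increasing) auto
    then show ?thesis using p_gt_1 by (simp add: P_def)
  qed
  have l0: "l > 0" using p_pos by (simp add: l_def)
  have kp: "k mod p \<le> p - 1" for k
    using mod_less_divisor[OF p_pos, of k] by linarith
  define T where "T y = Tr m (phase y)" for y
  \<comment> \<open>\<open>y ^ P * T y\<close> as a polynomial: multiplication by \<open>y ^ P\<close> clears the denominators in \<open>T\<close>.\<close>
  define gt where "gt = (\<Sum>i<m. monom a (P + p ^ i) + monom b (P - p ^ i))"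
  have le_P: "p ^ i \<le> P" if "i < m" for i
    unfolding P_def using that p_pos by (intro power_increasing) auto
  have poly_gt: "poly gt y = y ^ P * T y" if "y \<noteq> 0" for y
  proof -
    have "y ^ (P - p ^ i) = y ^ P / y ^ (p ^ i)" if "i < m" for i
      using le_P[OF that] \<open>y \<noteq> 0\<close> by (simp add: power_diff)
    then show ?thesis
      unfolding gt_def poly_sum T_def Tr_def sum_distrib_left
      by (intro sum.cong) (auto simp: poly_monom frob_phase power_add algebra_simps)
  qed
  have deg_gt: "degree gt \<le> 2 * P" unfolding gt_def
    by (intro degree_sum_le degree_add_le order_trans[OF degree_monom_le]) (use le_P in auto)
  have "coeff gt (2 * P) = (\<Sum>i<m. if i = m - 1 then a else 0)"
    unfolding gt_def coeff_sum
  proof (rule sum.cong)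
    fix i assume i: "i \<in> {..<m}"
    have "p ^ i = P \<longleftrightarrow> i = m - 1"
      unfolding P_def using p_gt_1 by (simp add: power_inject_exp)
    then show "coeff (monom a (P + p ^ i) + monom b (P - p ^ i)) (2 * P) = (if i = m - 1 then a else 0)"
      using P2 by auto
  qed simp
  also have "\<dots> = a" using m by (simp add: sum.delta)
  finally have cgt: "coeff gt (2 * P) = a" .
  then have deg_gt: "degree gt = 2 * P" using deg_gt ab le_degree[of gt "2*P"] by force
  have lc_gt: "lead_coeff gt = a" using cgt deg_gt by simp
  have gt0: "gt \<noteq> 0" using lc_gt ab by auto

  define mon :: "nat \<Rightarrow> 'a poly" where "mon n = monom 1 n" for n
  have pX: "poly (mon n) y = y ^ n" for n y by (simp add: mon_def poly_monom)
  have dX: "degree (mon n) = n" for n by (simp add: mon_def degree_monom_eq)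
  have X0: "mon n \<noteq> 0" for n by (simp add: mon_def)
  \<comment> \<open>The basis function with index \<open>k = i + p * j\<close> is \<open>x ^ (l * t) * (c - T x) ^ i * x ^ j\<close>, multiplied by \<open>x ^ (P * (p - 1))\<close> to become a polynomial.\<close>
  define E where "E k t = mon (l * t) * (smult c (mon P) - gt) ^ (k mod p) * mon (P * (p - 1 - k mod p)) * mon (k div p)" for k t
  define I where "I = {..<p * J} \<times> {..<P}"
  have "degree (smult c (mon P) - gt) \<le> 2 * P"
    by (rule degree_diff_le) (auto simp: deg_gt dX intro: order_trans[OF degree_smult_le])
  then have degE1: "degree ((smult c (mon P) - gt) ^ i) \<le> 2 * P * i" for i
    by (meson degree_power_le le_trans mult_le_mono1)
  have degE: "degree (E k t) < l * P + l" if "k < p * J" "t < P" for k t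
  proof -
    define i where "i = k mod p"
    have i: "i \<le> p - 1" unfolding i_def by (rule kp)
    have j: "k div p \<le> J - 1"
      using that(1) by (metis Suc_pred' less_Suc_eq_le less_mult_imp_div_less mult.commute J_def add_2_eq_Suc' zero_less_Suc)
    have "degree (E k t) \<le> l * t + 2 * P * i + P * (p - 1 - i) + k div p"
      unfolding E_def i_def[symmetric]
      by (intro order_trans[OF degree_mult_le] add_mono) (auto simp: dX degE1)
    also have "\<dots> \<le> l * (P - 1) + 2 * P * (p - 1) + (J - 1)"
    proof -
      have "2 * P * i + P * (p - 1 - i) \<le> 2 * P * (p - 1)"
      proof -
        have "2 * P * i + P * (p - 1 - i) \<le> 2 * P * i + 2 * P * (p - 1 - i)" by simp
        also have "\<dots> = 2 * P * (i + (p - 1 - i))" by (simp only: distrib_left)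
        also have "i + (p - 1 - i) = p - 1" using i by simp
        finally show ?thesis .
      qed
      moreover have "l * t \<le> l * (P - 1)" using that by (intro mult_le_mono2) simp
      ultimately show ?thesis using j by linarith
    qed
    also have "\<dots> < l * P + l"
    proof -
      have "l * (P - 1) + l = l * P" using P2 by (simp add: algebra_simps flip: mult_Suc_right)
      moreover have "2 * P * (p - 1) + 2 * P = 2 * l" unfolding lP using p_pos by (cases p) (auto simp: algebra_simps)
      ultimately show ?thesis using P2 unfolding J_def by linarith
    qed
    finally show ?thesis .
  qed
  have "card I = l * P + 2 * l" by (simp add: I_def J_def lP algebra_simps)
  then have "card I > l * P + l" using l0 by simp
  moreover have "coeff (case i of (k, t) \<Rightarrow> E k t) n = 0" if "i \<in> I" "n \<ge> l * P + l" for i n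
    using that degE by (force simp: I_def intro: coeff_eq_0)
  moreover have "finite I" by (simp add: I_def)
  ultimately obtain s where s: "\<exists>i\<in>I. s i \<noteq> 0" "(\<Sum>i\<in>I. smult (s i) (case i of (k, t) \<Rightarrow> E k t)) = 0"
    using linear_dependence_poly[of I "l * P + l" "\<lambda>i. case i of (k, t) \<Rightarrow> E k t"] by auto
  define sp where "sp k = (\<Sum>t<P. monom (s (k, t)) t)" for k
  have coeff_sp: "coeff (sp k) t = (if t < P then s (k, t) else 0)" for k t
    by (simp add: sp_def coeff_sum sum.delta)
  have deg_sp: "degree (sp k) \<le> P - 1" for k
    by (rule degree_le) (auto simp: coeff_sp)
  \<comment> \<open>The same function on the fibre, now in terms of \<open>y\<close>: \<open>x ^ l = y\<close>, \<open>c - T x = T y\<close> and \<open>x = y ^ l\<close>.\<close>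
  define Dk where "Dk k = gt ^ (k mod p) * mon (P * (p - 1 - k mod p)) * mon (l * (k div p))" for k
  define R where "R = (\<Sum>k<p*J. sp k * Dk k)"
  have Dk0: "Dk k \<noteq> 0" for k using gt0 X0 by (simp add: Dk_def)
  have degDk: "degree (Dk k) = P * (p - 1) + P * k" for k
  proof -
    define i j u where "i = k mod p" and "j = k div p" and "u = p - 1 - i"
    have iu: "i + u = p - 1" using kp[of k] by (simp add: i_def u_def)
    have kij: "k = i + p * j" by (simp add: i_def j_def)
    have "degree (Dk k) = 2 * P * i + P * u + l * j"
      using gt0 X0 by (simp add: Dk_def degree_mult_eq degree_power_eq deg_gt dX u_def i_def j_def)
    also have "\<dots> = P * (i + u) + P * (i + p * j)"
      by (simp add: lP algebra_simps)
    also have "\<dots> = P * (p - 1) + P * k" by (simp only: iu kij)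
    finally show ?thesis .
  qed
  \<comment> \<open>The degrees of the \<open>Dk k\<close> increase in steps of \<open>P\<close> while the factors \<open>sp k\<close> have degree below \<open>P\<close>, so the leading terms cannot cancel.\<close>
  have "R \<noteq> 0"
  proof -
    define A where "A = {k \<in> {..<p*J}. sp k \<noteq> 0}"
    have "A \<noteq> {}"
    proof -
      obtain k t where kt: "k < p * J" "t < P" "s (k, t) \<noteq> 0" using s(1) by (auto simp: I_def)
      then have "coeff (sp k) t \<noteq> 0" by (simp add: coeff_sp)
      then have "sp k \<noteq> 0" by auto
      then show ?thesis using kt by (auto simp: A_def)
    qed
    have finA: "finite A" by (simp add: A_def)
    define k where "k = Max A"
    have k: "k \<in> A" and kmax: "\<And>k'. k' \<in> A \<Longrightarrow> k' \<le> k"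
      using \<open>A \<noteq> {}\<close> Max_in[OF finA] Max_ge[OF finA] by (auto simp: k_def)
    define n where "n = degree (sp k * Dk k)"
    have n: "n \<ge> P * (p - 1) + P * k"
      using k Dk0 by (simp add: n_def A_def degree_mult_eq degDk)
    have "coeff R n = (\<Sum>k'<p*J. if k' = k then coeff (sp k * Dk k) n else 0)"
      unfolding R_def coeff_sum
    proof (rule sum.cong)
      fix k' assume k': "k' \<in> {..<p*J}"
      show "coeff (sp k' * Dk k') n = (if k' = k then coeff (sp k * Dk k) n else 0)"
      proof (cases "k' = k \<or> sp k' = 0")
        case False
        then have "k' < k" using kmax[of k'] k' by (force simp: A_def)
        have "degree (sp k' * Dk k') \<le> (P - 1) + (P * (p - 1) + P * k')"
          using degree_mult_le[of "sp k'" "Dk k'"] deg_sp[of k'] degDk[of k'] by linarith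
        also have "\<dots> < P * (p - 1) + P * Suc k'" using P2 by simp
        also have "\<dots> \<le> P * (p - 1) + P * k" using \<open>k' < k\<close> by (meson Suc_leI add_left_mono mult_le_mono2)
        finally show ?thesis using n False by (simp add: coeff_eq_0)
      qed auto
    qed simp
    also have "\<dots> = coeff (sp k * Dk k) n" using k by (simp add: A_def sum.delta)
    also have "\<dots> \<noteq> 0" using k Dk0 by (simp add: n_def A_def)
    finally show ?thesis by auto
  qed
  have degR: "degree R \<le> l * (P + 3)" unfolding R_def
  proof (rule degree_sum_le)
    fix k assume k: "k \<in> {..<p*J}"
    have "degree (sp k * Dk k) \<le> (P - 1) + (P * (p - 1) + P * k)"
      using degree_mult_le[of "sp k" "Dk k"] deg_sp[of k] degDk[of k] by linarith
    also have "\<dots> \<le> P + P * (p - 1) + P * (p * J)"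
    proof -
      have "P * k \<le> P * (p * J)" using k by (intro mult_le_mono2) simp
      then show ?thesis by linarith
    qed
    also have "\<dots> = l * (P + 3)" using p_pos by (cases p) (auto simp: lP J_def algebra_simps)
    finally show "degree (sp k * Dk k) \<le> l * (P + 3)" .
  qed auto
  have root: "poly R (x ^ l) = 0" if x: "x \<in> Z" for x
  proof -
    define y where "y = x ^ l"
    have x0: "x \<noteq> 0" and xK: "x ^ (p ^ (2*m)) = x" and Trx: "Tr (2*m) (phase x) = c"
      using x by (auto simp: Z_def fixed_field_def)
    have y0: "y \<noteq> 0" using x0 by (simp add: y_def)
    have yl: "y ^ l = x"
      using xK unfolding y_def l_def mult_2 power_add power_mult .
    have "Tr (2*m) (phase x) = T x + T y"
    proof -
      have "Tr (2*m) (phase x) = (\<Sum>i<m. phase x ^ (p ^ i)) + (\<Sum>i<m. phase x ^ (p ^ (i + m)))"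
        unfolding Tr_def mult_2 by (rule sum_lessThan_add)
      also have "(\<Sum>i<m. phase x ^ (p ^ (i + m))) = (\<Sum>i<m. (phase x ^ (p ^ m)) ^ (p ^ i))"
        by (simp only: add.commute[of _ m] power_add power_mult)
      also have "phase x ^ (p ^ m) = phase y" by (simp add: frob_phase' y_def l_def)
      finally show ?thesis by (simp add: T_def Tr_def)
    qed
    then have Ty: "T y = c - T x" using Trx by (simp add: algebra_simps)
    define W where "W = (\<Sum>k<p*J. poly (sp k) y * (c - T x) ^ (k mod p) * x ^ (k div p))"
    have i: "P * (k mod p) + P * (p - 1 - k mod p) = P * (p - 1)" for k
    proof -
      have "k mod p \<le> p - 1" by (rule kp)
      then have "k mod p + (p - 1 - k mod p) = p - 1" by simp
      then show ?thesis by (simp only: distrib_left[symmetric])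
    qed
    have "0 = poly (\<Sum>i\<in>I. smult (s i) (case i of (k, t) \<Rightarrow> E k t)) x" by (simp add: s(2))
    also have "\<dots> = (\<Sum>k<p*J. \<Sum>t<P. s (k,t) * poly (E k t) x)"
      unfolding I_def by (simp add: sum.cartesian_product poly_sum case_prod_unfold)
    also have "\<dots> = x ^ (P * (p - 1)) * W"
      unfolding W_def sum_distrib_left
    proof (rule sum.cong)
      fix k
      have "poly (E k t) x = y ^ t * (x ^ (P * (p - 1)) * (c - T x) ^ (k mod p) * x ^ (k div p))" for t
      proof -
        have "poly (E k t) x = y ^ t * (x ^ P * (c - T x)) ^ (k mod p) * x ^ (P * (p - 1 - k mod p)) * x ^ (k div p)"
          by (simp add: E_def pX poly_power poly_gt x0 y_def power_mult algebra_simps)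
        also have "\<dots> = y ^ t * (x ^ (P * (k mod p) + P * (p - 1 - k mod p)) * (c - T x) ^ (k mod p) * x ^ (k div p))"
          by (simp add: power_mult_distrib power_add power_mult)
        finally show ?thesis by (simp only: i)
      qed
      then show "(\<Sum>t<P. s (k,t) * poly (E k t) x) = x ^ (P * (p - 1)) * (poly (sp k) y * (c - T x) ^ (k mod p) * x ^ (k div p))"
        by (simp add: sp_def poly_sum poly_monom sum_distrib_left sum_distrib_right algebra_simps)
    qed simp
    finally have "W = 0" using x0 by simp
    have "poly R y = (\<Sum>k<p*J. poly (sp k) y * poly (Dk k) y)" by (simp add: R_def poly_sum)
    also have "\<dots> = y ^ (P * (p - 1)) * W"
      unfolding W_def sum_distrib_left
    proof (rule sum.cong)
      fix k
      have "y ^ (l * (k div p)) = x ^ (k div p)" by (simp only: power_mult yl)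
      then have "poly (Dk k) y = (y ^ P * (c - T x)) ^ (k mod p) * y ^ (P * (p - 1 - k mod p)) * x ^ (k div p)"
        by (simp only: Dk_def pX poly_power poly_mult poly_gt[OF y0] Ty)
      also have "\<dots> = y ^ (P * (k mod p) + P * (p - 1 - k mod p)) * (c - T x) ^ (k mod p) * x ^ (k div p)"
        by (simp add: power_mult_distrib power_add power_mult)
      finally show "poly (sp k) y * poly (Dk k) y = y ^ (P * (p - 1)) * (poly (sp k) y * (c - T x) ^ (k mod p) * x ^ (k div p))"
        by (simp only: i) (simp add: mult_ac)
    qed simp
    finally show ?thesis using \<open>W = 0\<close> by (simp add: y_def)
  qed
  have "inj_on (\<lambda>x. x ^ l) Z" by (auto simp: inj_on_def l_def frob_inj)
  then have "card Z = card ((\<lambda>x. x ^ l) ` Z)" by (simp add: card_image)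
  also have "\<dots> \<le> card {y. poly R y = 0}"
    using root poly_roots_finite[OF \<open>R \<noteq> 0\<close>] by (intro card_mono) auto
  also have "\<dots> \<le> degree R" by (rule card_poly_roots_bound) fact
  also have "\<dots> \<le> l * (P + 3)" by (rule degR)
  finally show ?thesis by (simp add: Z_def l_def P_def)
qed

end

lemma prod_lessThan_add:
  fixes g :: "nat \<Rightarrow> 'a::comm_monoid_mult"
  shows "prod g {..<m + n} = prod g {..<m} * (\<Prod>i<n. g (i + m))"
  by (induction n) (auto simp: mult_ac add_ac)

lemma monic_split_alg_closed:
  fixes h :: "'a::alg_closed_field poly"
  assumes "lead_coeff h = 1"
  shows "h = (\<Prod>x\<in>#proots h. [:-x, 1:])"
proof -
  have "h \<noteq> 0" using assms by auto
  obtain A where A: "size A = degree h" "h = smult (lead_coeff h) (\<Prod>x\<in>#A. [:-x, 1:])"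
    using alg_closed_imp_factorization[OF \<open>h \<noteq> 0\<close>] by blast
  have "proots h = proots (\<Prod>x\<in>#A. [:-x, 1:])"
    using A(2) assms by simp
  also have "\<dots> = A" by (rule proots_prod_mset_linear)
  finally show ?thesis using A(2) assms by simp
qed

lemma proots_linear_prod:
  fixes g :: "'i \<Rightarrow> 'a::idom"
  assumes "finite I"
  shows "proots (\<Prod>i\<in>I. [:-g i, 1:]) = image_mset g (mset_set I)"
  using assms by (subst proots_prod) (auto, induction I rule: finite_induct, auto)

lemma coeff_prod_mset_linear:
  fixes M :: "'a::field multiset"
  defines "g \<equiv> (\<Prod>x\<in>#M. [:-x, 1:])"
  assumes "0 \<notin># M"
  shows "coeff g (size M) = 1" "coeff (pCons 0 g) (size M) = - sum_mset M"
    "coeff g 0 \<noteq> 0" "(\<Sum>x\<in>#M. 1 / x) = - coeff g 1 / coeff g 0"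
proof -
  have "coeff (\<Prod>x\<in>#M. [:-x, 1:]) (size M) = 1 \<and> degree (\<Prod>x\<in>#M. [:-x, 1:]) = size M
    \<and> coeff (pCons 0 (\<Prod>x\<in>#M. [:-x, 1:])) (size M) = - sum_mset M
    \<and> coeff (\<Prod>x\<in>#M. [:-x, 1:]) 0 \<noteq> 0 
    \<and> (\<Sum>x\<in>#M. 1 / x) = - coeff (\<Prod>x\<in>#M. [:-x, 1:]) 1 / coeff (\<Prod>x\<in>#M. [:-x, 1:]) 0"
    using assms(2)
  proof (induction M)
    case (add x M)
    define h where "h = (\<Prod>x\<in>#M. [:-x, 1:])"
    have x: "x \<noteq> 0" and IH: "coeff h (size M) = 1" "degree h = size M"
       "coeff (pCons 0 h) (size M) = - sum_mset M" "coeff h 0 \<noteq> 0" 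
       "(\<Sum>x\<in>#M. 1 / x) = - coeff h 1 / coeff h 0"
      using add by (auto simp: h_def)
    have e: "(\<Prod>x\<in>#add_mset x M. [:-x, 1:]) = pCons 0 h - smult x h" by (simp add: h_def)
    have c0: "coeff h (Suc (size M)) = 0" using IH(2) by (simp add: coeff_eq_0)
    have lc: "coeff (pCons 0 h - smult x h) (size (add_mset x M)) = 1" using IH c0 by simp
    have "degree (pCons 0 h - smult x h) \<le> Suc (size M)"
      by (rule degree_diff_le) (use IH(2) in \<open>auto intro: order_trans[OF degree_pCons_le] order_trans[OF degree_smult_le]\<close>)
    moreover have "degree (pCons 0 h - smult x h) \<ge> Suc (size M)" using lc by (intro le_degree) simp
    moreover have "coeff (pCons 0 (pCons 0 h - smult x h)) (size (add_mset x M)) = - sum_mset (add_mset x M)"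
      using IH by simp
    moreover have "(\<Sum>y\<in>#add_mset x M. 1 / y) = - coeff (pCons 0 h - smult x h) 1 / coeff (pCons 0 h - smult x h) 0"
    proof -
      have "(\<Sum>y\<in>#add_mset x M. 1 / y) = 1 / x + (\<Sum>y\<in>#M. 1 / y)" by simp
      also have "\<dots> = 1 / x + - coeff h 1 / coeff h 0" unfolding IH(5) ..
      also have "\<dots> = - coeff (pCons 0 h - smult x h) 1 / coeff (pCons 0 h - smult x h) 0"
        using IH(4) x by (simp add: field_simps)
      finally show ?thesis .
    qed
    ultimately show ?case unfolding e using lc IH x by (intro conjI) auto
  qed auto
  then show "coeff g (size M) = 1" "coeff (pCons 0 g) (size M) = - sum_mset M"
    "coeff g 0 \<noteq> 0" "(\<Sum>x\<in>#M. 1 / x) = - coeff g 1 / coeff g 0"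
    by (auto simp: g_def)
qed

context char_p_closed
begin

section \<open>Frobenius-invariant polynomials and Frobenius orbits\<close>

text \<open>Frobenius acting on coefficients; its fixed points are the polynomials over the prime field.\<close>

definition frob_poly :: "'a poly \<Rightarrow> 'a poly" where "frob_poly u = map_poly (\<lambda>c. c ^ p) u"

lemma coeff_frob_poly: "coeff (frob_poly u) n = coeff u n ^ p"
  using p_pos by (simp add: frob_poly_def coeff_map_poly)

lemma frob_poly_mult: "frob_poly (u * v) = frob_poly u * frob_poly v"
proof (rule poly_eqI)
  fix n
  show "coeff (frob_poly (u * v)) n = coeff (frob_poly u * frob_poly v) n"
    using frob_sum[where n = 1, of "\<lambda>i. coeff u i * coeff v (n - i)" "{..n}"]
    by (simp add: coeff_frob_poly coeff_mult power_mult_distrib)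
qed

lemma frob_poly_1: "frob_poly 1 = 1"
  using p_pos by (intro poly_eqI) (auto simp: coeff_frob_poly)

lemma frob_poly_linear: "frob_poly [:-x, 1:] = [:- (x ^ p), 1:]"
  using frob_minus[of x 1] p_pos by (intro poly_eqI) (auto simp: coeff_frob_poly coeff_pCons split: nat.split)

lemma frob_poly_prod: "frob_poly (prod g A) = (\<Prod>i\<in>A. frob_poly (g i))"
  by (induction A rule: infinite_finite_induct) (auto simp: frob_poly_1 frob_poly_mult)

lemma frob_poly_prod_mset: "frob_poly (\<Prod>x\<in>#M. [:-x, 1:]) = (\<Prod>x\<in>#image_mset (\<lambda>x. x ^ p) M. [:-x, 1:])"
  by (induction M) (auto simp: frob_poly_1 frob_poly_mult frob_poly_linear simp del: mult_pCons_left)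

lemma frob_poly_eq_iff: "frob_poly u = u \<longleftrightarrow> (\<forall>i. coeff u i \<in> fixed_field 1)"
  by (auto simp: poly_eq_iff coeff_frob_poly fixed_field_def)

text \<open>For \<open>x\<close> in \<open>fixed_field j\<close> this is the characteristic polynomial of \<open>x\<close> over the prime field, a power of
the minimal polynomial.\<close>

definition orbit_poly :: "nat \<Rightarrow> 'a \<Rightarrow> 'a poly" where "orbit_poly j x = (\<Prod>i<j. [:- (x ^ (p ^ i)), 1:])"

lemma proots_orbit_poly: "proots (orbit_poly j x) = image_mset (\<lambda>i. x ^ (p ^ i)) (mset_set {..<j})"
  unfolding orbit_poly_def by (rule proots_linear_prod) simp

lemma orbit_poly_nonzero: "orbit_poly j x \<noteq> 0" by (simp add: orbit_poly_def)

lemma lead_coeff_orbit_poly: "lead_coeff (orbit_poly j x) = 1"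
  unfolding orbit_poly_def lead_coeff_prod by simp

lemma degree_orbit_poly: "degree (orbit_poly j x) = j"
  using size_proots_alg_closed[of "orbit_poly j x"] by (simp add: proots_orbit_poly)

lemma frob_poly_orbit_poly: assumes "x \<in> fixed_field j" shows "frob_poly (orbit_poly j x) = orbit_poly j x"
proof (cases j)
  case (Suc k)
  have "frob_poly (orbit_poly j x) = (\<Prod>i<j. [:- (x ^ (p ^ Suc i)), 1:])"
    unfolding orbit_poly_def frob_poly_prod frob_poly_linear by (simp add: mult.commute flip: power_mult)
  also have "\<dots> = (\<Prod>i<k. [:- (x ^ (p ^ Suc i)), 1:]) * [:- (x ^ (p ^ j)), 1:]"
    by (simp add: Suc del: mult_pCons_left mult_pCons_right power_Suc)
  also have "x ^ (p ^ j) = x ^ (p ^ 0)" using assms by (simp add: fixed_field_def)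
  finally show ?thesis
    unfolding orbit_poly_def Suc by (subst (2) prod.lessThan_Suc_shift) (simp add: mult.commute del: mult_pCons_left mult_pCons_right)
qed (simp add: orbit_poly_def frob_poly_1)

definition invariant_polys :: "nat \<Rightarrow> 'a poly set" where
  "invariant_polys d = {h. degree h = d \<and> lead_coeff h = 1 \<and> coeff h 0 \<noteq> 0 \<and> frob_poly h = h}"

lemma finite_invariant_polys: "finite (invariant_polys d)"
proof (rule inj_on_finite)
  show "inj_on (\<lambda>h. restrict (coeff h) {..d}) (invariant_polys d)"
  proof (rule inj_onI)
    fix g h assume g: "g \<in> invariant_polys d" and h: "h \<in> invariant_polys d" and e: "restrict (coeff g) {..d} = restrict (coeff h) {..d}"
    show "g = h"
    proof (rule poly_eqI)
      fix n
      show "coeff g n = coeff h n"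
        using g h fun_cong[OF e, of n] by (cases "n \<le> d") (auto simp: invariant_polys_def coeff_eq_0)
    qed
  qed
  show "(\<lambda>h. restrict (coeff h) {..d}) ` invariant_polys d \<subseteq> PiE {..d} (\<lambda>_. fixed_field 1)"
    by (intro image_subsetI) (simp add: restrict_PiE_iff invariant_polys_def frob_poly_eq_iff)
  show "finite (PiE {..d} (\<lambda>_. fixed_field 1))"
    using card_fixed_field[of 1] by (intro finite_PiE) auto
qed

lemma invariant_polys_0: "invariant_polys 0 = {1}"
proof -
  have "h = 1" if "degree h = 0" "lead_coeff h = 1" for h :: "'a poly"
    using that by (metis degree_0_id one_pCons monom_0 degree_eq_zeroE coeff_pCons_0)
  then show ?thesis by (auto simp: invariant_polys_def frob_poly_1)
qed

lemma proots_invariant_polys: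
  assumes "h \<in> invariant_polys d"
  shows "h = (\<Prod>x\<in>#proots h. [:-x, 1:])" "size (proots h) = d" "0 \<notin># proots h"
    "image_mset (\<lambda>x. x ^ p) (proots h) = proots h"
proof -
  show h: "h = (\<Prod>x\<in>#proots h. [:-x, 1:])"
    using assms by (intro monic_split_alg_closed) (auto simp: invariant_polys_def)
  show "size (proots h) = d" using assms by (simp add: invariant_polys_def size_proots_alg_closed)
  have h0: "h \<noteq> 0" using assms by (auto simp: invariant_polys_def)
  then show "0 \<notin># proots h"
    using assms by (auto simp: invariant_polys_def set_count_proots poly_0_coeff_0)
  have "frob_poly h = h" using assms by (simp add: invariant_polys_def)
  then have "(\<Prod>x\<in>#image_mset (\<lambda>x. x ^ p) (proots h). [:-x, 1:]) = (\<Prod>x\<in>#proots h. [:-x, 1:])"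
    using frob_poly_prod_mset[of "proots h"] h by simp
  then show "image_mset (\<lambda>x. x ^ p) (proots h) = proots h" by (metis proots_prod_mset_linear)
qed

lemma orbit_poly_in_invariant_polys: assumes "x \<in> fixed_field j - {0}" shows "orbit_poly j x \<in> invariant_polys j"
proof -
  have "poly (orbit_poly j x) 0 \<noteq> 0" using assms by (simp add: orbit_poly_def poly_prod)
  then show ?thesis using assms lead_coeff_orbit_poly[of j x] by (simp add: invariant_polys_def degree_orbit_poly frob_poly_orbit_poly poly_0_coeff_0)
qed

text \<open>This replaces unique factorisation over the prime field. A root \<open>x\<close> of \<open>h\<close> whose Frobenius orbit has
\<open>d\<close> elements yields the pairs \<open>(d * t, x)\<close> with \<open>1 \<le> t \<le> count (proots h) x\<close>, and no other pairs have
second component \<open>x\<close>. Summing over the roots gives the number of roots with multiplicity.\<close>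

lemma card_orbit_poly_divisors:
  assumes h: "h \<in> invariant_polys n"
  shows "card {(j, x). j \<in> {1..n} \<and> x \<in> fixed_field j - {0} \<and> orbit_poly j x dvd h} = n"
proof -
  define M where "M = proots h"
  note hM = proots_invariant_polys[OF h, folded M_def]
  have h0: "h \<noteq> 0" using h by (auto simp: invariant_polys_def)
  have countM: "count M x = Polynomial.order x h" for x using h0 by (simp add: M_def)
  have count_frob1: "count M (x ^ p) = count M x" for x
  proof -
    have "inj (\<lambda>x::'a. x ^ p)" using frob_inj[of _ 1] by (auto intro: injI)
    then have "(\<lambda>x. x ^ p) -` {x ^ p} \<inter> set_mset M = (if x \<in># M then {x} else {})"
      by (auto dest: injD)
    then have "count (image_mset (\<lambda>x. x ^ p) M) (x ^ p) = count M x"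
      by (simp add: count_image_mset not_in_iff)
    then show ?thesis by (simp only: hM(4))
  qed
  have count_frob: "count M (x ^ (p ^ i)) = count M x" for x i
  proof (induction i)
    case (Suc i)
    have "x ^ (p ^ Suc i) = (x ^ (p ^ i)) ^ p" by (simp add: mult.commute flip: power_mult)
    then show ?case using Suc count_frob1 by simp
  qed simp
  have ex: "\<exists>d>0. x \<in> fixed_field d" if x: "x \<in># M" for x
  proof -
    have sub: "range (\<lambda>i. x ^ (p ^ i)) \<subseteq> set_mset M"
      using x by (auto simp: count_frob simp flip: count_greater_zero_iff)
    then have "finite (range (\<lambda>i::nat. x ^ (p ^ i)))" using finite_subset by blast
    then have "\<not> inj (\<lambda>i::nat. x ^ (p ^ i))" using finite_imageD by blast
    then obtain i j where ij: "i < j" "x ^ (p ^ i) = x ^ (p ^ j)" by (metis linorder_injI)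
    have "x ^ (p ^ j) = (x ^ (p ^ (j - i))) ^ (p ^ i)"
      using ij(1) by (simp flip: power_mult power_add)
    then have "x = x ^ (p ^ (j - i))" using ij(2) frob_inj by metis
    then show ?thesis using ij(1) by (intro exI[of _ "j - i"]) (auto simp: fixed_field_def)
  qed
  \<comment> \<open>The length of the Frobenius orbit of \<open>x\<close>.\<close>
  define d where "d x = (LEAST d. d > 0 \<and> x \<in> fixed_field d)" for x :: 'a
  have d: "d x > 0" "x \<in> fixed_field (d x)" if "x \<in># M" for x
    using LeastI_ex[OF ex[OF that]] by (auto simp: d_def)
  have dmin: "d x \<le> k" if "k > 0" "x \<in> fixed_field k" for x k
    using that by (auto simp: d_def intro: Least_le)
  have mult_d: "x \<in> fixed_field (d x * t)" if "x \<in># M" for x t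
  proof (induction t)
    case (Suc t)
    then have "x ^ (p ^ (d x + d x * t)) = x ^ (p ^ d x)" by (rule fixed_field_periodic)
    then show ?case using d(2)[OF that] by (simp add: fixed_field_def)
  qed (simp add: fixed_field_def)
  have dvd_d: "d x dvd j" if "x \<in># M" "x \<in> fixed_field j" for x j
  proof (rule ccontr)
    assume "\<not> d x dvd j"
    then have r: "j mod d x > 0" by (simp add: dvd_eq_mod_eq_0)
    have "x ^ (p ^ (j mod d x + d x * (j div d x))) = x ^ (p ^ (j mod d x))"
      by (rule fixed_field_periodic[OF mult_d[OF that(1)]])
    then have "x \<in> fixed_field (j mod d x)" using that(2) by (simp add: fixed_field_def)
    then have "d x \<le> j mod d x" by (rule dmin[OF r])
    then show False using mod_less_divisor[OF d(1)[OF that(1)], of j] by simp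
  qed
  have inj_orb: "inj_on (\<lambda>i. x ^ (p ^ i)) {..<d x}" if "x \<in># M" for x
  proof (rule linorder_inj_onI)
    fix i j assume ij: "i < j" "j \<in> {..<d x}"
    show "x ^ (p ^ i) \<noteq> x ^ (p ^ j)"
    proof
      assume e: "x ^ (p ^ i) = x ^ (p ^ j)"
      have "x ^ (p ^ j) = (x ^ (p ^ (j - i))) ^ (p ^ i)"
        using ij(1) by (simp flip: power_mult power_add)
      then have "x = x ^ (p ^ (j - i))" using e frob_inj by metis
      then show False using dmin[of "j - i" x] ij by (auto simp: fixed_field_def)
    qed
  qed auto
  have orbit_poly_pow: "orbit_poly (d x * t) x = orbit_poly (d x) x ^ t" if "x \<in># M" for x t
  proof (induction t)
    case (Suc t)
    have "orbit_poly (d x * Suc t) x = orbit_poly (d x * t) x * (\<Prod>i<d x. [:- (x ^ (p ^ (i + d x * t))), 1:])"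
      unfolding orbit_poly_def mult_Suc_right add.commute[of "d x"] by (rule prod_lessThan_add)
    also have "\<dots> = orbit_poly (d x * t) x * orbit_poly (d x) x"
      using fixed_field_periodic[OF mult_d[OF that]] by (simp add: orbit_poly_def)
    finally show ?case by (simp only: Suc power_Suc2)
  qed (simp add: orbit_poly_def)
  have proots_Nd: "proots (orbit_poly (d x) x ^ t) = repeat_mset t (mset_set ((\<lambda>i. x ^ (p ^ i)) ` {..<d x}))" if "x \<in># M" for x t
    using inj_orb[OF that] by (simp add: proots_power proots_orbit_poly image_mset_mset_set)
  have xorb: "x \<in> (\<lambda>i. x ^ (p ^ i)) ` {..<d x}" if "x \<in># M" for x
    using d(1)[OF that] by (intro image_eqI[of _ _ 0]) auto
  have "{(j, x). j \<in> {1..n} \<and> x \<in> fixed_field j - {0} \<and> orbit_poly j x dvd h} =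
        (\<lambda>(x, t). (d x * t, x)) ` (SIGMA x:set_mset M. {1..count M x})" (is "?A = ?B")
  proof (rule antisym)
    show "?A \<subseteq> ?B"
    proof (rule subsetI)
      fix z assume "z \<in> ?A"
      then obtain j x where z: "z = (j, x)" and j: "j \<in> {1..n}" and x: "x \<in> fixed_field j" "x \<noteq> 0" "orbit_poly j x dvd h"
        by auto
      have "poly (orbit_poly j x) x = 0" using j by (auto simp: orbit_poly_def poly_prod intro!: bexI[of _ 0])
      then have "poly h x = 0" using x(3) by (auto elim!: dvdE)
      then have xM: "x \<in># M" using h0 by (simp add: M_def)
      obtain t where t: "j = d x * t" using dvd_d[OF xM x(1)] by (elim dvdE)
      have "count (proots (orbit_poly (d x) x ^ t)) x \<le> count M x"
        using x(3) h0 orbit_poly_pow[OF xM, of t] t orbit_poly_nonzero[of j x] unfolding countM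
        by (simp add: dvd_imp_order_le)
      then have "t \<le> count M x"
        using xorb[OF xM] by (simp add: proots_Nd[OF xM])
      moreover have "t \<ge> 1" using j t by (cases t) auto
      ultimately show "z \<in> ?B" unfolding z using xM t by (intro image_eqI[of _ _ "(x, t)"]) auto
    qed
    show "?B \<subseteq> ?A"
    proof (rule subsetI)
      fix z assume "z \<in> ?B"
      then obtain x t where z: "z = (d x * t, x)" and xM: "x \<in># M" and t: "t \<in> {1..count M x}"
        by (elim imageE SigmaE) auto
      have "proots (orbit_poly (d x) x ^ t) \<subseteq># M"
        unfolding proots_Nd[OF xM]
        by (rule mset_subset_eqI) (use t count_frob in \<open>auto simp: count_mset_set'\<close>)
      then have "image_mset (\<lambda>x. [:-x, 1:]) (proots (orbit_poly (d x) x ^ t)) \<subseteq># image_mset (\<lambda>x. [:-x, 1:]) M"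
        by (rule image_mset_subseteq_mono)
      then have "(\<Prod>x\<in>#proots (orbit_poly (d x) x ^ t). [:-x, 1:]) dvd (\<Prod>x\<in>#M. [:-x, 1:])"
        by (rule prod_mset_subset_imp_dvd)
      moreover have "(\<Prod>x\<in>#proots (orbit_poly (d x) x ^ t). [:-x, 1:]) = orbit_poly (d x) x ^ t"
        by (rule monic_split_alg_closed[symmetric]) (simp add: lead_coeff_power lead_coeff_orbit_poly)
      ultimately have dv: "orbit_poly (d x * t) x dvd h" using hM(1) by (simp add: orbit_poly_pow[OF xM])
      have "d x * t \<le> n" using dvd_imp_degree_le[OF dv h0] h by (simp add: degree_orbit_poly invariant_polys_def)
      then show "z \<in> ?A" using t d(1)[OF xM] dv mult_d[OF xM] hM(3) xM by (auto simp: Suc_le_eq z)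
    qed
  qed
  moreover have "inj_on (\<lambda>(x, t). (d x * t, x)) (SIGMA x:set_mset M. {1..count M x})"
    using d(1) by (fastforce simp: inj_on_def)
  ultimately have "card {(j, x). j \<in> {1..n} \<and> x \<in> fixed_field j - {0} \<and> orbit_poly j x dvd h} = card (SIGMA x:set_mset M. {1..count M x})"
    by (simp only: card_image)
  also have "\<dots> = size M" by (simp add: size_multiset_overloaded_eq)
  finally show ?thesis using hM(2) by simp
qed

end

section \<open>The L-function of a Kloosterman sum and the Weil bound\<close>

locale kloosterman_char = kloosterman_fun p ty a b
  for p :: nat and ty :: "'a::alg_closed_field itself" and a b :: 'a +
  fixes \<psi> :: "'a \<Rightarrow> complex"
  assumes psi_add: "x \<in> fixed_field 1 \<Longrightarrow> y \<in> fixed_field 1 \<Longrightarrow> \<psi> (x + y) = \<psi> x * \<psi> y"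
    and psi_nontriv: "\<exists>x\<in>fixed_field 1. \<psi> x \<noteq> 1"
    and psi_norm: "x \<in> fixed_field 1 \<Longrightarrow> norm (\<psi> x) = 1"
begin

(* ext_sum 1 and fixed_field 1 are to be kept in this form. *)
declare One_nat_def [simp del]

lemma coeff_pCons_1: "coeff (pCons x q) 1 = coeff q 0"
  by (simp add: One_nat_def)

lemma psi_0: "\<psi> 0 = 1"
proof -
  have "\<psi> 0 = \<psi> 0 * \<psi> 0" using psi_add[of 0 0] fixed_field_0 by simp
  moreover have "\<psi> 0 \<noteq> 0" using psi_norm[of 0] fixed_field_0 by auto
  ultimately show ?thesis by simp
qed

lemma psi_sum_eq_0: "(\<Sum>x\<in>fixed_field 1. \<psi> x) = 0"
proof -
  obtain u where u: "u \<in> fixed_field 1" "\<psi> u \<noteq> 1" using psi_nontriv by blast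
  have "(\<Sum>x\<in>fixed_field 1. \<psi> x) = (\<Sum>x\<in>fixed_field 1. \<psi> (x + u))"
    by (rule sum.reindex_bij_witness[of _ "\<lambda>x. x + u" "\<lambda>x. x - u"]) (auto intro: fixed_field_add fixed_field_diff u)
  also have "\<dots> = (\<Sum>x\<in>fixed_field 1. \<psi> x) * \<psi> u"
    unfolding sum_distrib_right by (rule sum.cong) (auto simp: psi_add u)
  finally show ?thesis using u(2) by simp
qed

definition ext_sum :: "nat \<Rightarrow> complex" where "ext_sum n = (\<Sum>x\<in>fixed_field n - {0}. \<psi> (Tr n (phase x)))"

text \<open>Sorting \<open>x\<close> by the trace of \<open>phase x\<close>, one may subtract from every fibre size the upper bound \<open>B\<close> of
\<open>stepanov_fibre_bound\<close>, because a nontrivial character sums to zero. What is left has total mass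
\<open>p * B - (p ^ (2 * m) - 1)\<close>, so an upper bound for the fibres bounds the sum on both sides.\<close>

lemma ext_sum_bound:
  assumes m: "m \<ge> 2"
  shows "norm (ext_sum (2 * m)) \<le> (3 * real p + 1) * real p ^ m"
proof -
  define Z where "Z c = {x \<in> fixed_field (2*m) - {0}. Tr (2*m) (phase x) = c}" for c
  define B where "B = p ^ (2*m-1) + 3 * p ^ m"
  have fin: "finite (fixed_field (2*m) - {0})" and fin1: "finite (fixed_field 1)" using card_fixed_field[of "2*m"] card_fixed_field[of 1] m by auto
  have "p ^ m * p ^ (m - 1) = p ^ (2*m-1)" using m by (simp add: mult_2 flip: power_add)
  then have ZB: "card (Z c) \<le> B" for c
    using stepanov_fibre_bound[OF m, of c] unfolding Z_def B_def by (simp add: algebra_simps)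
  have TK: "Tr (2*m) (phase x) \<in> fixed_field 1" if "x \<in> fixed_field (2*m)" for x
    by (intro Tr_fixed_field_1 phase_fixed_field that)
  have "ext_sum (2*m) = (\<Sum>c\<in>fixed_field 1. \<Sum>x\<in>Z c. \<psi> (Tr (2*m) (phase x)))"
    unfolding ext_sum_def Z_def by (rule sum.group[symmetric]) (use fin fin1 TK in auto)
  also have "\<dots> = (\<Sum>c\<in>fixed_field 1. of_nat (card (Z c)) * \<psi> c)"
    by (intro sum.cong) (auto simp: Z_def)
  also have "\<dots> = (\<Sum>c\<in>fixed_field 1. of_nat B * \<psi> c) - (\<Sum>c\<in>fixed_field 1. of_nat (B - card (Z c)) * \<psi> c)"
    using ZB by (simp add: of_nat_diff left_diff_distrib flip: sum_subtractf)
  also have "\<dots> = - (\<Sum>c\<in>fixed_field 1. of_nat (B - card (Z c)) * \<psi> c)"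
    by (simp add: psi_sum_eq_0 flip: sum_distrib_left)
  also have "norm \<dots> \<le> (\<Sum>c\<in>fixed_field 1. real (B - card (Z c)))"
    unfolding norm_minus_cancel by (rule sum_norm_le) (auto simp: norm_mult psi_norm)
  also have "\<dots> = real p * real B - real (\<Sum>c\<in>fixed_field 1. card (Z c))"
    using ZB card_fixed_field[of 1] by (simp add: of_nat_diff sum_subtractf)
  also have "(\<Sum>c\<in>fixed_field 1. card (Z c)) = card (fixed_field (2*m) - {0})"
    unfolding Z_def using sum.group[of "fixed_field (2*m) - {0}" "fixed_field 1" "\<lambda>x. Tr (2*m) (phase x)" "\<lambda>_. 1::nat"] fin fin1 TK by auto
  also have "\<dots> = p ^ (2*m) - 1"
    using card_fixed_field[of "2*m"] m fixed_field_0[of "2*m"] by simp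
  also have "real (p ^ (2*m) - 1) = real p ^ (2*m) - 1"
    using p_pos by (simp add: of_nat_diff)
  also have "real p * real B = real p ^ (2*m) + 3 * real p * real p ^ m"
  proof -
    have e: "Suc (2*m-1) = 2*m" using m by arith
    have "real p * real p ^ (2*m-1) = real p ^ (2*m)" by (simp only: power_Suc[symmetric] e)
    then show ?thesis by (simp add: B_def distrib_left)
  qed
  finally have "norm (ext_sum (2*m)) \<le> 3 * real p * real p ^ m + 1" by simp
  also have "\<dots> \<le> 3 * real p * real p ^ m + real p ^ m"
    using p_pos by (simp add: one_le_power)
  finally show ?thesis by (simp add: algebra_simps)
qed

text \<open>A multiplicative function on invariant polynomials; its sums \<open>L_coeff d\<close> over degree \<open>d\<close> are the
coefficients of the L-function whose logarithmic derivative generates the sums \<open>ext_sum n\<close>.\<close>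

definition \<Lambda> :: "'a poly \<Rightarrow> complex" where "\<Lambda> h = \<psi> (\<Sum>x\<in>#proots h. phase x)"

definition L_coeff :: "nat \<Rightarrow> complex" where "L_coeff d = (\<Sum>h\<in>invariant_polys d. \<Lambda> h)"

text \<open>Both the sum of the roots and the sum of their inverses are read off from two coefficients each,
so \<open>\<Lambda>\<close> depends on the coefficients in a simple way. The coefficient of index \<open>d - 1\<close> is written as the
coefficient \<open>d\<close> of \<open>pCons 0 h\<close>, which is correct for \<open>d = 0\<close> as well.\<close>

lemma sum_proots_eq:
  assumes h: "h \<in> invariant_polys d"
  shows "(\<Sum>x\<in>#proots h. phase x) = - (a * coeff (pCons 0 h) d) - b * (coeff h 1 / coeff h 0)"
proof -
  note hM = proots_invariant_polys[OF h]
  note c = coeff_prod_mset_linear[OF hM(3), folded hM(1)]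
  have split: "(\<Sum>x\<in>#M. phase x) = a * sum_mset M + b * (\<Sum>x\<in>#M. 1 / x)" for M
    by (induction M) (auto simp: phase_def algebra_simps)
  have "coeff (pCons 0 h) d = - sum_mset (proots h)" using c(2) unfolding hM(2) .
  then have "sum_mset (proots h) = - coeff (pCons 0 h) d" by simp
  then show ?thesis unfolding split c(4) by simp
qed

lemma coeff_invariant_polys: "h \<in> invariant_polys d \<Longrightarrow> coeff h i \<in> fixed_field 1"
  by (auto simp: invariant_polys_def frob_poly_eq_iff)

lemma coeff_pCons_invariant_polys: "h \<in> invariant_polys d \<Longrightarrow> coeff (pCons 0 h) i \<in> fixed_field 1"
  using coeff_invariant_polys fixed_field_0 by (auto simp: coeff_pCons split: nat.split)

lemma sum_proots_fixed_field: "h \<in> invariant_polys d \<Longrightarrow> (\<Sum>x\<in>#proots h. phase x) \<in> fixed_field 1"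
  unfolding sum_proots_eq by (intro fixed_field_diff fixed_field_minus fixed_field_mult fixed_field_divide coeff_invariant_polys coeff_pCons_invariant_polys ab)

lemma Lambda_orbit_poly: "x \<in> fixed_field j - {0} \<Longrightarrow> \<Lambda> (orbit_poly j x) = \<psi> (Tr j (phase x))"
  by (simp add: \<Lambda>_def proots_orbit_poly Tr_def frob_phase' multiset.map_comp comp_def flip: sum_unfold_sum_mset)

lemma Lambda_mult:
  assumes "g \<in> invariant_polys d" "h \<in> invariant_polys e" shows "\<Lambda> (g * h) = \<Lambda> g * \<Lambda> h"
proof -
  have "g \<noteq> 0" "h \<noteq> 0" using assms by (auto simp: invariant_polys_def)
  then show ?thesis using assms by (simp add: \<Lambda>_def proots_mult psi_add sum_proots_fixed_field)
qed

lemma invariant_polys_mult: "g \<in> invariant_polys d \<Longrightarrow> h \<in> invariant_polys e \<Longrightarrow> g * h \<in> invariant_polys (d + e)"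
proof -
  assume g: "g \<in> invariant_polys d" and h: "h \<in> invariant_polys e"
  then have "g \<noteq> 0" "h \<noteq> 0" by (auto simp: invariant_polys_def)
  moreover have "lead_coeff g = 1" "lead_coeff h = 1" using g h by (auto simp: invariant_polys_def)
  then have "lead_coeff (g * h) = 1" by (simp add: lead_coeff_mult)
  ultimately show ?thesis using g h by (simp add: invariant_polys_def frob_poly_mult degree_mult_eq coeff_mult_0)
qed

lemma invariant_polys_quotient:
  assumes "g \<in> invariant_polys d" "g * h \<in> invariant_polys n" shows "h \<in> invariant_polys (n - d)"
proof -
  have g0: "g \<noteq> 0" and h0: "h \<noteq> 0" using assms by (auto simp: invariant_polys_def)
  have "frob_poly g * frob_poly h = g * h" "frob_poly g = g" using assms by (auto simp: invariant_polys_def frob_poly_mult)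
  then have "frob_poly h = h" using g0 by simp
  moreover have "lead_coeff (g * h) = 1" "lead_coeff g = 1" using assms by (auto simp: invariant_polys_def)
  then have "lead_coeff h = 1" using lead_coeff_mult[of g h] by simp
  ultimately show ?thesis using assms g0 h0
    by (auto simp: invariant_polys_def degree_mult_eq coeff_mult_0)
qed

text \<open>Newton's identity between power sums and coefficients. By \<open>card_orbit_poly_divisors\<close> the left side
counts each \<open>h\<close> once for every pair \<open>(j, x)\<close> with \<open>orbit_poly j x\<close> dividing \<open>h\<close>; writing
\<open>h = orbit_poly j x * g\<close> and using multiplicativity of \<open>\<Lambda>\<close> gives the right side.\<close>

lemma newton_identity: "of_nat n * L_coeff n = (\<Sum>j=1..n. ext_sum j * L_coeff (n - j))"
proof -
  have "of_nat n * L_coeff n = (\<Sum>h\<in>invariant_polys n. \<Sum>z\<in>{(j, x). j \<in> {1..n} \<and> x \<in> fixed_field j - {0} \<and> orbit_poly j x dvd h}. \<Lambda> h)"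
    unfolding L_coeff_def sum_distrib_left by (rule sum.cong) (auto simp only: sum_constant card_orbit_poly_divisors)
  also have "\<dots> = (\<Sum>h\<in>invariant_polys n. \<Sum>z\<in>(SIGMA j:{1..n}. fixed_field j - {0}). if orbit_poly (fst z) (snd z) dvd h then \<Lambda> h else 0)"
  proof (rule sum.cong)
    fix h
    have "finite (SIGMA j:{1..n}. fixed_field j - {0})" using card_fixed_field(1) by (intro finite_SigmaI) auto
    moreover have "{(j, x). j \<in> {1..n} \<and> x \<in> fixed_field j - {0} \<and> orbit_poly j x dvd h} = (SIGMA j:{1..n}. fixed_field j - {0}) \<inter> {z. orbit_poly (fst z) (snd z) dvd h}"
      by auto
    ultimately show "(\<Sum>z\<in>{(j, x). j \<in> {1..n} \<and> x \<in> fixed_field j - {0} \<and> orbit_poly j x dvd h}. \<Lambda> h) =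
       (\<Sum>z\<in>(SIGMA j:{1..n}. fixed_field j - {0}). if orbit_poly (fst z) (snd z) dvd h then \<Lambda> h else 0)"
      by (simp only: sum.inter_restrict mem_Collect_eq)
  qed simp
  also have "\<dots> = (\<Sum>z\<in>(SIGMA j:{1..n}. fixed_field j - {0}). \<Sum>h\<in>invariant_polys n. if orbit_poly (fst z) (snd z) dvd h then \<Lambda> h else 0)"
    by (rule sum.swap)
  also have "\<dots> = (\<Sum>j=1..n. \<Sum>x\<in>fixed_field j - {0}. \<Sum>h\<in>invariant_polys n. if orbit_poly j x dvd h then \<Lambda> h else 0)"
    using card_fixed_field(1) by (subst sum.Sigma) (auto simp: case_prod_unfold)
  also have "\<dots> = (\<Sum>j=1..n. \<Sum>x\<in>fixed_field j - {0}. \<psi> (Tr j (phase x)) * L_coeff (n - j))"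
  proof (intro sum.cong refl)
    fix j x assume j: "j \<in> {1..n}" and x: "x \<in> fixed_field j - {0}"
    have NH: "orbit_poly j x \<in> invariant_polys j" by (rule orbit_poly_in_invariant_polys) fact
    have "(\<Sum>h\<in>invariant_polys n. if orbit_poly j x dvd h then \<Lambda> h else 0) = (\<Sum>h\<in>{h\<in>invariant_polys n. orbit_poly j x dvd h}. \<Lambda> h)"
      using finite_invariant_polys by (simp add: sum.inter_filter)
    also have "\<dots> = (\<Sum>g\<in>invariant_polys (n - j). \<Lambda> (orbit_poly j x * g))"
    proof (rule sum.reindex_bij_witness[of _ "\<lambda>g. orbit_poly j x * g" "\<lambda>h. h div orbit_poly j x"])
      fix h assume h: "h \<in> {h \<in> invariant_polys n. orbit_poly j x dvd h}"
      then show "orbit_poly j x * (h div orbit_poly j x) = h" by simp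
      then show "h div orbit_poly j x \<in> invariant_polys (n - j)" using h NH by (intro invariant_polys_quotient[of "orbit_poly j x"]) auto
      show "\<Lambda> (orbit_poly j x * (h div orbit_poly j x)) = \<Lambda> h" using h by simp
    next
      fix g assume "g \<in> invariant_polys (n - j)"
      then show "orbit_poly j x * g \<in> {h \<in> invariant_polys n. orbit_poly j x dvd h}" using invariant_polys_mult[OF NH, of g "n - j"] j by simp
      show "orbit_poly j x * g div orbit_poly j x = g" using orbit_poly_nonzero by simp
    qed
    also have "\<dots> = \<psi> (Tr j (phase x)) * L_coeff (n - j)"
      unfolding L_coeff_def sum_distrib_left by (rule sum.cong) (auto simp: Lambda_mult[OF NH] Lambda_orbit_poly[OF x])
    finally show "(\<Sum>h\<in>invariant_polys n. if orbit_poly j x dvd h then \<Lambda> h else 0) = \<psi> (Tr j (phase x)) * L_coeff (n - j)" .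
  qed
  also have "\<dots> = (\<Sum>j=1..n. ext_sum j * L_coeff (n - j))" by (simp add: ext_sum_def sum_distrib_right)
  finally show ?thesis .
qed

lemma L_coeff_0: "L_coeff 0 = 1"
  by (simp add: L_coeff_def invariant_polys_0 \<Lambda>_def psi_0)

lemma L_coeff_1: "L_coeff 1 = ext_sum 1"
  using newton_identity[of 1] by (simp add: L_coeff_0)

lemma invariant_polys_shift:
  assumes h: "h \<in> invariant_polys (Suc (Suc d))" and t: "t \<in> fixed_field 1"
  shows "h + monom t (Suc d) \<in> invariant_polys (Suc (Suc d))"
proof -
  have "degree (monom t (Suc d)) < degree h" using h by (auto simp: invariant_polys_def intro: le_less_trans[OF degree_monom_le])
  then have "degree (h + monom t (Suc d)) = Suc (Suc d)" using h by (simp add: degree_add_eq_left invariant_polys_def)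
  moreover have "coeff (h + monom t (Suc d)) i \<in> fixed_field 1" for i
    using coeff_invariant_polys[OF h, of i] t fixed_field_add[of _ 1 t] by (auto simp: fixed_field_add)
  ultimately show ?thesis using h by (auto simp: invariant_polys_def frob_poly_eq_iff)
qed

lemma Lambda_shift:
  assumes h: "h \<in> invariant_polys (Suc (Suc d))" and t: "t \<in> fixed_field 1"
  shows "\<Lambda> (h + monom t (Suc d)) = \<Lambda> h * \<psi> (- (a * t) - b * ((if d = 0 then t else 0) / coeff h 0))"
proof -
  note h' = invariant_polys_shift[OF h t]
  have "(\<Sum>x\<in>#proots (h + monom t (Suc d)). phase x) = (\<Sum>x\<in>#proots h. phase x) + (- (a * t) - b * ((if d = 0 then t else 0) / coeff h 0))"
    unfolding sum_proots_eq[OF h] sum_proots_eq[OF h'] by (simp add: algebra_simps add_divide_distrib)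
  moreover have "- (a * t) - b * ((if d = 0 then t else 0) / coeff h 0) \<in> fixed_field 1"
    by (intro fixed_field_diff fixed_field_minus fixed_field_mult fixed_field_divide coeff_invariant_polys[OF h] ab) (auto simp: t fixed_field_0)
  ultimately show ?thesis by (simp add: \<Lambda>_def psi_add sum_proots_fixed_field[OF h])
qed

text \<open>From degree 3 on, the second highest coefficient of \<open>h\<close> is not among those that enter the sum of the
inverse roots. Shifting it multiplies every \<open>\<Lambda> h\<close> by a common character value, which can be chosen
different from 1.\<close>

lemma L_coeff_ge_3: "L_coeff (Suc (Suc (Suc d))) = 0"
proof -
  obtain u where u: "u \<in> fixed_field 1" "\<psi> u \<noteq> 1" using psi_nontriv by blast
  define t where "t = - u / a"
  have t: "t \<in> fixed_field 1" "- (a * t) = u" using u ab by (auto simp: t_def intro: fixed_field_divide fixed_field_minus)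
  let ?n = "Suc (Suc (Suc d))"
  have "L_coeff ?n = (\<Sum>h\<in>invariant_polys ?n. \<Lambda> (h + monom t (Suc (Suc d))))"
    unfolding L_coeff_def
    by (rule sum.reindex_bij_witness[of _ "\<lambda>h. h + monom t (Suc (Suc d))" "\<lambda>h. h + monom (-t) (Suc (Suc d))"])
       (use t(1) fixed_field_minus[OF t(1)] in \<open>auto intro: invariant_polys_shift simp: add_monom add.assoc\<close>)
  also have "\<dots> = L_coeff ?n * \<psi> u"
    unfolding L_coeff_def sum_distrib_right by (rule sum.cong) (auto simp: Lambda_shift t)
  finally show ?thesis using u(2) by simp
qed

text \<open>In degree 2 the shift changes both the sum of the roots and the sum of their inverses, and it cancels
the contribution of every constant term except \<open>- b / a\<close>, where the two changes compensate and
\<open>\<Lambda> h = 1\<close>.\<close>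

lemma L_coeff_2: "L_coeff 2 = of_nat p"
proof -
  define c0 where "c0 = - b / a"
  have c0: "c0 \<in> fixed_field 1" "c0 \<noteq> 0" "a + b / c0 = 0" using ab by (auto simp: c0_def intro: fixed_field_divide fixed_field_minus)
  define Hc where "Hc c = {h \<in> invariant_polys 2. coeff h 0 = c}" for c
  have zero: "(\<Sum>h\<in>Hc c. \<Lambda> h) = 0" if c: "c \<in> fixed_field 1" "c \<noteq> 0" "c \<noteq> c0" for c
  proof -
    obtain u where u: "u \<in> fixed_field 1" "\<psi> u \<noteq> 1" using psi_nontriv by blast
    have ne: "a + b / c \<noteq> 0" using c ab by (auto simp: c0_def field_simps add_eq_0_iff)
    define t where "t = - u / (a + b / c)"
    have "t * (a + b / c) = - u" using ne by (simp add: t_def)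
    then have "- (a * t) - b * (t / c) = u" by (simp add: algebra_simps eq_neg_iff_add_eq_0 neg_eq_iff_add_eq_0)
    moreover have "t \<in> fixed_field 1"
      unfolding t_def by (intro fixed_field_divide fixed_field_minus fixed_field_add u ab c)
    ultimately have t: "t \<in> fixed_field 1" "- (a * t) - b * (t / c) = u" by auto
    have "(\<Sum>h\<in>Hc c. \<Lambda> h) = (\<Sum>h\<in>Hc c. \<Lambda> (h + monom t 1))"
      by (rule sum.reindex_bij_witness[of _ "\<lambda>h. h + monom t 1" "\<lambda>h. h + monom (-t) 1"])
         (use t(1) fixed_field_minus[OF t(1)] invariant_polys_shift[of _ 0] in \<open>auto simp: add_monom add.assoc Hc_def numeral_2_eq_2 One_nat_def\<close>)
    also have "\<dots> = (\<Sum>h\<in>Hc c. \<Lambda> h) * \<psi> u"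
      unfolding sum_distrib_right
      by (rule sum.cong) (use t Lambda_shift[of _ 0 t] in \<open>auto simp: Hc_def numeral_2_eq_2 One_nat_def\<close>)
    finally show ?thesis using u(2) by simp
  qed
  have fin1: "finite (fixed_field 1 - {0})" using card_fixed_field(1)[of 1] by simp
  have img: "(\<lambda>h. coeff h 0) ` invariant_polys 2 \<subseteq> fixed_field 1 - {0}"
  proof (rule image_subsetI)
    fix h assume h: "h \<in> invariant_polys 2"
    then have "coeff h 0 \<noteq> 0" by (simp add: invariant_polys_def)
    then show "coeff h 0 \<in> fixed_field 1 - {0}" using coeff_invariant_polys[OF h] by simp
  qed
  have "L_coeff 2 = (\<Sum>c\<in>fixed_field 1 - {0}. \<Sum>h\<in>Hc c. \<Lambda> h)"
    unfolding L_coeff_def Hc_def by (rule sum.group[OF finite_invariant_polys fin1 img, symmetric])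
  also have "\<dots> = (\<Sum>c\<in>fixed_field 1 - {0}. if c = c0 then (\<Sum>h\<in>Hc c0. \<Lambda> h) else 0)"
    by (rule sum.cong) (auto simp: zero)
  also have "\<dots> = (\<Sum>h\<in>Hc c0. \<Lambda> h)" using c0 fin1 by (simp add: sum.delta)
  also have "\<dots> = (\<Sum>h\<in>Hc c0. 1)"
  proof (rule sum.cong)
    fix h assume "h \<in> Hc c0"
    then have h: "h \<in> invariant_polys 2" "coeff h 0 = c0" by (auto simp: Hc_def)
    have "(\<Sum>x\<in>#proots h. phase x) = - (a + b / c0) * coeff h 1"
      unfolding sum_proots_eq[OF h(1)] h(2) by (simp add: numeral_2_eq_2 One_nat_def algebra_simps)
    then show "\<Lambda> h = 1" by (simp add: \<Lambda>_def c0 psi_0)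
  qed simp
  also have "\<dots> = of_nat (card (Hc c0))" by simp
  also have "card (Hc c0) = card (fixed_field 1)"
  proof (rule bij_betw_same_card[OF bij_betw_byWitness[where f = "\<lambda>h. coeff h 1" and f' = "\<lambda>c. [:c0, c, 1:]"]])
    show "\<forall>h\<in>Hc c0. [:c0, coeff h 1, 1:] = h"
    proof
      fix h assume h: "h \<in> Hc c0"
      show "[:c0, coeff h 1, 1:] = h"
      proof (rule poly_eqI)
        fix n show "coeff [:c0, coeff h 1, 1:] n = coeff h n"
          using h by (auto simp: Hc_def invariant_polys_def coeff_pCons numeral_2_eq_2 One_nat_def coeff_eq_0 split: nat.split)
      qed
    qed
    show "(\<lambda>c. [:c0, c, 1:]) ` fixed_field 1 \<subseteq> Hc c0"
      using c0 fixed_field_1[of 1] fixed_field_0[of 1] by (auto simp: Hc_def invariant_polys_def frob_poly_eq_iff coeff_pCons split: nat.split)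
  qed (auto simp: Hc_def coeff_invariant_polys coeff_pCons_1)
  finally show ?thesis using card_fixed_field[of 1] by simp
qed

lemma ext_sum_2: "ext_sum 2 = 2 * of_nat p - ext_sum 1 ^ 2"
proof -
  have "2 * L_coeff 2 = ext_sum 1 * L_coeff 1 + ext_sum 2 * L_coeff 0"
    using newton_identity[of 2] by (simp add: numeral_2_eq_2 One_nat_def)
  then show ?thesis by (simp add: L_coeff_2 L_coeff_1[simplified] L_coeff_0 power2_eq_square algebra_simps)
qed

text \<open>The L-function being a polynomial of degree 2, Newton's identities become a two-term recursion.\<close>

lemma ext_sum_rec: "ext_sum (Suc (Suc (Suc n))) = - ext_sum 1 * ext_sum (Suc (Suc n)) - of_nat p * ext_sum (Suc n)"
proof -
  let ?n = "Suc (Suc (Suc n))"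
  have "0 = (\<Sum>j=1..?n. ext_sum j * L_coeff (?n - j))" using newton_identity[of ?n] by (simp add: L_coeff_ge_3)
  also have "\<dots> = (\<Sum>j\<in>{Suc n, Suc (Suc n), ?n}. ext_sum j * L_coeff (?n - j))"
  proof (rule sum.mono_neutral_right)
    show "\<forall>i\<in>{1..?n} - {Suc n, Suc (Suc n), ?n}. ext_sum i * L_coeff (?n - i) = 0"
    proof
      fix i assume i: "i \<in> {1..?n} - {Suc n, Suc (Suc n), ?n}"
      then have "?n - i = Suc (Suc (Suc (n - i)))" by auto
      then show "ext_sum i * L_coeff (?n - i) = 0" by (simp add: L_coeff_ge_3)
    qed
  qed auto
  also have "\<dots> = ext_sum (Suc n) * L_coeff 2 + ext_sum (Suc (Suc n)) * L_coeff 1 + ext_sum ?n * L_coeff 0"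
    by (simp add: numeral_2_eq_2 One_nat_def add.assoc)
  finally have "ext_sum (Suc n) * L_coeff 2 + ext_sum (Suc (Suc n)) * L_coeff 1 + ext_sum ?n * L_coeff 0 = 0" by simp
  then have "ext_sum ?n + (ext_sum (Suc n) * of_nat p + ext_sum (Suc (Suc n)) * ext_sum 1) = 0"
    unfolding L_coeff_2 L_coeff_1 L_coeff_0 by (simp add: algebra_simps)
  then have "ext_sum ?n = - (ext_sum (Suc n) * of_nat p + ext_sum (Suc (Suc n)) * ext_sum 1)" by (simp only: eq_neg_iff_add_eq_0)
  also have "\<dots> = - ext_sum 1 * ext_sum (Suc (Suc n)) - of_nat p * ext_sum (Suc n)" by (simp add: algebra_simps)
  finally show ?thesis .
qed

text \<open>The recursion gives \<open>ext_sum n = - (\<alpha> ^ n + \<beta> ^ n)\<close> with \<open>\<alpha> * \<beta> = p\<close>. If one of the two exceeded the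
square root of \<open>p\<close> in absolute value, the other would lie below it, and \<open>ext_sum (2 * m)\<close> would outgrow
\<open>p ^ m\<close> by an exponential factor, against \<open>ext_sum_bound\<close>.\<close>

theorem weil_bound: "norm (ext_sum 1) \<le> 2 * sqrt (real p)"
proof (rule ccontr)
  assume neg: "\<not> ?thesis"
  define s where "s = ext_sum 1"
  define D where "D = csqrt (s ^ 2 - 4 * of_nat p)"
  define \<alpha> where "\<alpha> = (- s + D) / 2"
  define \<beta> where "\<beta> = (- s - D) / 2"
  have D2: "D ^ 2 = s ^ 2 - 4 * of_nat p" by (simp add: D_def)
  have sum: "\<alpha> + \<beta> = - s" by (simp add: \<alpha>_def \<beta>_def field_simps)
  have "4 * (\<alpha> * \<beta>) = s ^ 2 - D ^ 2" by (simp add: \<alpha>_def \<beta>_def power2_eq_square field_simps)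
  then have prd: "\<alpha> * \<beta> = of_nat p" by (simp add: D2)
  have rec: "\<alpha> ^ Suc (Suc k) + \<beta> ^ Suc (Suc k) = (\<alpha> + \<beta>) * (\<alpha> ^ Suc k + \<beta> ^ Suc k) - \<alpha> * \<beta> * (\<alpha> ^ k + \<beta> ^ k)" for k
    by (simp add: algebra_simps)
  have gen: "- s * - u - of_nat p * - v = - (- s * u - of_nat p * v)" for u v
    by (simp add: algebra_simps)
  have ext_sum: "ext_sum (Suc n) = - (\<alpha> ^ Suc n + \<beta> ^ Suc n) \<and> ext_sum (Suc (Suc n)) = - (\<alpha> ^ Suc (Suc n) + \<beta> ^ Suc (Suc n))" for n
  proof (induction n)
    case 0
    show ?case using ext_sum_2 rec[of 0] sum prd by (simp add: s_def numeral_2_eq_2 power2_eq_square One_nat_def)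
  next
    case (Suc n)
    then have e1: "ext_sum (Suc n) = - (\<alpha> ^ Suc n + \<beta> ^ Suc n)"
      and e2: "ext_sum (Suc (Suc n)) = - (\<alpha> ^ Suc (Suc n) + \<beta> ^ Suc (Suc n))" by blast+
    have "ext_sum (Suc (Suc (Suc n))) = - (\<alpha> ^ Suc (Suc (Suc n)) + \<beta> ^ Suc (Suc (Suc n)))"
      unfolding ext_sum_rec s_def[symmetric] rec[of "Suc n"] sum prd e1 e2 by (rule gen)
    then show ?case using e2 by blast
  qed
  have False if big: "norm x > sqrt (real p)" and xy: "x * y = of_nat p" and S': "\<And>n. ext_sum (Suc n) = - (x ^ Suc n + y ^ Suc n)" for x y
  proof -
    have sp: "sqrt (real p) > 0" using p_pos by simp
    have nxy: "norm x * norm y = real p" using xy by (metis norm_mult norm_of_nat)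
    have "norm y \<le> sqrt (real p)"
    proof (rule ccontr)
      assume "\<not> ?thesis"
      then have "sqrt (real p) * sqrt (real p) < norm x * norm y" using big sp by (intro mult_strict_mono) auto
      then show False using nxy by simp
    qed
    then have ny: "norm y ^ 2 \<le> real p" by (metis norm_ge_zero power_mono real_sqrt_pow2 of_nat_0_le_iff)
    define \<rho> where "\<rho> = norm x ^ 2 / real p"
    have "real p < norm x ^ 2" using power_strict_mono[OF big, of 2] sp by simp
    then have "\<rho> > 1" using p_pos by (simp add: \<rho>_def)
    then obtain m0 where m0: "3 * real p + 2 < \<rho> ^ m0" using real_arch_pow by blast
    define m where "m = m0 + 2"
    have "\<rho> ^ m0 \<le> \<rho> ^ m" using \<open>\<rho> > 1\<close> by (intro power_increasing) (auto simp: m_def)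
    then have m: "3 * real p + 2 < \<rho> ^ m" using m0 by simp
    have "norm x ^ (2*m) - norm y ^ (2*m) \<le> norm (x ^ (2*m) + y ^ (2*m))"
      using norm_triangle_ineq2[of "x ^ (2*m)" "- (y ^ (2*m))"] by (simp add: norm_power)
    also have "x ^ (2*m) + y ^ (2*m) = - ext_sum (2*m)"
    proof -
      have "m \<ge> 2" unfolding m_def by (rule le_add2)
      then have e: "Suc (2*m-1) = 2*m" by arith
      show ?thesis using S'[of "2*m-1"] unfolding e by (simp only: minus_minus)
    qed
    also have "norm \<dots> = norm (ext_sum (2*m))" by (rule norm_minus_cancel)
    also have "\<dots> \<le> (3 * real p + 1) * real p ^ m" by (rule ext_sum_bound) (unfold m_def, rule le_add2)
    finally have "norm x ^ (2*m) \<le> (3 * real p + 1) * real p ^ m + norm y ^ (2*m)" by simp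
    also have "norm y ^ (2*m) \<le> real p ^ m" unfolding power_mult using ny by (intro power_mono) auto
    finally have "norm x ^ (2*m) \<le> (3 * real p + 2) * real p ^ m" by (simp add: algebra_simps)
    moreover have "norm x ^ (2*m) = \<rho> ^ m * real p ^ m"
      using p_pos by (simp add: \<rho>_def power_mult power_divide)
    ultimately show False using m p_pos by (simp add: mult_le_cancel_right)
  qed
  then have "norm \<alpha> \<le> sqrt (real p)" "norm \<beta> \<le> sqrt (real p)"
    using ext_sum prd by (metis not_le add.commute mult.commute)+
  then have "norm (\<alpha> + \<beta>) \<le> 2 * sqrt (real p)" using norm_triangle_ineq[of \<alpha> \<beta>] by linarith
  then show False using neg sum by (simp add: s_def)
qed

end

section \<open>Kloosterman sums to a prime modulus\<close>

definition e_mod :: "nat \<Rightarrow> int \<Rightarrow> complex" where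
  "e_mod q k = cis (2 * pi * real_of_int k / real q)"

text \<open>The customary sum over units and their inverses, written as a sum over all solutions of a
congruence; this form is convenient for the Chinese remainder theorem and for counting solutions.\<close>

definition kloosterman :: "nat \<Rightarrow> int \<Rightarrow> int \<Rightarrow> int \<Rightarrow> complex" where
  "kloosterman q c m n = (\<Sum>x<q. \<Sum>y<q. if [c * int x * int y = 1] (mod int q)
      then e_mod q (m * int x + n * int y) else 0)"

lemma e_mod_cong:
  assumes "[k = l] (mod int q)" "q > 0"
  shows "e_mod q k = e_mod q l"
proof -
  obtain t where t: "k = l + int q * t" using assms(1) by (metis cong_iff_lin cong_sym)
  have "2 * pi * real_of_int k / real q = 2 * pi * real_of_int l / real q + 2 * pi * of_int t"
    using assms(2) by (simp add: t field_simps)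
  then show ?thesis by (simp add: e_mod_def cis_mult[symmetric] cis_multiple_2pi)
qed

context char_p_closed
begin

lemma of_nat_fixed_field_1: "of_nat k \<in> fixed_field 1"
proof (induction k)
  case (Suc k)
  then show ?case using fixed_field_add[OF fixed_field_1[of 1] Suc] by simp
qed (use fixed_field_0 in simp)

lemma of_int_fixed_field_1: "of_int k \<in> fixed_field 1"
  by (cases k rule: int_cases2) (auto intro: of_nat_fixed_field_1 fixed_field_minus simp del: One_nat_def)

lemma of_int_eq_iff: "(of_int k :: 'a) = of_int l \<longleftrightarrow> [k = l] (mod int p)"
proof -
  have "(of_int k :: 'a) = of_int l \<longleftrightarrow> (of_int (k - l) :: 'a) = 0" by simp
  also have "\<dots> \<longleftrightarrow> int p dvd k - l" by (simp only: of_int_eq_0_iff_char_dvd char_p)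
  finally show ?thesis by (simp add: cong_iff_dvd_diff)
qed

lemma bij_of_nat: "bij_betw (of_nat :: nat \<Rightarrow> 'a) {..<p} (fixed_field 1)"
proof -
  have "inj_on (of_nat :: nat \<Rightarrow> 'a) {..<p}"
  proof (rule inj_onI)
    fix x y assume "x \<in> {..<p}" "y \<in> {..<p}" "(of_nat x :: 'a) = of_nat y"
    then show "x = y" using of_int_eq_iff[of "int x" "int y"] by (simp add: cong_int_iff cong_def)
  qed
  moreover have "of_nat ` {..<p} = fixed_field 1"
  proof (rule card_subset_eq)
    show "card (of_nat ` {..<p} :: 'a set) = card (fixed_field 1)"
      using \<open>inj_on _ _\<close> card_fixed_field[of 1] by (simp add: card_image)
  qed (use card_fixed_field(1)[of 1] of_nat_fixed_field_1 in auto)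
  ultimately show ?thesis by (simp add: bij_betw_def)
qed

definition add_char :: "'a \<Rightarrow> complex" where
  "add_char x = cis (2 * pi * real (the_inv_into {..<p} of_nat x) / real p)"

lemma add_char_of_int: "add_char (of_int k) = e_mod p k"
proof -
  define j where "j = the_inv_into {..<p} of_nat (of_int k :: 'a)"
  have "of_nat j = (of_int k :: 'a)"
    unfolding j_def using bij_of_nat of_int_fixed_field_1[of k] by (simp add: f_the_inv_into_f_bij_betw)
  then have "[int j = k] (mod int p)" using of_int_eq_iff[of "int j" k] by simp
  from e_mod_cong[OF this p_pos] show ?thesis by (simp add: add_char_def j_def e_mod_def)
qed

lemma fixed_field_1_eq_of_int: "x \<in> fixed_field 1 \<Longrightarrow> \<exists>k. x = of_int k"
  using bij_of_nat by (force simp: bij_betw_def intro: exI[of _ "int _"])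

text \<open>The residues modulo \<open>p\<close> are transported to \<open>fixed_field 1\<close>. There \<open>y\<close> is \<open>1 / (c * x)\<close>, and the sum becomes
\<open>ext_sum 1\<close> for the phase with coefficients \<open>m\<close> and \<open>n / c\<close>.\<close>

lemma kloosterman_bound_prime:
  assumes "\<not> int p dvd c" "\<not> int p dvd m" "\<not> int p dvd n"
  shows "norm (kloosterman p c m n) \<le> 2 * sqrt (real p)"
proof -
  define a b :: 'a where "a = of_int m" and "b = of_int n / of_int c"
  have C0: "(of_int c :: 'a) \<noteq> 0" using assms(1) of_int_eq_iff[of c 0] by (simp add: cong_0_iff)
  interpret kloosterman_char p ty a b add_char
  proof
    show "a \<in> fixed_field 1" "b \<in> fixed_field 1" by (auto simp: a_def b_def intro!: of_int_fixed_field_1 fixed_field_divide simp del: One_nat_def)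
    show "a \<noteq> 0" "b \<noteq> 0" using assms of_int_eq_iff[of m 0] of_int_eq_iff[of n 0] C0
      by (auto simp: a_def b_def cong_0_iff)
    fix x y assume "x \<in> fixed_field 1" "y \<in> fixed_field 1"
    then obtain k l where kl: "x = of_int k" "y = of_int l" using fixed_field_1_eq_of_int by blast
    show "add_char (x + y) = add_char x * add_char y"
      unfolding kl of_int_add[symmetric] add_char_of_int e_mod_def cis_mult by (simp add: add_divide_distrib distrib_left)
  next
    show "\<exists>x\<in>fixed_field 1. add_char x \<noteq> 1"
    proof (rule bexI[of _ "of_int 1"])
      show "add_char (of_int 1) \<noteq> 1"
      proof
        assume "add_char (of_int 1) = 1"
        then have "cis (2 * pi * (1 / real p)) = 1" unfolding add_char_of_int e_mod_def by simp
        then have "cos (2 * pi * (1 / real p)) = 1" by (simp add: complex_eq_iff)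
        then obtain t :: int where "2 * pi * (1 / real p) = of_int t * 2 * pi" using cos_one_2pi_int by blast
        then have "(2 * pi) * (1 / real p) = (2 * pi) * of_int t" by (simp only: mult_ac)
        then have "1 / real p = of_int t" by (subst (asm) mult_left_cancel) auto
        moreover have "0 < 1 / real p" "1 / real p < 1" using p_gt_1 by auto
        ultimately have "0 < t" "t < 1" by (simp_all only: of_int_0_less_iff of_int_less_1_iff)
        then show False by simp
      qed
    qed (rule of_int_fixed_field_1)
  qed (simp add: add_char_def)
  have "kloosterman p c m n = (\<Sum>x<p. \<Sum>y<p. if of_int c * of_nat x * of_nat y = (1::'a)
     then add_char (of_int m * of_nat x + of_int n * of_nat y) else 0)"
    unfolding kloosterman_def
  proof (intro sum.cong refl)
    fix x y :: nat
    have "of_int c * of_nat x * of_nat y = (1::'a) \<longleftrightarrow> [c * int x * int y = 1] (mod int p)"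
      using of_int_eq_iff[of "c * int x * int y" 1] by simp
    moreover have "add_char (of_int m * of_nat x + of_int n * of_nat y) = e_mod p (m * int x + n * int y)"
      using add_char_of_int[of "m * int x + n * int y"] by simp
    ultimately show "(if [c * int x * int y = 1] (mod int p) then e_mod p (m * int x + n * int y) else 0)
      = (if of_int c * of_nat x * of_nat y = (1::'a) then add_char (of_int m * of_nat x + of_int n * of_nat y) else 0)" by simp
  qed
  also have "\<dots> = (\<Sum>x\<in>fixed_field 1. \<Sum>y\<in>fixed_field 1. if of_int c * x * y = 1 then add_char (of_int m * x + of_int n * y) else 0)"
    by (simp only: sum.reindex_bij_betw[OF bij_of_nat, symmetric])
  also have "\<dots> = (\<Sum>x\<in>fixed_field 1 - {0}. \<Sum>y\<in>fixed_field 1. if of_int c * x * y = 1 then add_char (of_int m * x + of_int n * y) else 0)"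
    by (rule sum.mono_neutral_right) (use card_fixed_field(1)[of 1] in auto)
  also have "\<dots> = ext_sum 1"
    unfolding ext_sum_def
  proof (rule sum.cong)
    fix x assume x: "x \<in> fixed_field 1 - {0}"
    have "(\<Sum>y\<in>fixed_field 1. if of_int c * x * y = 1 then add_char (of_int m * x + of_int n * y) else 0)
      = (\<Sum>y\<in>fixed_field 1. if y = 1 / (of_int c * x) then add_char (phase x) else 0)"
    proof (rule sum.cong)
      fix y
      have "of_int c * x * y = 1 \<longleftrightarrow> y = 1 / (of_int c * x)" using x C0 by (auto simp: field_simps)
      then show "(if of_int c * x * y = 1 then add_char (of_int m * x + of_int n * y) else 0) 
        = (if y = 1 / (of_int c * x) then add_char (phase x) else 0)"
        by (simp add: phase_def) (simp add: a_def b_def)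
    qed simp
    also have "1 / (of_int c * x) \<in> fixed_field 1" using x by (intro fixed_field_divide fixed_field_mult fixed_field_1 of_int_fixed_field_1) auto
    then have "(\<Sum>y\<in>fixed_field 1. if y = 1 / (of_int c * x) then add_char (phase x) else 0) = add_char (phase x)"
      using card_fixed_field(1)[of 1] by (simp add: sum.delta)
    finally show "(\<Sum>y\<in>fixed_field 1. if of_int c * x * y = 1 then add_char (of_int m * x + of_int n * y) else 0) = add_char (Tr 1 (phase x))"
      by (simp add: Tr_def)
  qed simp
  finally show ?thesis using weil_bound by simp
qed

end

text \<open>The preceding bound needs a type of characteristic \<open>p\<close>, while \<open>p\<close> is to be universally quantified. The way
out is a single type built for one particular prime: a counterexample to the bound if there is one,
and 2 otherwise. As the bound holds for this prime, there are no counterexamples.\<close>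

definition weil_ok :: "nat \<Rightarrow> bool" where
  "weil_ok p \<longleftrightarrow> (\<forall>c m n. \<not> int p dvd c \<longrightarrow> \<not> int p dvd m \<longrightarrow> \<not> int p dvd n \<longrightarrow>
     norm (kloosterman p c m n) \<le> 2 * sqrt (real p))"

definition bad_prime :: nat where
  "bad_prime = (if \<exists>p. prime p \<and> \<not> weil_ok p then SOME p. prime p \<and> \<not> weil_ok p else 2)"

lemma prime_bad_prime: "prime bad_prime"
  using someI_ex[of "\<lambda>p. prime p \<and> \<not> weil_ok p"] by (auto simp: bad_prime_def)

typedef bad_residue = "{..<bad_prime}"
  using prime_gt_0_nat[OF prime_bad_prime] by blast

lemma card_bad_residue: "CARD(bad_residue) = bad_prime"
  using type_definition.card[OF type_definition_bad_residue] by simp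

instance bad_residue :: prime_card
  by standard (simp add: card_bad_residue prime_bad_prime)

lemma weil_prime:
  assumes "prime p" "\<not> int p dvd c" "\<not> int p dvd m" "\<not> int p dvd n"
  shows "norm (kloosterman p c m n) \<le> 2 * sqrt (real p)"
proof -
  interpret char_p_closed bad_prime "TYPE(bad_residue mod_ring alg_closure)"
    by standard (simp_all add: prime_bad_prime card_bad_residue)
  have "weil_ok bad_prime"
    using kloosterman_bound_prime by (simp add: weil_ok_def)
  then have "\<not> (\<exists>p. prime p \<and> \<not> weil_ok p)"
    using someI_ex[of "\<lambda>p. prime p \<and> \<not> weil_ok p"] by (auto simp: bad_prime_def split: if_splits)
  then show ?thesis using assms by (auto simp: weil_ok_def)
qed

section \<open>Kloosterman sums to a general modulus\<close>

lemma e_mod_add: "e_mod q (k + l) = e_mod q k * e_mod q l"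
  by (simp add: e_mod_def cis_mult add_divide_distrib distrib_left)

lemma e_mod_0 [simp]: "e_mod q 0 = 1"
  by (simp add: e_mod_def)

lemma norm_e_mod [simp]: "norm (e_mod q k) = 1"
  by (simp add: e_mod_def)

lemma e_mod_power: "e_mod q (int j * k) = e_mod q k ^ j"
  by (induction j) (simp_all add: e_mod_add distrib_right)

lemma e_mod_period: "q > 0 \<Longrightarrow> e_mod q (int q * k) = 1"
  using e_mod_cong[of "int q * k" 0 q] by (simp add: cong_0_iff)

lemma e_mod_scale: "u > 0 \<Longrightarrow> e_mod (u * v) (int u * k) = e_mod v k"
  by (simp add: e_mod_def field_simps)

lemma norm_1_minus_cis: "norm (1 - cis t) = 2 * \<bar>sin (t / 2)\<bar>"
proof -
  have "norm (1 - cis t) ^ 2 = (1 - cos t) ^ 2 + sin t ^ 2"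
    by (simp add: cmod_power2)
  also have "\<dots> = 2 - 2 * cos t" using sin_cos_squared_add[of t] by (simp add: power2_eq_square algebra_simps)
  also have "\<dots> = (2 * \<bar>sin (t / 2)\<bar>) ^ 2"
    using cos_double_sin[of "t / 2"] by (simp add: power_mult_distrib)
  finally show ?thesis by (rule power2_eq_imp_eq) auto
qed

lemma sin_ge_half:
  assumes "0 \<le> x" "x \<le> pi / 2" shows "x / 2 \<le> sin x"
proof (cases "x \<le> pi / 3")
  case True
  have "sin 0 - 0 / 2 \<le> sin x - x / 2"
  proof (rule DERIV_nonneg_imp_nondecreasing[OF assms(1), of "\<lambda>x. sin x - x / 2"])
    fix y assume y: "0 \<le> y" "y \<le> x"
    have "cos (pi / 3) \<le> cos y" using y True by (intro cos_monotone_0_pi_le) auto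
    then have "cos y - 1 / 2 \<ge> 0" by (simp add: cos_60)
    then show "\<exists>D. ((\<lambda>x. sin x - x / 2) has_real_derivative D) (at y) \<and> 0 \<le> D"
      by (intro exI[of _ "cos y - 1 / 2"] conjI) (auto intro!: derivative_eq_intros)
  qed
  then show ?thesis by simp
next
  case False
  have "sin (pi / 3) \<le> sin x" using False assms by (intro sin_monotone_2pi_le) auto
  then have "sqrt 3 / 2 \<le> sin x" by (simp add: sin_60)
  moreover have "1.7 \<le> sqrt (3::real)" by (rule real_le_rsqrt) (simp add: power2_eq_square)
  moreover have "pi < 3.2" using pi_approx by simp
  ultimately show ?thesis using assms by simp
qed

text \<open>The geometric sums over intervals have denominators \<open>1 - e_mod q m\<close>, of size about the distance from \<open>m / q\<close>
to the nearest integer. Adding the contributions of both ends \<open>0\<close> and \<open>q\<close> avoids a minimum.\<close>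

lemma norm_1_minus_e_mod:
  assumes "0 < m" "m < q"
  shows "1 / norm (1 - e_mod q (int m)) \<le> real q / real m + real q / real (q - m)"
proof -
  define \<theta> where "\<theta> = pi * real m / real q"
  have n: "norm (1 - e_mod q (int m)) = 2 * \<bar>sin \<theta>\<bar>"
    using norm_1_minus_cis[of "2 * pi * real m / real q"] by (simp add: e_mod_def \<theta>_def)
  have th: "0 < \<theta>" "\<theta> < pi" using assms by (auto simp: \<theta>_def field_simps)
  have pos: "real q / real m > 0" "real q / real (q - m) > 0" using assms by auto
  show ?thesis
  proof (cases "\<theta> \<le> pi / 2")
    case True
    have "1 * (real m / real q) \<le> pi * (real m / real q)" by (rule mult_right_mono) (use pi_ge_two in linarith, simp)
    then have "real m / real q \<le> \<theta>" by (simp add: \<theta>_def)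
    also have "\<dots> \<le> 2 * \<bar>sin \<theta>\<bar>" using sin_ge_half[of \<theta>] th True by simp
    finally have "1 / (2 * \<bar>sin \<theta>\<bar>) \<le> 1 / (real m / real q)" using assms by (intro frac_le) auto
    then show ?thesis unfolding n using pos by simp
  next
    case False
    have e: "pi - \<theta> = pi * (real (q - m) / real q)" using assms by (simp add: \<theta>_def of_nat_diff field_simps)
    have "1 * (real (q - m) / real q) \<le> pi * (real (q - m) / real q)" by (rule mult_right_mono) (use pi_ge_two in linarith, simp)
    then have "real (q - m) / real q \<le> pi - \<theta>" unfolding e by simp
    also have "\<dots> \<le> 2 * \<bar>sin (pi - \<theta>)\<bar>" using sin_ge_half[of "pi - \<theta>"] th False by simp
    also have "sin (pi - \<theta>) = sin \<theta>" by simp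
    finally have "1 / (2 * \<bar>sin \<theta>\<bar>) \<le> 1 / (real (q - m) / real q)" using assms by (intro frac_le) auto
    then show ?thesis unfolding n using pos by simp
  qed
qed

lemma e_mod_ne_1: assumes "0 < m" "m < q" shows "e_mod q (int m) \<noteq> 1"
proof
  assume "e_mod q (int m) = 1"
  then have "sin (pi * real m / real q) = 0"
    using norm_1_minus_cis[of "2 * pi * real m / real q"] by (simp add: e_mod_def)
  moreover have "sin (pi * real m / real q) > 0"
    using assms by (intro sin_gt_zero) (auto simp: field_simps)
  ultimately show False by simp
qed

lemma sum_e_mod: 
  assumes "q > 0"
  shows "(\<Sum>m<q. e_mod q (int m * k)) = (if int q dvd k then of_nat q else 0)"
proof (cases "int q dvd k")
  case True
  then have "e_mod q (int m * k) = 1" for m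
    using e_mod_cong[of "int m * k" 0 q] assms by (simp add: cong_0_iff)
  then show ?thesis using True by simp
next
  case False
  define j where "j = nat (k mod int q)"
  have b: "0 \<le> k mod int q" "k mod int q < int q" "k mod int q \<noteq> 0"
    using False assms pos_mod_bound[of "int q" k] by (auto simp: dvd_eq_mod_eq_0)
  then have j3: "int j = k mod int q" by (simp add: j_def)
  have j: "0 < j" "j < q" using b unfolding j3[symmetric] by linarith+
  have "e_mod q k = e_mod q (int j)"
    by (rule e_mod_cong) (use j3 assms in \<open>auto simp: cong_def\<close>)
  then have ne: "e_mod q k \<noteq> 1" using e_mod_ne_1[OF j(1,2)] by metis
  have "(\<Sum>m<q. e_mod q (int m * k)) = (\<Sum>m<q. e_mod q k ^ m)" by (simp add: e_mod_power)
  also have "\<dots> = (e_mod q k ^ q - 1) / (e_mod q k - 1)" by (rule geometric_sum[OF ne])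
  also have "e_mod q k ^ q = 1" using e_mod_power[of q q k] e_mod_period[OF assms, of k] by simp
  finally show ?thesis using False by simp
qed

lemma mod_inverse_unique:
  assumes "[c * int x * int y = 1] (mod int q)" "[c * int x * int y' = 1] (mod int q)" "y < q" "y' < q"
  shows "y = y'"
proof -
  have "[(c * int x) * int y = (c * int x) * int y'] (mod int q)"
    using assms(1,2) cong_trans cong_sym by blast
  moreover have "coprime (c * int x) (int q)"
    using assms(1) by (metis coprime_iff_invertible_int)
  ultimately have "[int y = int y'] (mod int q)" by (simp add: cong_mult_lcancel)
  then show ?thesis using assms(3,4) by (simp add: cong_int_iff cong_def)
qed

lemma sum_mod_inverse_le_1: "(\<Sum>y<q. if [c * int x * int y = 1] (mod int q) then 1 else (0::real)) \<le> 1"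
proof (cases "\<exists>y<q. [c * int x * int y = 1] (mod int q)")
  case True
  then obtain y where y: "y < q" "[c * int x * int y = 1] (mod int q)" by blast
  have "(\<Sum>y'<q. if [c * int x * int y' = 1] (mod int q) then 1 else (0::real)) = (\<Sum>y'<q. if y' = y then 1 else 0)"
    by (rule sum.cong) (use y mod_inverse_unique in auto)
  then show ?thesis by simp
next
  case False
  then have "(\<Sum>y<q. if [c * int x * int y = 1] (mod int q) then 1 else (0::real)) = 0" by (intro sum.neutral) auto
  then show ?thesis by simp
qed

lemma kloosterman_trivial: "norm (kloosterman q c m n) \<le> real q"
proof -
  have "norm (kloosterman q c m n) \<le> (\<Sum>x<q. \<Sum>y<q. if [c * int x * int y = 1] (mod int q) then 1 else (0::real))"
    unfolding kloosterman_def by (intro order_trans[OF norm_sum] sum_mono) (auto split: if_splits)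
  also have "\<dots> \<le> (\<Sum>x<q. 1)" by (intro sum_mono sum_mod_inverse_le_1)
  finally show ?thesis by simp
qed

lemma kloosterman_swap: "kloosterman q c m n = kloosterman q c n m"
  unfolding kloosterman_def by (subst sum.swap, intro sum.cong refl) (simp add: ac_simps)

lemma cong_int_mod: "[int (a mod q) = int a] (mod int q)"
  by (simp add: cong_def zmod_int)

lemma sum_product4:
  fixes a b :: "_ \<Rightarrow> _ \<Rightarrow> complex"
  shows "(\<Sum>x\<in>A. \<Sum>x'\<in>A'. \<Sum>y\<in>B. \<Sum>y'\<in>B'. a x x' * b y y') = (\<Sum>x\<in>A. \<Sum>x'\<in>A'. a x x') * (\<Sum>y\<in>B. \<Sum>y'\<in>B'. b y y')"
proof -
  have "(\<Sum>x\<in>A. \<Sum>x'\<in>A'. \<Sum>y\<in>B. \<Sum>y'\<in>B'. a x x' * b y y') = (\<Sum>x\<in>A. \<Sum>x'\<in>A'. a x x' * (\<Sum>y\<in>B. \<Sum>y'\<in>B'. b y y'))"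
    by (simp only: sum_distrib_left)
  then show ?thesis by (simp only: sum_distrib_right)
qed

lemma bij_crt:
  fixes u v :: nat
  assumes "coprime u v" "u > 0" "v > 0"
  shows "bij_betw (\<lambda>(x, y). (v * x + u * y) mod (u * v)) ({..<u} \<times> {..<v}) {..<u * v}"
proof -
  let ?f = "\<lambda>(x, y). (v * x + u * y) mod (u * v)"
  have inj: "inj_on ?f ({..<u} \<times> {..<v})"
  proof (rule inj_onI, clarify)
    fix x y x' y' assume xy: "x < u" "y < v" "x' < u" "y' < v"
      and "(v * x + u * y) mod (u * v) = (v * x' + u * y') mod (u * v)"
    then have e: "[v * x + u * y = v * x' + u * y'] (mod u * v)" by (simp add: cong_def)
    have "[v * x + u * y = v * x' + u * y'] (mod u)" using e cong_modulus_mult_nat by blast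
    then have "[v * x = v * x'] (mod u)" by (simp add: cong_def)
    then have "[x = x'] (mod u)" using assms(1) by (simp add: cong_mult_lcancel_nat coprime_commute)
    moreover have "[v * x + u * y = v * x' + u * y'] (mod v)" using e cong_modulus_mult_nat[of _ _ v u] by (simp add: mult.commute)
    then have "[u * y = u * y'] (mod v)" by (simp add: cong_def)
    then have "[y = y'] (mod v)" using assms(1) by (simp add: cong_mult_lcancel_nat)
    ultimately show "x = x' \<and> y = y'" using xy by (simp add: cong_def)
  qed
  moreover have "?f ` ({..<u} \<times> {..<v}) = {..<u * v}"
    by (rule card_subset_eq) (use assms inj in \<open>auto simp: card_image\<close>)
  ultimately show ?thesis by (simp add: bij_betw_def)
qed

lemma sum_crt:
  fixes u v :: nat
  assumes "coprime u v" "u > 0" "v > 0"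
  shows "(\<Sum>x<u * v. g x) = (\<Sum>x<u. \<Sum>y<v. g ((v * x + u * y) mod (u * v)))"
  using sum.reindex_bij_betw[OF bij_crt[OF assms], of g]
  by (simp add: sum.cartesian_product case_prod_unfold)

text \<open>Write \<open>x\<close> and \<open>y\<close> as \<open>v * x + u * y\<close> by the Chinese remainder theorem. The exponential splits, and the
congruence splits into one modulo \<open>u\<close> and one modulo \<open>v\<close>, whose constants pick up the squares of the
other modulus. Carrying the parameter \<open>c\<close> along avoids inverses of \<open>u\<close> and \<open>v\<close>.\<close>

lemma kloosterman_mult:
  assumes "coprime u v" "u > 0" "v > 0"
  shows "kloosterman (u * v) c m n = kloosterman u (c * int v ^ 2) m n * kloosterman v (c * int u ^ 2) m n"
proof -
  define P where "P x x' = [c * int v ^ 2 * int x * int x' = 1] (mod int u)" for x x'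
  define R where "R y y' = [c * int u ^ 2 * int y * int y' = 1] (mod int v)" for y y'
  have cond: "[c * int ((v * x + u * y) mod (u * v)) * int ((v * x' + u * y') mod (u * v)) = 1] (mod int (u * v)) \<longleftrightarrow> P x x' \<and> R y y'" for x y x' y'
  proof -
    define w where "w = c * int (v * x + u * y) * int (v * x' + u * y')"
    have "[c * int ((v * x + u * y) mod (u * v)) * int ((v * x' + u * y') mod (u * v)) = w] (mod int (u * v))"
      unfolding w_def by (intro cong_mult cong_refl cong_int_mod)
    then have "[c * int ((v * x + u * y) mod (u * v)) * int ((v * x' + u * y') mod (u * v)) = 1] (mod int (u * v)) \<longleftrightarrow> [w = 1] (mod int u * int v)"
      unfolding cong_def of_nat_mult by (simp only:)
    also have "\<dots> \<longleftrightarrow> [w = 1] (mod int u) \<and> [w = 1] (mod int v)"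
    proof (intro iffI conjI)
      assume "[w = 1] (mod int u * int v)"
      then show "[w = 1] (mod int u)" "[w = 1] (mod int v)"
        using cong_modulus_mult[of w 1 "int u" "int v"] cong_modulus_mult[of w 1 "int v" "int u"]
        by (simp_all only: mult.commute[of "int v"])
    next
      assume "[w = 1] (mod int u) \<and> [w = 1] (mod int v)"
      then show "[w = 1] (mod int u * int v)" using assms(1) by (intro coprime_cong_mult) auto
    qed
    also have "[w = 1] (mod int u) \<longleftrightarrow> P x x'"
    proof -
      have "w = c * int v ^ 2 * int x * int x' + int u * (c * (int v * int x * int y' + int v * int y * int x' + int u * int y * int y'))"
        by (simp add: w_def algebra_simps power2_eq_square)
      then show ?thesis by (simp add: P_def cong_def)
    qed
    also have "[w = 1] (mod int v) \<longleftrightarrow> R y y'"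
    proof -
      have "w = c * int u ^ 2 * int y * int y' + int v * (c * (int u * int x * int y' + int u * int y * int x' + int v * int x * int x'))"
        by (simp add: w_def algebra_simps power2_eq_square)
      then show ?thesis by (simp add: R_def cong_def)
    qed
    finally show ?thesis .
  qed
  have ev: "e_mod (u * v) (m * int ((v * x + u * y) mod (u * v)) + n * int ((v * x' + u * y') mod (u * v)))
     = e_mod u (m * int x + n * int x') * e_mod v (m * int y + n * int y')" for x y x' y'
  proof -
    have "e_mod (u * v) (m * int ((v * x + u * y) mod (u * v)) + n * int ((v * x' + u * y') mod (u * v)))
        = e_mod (u * v) (m * int (v * x + u * y) + n * int (v * x' + u * y'))"
      by (rule e_mod_cong, intro cong_add cong_mult cong_refl cong_int_mod) (use assms in simp)
    also have "m * int (v * x + u * y) + n * int (v * x' + u * y') = int v * (m * int x + n * int x') + int u * (m * int y + n * int y')"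
      by (simp add: algebra_simps)
    also have "e_mod (u * v) \<dots> = e_mod (v * u) (int v * (m * int x + n * int x')) * e_mod (u * v) (int u * (m * int y + n * int y'))"
      by (simp only: e_mod_add mult.commute[of v u])
    finally show ?thesis using assms by (simp only: e_mod_scale)
  qed
  have "kloosterman (u * v) c m n = (\<Sum>x<u. \<Sum>y<v. \<Sum>x'<u. \<Sum>y'<v.
     if P x x' \<and> R y y' then e_mod u (m * int x + n * int x') * e_mod v (m * int y + n * int y') else 0)"
    unfolding kloosterman_def sum_crt[OF assms] cond ev ..
  also have "\<dots> = (\<Sum>x<u. \<Sum>x'<u. \<Sum>y<v. \<Sum>y'<v.
     (if P x x' then e_mod u (m * int x + n * int x') else 0) * (if R y y' then e_mod v (m * int y + n * int y') else 0))"
    by (subst (2) sum.swap) (auto intro!: sum.cong)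
  also have "\<dots> = kloosterman u (c * int v ^ 2) m n * kloosterman v (c * int u ^ 2) m n"
    unfolding kloosterman_def P_def R_def by (rule sum_product4)
  finally show ?thesis .
qed

lemma mod_inverse_exists:
  assumes "coprime (c * int x) (int q)" "q > 0"
  shows "\<exists>y<q. [c * int x * int y = 1] (mod int q)"
proof -
  obtain z where z: "[c * int x * z = 1] (mod int q)" using assms(1) cong_solve_coprime_int by blast
  have "[c * int x * int (nat (z mod int q)) = 1] (mod int q)"
  proof -
    have "[c * int x * (z mod int q) = c * int x * z] (mod int q)" by (intro cong_mult) (auto simp: cong_def)
    then show ?thesis using z assms(2) cong_trans by fastforce
  qed
  moreover have "nat (z mod int q) < q" using assms(2) by (simp add: nat_less_iff)
  ultimately show ?thesis by blast
qed

text \<open>When one frequency vanishes modulo \<open>p\<close>, the sum is a complete sum of additive characters without the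
term of the residue 0.\<close>

lemma kloosterman_prime_degenerate:
  assumes p: "prime p" "\<not> int p dvd c" and m: "int p dvd m" and n: "\<not> int p dvd n"
  shows "kloosterman p c m n = -1"
proof -
  have p0: "p > 0" using p prime_gt_0_nat by blast
  have cop: "coprime (c * int y) (int p)" if "0 < y" "y < p" for y
  proof -
    have "\<not> int p dvd c * int y"
    proof -
      have "\<not> p dvd y" using that by (auto dest: dvd_imp_le)
      moreover have "prime (int p)" using p by simp
      ultimately show ?thesis using p(2) prime_dvd_mult_iff[of "int p" c "int y"] by simp
    qed
    moreover have "prime (int p)" using p by simp
    ultimately show ?thesis by (metis coprime_commute prime_imp_coprime)
  qed
  have "kloosterman p c m n = (\<Sum>y<p. \<Sum>x<p. if [c * int y * int x = 1] (mod int p) then e_mod p (n * int y) else 0)"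
    unfolding kloosterman_def
  proof (subst sum.swap, intro sum.cong refl)
    fix x y :: nat
    have "e_mod p (m * int x + n * int y) = e_mod p (n * int y)"
      by (rule e_mod_cong) (use m p0 in \<open>auto simp: cong_iff_dvd_diff\<close>)
    then show "(if [c * int x * int y = 1] (mod int p) then e_mod p (m * int x + n * int y) else 0) =
      (if [c * int y * int x = 1] (mod int p) then e_mod p (n * int y) else 0)"
      by (simp add: ac_simps)
  qed
  also have "\<dots> = (\<Sum>y<p. if y = 0 then 0 else e_mod p (n * int y))"
  proof (rule sum.cong)
    fix y assume y: "y \<in> {..<p}"
    show "(\<Sum>x<p. if [c * int y * int x = 1] (mod int p) then e_mod p (n * int y) else 0) = (if y = 0 then 0 else e_mod p (n * int y))"
    proof (cases "y = 0")
      case True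
      have "\<not> [0 = 1] (mod int p)" using prime_gt_1_nat[OF p(1)] by (simp add: cong_def)
      then show ?thesis using True by simp
    next
      case False
      then obtain x0 where x0: "x0 < p" "[c * int y * int x0 = 1] (mod int p)"
        using mod_inverse_exists[OF cop[of y] p0] y by auto
      have "(\<Sum>x<p. if [c * int y * int x = 1] (mod int p) then e_mod p (n * int y) else 0) = (\<Sum>x<p. if x = x0 then e_mod p (n * int y) else 0)"
      proof (rule sum.cong)
        fix x assume "x \<in> {..<p}"
        then have "[c * int y * int x = 1] (mod int p) \<longleftrightarrow> x = x0"
          using x0 mod_inverse_unique[of c y x p x0] by blast
        then show "(if [c * int y * int x = 1] (mod int p) then e_mod p (n * int y) else 0) = (if x = x0 then e_mod p (n * int y) else 0)"
          by (simp only:)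
      qed simp
      then show ?thesis using False x0 by simp
    qed
  qed simp
  also have "\<dots> = (\<Sum>y<p. e_mod p (n * int y)) - 1"
    using p0 by (simp add: sum.remove[of _ 0] lessThan_iff) 
  also have "(\<Sum>y<p. e_mod p (n * int y)) = 0"
    using sum_e_mod[OF p0, of n] n by (simp add: mult.commute)
  finally show ?thesis by simp
qed

lemma kloosterman_prime:
  assumes p: "prime p" "\<not> int p dvd c"
  shows "norm (kloosterman p c m n) \<le> 2 * sqrt (real p) * sqrt (real_of_int (gcd (gcd m n) (int p)))"
proof -
  have p1: "real p \<ge> 1" using prime_gt_0_nat[OF p(1)] by simp
  have g1: "gcd (gcd m n) (int p) \<ge> 1" using prime_gt_0_nat[OF p(1)] by (simp add: int_one_le_iff_zero_less)
  have s1: "sqrt (real p) \<ge> 1" using p1 by simp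
  have sg: "sqrt (real_of_int (gcd (gcd m n) (int p))) \<ge> 1" using g1 by simp
  have low2: "2 * sqrt (real p) * 1 \<le> 2 * sqrt (real p) * sqrt (real_of_int (gcd (gcd m n) (int p)))"
    by (rule mult_left_mono[OF sg]) simp
  then have low: "1 \<le> 2 * sqrt (real p) * sqrt (real_of_int (gcd (gcd m n) (int p)))"
    "2 * sqrt (real p) \<le> 2 * sqrt (real p) * sqrt (real_of_int (gcd (gcd m n) (int p)))"
    using s1 by linarith+
  consider "int p dvd m" "int p dvd n" | "int p dvd m" "\<not> int p dvd n" | "\<not> int p dvd m" "int p dvd n" | "\<not> int p dvd m" "\<not> int p dvd n" by blast
  then show ?thesis
  proof cases
    case 1
    then have "gcd (gcd m n) (int p) = int p" by (simp add: gcd_proj2_if_dvd_int)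
    then have "2 * sqrt (real p) * sqrt (real_of_int (gcd (gcd m n) (int p))) = 2 * real p" by simp
    then show ?thesis using kloosterman_trivial[of p c m n] by simp
  next
    case 2
    then show ?thesis using kloosterman_prime_degenerate[OF p 2] low by simp
  next
    case 3
    then show ?thesis using kloosterman_prime_degenerate[OF p 3(2,1)] low by (simp add: kloosterman_swap[of p c m n])
  next
    case 4
    then show ?thesis using weil_prime[OF p 4] low by linarith
  qed
qed

definition num_divisors :: "nat \<Rightarrow> nat" where "num_divisors n = card {d. d dvd n}"

lemma finite_divisors: "n > 0 \<Longrightarrow> finite {d. d dvd (n::nat)}"
  using finite_subset[of "{d. d dvd n}" "{..n}"] dvd_imp_le by auto

lemma num_divisors_mono: "m dvd n \<Longrightarrow> n > 0 \<Longrightarrow> num_divisors m \<le> num_divisors n"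
  unfolding num_divisors_def by (rule card_mono) (auto intro: finite_divisors dvd_trans)

lemma num_divisors_prime_mult:
  assumes "prime p" "\<not> p dvd a" "a > 0"
  shows "2 * num_divisors a \<le> num_divisors (p * a)"
proof -
  have p0: "p > 0" using assms(1) prime_gt_0_nat by blast
  have disj: "{d. d dvd a} \<inter> (\<lambda>d. p * d) ` {d. d dvd a} = {}"
    using assms(2) by (auto dest: dvd_mult_left)
  have "card ({d. d dvd a} \<union> (\<lambda>d. p * d) ` {d. d dvd a}) = card {d. d dvd a} + card ((\<lambda>d. p * d) ` {d. d dvd a})"
    by (rule card_Un_disjoint) (use finite_divisors[OF assms(3)] disj in auto)
  also have "card ((\<lambda>d. p * d) ` {d. d dvd a}) = card {d. d dvd a}"
    by (rule card_image) (use p0 in \<open>auto simp: inj_on_def\<close>)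
  finally have "2 * num_divisors a = card ({d. d dvd a} \<union> (\<lambda>d. p * d) ` {d. d dvd a})" by (simp add: num_divisors_def)
  also have "\<dots> \<le> num_divisors (p * a)"
    unfolding num_divisors_def by (rule card_mono) (use finite_divisors[of "p * a"] p0 assms(3) in auto)
  finally show ?thesis .
qed

lemma num_divisors_prime_power_mult:
  assumes "prime p" "a > 0"
  shows "num_divisors (p ^ k * a) \<le> (k + 1) * num_divisors a"
proof -
  have "{d. d dvd p ^ k * a} \<subseteq> (\<lambda>(i, e). p ^ i * e) ` ({..k} \<times> {d. d dvd a})"
  proof
    fix d assume "d \<in> {d. d dvd p ^ k * a}"
    then obtain d1 d2 where d: "d = d1 * d2" "d1 dvd p ^ k" "d2 dvd a"
      using division_decomp by blast
    then obtain i where "i \<le> k" "d1 = p ^ i" using divides_primepow_nat[OF assms(1)] by auto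
    then show "d \<in> (\<lambda>(i, e). p ^ i * e) ` ({..k} \<times> {d. d dvd a})" using d by auto
  qed
  then have "card {d. d dvd p ^ k * a} \<le> card ((\<lambda>(i, e). p ^ i * e) ` ({..k} \<times> {d. d dvd a}))"
    by (rule card_mono[rotated]) (use finite_divisors[OF assms(2)] in auto)
  also have "\<dots> \<le> card ({..k} \<times> {d. d dvd a})"
    by (rule card_image_le) (use finite_divisors[OF assms(2)] in auto)
  finally show ?thesis by (simp add: num_divisors_def card_cartesian_product)
qed

text \<open>Every prime power contributes a factor \<open>k + 1\<close> to the divisor count. This is at most \<open>p ^ (k * \<delta>)\<close> once \<open>p\<close>
exceeds \<open>2 powr (1 / \<delta>)\<close>; each of the finitely many smaller primes costs a constant factor.\<close>

lemma divisor_bound: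
  fixes \<delta> :: real
  assumes d: "\<delta> > 0"
  shows "\<exists>C\<ge>1. \<forall>n>0. real (num_divisors n) \<le> C * real n powr \<delta>"
proof -
  define C0 where "C0 = max 1 (1 / (\<delta> * ln 2))"
  define P0 where "P0 = nat \<lceil>2 powr (1 / \<delta>)\<rceil>"
  have C01: "C0 \<ge> 1" by (simp add: C0_def)
  have dl: "\<delta> * ln 2 > 0" using d by simp
  have small: "real k + 1 \<le> C0 * real p powr (real k * \<delta>)" if "p \<ge> 2" for p k :: nat
  proof -
    have "1 / (\<delta> * ln 2) \<le> C0" by (simp add: C0_def)
    then have "C0 * (\<delta> * ln 2) \<ge> 1" by (simp only: pos_divide_le_eq[OF dl])
    then have "real k * 1 \<le> real k * (C0 * (\<delta> * ln 2))" by (rule mult_left_mono) simp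
    then have "real k + 1 \<le> C0 * (1 + real k * \<delta> * ln 2)" using C01 by (simp add: algebra_simps)
    also have "\<dots> \<le> C0 * exp (real k * \<delta> * ln 2)"
      using C01 exp_ge_add_one_self by (intro mult_left_mono) auto
    also have "exp (real k * \<delta> * ln 2) = 2 powr (real k * \<delta>)" by (simp add: powr_def)
    also have "C0 * 2 powr (real k * \<delta>) \<le> C0 * real p powr (real k * \<delta>)"
      using that C01 d by (intro mult_left_mono powr_mono2) auto
    finally show ?thesis by simp
  qed
  have large: "real k + 1 \<le> real p powr (real k * \<delta>)" if "p \<ge> P0" for p k :: nat
  proof -
    have "2 powr (1 / \<delta>) \<le> real p" using that by (simp add: P0_def nat_le_iff ceiling_le_iff)
    then have "(2 powr (1 / \<delta>)) powr (real k * \<delta>) \<le> real p powr (real k * \<delta>)"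
      using d by (intro powr_mono2) auto
    moreover have "(2 powr (1 / \<delta>)) powr (real k * \<delta>) = 2 ^ k"
      using d by (simp add: powr_powr powr_realpow)
    moreover have "k + 1 \<le> 2 ^ k" by (induction k) auto
    then have "real (k + 1) \<le> real (2 ^ k)" by (simp only: of_nat_le_iff)
    then have "real k + 1 \<le> 2 ^ k" by simp
    ultimately show ?thesis by linarith
  qed
  define sm where "sm n = {p \<in> prime_factors n. p < P0}" for n
  have main: "real (num_divisors n) \<le> C0 ^ card (sm n) * real n powr \<delta>" if "n > 0" for n
    using that
  proof (induction n rule: less_induct)
    case (less n)
    show ?case
    proof (cases "n = 1")
      case True
      then show ?thesis using C01 by (simp add: num_divisors_def one_le_power)
    next
      case False
      then obtain p where p: "prime p" "p dvd n" using prime_factor_nat by blast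
      define k where "k = multiplicity p n"
      have "\<not> is_unit p" using p(1) not_prime_unit by blast
      then obtain m where m: "n = p ^ k * m" "\<not> p dvd m"
        using multiplicity_decompose'[of n p] less.prems unfolding k_def by auto
      have p2: "p \<ge> 2" using p(1) prime_ge_2_nat by blast
      have k0: "k > 0" using p m by (cases k) auto
      have m0: "m > 0" using less.prems m by (cases m) auto
      have "p ^ k > 1" using p2 k0 by (intro one_less_power) auto
      then have mn: "m < n" using m m0 by simp
      have pf: "prime_factors n = insert p (prime_factors m)"
        using m p(1) k0 m0 p2 by (simp add: prime_factors_product prime_factors_power prime_prime_factors)
      have IH: "real (num_divisors m) \<le> C0 ^ card (sm m) * real m powr \<delta>" using less.IH[OF mn m0] .
      have fin: "finite (sm m)" by (simp add: sm_def)
      have pm: "p \<notin> sm m" using m by (auto simp: sm_def)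
      have np: "real n powr \<delta> = real p powr (real k * \<delta>) * real m powr \<delta>"
        using p2 by (simp add: m powr_mult powr_powr flip: powr_realpow)
      have "real (num_divisors n) \<le> real ((k + 1) * num_divisors m)"
        using num_divisors_prime_power_mult[OF p(1) m0, of k] m by (simp only: of_nat_le_iff)
      then have t: "real (num_divisors n) \<le> (real k + 1) * real (num_divisors m)" by (simp add: distrib_right)
      show ?thesis
      proof (cases "p < P0")
        case True
        then have "sm n = insert p (sm m)" by (auto simp: sm_def pf)
        then have c: "card (sm n) = Suc (card (sm m))" using fin pm by simp
        have "real (num_divisors n) \<le> (C0 * real p powr (real k * \<delta>)) * (C0 ^ card (sm m) * real m powr \<delta>)"
          using C01 by (intro order_trans[OF t] mult_mono[OF small[OF p2, of k] IH]) auto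
        then show ?thesis by (simp add: c np mult_ac)
      next
        case False
        then have c: "sm n = sm m" by (auto simp: sm_def pf)
        have "real (num_divisors n) \<le> (real p powr (real k * \<delta>)) * (C0 ^ card (sm m) * real m powr \<delta>)"
          using False by (intro order_trans[OF t] mult_mono[OF large[of p k] IH]) auto
        then show ?thesis by (simp add: c np mult_ac)
      qed
    qed
  qed
  have "real (num_divisors n) \<le> C0 ^ P0 * real n powr \<delta>" if "n > 0" for n
  proof -
    have "card (sm n) \<le> card {..<P0}" by (rule card_mono) (auto simp: sm_def)
    then have "C0 ^ card (sm n) \<le> C0 ^ P0" using C01 by (intro power_increasing) auto
    then show ?thesis using main[OF that] by (meson mult_right_mono order_trans powr_ge_zero)
  qed
  moreover have "C0 ^ P0 \<ge> 1" using C01 by (rule one_le_power)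
  ultimately show ?thesis by blast
qed

lemma gcd_mult_le:
  assumes "coprime (u::int) v" "g \<noteq> 0 \<or> u * v \<noteq> 0"
  shows "gcd g u * gcd g v \<le> gcd g (u * v)"
proof (rule zdvd_imp_le)
  have "coprime (gcd g u) (gcd g v)" using assms(1) by (meson coprime_divisors gcd_dvd2)
  then have "gcd g u * gcd g v dvd g" by (intro divides_mult) auto
  moreover have "gcd g u * gcd g v dvd u * v" by (intro mult_dvd_mono) auto
  ultimately show "gcd g u * gcd g v dvd gcd g (u * v)" by simp
  show "gcd g (u * v) > 0" using assms(2) by auto
qed

text \<open>Split off the primes of the squarefree part one after the other and use the Weil bound for each of
them; the remaining factor \<open>b\<close> is estimated trivially.\<close>

lemma kloosterman_squarefree:
  assumes "squarefree a" "coprime a b" "b > 0" "coprime c (int (a * b))"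
  shows "norm (kloosterman (a * b) c m n) \<le> real (num_divisors a) * sqrt (real a) * sqrt (real_of_int (gcd (gcd m n) (int a))) * real b"
  using assms
proof (induction a arbitrary: c rule: less_induct)
  case (less a)
  have a0: "a > 0" using less.prems(1) by (cases a) auto
  show ?case
  proof (cases "a = 1")
    case True
    then show ?thesis using kloosterman_trivial[of b c m n] by (simp add: num_divisors_def)
  next
    case False
    then obtain p where p: "prime p" "p dvd a" using prime_factor_nat by blast
    obtain a' where a': "a = p * a'" using p(2) by (elim dvdE)
    have p1: "p > 1" using p(1) prime_gt_1_nat by blast
    have a'0: "a' > 0" and lt: "a' < a" using a0 a' p1 by auto
    have np: "\<not> p dvd a'"
    proof
      assume "p dvd a'"
      then have "p ^ 2 dvd a" using a' by (simp add: power2_eq_square)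
      then have "p dvd 1" using less.prems(1) squarefreeD by blast
      then show False using p1 by simp
    qed
    have npb: "\<not> p dvd b" 
      using less.prems(2) p(1) a' by (metis coprime_common_divisor_nat dvd_triv_left not_prime_1)
    have cop: "coprime p (a' * b)" using np npb p(1) by (simp add: prime_imp_coprime)
    have pc: "\<not> int p dvd c"
    proof
      assume "int p dvd c"
      moreover have "int p dvd int (a * b)" using a' by simp
      ultimately have "is_unit (int p)" using less.prems(4) coprime_common_divisor by blast
      then show False using p1 by simp
    qed
    have pp: "prime (int p)" using p(1) by simp
    have pc': "\<not> int p dvd c * int (a' * b) ^ 2"
    proof -
      have "\<not> p dvd a' * b" using np npb p(1) by (simp add: prime_dvd_mult_iff)
      then have "\<not> int p dvd int (a' * b)" by (simp only: int_dvd_int_iff not_False_eq_True)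
      then show ?thesis unfolding power2_eq_square prime_dvd_mult_iff[OF pp] using pc by blast
    qed
    have "coprime c (int (a' * b))" using less.prems(4) a' by (simp add: coprime_mult_right_iff)
    moreover have "coprime (int p ^ 2) (int (a' * b))" using cop by (simp only: coprime_power_left_iff coprime_int_iff) simp
    ultimately have c': "coprime (c * int p ^ 2) (int (a' * b))" by (simp only: coprime_mult_left_iff)
    have sq': "squarefree a'" using less.prems(1) a' squarefree_multD by blast
    have cop': "coprime a' b" using less.prems(2) a' by (simp add: coprime_mult_left_iff)
    define g where "g = gcd m n"
    have IH: "norm (kloosterman (a' * b) (c * int p ^ 2) m n) \<le> real (num_divisors a') * sqrt (real a') * sqrt (real_of_int (gcd g (int a'))) * real b"
      unfolding g_def by (rule less.IH[OF lt sq' cop' less.prems(3) c'])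
    have P: "norm (kloosterman p (c * int (a' * b) ^ 2) m n) \<le> 2 * sqrt (real p) * sqrt (real_of_int (gcd g (int p)))"
      unfolding g_def by (rule kloosterman_prime[OF p(1) pc'])
    have "kloosterman (a * b) c m n = kloosterman p (c * int (a' * b) ^ 2) m n * kloosterman (a' * b) (c * int p ^ 2) m n"
      using kloosterman_mult[OF cop, of c m n] p1 a'0 less.prems(3) by (simp add: a' mult.assoc)
    then have "norm (kloosterman (a * b) c m n) = norm (kloosterman p (c * int (a' * b) ^ 2) m n) * norm (kloosterman (a' * b) (c * int p ^ 2) m n)"
      by (simp only: norm_mult)
    also have "\<dots> \<le> (2 * sqrt (real p) * sqrt (real_of_int (gcd g (int p)))) * (real (num_divisors a') * sqrt (real a') * sqrt (real_of_int (gcd g (int a'))) * real b)"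
      by (rule mult_mono[OF P IH]) auto
    also have "\<dots> = (2 * real (num_divisors a')) * (sqrt (real p) * sqrt (real a')) * (sqrt (real_of_int (gcd g (int p))) * sqrt (real_of_int (gcd g (int a')))) * real b"
      by (simp only: mult_ac)
    also have "\<dots> \<le> real (num_divisors a) * sqrt (real a) * sqrt (real_of_int (gcd g (int a))) * real b"
    proof (intro mult_right_mono mult_mono)
      show "2 * real (num_divisors a') \<le> real (num_divisors a)" using num_divisors_prime_mult[OF p(1) np a'0] a' by simp
      show "sqrt (real p) * sqrt (real a') \<le> sqrt (real a)" by (simp add: a' real_sqrt_mult)
      have "coprime (int p) (int a')" using np p(1) by (simp add: prime_imp_coprime)
      then have "gcd g (int p) * gcd g (int a') \<le> gcd g (int a)"
        using gcd_mult_le[of "int p" "int a'" g] a0 a' by simp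
      then show "sqrt (real_of_int (gcd g (int p))) * sqrt (real_of_int (gcd g (int a'))) \<le> sqrt (real_of_int (gcd g (int a)))"
        by (simp flip: real_sqrt_mult of_int_mult)
    qed auto
    finally show ?thesis by (simp add: g_def)
  qed
qed

text \<open>The modulus is \<open>q = s * k\<^sup>2\<close> with \<open>s\<close> squarefree. The first two factors are
the classical bound; the others come from the trivial estimate of the part of \<open>q\<close> that shares its primes
with \<open>k\<close>.\<close>

definition kloosterman_factor :: "nat \<Rightarrow> real" where
  "kloosterman_factor q = real (num_divisors q) * sqrt (real q) * real (square_part q) * sqrt (real (gcd (squarefree_part q) (square_part q)))"

lemma kloosterman_bound:
  assumes "q > 0" "coprime c (int q)"
  shows "norm (kloosterman q c m n) \<le> kloosterman_factor q * sqrt (real_of_int (gcd (gcd m n) (int q)))"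
proof -
  define s where "s = squarefree_part q"
  define k where "k = square_part q"
  define g where "g = gcd s k"
  have q: "q = s * k ^ 2" unfolding s_def k_def by (rule squarefree_decompose)
  have s0: "s > 0" and k0: "k > 0" using q assms(1) by (auto intro!: Nat.gr0I)
  have g0: "g > 0" using s0 by (simp add: g_def)
  \<comment> \<open>Removing from \<open>s\<close> its common part with \<open>k\<close> leaves a squarefree factor coprime to the rest of \<open>q\<close>.\<close>
  define a where "a = s div g"
  define b where "b = g * k ^ 2"
  have sa: "s = a * g" by (simp add: a_def g_def)
  have qab: "q = a * b" by (simp add: q sa b_def)
  have sqs: "squarefree s" by (simp add: s_def)
  then have sqa: "squarefree a" using sa squarefree_multD by blast
  have b0: "b > 0" using g0 k0 by (simp add: b_def)
  have cop: "coprime a b"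
  proof (rule ccontr)
    assume "\<not> coprime a b"
    then have "gcd a b \<noteq> 1" unfolding coprime_iff_gcd_eq_1 .
    then obtain p where p: "prime p" "p dvd gcd a b" using prime_factor_nat by blast
    then have p: "prime p" "p dvd a" "p dvd b" by auto
    have "p dvd k" using p by (auto simp: b_def prime_dvd_mult_iff g_def dest: prime_dvd_power)
    moreover have "p dvd s" using p(2) sa by simp
    ultimately have "p dvd g" by (simp add: g_def)
    then have "p ^ 2 dvd s" using p(2) sa by (simp add: power2_eq_square mult_dvd_mono)
    then have "p dvd 1" using sqs squarefreeD by blast
    then show False using p(1) by simp
  qed
  have a0: "a > 0" using s0 sa by (auto intro!: Nat.gr0I)
  have "norm (kloosterman q c m n) \<le> real (num_divisors a) * sqrt (real a) * sqrt (real_of_int (gcd (gcd m n) (int a))) * real b"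
    using kloosterman_squarefree[OF sqa cop b0, of c m n] assms(2) by (simp add: qab)
  also have "\<dots> \<le> real (num_divisors q) * sqrt (real a) * sqrt (real_of_int (gcd (gcd m n) (int q))) * real b"
  proof (intro mult_right_mono mult_mono)
    show "real (num_divisors a) \<le> real (num_divisors q)" using num_divisors_mono[of a q] assms(1) qab by simp
    have "gcd (gcd m n) (int a) dvd gcd (gcd m n) (int q)" using qab by (intro gcd_mono) auto
    then have "gcd (gcd m n) (int a) \<le> gcd (gcd m n) (int q)" using assms(1) by (intro zdvd_imp_le) auto
    then show "sqrt (real_of_int (gcd (gcd m n) (int a))) \<le> sqrt (real_of_int (gcd (gcd m n) (int q)))" by simp
  qed auto
  also have "\<dots> = real (num_divisors q) * (sqrt (real a) * real b) * sqrt (real_of_int (gcd (gcd m n) (int q)))"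
    by (simp only: mult_ac)
  also have "sqrt (real a) * real b = sqrt (real q) * real k * sqrt (real g)"
  proof -
    have "sqrt (real q) * real k * sqrt (real g) = sqrt (real a) * (sqrt (real g) * sqrt (real g)) * (real k * real k)"
      by (simp add: qab b_def real_sqrt_mult power2_eq_square)
    then show ?thesis unfolding b_def by (simp only: power2_eq_square) (simp add: b_def power2_eq_square)
  qed
  finally show ?thesis by (simp add: kloosterman_factor_def s_def[symmetric] k_def[symmetric] g_def[symmetric] mult_ac)
qed

text \<open>Bound \<open>gcd m q\<close> by a sum over all divisors \<open>d\<close> of \<open>q\<close> that divide \<open>m\<close>; each \<open>d\<close> contributes at most a harmonic
sum.\<close>

lemma sum_gcd_bound:
  assumes "q > 0"
  shows "(\<Sum>m\<in>{1..<q}. sqrt (real (gcd m q)) / real m) \<le> real (num_divisors q) * harm q"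
proof -
  have "(\<Sum>m\<in>{1..<q}. sqrt (real (gcd m q)) / real m) \<le> (\<Sum>m\<in>{1..<q}. \<Sum>d | d dvd q. if d dvd m then sqrt (real d) / real m else 0)"
  proof (rule sum_mono)
    fix m assume "m \<in> {1..<q}"
    have "(if gcd m q dvd m then sqrt (real (gcd m q)) / real m else 0) \<le> (\<Sum>d | d dvd q. if d dvd m then sqrt (real d) / real m else 0)"
      by (rule member_le_sum) (use finite_divisors[OF assms] in auto)
    then show "sqrt (real (gcd m q)) / real m \<le> (\<Sum>d | d dvd q. if d dvd m then sqrt (real d) / real m else 0)" by simp
  qed
  also have "\<dots> = (\<Sum>d | d dvd q. \<Sum>m\<in>{1..<q}. if d dvd m then sqrt (real d) / real m else 0)"
    by (rule sum.swap)
  also have "\<dots> \<le> (\<Sum>d | d dvd q. harm q)"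
  proof (rule sum_mono)
    fix d assume "d \<in> {d. d dvd q}"
    then have d0: "d > 0" using assms by (auto intro!: Nat.gr0I)
    have "(\<Sum>m\<in>{1..<q}. if d dvd m then sqrt (real d) / real m else 0) = (\<Sum>m\<in>{m\<in>{1..<q}. d dvd m}. sqrt (real d) / real m)"
      by (rule sum.inter_filter[symmetric]) simp
    also have "\<dots> \<le> (\<Sum>m\<in>(\<lambda>t. d * t) ` {1..q}. sqrt (real d) / real m)"
    proof (rule sum_mono2)
      show "{m \<in> {1..<q}. d dvd m} \<subseteq> (\<lambda>t. d * t) ` {1..q}"
      proof
        fix m assume m: "m \<in> {m \<in> {1..<q}. d dvd m}"
        then obtain t where t: "m = d * t" by auto
        then have "t \<le> m" "t \<ge> 1" using d0 m by (auto intro!: Nat.gr0I simp: Suc_le_eq)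
        then have "t \<in> {1..q}" using m by auto
        then show "m \<in> (\<lambda>t. d * t) ` {1..q}" using t by blast
      qed
    qed auto
    also have "\<dots> = (\<Sum>t=1..q. sqrt (real d) / real (d * t))"
      by (subst sum.reindex) (use d0 in \<open>auto simp: inj_on_def\<close>)
    also have "\<dots> \<le> (\<Sum>t=1..q. inverse (real t))"
    proof (rule sum_mono)
      fix t assume "t \<in> {1..q}"
      have "sqrt (real d) \<le> real d" using d0 by (intro real_le_lsqrt) (auto simp: power2_eq_square)
      then have "sqrt (real d) / real (d * t) \<le> real d / real (d * t)" by (intro divide_right_mono) auto
      also have "\<dots> = inverse (real t)" using d0 by (simp add: field_simps)
      finally show "sqrt (real d) / real (d * t) \<le> inverse (real t)" .
    qed
    also have "\<dots> = harm q" by (simp add: harm_def)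
    finally show "(\<Sum>m\<in>{1..<q}. if d dvd m then sqrt (real d) / real m else 0) \<le> harm q" .
  qed
  also have "\<dots> = real (num_divisors q) * harm q" by (simp add: num_divisors_def)
  finally show ?thesis .
qed

lemma sum_reflect: "(\<Sum>m\<in>{1..<q}. g (q - m)) = (\<Sum>m\<in>{1..<(q::nat)}. g m)"
  by (rule sum.reindex_bij_witness[of _ "\<lambda>m. q - m" "\<lambda>m. q - m"]) auto

section \<open>Modular inverses in a box\<close>

definition box_count :: "nat \<Rightarrow> int \<Rightarrow> int \<Rightarrow> nat \<Rightarrow> int \<Rightarrow> nat \<Rightarrow> nat" where
  "box_count q c A L B M =
     card {(x, y). x \<in> {A..<A + int L} \<and> y \<in> {B..<B + int M} \<and> [c * x * y = 1] (mod int q)}"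

text \<open>The Fourier coefficients of the interval with \<open>L\<close> elements starting at \<open>A\<close>, taken modulo \<open>q\<close>.\<close>

definition interval_fourier :: "nat \<Rightarrow> int \<Rightarrow> nat \<Rightarrow> nat \<Rightarrow> complex" where
  "interval_fourier q A L m = (\<Sum>x\<in>{A..<A + int L}. e_mod q (int m * x))"

lemma sum_int_interval: "(\<Sum>x\<in>{A..<A + int L}. g x) = (\<Sum>j<L. g (A + int j))"
  by (rule sum.reindex_bij_witness[of _ "\<lambda>j. A + int j" "\<lambda>x. nat (x - A)"]) auto

lemma norm_interval_fourier_le: 
  assumes "L \<le> q"
  shows "norm (interval_fourier q A L m) \<le> real q"
proof -
  have "norm (interval_fourier q A L m) \<le> (\<Sum>x\<in>{A..<A + int L}. 1)"
    unfolding interval_fourier_def by (rule sum_norm_le) simp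
  then show ?thesis using assms by simp
qed

lemma norm_interval_fourier:
  assumes "0 < m" "m < q"
  shows "norm (interval_fourier q A L m) \<le> real q * (2 / real m + 2 / real (q - m))"
proof -
  have ne: "e_mod q (int m) \<noteq> 1" by (rule e_mod_ne_1[OF assms])
  have "interval_fourier q A L m = (\<Sum>j<L. e_mod q (int m * A) * e_mod q (int m) ^ j)"
    unfolding interval_fourier_def sum_int_interval
    by (rule sum.cong) (simp_all add: distrib_left e_mod_add e_mod_power[symmetric] mult.commute)
  also have "\<dots> = e_mod q (int m * A) * ((e_mod q (int m) ^ L - 1) / (e_mod q (int m) - 1))"
    by (simp add: sum_distrib_left[symmetric] geometric_sum[OF ne])
  also have "norm \<dots> = norm (e_mod q (int m) ^ L - 1) / norm (1 - e_mod q (int m))"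
    by (simp add: norm_mult norm_divide norm_minus_commute)
  also have "\<dots> \<le> 2 / norm (1 - e_mod q (int m))"
    using norm_triangle_ineq4[of "e_mod q (int m) ^ L" 1] by (intro divide_right_mono) (auto simp: norm_power)
  also have "\<dots> = 2 * (1 / norm (1 - e_mod q (int m)))" by simp
  also have "\<dots> \<le> 2 * (real q / real m + real q / real (q - m))"
    by (intro mult_left_mono norm_1_minus_e_mod assms) simp
  finally show ?thesis by (simp add: algebra_simps)
qed

lemma indicator_fourier:
  assumes "q > 0"
  shows "of_nat (card {x \<in> {A..<A + int L}. [x = int z] (mod int q)}) = (1 / of_nat q) * (\<Sum>m<q. interval_fourier q A L m * e_mod q (- (int m * int z)))"
proof -
  have "(\<Sum>m<q. interval_fourier q A L m * e_mod q (- (int m * int z))) = (\<Sum>m<q. \<Sum>x\<in>{A..<A + int L}. e_mod q (int m * (x - int z)))"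
    unfolding interval_fourier_def sum_distrib_right
    by (intro sum.cong refl) (simp add: e_mod_add[symmetric] right_diff_distrib)
  also have "\<dots> = (\<Sum>x\<in>{A..<A + int L}. \<Sum>m<q. e_mod q (int m * (x - int z)))" by (rule sum.swap)
  also have "\<dots> = (\<Sum>x\<in>{A..<A + int L}. if [x = int z] (mod int q) then of_nat q else 0)"
    using assms by (intro sum.cong refl) (simp add: sum_e_mod cong_iff_dvd_diff)
  also have "\<dots> = of_nat q * of_nat (card {x \<in> {A..<A + int L}. [x = int z] (mod int q)})"
    by (subst sum.inter_filter[symmetric]) auto
  finally show ?thesis using assms by simp
qed

text \<open>Completion: expanding the indicator functions of both sides of the box into additive characters
turns the count into a sum of Kloosterman sums. Intervals of integers are first reduced modulo \<open>q\<close>.\<close>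

lemma box_count_fourier:
  assumes q: "q > 0"
  shows "of_nat (box_count q c A L B M) =
    (1 / of_nat q ^ 2) * (\<Sum>(m, n)\<in>{..<q} \<times> {..<q}. interval_fourier q A L m * interval_fourier q B M n * kloosterman q c (- int m) (- int n))"
proof -
  define T where "T z w = [c * int z * int w = 1] (mod int q)" for z w
  define \<alpha> where "\<alpha> z = card {x \<in> {A..<A + int L}. [x = int z] (mod int q)}" for z
  define \<beta> where "\<beta> w = card {y \<in> {B..<B + int M}. [y = int w] (mod int q)}" for w
  let ?X = "{A..<A + int L}" and ?Y = "{B..<B + int M}" and ?P = "{..<q} \<times> {..<q}"
  let ?S = "{(x, y). x \<in> ?X \<and> y \<in> ?Y \<and> [c * x * y = 1] (mod int q)}"
  define r where "r = (\<lambda>(x, y). (nat (x mod int q), nat (y mod int q)))"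
  have rI: "x mod int q = int z \<longleftrightarrow> nat (x mod int q) = z" for x z
    using q by (metis nat_int nonneg_int_cases of_nat_0_less_iff pos_mod_sign int_nat_eq)
  have cong_mod: "[x = int z] (mod int q) \<longleftrightarrow> nat (x mod int q) = z" if "z < q" for x z
    using that by (simp add: cong_def flip: rI)
  have fin: "finite ?S" by (rule finite_subset[of _ "?X \<times> ?Y"]) auto
  have rP: "r ` ?S \<subseteq> ?P" using q by (auto simp: r_def nat_less_iff)
  have "card ?S = (\<Sum>u\<in>?P. card {s \<in> ?S. r s = u})"
    using sum.group[OF fin _ rP, of "\<lambda>_. 1::nat"] by simp
  also have "\<dots> = (\<Sum>(z, w)\<in>?P. if T z w then \<alpha> z * \<beta> w else 0)"
  proof (rule sum.cong)
    fix u assume "u \<in> ?P"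
    then obtain z w where u: "u = (z, w)" "z < q" "w < q" by auto
    have TT: "[c * x * y = 1] (mod int q) \<longleftrightarrow> T z w" if "[x = int z] (mod int q)" "[y = int w] (mod int q)" for x y
    proof -
      have "[c * x * y = c * int z * int w] (mod int q)" using that by (intro cong_mult cong_refl)
      then show ?thesis unfolding T_def cong_def by (simp only:)
    qed
    have "{s \<in> ?S. r s = u} = (if T z w then {x \<in> ?X. [x = int z] (mod int q)} \<times> {y \<in> ?Y. [y = int w] (mod int q)} else {})"
      using TT cong_mod[OF u(2)] cong_mod[OF u(3)] unfolding u(1) by (auto simp: r_def)
    then have "card {s \<in> ?S. r s = u} = (if T z w then \<alpha> z * \<beta> w else 0)"
      by (simp add: \<alpha>_def \<beta>_def card_cartesian_product)
    then show "card {s \<in> ?S. r s = u} = (case u of (z, w) \<Rightarrow> if T z w then \<alpha> z * \<beta> w else 0)" by (simp add: u)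
  qed simp
  finally have "of_nat (box_count q c A L B M) = (\<Sum>(z, w)\<in>?P. if T z w then of_nat (\<alpha> z) * of_nat (\<beta> w) else (0::complex))"
    unfolding box_count_def by (simp add: case_prod_unfold of_nat_sum if_distrib cong: if_cong)
  also have "\<dots> = (\<Sum>(z, w)\<in>?P. \<Sum>(m, n)\<in>?P. (1 / of_nat q ^ 2) * (interval_fourier q A L m * interval_fourier q B M n * (if T z w then e_mod q (- int m * int z + - int n * int w) else 0)))"
  proof (intro sum.cong refl)
    fix u assume "u \<in> ?P"
    obtain z w where u: "u = (z, w)" by force
    have "of_nat (\<alpha> z) * of_nat (\<beta> w) = (1 / of_nat q ^ 2) * ((\<Sum>m<q. interval_fourier q A L m * e_mod q (- (int m * int z))) * (\<Sum>n<q. interval_fourier q B M n * e_mod q (- (int n * int w))))"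
      unfolding \<alpha>_def \<beta>_def indicator_fourier[OF q] by (simp add: power2_eq_square)
    also have "\<dots> = (\<Sum>(m, n)\<in>?P. (1 / of_nat q ^ 2) * (interval_fourier q A L m * interval_fourier q B M n * e_mod q (- int m * int z + - int n * int w)))"
      unfolding sum.cartesian_product[symmetric]
      by (simp only: sum_product, simp only: sum_distrib_left, intro sum.cong refl)
        (simp only: e_mod_add mult_minus_left, simp only: mult_ac)
    finally show "(case u of (z, w) \<Rightarrow> if T z w then of_nat (\<alpha> z) * of_nat (\<beta> w) else (0::complex)) =
       (case u of (z, w) \<Rightarrow> \<Sum>(m, n)\<in>?P. (1 / of_nat q ^ 2) * (interval_fourier q A L m * interval_fourier q B M n * (if T z w then e_mod q (- int m * int z + - int n * int w) else 0)))"
      by (simp add: u case_prod_unfold)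
  qed
  also have "\<dots> = (\<Sum>(m, n)\<in>?P. \<Sum>(z, w)\<in>?P. (1 / of_nat q ^ 2) * (interval_fourier q A L m * interval_fourier q B M n * (if T z w then e_mod q (- int m * int z + - int n * int w) else 0)))"
    unfolding case_prod_unfold by (rule sum.swap)
  also have "\<dots> = (\<Sum>(m, n)\<in>?P. (1 / of_nat q ^ 2) * (interval_fourier q A L m * interval_fourier q B M n * kloosterman q c (- int m) (- int n)))"
    unfolding kloosterman_def T_def sum.cartesian_product by (simp add: case_prod_unfold sum_distrib_left)
  also have "\<dots> = (1 / of_nat q ^ 2) * (\<Sum>(m, n)\<in>?P. interval_fourier q A L m * interval_fourier q B M n * kloosterman q c (- int m) (- int n))"
    by (simp add: case_prod_unfold sum_distrib_left)
  finally show ?thesis .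
qed

lemma kloosterman_0_0:
  assumes "q > 0" "coprime c (int q)"
  shows "kloosterman q c 0 0 = of_nat (totient q)"
proof -
  have "kloosterman q c 0 0 = (\<Sum>x<q. if coprime x q then 1 else 0)"
    unfolding kloosterman_def
  proof (rule sum.cong)
    fix x assume "x \<in> {..<q}"
    show "(\<Sum>y<q. if [c * int x * int y = 1] (mod int q) then e_mod q (0 * int x + 0 * int y) else 0) = (if coprime x q then 1 else 0)"
    proof (cases "coprime x q")
      case True
      then have "coprime (c * int x) (int q)" using assms(2) by simp
      then obtain y0 where y0: "y0 < q" "[c * int x * int y0 = 1] (mod int q)"
        using mod_inverse_exists assms(1) by blast
      have "(\<Sum>y<q. if [c * int x * int y = 1] (mod int q) then e_mod q (0 * int x + 0 * int y) else 0) = (\<Sum>y<q. if y = y0 then 1 else 0)"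
      proof (rule sum.cong)
        fix y assume "y \<in> {..<q}"
        then have "[c * int x * int y = 1] (mod int q) \<longleftrightarrow> y = y0"
          using y0 mod_inverse_unique[of c x y q y0] by blast
        then show "(if [c * int x * int y = 1] (mod int q) then e_mod q (0 * int x + 0 * int y) else 0) = (if y = y0 then 1 else 0)"
          by simp
      qed simp
      then show ?thesis using True y0(1) by simp
    next
      case False
      have "\<not> [c * int x * int y = 1] (mod int q)" for y
      proof
        assume "[c * int x * int y = 1] (mod int q)"
        then have "[int x * (c * int y) = 1] (mod int q)" by (simp add: mult_ac)
        then have "coprime (int x) (int q)" using coprime_iff_invertible_int by blast
        then show False using False by simp
      qed
      then show ?thesis using False by simp
    qed
  qed simp
  also have "\<dots> = of_nat (card {x \<in> {..<q}. coprime x q})"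
    by (subst sum.inter_filter[symmetric]) auto
  also have "card {x \<in> {..<q}. coprime x q} = totient q"
  proof (cases "q = 1")
    case False
    then have "{x \<in> {..<q}. coprime x q} = totatives q"
      using assms(1) by (auto simp: totatives_def intro: Nat.gr0I le_neq_trans)
    then show ?thesis by (simp add: totient_def)
  qed (auto simp: lessThan_Suc)
  finally show ?thesis .
qed

definition box_err :: "nat \<Rightarrow> real" where
  "box_err q = 16 * real (num_divisors q) * kloosterman_factor q * harm q * (1 + harm q)"

lemma kloosterman_factor_nonneg: "kloosterman_factor q \<ge> 0" by (simp add: kloosterman_factor_def)

text \<open>The frequency \<open>(0, 0)\<close> yields the expected number. The others are estimated by the Kloosterman bound, and
the sum over the frequencies of the Fourier coefficients costs two harmonic factors.\<close>

lemma box_count_bound: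
  assumes q: "q > 0" and c: "coprime c (int q)" and L: "L \<le> q" and M: "M \<le> q"
  shows "\<bar>real (box_count q c A L B M) - real L * real M * real (totient q) / real q ^ 2\<bar> \<le> box_err q"
proof -
  let ?K = "real q ^ 2 * kloosterman_factor q"
  let ?P = "{..<q} \<times> {..<q}"
  \<comment> \<open>\<open>q * w m\<close> bounds the Fourier coefficients of both intervals; at frequency 0 the bound is the trivial one, as \<open>L, M \<le> q\<close>.\<close>
  define w where "w m = (if m = 0 then 1 else 2 / real m + 2 / real (q - m))" for m
  define G where "G m = sqrt (real (gcd m q))" for m
  define F where "F = (\<lambda>(m, n). interval_fourier q A L m * interval_fourier q B M n * kloosterman q c (- int m) (- int n))"
  have w0: "w m \<ge> 0" for m by (simp add: w_def)
  have G0: "G m \<ge> 0" for m by (simp add: G_def)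
  have Xw: "norm (interval_fourier q A L m) \<le> real q * w m" if "m < q" for m
    using norm_interval_fourier[of m q A L] norm_interval_fourier_le[OF L, of A m] that by (auto simp: w_def)
  have Yw: "norm (interval_fourier q B M n) \<le> real q * w n" if "n < q" for n
    using norm_interval_fourier[of n q B M] norm_interval_fourier_le[OF M, of B n] that by (auto simp: w_def)
  have X0: "interval_fourier q A L 0 = of_nat L" "interval_fourier q B M 0 = of_nat M" by (auto simp: interval_fourier_def)
  have F00: "F (0, 0) = of_nat L * of_nat M * of_nat (totient q)"
    using kloosterman_0_0[OF q c] by (simp add: F_def X0)
  have KG: "norm (kloosterman q c (- int m) (- int n)) \<le> kloosterman_factor q * (if m = 0 then G n else G m)" for m n
  proof -
    have "norm (kloosterman q c (- int m) (- int n)) \<le> kloosterman_factor q * sqrt (real_of_int (gcd (gcd (- int m) (- int n)) (int q)))"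
      by (rule kloosterman_bound[OF q c])
    also have "gcd (gcd (- int m) (- int n)) (int q) = int (gcd (gcd m n) q)" by simp
    also have "sqrt (real_of_int (int (gcd (gcd m n) q))) \<le> (if m = 0 then G n else G m)"
    proof (cases "m = 0")
      case False
      have "gcd (gcd m n) q dvd gcd m q" by (intro gcd_mono) auto
      then have "gcd (gcd m n) q \<le> gcd m q" using q by (intro dvd_imp_le) auto
      then show ?thesis using False by (simp add: G_def)
    qed (simp add: G_def)
    finally show ?thesis using kloosterman_factor_nonneg by (simp add: mult_left_mono)
  qed
  have normF: "norm (F (m, n)) \<le> ?K * (w m * w n * (if m = 0 then G n else G m))" if "m < q" "n < q" for m n
  proof -
    have "norm (F (m, n)) = norm (interval_fourier q A L m) * norm (interval_fourier q B M n) * norm (kloosterman q c (- int m) (- int n))"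
      by (simp add: F_def norm_mult)
    also have "\<dots> \<le> (real q * w m) * (real q * w n) * (kloosterman_factor q * (if m = 0 then G n else G m))"
      using w0 Xw[OF that(1)] Yw[OF that(2)] KG[of m n] by (intro mult_mono) (auto intro!: mult_nonneg_nonneg)
    also have "\<dots> = ?K * (w m * w n * (if m = 0 then G n else G m))"
      by (simp only: power2_eq_square mult_ac)
    finally show ?thesis .
  qed
  define W where "W = (\<Sum>n<q. w n)"
  define GG where "GG = (\<Sum>m\<in>{1..<q}. w m * G m)"
  have refl: "(\<Sum>m\<in>{1..<q}. (2 / real m + 2 / real (q - m)) * g m) = 4 * (\<Sum>m\<in>{1..<q}. g m / real m)"
    if "\<And>m. m < q \<Longrightarrow> g (q - m) = g m" for g :: "nat \<Rightarrow> real"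
  proof -
    have "(\<Sum>m\<in>{1..<q}. g m / real (q - m)) = (\<Sum>m\<in>{1..<q}. g (q - m) / real m)"
      using sum_reflect[of "\<lambda>m. g (q - m) / real m" q]
      by (subst sum_reflect[symmetric]) (auto intro!: sum.cong)
    also have "\<dots> = (\<Sum>m\<in>{1..<q}. g m / real m)" by (intro sum.cong) (auto simp: that)
    finally show ?thesis
      by (simp add: distrib_right sum.distrib flip: sum_distrib_left times_divide_eq_right)
  qed
  have "GG = (\<Sum>m\<in>{1..<q}. (2 / real m + 2 / real (q - m)) * G m)"
    unfolding GG_def by (rule sum.cong) (auto simp: w_def)
  also have "\<dots> = 4 * (\<Sum>m\<in>{1..<q}. G m / real m)"
  proof (rule refl)
    fix m assume "m < q"
    then have "gcd (q - m) q = gcd m q"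
      by (metis gcd.commute gcd_diff1_nat gcd_diff2_nat less_imp_le_nat)
    then show "G (q - m) = G m" by (simp add: G_def)
  qed
  also have "\<dots> \<le> 4 * (real (num_divisors q) * harm q)"
    using sum_gcd_bound[OF q] by (simp add: G_def)
  finally have GG: "GG \<le> 4 * (real (num_divisors q) * harm q)" .
  have GG0: "GG \<ge> 0" unfolding GG_def using w0 G0 by (intro sum_nonneg) auto
  have "W = w 0 + (\<Sum>n\<in>{1..<q}. w n)"
    unfolding W_def using q by (simp add: lessThan_atLeast0 sum.atLeast_Suc_lessThan)
  also have "(\<Sum>n\<in>{1..<q}. w n) = (\<Sum>m\<in>{1..<q}. (2 / real m + 2 / real (q - m)) * 1)"
    by (rule sum.cong) (auto simp: w_def)
  also have "\<dots> = 4 * (\<Sum>m\<in>{1..<q}. 1 / real m)" by (rule refl) simp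
  also have "(\<Sum>m\<in>{1..<q}. 1 / real m) \<le> harm q"
    unfolding harm_def by (simp add: inverse_eq_divide, rule sum_mono2) auto
  finally have W: "W \<le> 1 + 4 * harm q" by (simp add: w_def)
  have W0: "W \<ge> 0" unfolding W_def using w0 by (intro sum_nonneg) auto
  have "of_nat (box_count q c A L B M) - of_nat L * of_nat M * of_nat (totient q) / of_nat q ^ 2
     = (1 / of_nat q ^ 2) * (\<Sum>u\<in>?P - {(0, 0)}. F u)"
    unfolding box_count_fourier[OF q] F_def[symmetric] using q F00
    by (subst sum.remove[of _ "(0,0)"]) (auto simp: field_simps)
  then have "norm (of_nat (box_count q c A L B M) - of_nat L * of_nat M * of_nat (totient q) / of_nat q ^ 2 :: complex)
     = (1 / real q ^ 2) * norm (\<Sum>u\<in>?P - {(0, 0)}. F u)"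
    by (simp add: norm_mult norm_divide norm_power)
  also have "\<dots> \<le> (1 / real q ^ 2) * (?K * (GG * W + GG))"
  proof (rule mult_left_mono)
    have "norm (\<Sum>u\<in>?P - {(0, 0)}. F u) \<le> (\<Sum>u\<in>?P - {(0, 0)}. norm (F u))" by (rule norm_sum)
    also have "\<dots> \<le> (\<Sum>(m,n)\<in>?P - {(0, 0)}. ?K * (w m * w n * (if m = 0 then G n else G m)))"
      by (rule sum_mono) (use normF in auto)
    also have Pe: "?P - {(0, 0)} = {1..<q} \<times> {..<q} \<union> {0} \<times> {1..<q}" using q by auto
    also have "(\<Sum>(m,n)\<in>\<dots>. ?K * (w m * w n * (if m = 0 then G n else G m)))
      = (\<Sum>(m,n)\<in>{1..<q} \<times> {..<q}. ?K * (w m * w n * (if m = 0 then G n else G m)))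
      + (\<Sum>(m,n)\<in>{0} \<times> {1..<q}. ?K * (w m * w n * (if m = 0 then G n else G m)))"
      by (rule sum.union_disjoint) auto
    also have "(\<Sum>(m,n)\<in>{1..<q} \<times> {..<q}. ?K * (w m * w n * (if m = 0 then G n else G m))) = ?K * (GG * W)"
    proof -
      have "(\<Sum>(m,n)\<in>{1..<q} \<times> {..<q}. ?K * (w m * w n * (if m = 0 then G n else G m))) = (\<Sum>m\<in>{1..<q}. \<Sum>n<q. ?K * ((w m * G m) * w n))"
        by (subst sum.cartesian_product[symmetric]) (auto intro!: sum.cong simp: mult_ac)
      then show ?thesis unfolding GG_def W_def sum_product by (simp only: sum_distrib_left)
    qed
    also have "(\<Sum>(m,n)\<in>{0} \<times> {1..<q}. ?K * (w m * w n * (if m = 0 then G n else G m))) = ?K * GG"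
      by (subst sum.cartesian_product[symmetric]) (simp add: GG_def w_def sum_distrib_left)
    finally show "norm (\<Sum>u\<in>?P - {(0, 0)}. F u) \<le> ?K * (GG * W + GG)"
      unfolding Pe by (simp only: distrib_left)
  qed simp
  also have "\<dots> = kloosterman_factor q * (GG * (W + 1))" using q by (simp add: distrib_left)
  also have "\<dots> \<le> kloosterman_factor q * ((4 * (real (num_divisors q) * harm q)) * (4 * (1 + harm q)))"
    using GG W GG0 W0 by (intro mult_left_mono[OF _ kloosterman_factor_nonneg] mult_mono) (auto intro!: mult_nonneg_nonneg harm_nonneg)
  also have "\<dots> = box_err q" by (simp add: box_err_def algebra_simps)
  finally have "norm (of_nat (box_count q c A L B M) - of_nat L * of_nat M * of_nat (totient q) / of_nat q ^ 2 :: complex) \<le> box_err q" .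
  moreover have "(of_nat (box_count q c A L B M) - of_nat L * of_nat M * of_nat (totient q) / of_nat q ^ 2 :: complex)
     = complex_of_real (real (box_count q c A L B M) - real L * real M * real (totient q) / real q ^ 2)" by simp
  ultimately show ?thesis by (simp only: norm_of_real)
qed

section \<open>The average of the discrepancy over the modulus\<close>

lemma sum_inv_sqrt: "(\<Sum>t=1..N. 1 / sqrt (real t)) \<le> 2 * sqrt (real N)"
proof (induction N)
  case (Suc N)
  have pos: "sqrt (real (Suc N)) + sqrt (real N) > 0" by (intro add_pos_nonneg) auto
  have "1 / sqrt (real (Suc N)) = 2 * (1 / (2 * sqrt (real (Suc N))))" by simp
  also have "\<dots> \<le> 2 * (1 / (sqrt (real (Suc N)) + sqrt (real N)))"
    by (intro mult_left_mono frac_le) (use pos in auto)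
  also have "1 / (sqrt (real (Suc N)) + sqrt (real N)) = sqrt (real (Suc N)) - sqrt (real N)"
  proof -
    have "(sqrt (real (Suc N)) - sqrt (real N)) * (sqrt (real (Suc N)) + sqrt (real N)) = 1"
      by (simp add: algebra_simps)
    then show ?thesis using pos by (metis less_irrefl nonzero_mult_div_cancel_right)
  qed
  finally show ?case using Suc by simp
qed simp

lemma harm_le_ln: "n > 0 \<Longrightarrow> harm n \<le> 1 + ln (real n)"
  using decseqD[OF decseq_harm_diff_ln, of 0 "n - 1"] by (cases n) (auto simp: harm_def)

lemma harm_powr_bound:
  fixes \<delta> :: real assumes "\<delta> > 0"
  shows "\<exists>C\<ge>1. \<forall>n>0. harm n \<le> C * real n powr \<delta>"
proof (intro exI[of _ "1 + 1 / \<delta>"] conjI allI impI)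
  fix n :: nat assume n: "n > 0"
  have p1: "real n powr \<delta> \<ge> 1" using n assms by (simp add: ge_one_powr_ge_zero)
  have "\<delta> * ln (real n) = ln (real n powr \<delta>)" using n by (simp add: ln_powr)
  also have "\<dots> \<le> real n powr \<delta>" using ln_le_minus_one[of "real n powr \<delta>"] p1 n by simp
  finally have "ln (real n) \<le> (1 / \<delta>) * real n powr \<delta>" using assms by (simp add: field_simps)
  then show "harm n \<le> (1 + 1 / \<delta>) * real n powr \<delta>"
    using harm_le_ln[OF n] p1 by (simp add: distrib_right)
qed (use assms in auto)

text \<open>Group the moduli by their square part \<open>k\<close>. The squarefree parts run up to \<open>Q / k\<^sup>2\<close>, so the sum over them is
at most about the square root of \<open>Q\<close> divided by \<open>k\<close>: the loss from the trivial estimate at moduli with large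
square part is compensated by their rarity.\<close>

lemma sum_squarefree_ratio:
  "(\<Sum>q=1..Q. sqrt (real (gcd (squarefree_part q) (square_part q))) / sqrt (real (squarefree_part q)))
    \<le> 2 * sqrt (real Q) * (\<Sum>k=1..Q. real (num_divisors k) / real k)"
proof -
  let ?T = "SIGMA k:{1..Q}. {s\<in>{1..Q}. s * k ^ 2 \<le> Q}"
  have fin: "finite ?T" by (rule finite_SigmaI) auto
  have inj: "inj_on (\<lambda>q. (square_part q, squarefree_part q)) {1..Q}"
    by (rule inj_onI) (auto intro: squarefree_decomposition_unique)
  have img: "(\<lambda>q. (square_part q, squarefree_part q)) ` {1..Q} \<subseteq> ?T"
  proof (rule image_subsetI)
    fix q assume q: "q \<in> {1..Q}"
    have d: "squarefree_part q * square_part q ^ 2 = q" using squarefree_decompose[of q] by simp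
    have s0: "squarefree_part q > 0" and k0: "square_part q > 0"
      using q by (auto intro!: Nat.gr0I)
    have "squarefree_part q * 1 \<le> squarefree_part q * square_part q ^ 2" using k0 by (intro mult_le_mono2) simp
    moreover have "square_part q * 1 \<le> square_part q * (square_part q * squarefree_part q)" using k0 s0 by (intro mult_le_mono2) simp
    then have "square_part q \<le> squarefree_part q * square_part q ^ 2" by (simp add: power2_eq_square mult_ac)
    ultimately show "(square_part q, squarefree_part q) \<in> ?T"
      using q s0 k0 unfolding d by (auto simp: d)
  qed
  have "(\<Sum>q=1..Q. sqrt (real (gcd (squarefree_part q) (square_part q))) / sqrt (real (squarefree_part q)))
     = (\<Sum>(k, s)\<in>(\<lambda>q. (square_part q, squarefree_part q)) ` {1..Q}. sqrt (real (gcd s k)) / sqrt (real s))"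
    by (subst sum.reindex[OF inj]) simp
  also have "\<dots> \<le> (\<Sum>(k, s)\<in>?T. sqrt (real (gcd s k)) / sqrt (real s))"
    by (rule sum_mono2[OF fin img]) auto
  also have "\<dots> = (\<Sum>k=1..Q. \<Sum>s\<in>{s\<in>{1..Q}. s * k ^ 2 \<le> Q}. sqrt (real (gcd s k)) / sqrt (real s))"
    by (rule sum.Sigma[symmetric]) auto
  also have "\<dots> \<le> (\<Sum>k=1..Q. real (num_divisors k) * (2 * sqrt (real Q) / real k))"
  proof (rule sum_mono)
    fix k assume "k \<in> {1..Q}"
    then have k0: "k > 0" by simp
    let ?S = "{s\<in>{1..Q}. s * k ^ 2 \<le> Q}"
    have "(\<Sum>s\<in>?S. sqrt (real (gcd s k)) / sqrt (real s)) \<le> (\<Sum>s\<in>?S. \<Sum>d | d dvd k. if d dvd s then sqrt (real d) / sqrt (real s) else 0)"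
    proof (rule sum_mono)
      fix s
      have "(if gcd s k dvd s then sqrt (real (gcd s k)) / sqrt (real s) else 0) \<le> (\<Sum>d | d dvd k. if d dvd s then sqrt (real d) / sqrt (real s) else 0)"
        by (rule member_le_sum) (use finite_divisors[OF k0] in auto)
      then show "sqrt (real (gcd s k)) / sqrt (real s) \<le> (\<Sum>d | d dvd k. if d dvd s then sqrt (real d) / sqrt (real s) else 0)" by simp
    qed
    also have "\<dots> = (\<Sum>d | d dvd k. \<Sum>s\<in>?S. if d dvd s then sqrt (real d) / sqrt (real s) else 0)"
      by (rule sum.swap)
    also have "\<dots> \<le> (\<Sum>d | d dvd k. 2 * sqrt (real Q) / real k)"
    proof (rule sum_mono)
      fix d assume "d \<in> {d. d dvd k}"
      then have d0: "d > 0" using k0 by (auto intro!: Nat.gr0I)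
      define N where "N = Q div k ^ 2"
      have "(\<Sum>s\<in>?S. if d dvd s then sqrt (real d) / sqrt (real s) else 0) = (\<Sum>s\<in>{s\<in>?S. d dvd s}. sqrt (real d) / sqrt (real s))"
        by (rule sum.inter_filter[symmetric]) simp
      also have "\<dots> \<le> (\<Sum>s\<in>(\<lambda>t. d * t) ` {1..N}. sqrt (real d) / sqrt (real s))"
      proof (rule sum_mono2)
        show "{s\<in>?S. d dvd s} \<subseteq> (\<lambda>t. d * t) ` {1..N}"
        proof
          fix s assume s: "s \<in> {s\<in>?S. d dvd s}"
          then obtain t where t: "s = d * t" by (auto elim: dvdE)
          have t1: "t \<ge> 1" using s t by (cases t) auto
          have "t \<le> s" using t d0 by simp
          then have "t * k ^ 2 \<le> s * k ^ 2" by (rule mult_le_mono1)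
          also have "\<dots> \<le> Q" using s by blast
          finally have "t * k ^ 2 \<le> Q" .
          then have "t \<le> N" unfolding N_def using k0 by (simp add: less_eq_div_iff_mult_less_eq)
          then have "t \<in> {1..N}" using t1 by simp
          then show "s \<in> (\<lambda>t. d * t) ` {1..N}" using t by blast
        qed
      qed auto
      also have "\<dots> = (\<Sum>t=1..N. sqrt (real d) / sqrt (real (d * t)))"
        by (subst sum.reindex) (use d0 in \<open>auto simp: inj_on_def\<close>)
      also have "\<dots> = (\<Sum>t=1..N. 1 / sqrt (real t))"
        using d0 by (intro sum.cong) (auto simp: real_sqrt_mult)
      also have "\<dots> \<le> 2 * sqrt (real N)" by (rule sum_inv_sqrt)
      also have "\<dots> \<le> 2 * (sqrt (real Q) / real k)"
      proof -
        have "real N \<le> real Q / real (k ^ 2)" unfolding N_def by (rule of_nat_div_le_of_nat)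
        then have "sqrt (real N) \<le> sqrt (real Q / real (k ^ 2))" by simp
        then show ?thesis using k0 by (simp add: real_sqrt_divide)
      qed
      finally show "(\<Sum>s\<in>?S. if d dvd s then sqrt (real d) / sqrt (real s) else 0) \<le> 2 * sqrt (real Q) / real k" by simp
    qed
    also have "\<dots> = real (num_divisors k) * (2 * sqrt (real Q) / real k)" by (simp add: num_divisors_def)
    finally show "(\<Sum>s\<in>?S. sqrt (real (gcd s k)) / sqrt (real s)) \<le> real (num_divisors k) * (2 * sqrt (real Q) / real k)" .
  qed
  also have "\<dots> = 2 * sqrt (real Q) * (\<Sum>k=1..Q. real (num_divisors k) / real k)"
    by (simp add: sum_distrib_left mult_ac)
  finally show ?thesis .
qed

lemma kloosterman_factor_div:
  assumes "q > 0"
  shows "kloosterman_factor q / real q = real (num_divisors q) * (sqrt (real (gcd (squarefree_part q) (square_part q))) / sqrt (real (squarefree_part q)))"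
proof -
  define s k where "s = squarefree_part q" and "k = square_part q"
  have q: "q = s * k ^ 2" unfolding s_def k_def by (rule squarefree_decompose)
  have s0: "s > 0" and k0: "k > 0" using q assms by (auto intro!: Nat.gr0I)
  have e: "sqrt (real q) * real k / real q = 1 / sqrt (real s)"
  proof -
    have "sqrt (real q) = sqrt (real s) * real k" by (simp add: q real_sqrt_mult)
    moreover have "real q = sqrt (real s) * sqrt (real s) * (real k * real k)" by (simp add: q power2_eq_square)
    ultimately show ?thesis using s0 k0 by (simp add: field_simps)
  qed
  have "kloosterman_factor q / real q = real (num_divisors q) * (sqrt (real (gcd s k)) * (sqrt (real q) * real k / real q))"
    by (simp add: kloosterman_factor_def s_def k_def)
  then show ?thesis unfolding e by (simp add: s_def k_def)
qed

text \<open>All arithmetic factors are absorbed into powers \<open>Q powr \<eta>\<close> with \<open>\<eta> = \<delta> / 6\<close>: two each for the divisor counts and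
the harmonic factors of \<open>box_err\<close>, two for the remaining sum over square parts.\<close>

lemma sum_box_err:
  fixes \<delta> :: real assumes "\<delta> > 0"
  shows "\<exists>C\<ge>0. \<forall>Q>0. (\<Sum>q=1..Q. box_err q / real q) \<le> C * real Q powr (1/2 + \<delta>)"
proof -
  define \<eta> where "\<eta> = \<delta> / 6"
  have e: "\<eta> > 0" using assms by (simp add: \<eta>_def)
  obtain C1 where C1: "C1 \<ge> 1" "\<And>n. n > 0 \<Longrightarrow> real (num_divisors n) \<le> C1 * real n powr \<eta>"
    using divisor_bound[OF e] by blast
  obtain C2 where C2: "C2 \<ge> 1" "\<And>n. n > 0 \<Longrightarrow> harm n \<le> C2 * real n powr \<eta>"
    using harm_powr_bound[OF e] by blast
  define C where "C = 32 * C1 ^ 2 * C2 ^ 2 * (2 * (C1 * C2))"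
  have "(\<Sum>q=1..Q. box_err q / real q) \<le> C * real Q powr (1/2 + \<delta>)" if Q: "Q > 0" for Q
  proof -
    define Xq where "Xq = real Q powr \<eta>"
    have X1: "Xq \<ge> 1" unfolding Xq_def using Q e by (simp add: ge_one_powr_ge_zero)
    have tauX: "real (num_divisors q) \<le> C1 * Xq" and harmX: "harm q \<le> C2 * Xq" if "q \<in> {1..Q}" for q
    proof -
      have "real q powr \<eta> \<le> Xq" unfolding Xq_def using that e by (intro powr_mono2) auto
      then have "C1 * real q powr \<eta> \<le> C1 * Xq" "C2 * real q powr \<eta> \<le> C2 * Xq"
        using C1 C2 by (auto intro!: mult_left_mono)
      then show "real (num_divisors q) \<le> C1 * Xq" "harm q \<le> C2 * Xq" using C1(2)[of q] C2(2)[of q] that by auto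
    qed
    let ?r = "\<lambda>q. sqrt (real (gcd (squarefree_part q) (square_part q))) / sqrt (real (squarefree_part q))"
    have "(\<Sum>q=1..Q. box_err q / real q) \<le> (\<Sum>q=1..Q. (32 * (C1 * Xq) ^ 2 * (C2 * Xq) ^ 2) * ?r q)"
    proof (rule sum_mono)
      fix q assume q: "q \<in> {1..Q}"
      have h1: "harm q \<ge> (1::real)"
        using harm_mono[of 1 q, where ?'a = real] q by (simp add: harm_def)
      have "box_err q / real q = 16 * real (num_divisors q) * harm q * (1 + harm q) * (kloosterman_factor q / real q)"
        by (simp add: box_err_def)
      also have "kloosterman_factor q / real q = real (num_divisors q) * ?r q" by (rule kloosterman_factor_div) (use q in simp)
      also have "16 * real (num_divisors q) * harm q * (1 + harm q) * (real (num_divisors q) * ?r q)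
         = 16 * (real (num_divisors q) ^ 2 * (harm q * (1 + harm q))) * ?r q"
        by (simp only: power2_eq_square mult_ac)
      also have "\<dots> \<le> 16 * ((C1 * Xq) ^ 2 * ((C2 * Xq) * (2 * (C2 * Xq)))) * ?r q"
      proof -
        have "1 + harm q \<le> 2 * (C2 * Xq)" using h1 harmX[OF q] by simp
        then have "harm q * (1 + harm q) \<le> (C2 * Xq) * (2 * (C2 * Xq))"
          using harmX[OF q] h1 by (intro mult_mono) auto
        moreover have "real (num_divisors q) ^ 2 \<le> (C1 * Xq) ^ 2" using tauX[OF q] by (intro power_mono) auto
        ultimately have "real (num_divisors q) ^ 2 * (harm q * (1 + harm q)) \<le> (C1 * Xq) ^ 2 * ((C2 * Xq) * (2 * (C2 * Xq)))"
          using h1 by (intro mult_mono[of "real (num_divisors q) ^ 2" _ "harm q * (1 + harm q)"]) auto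
        then show ?thesis by (intro mult_right_mono mult_left_mono) auto
      qed
      also have "16 * ((C1 * Xq) ^ 2 * ((C2 * Xq) * (2 * (C2 * Xq)))) = 32 * (C1 * Xq) ^ 2 * (C2 * Xq) ^ 2"
        by (simp add: power2_eq_square)
      finally show "box_err q / real q \<le> (32 * (C1 * Xq) ^ 2 * (C2 * Xq) ^ 2) * ?r q" .
    qed
    also have "\<dots> = (32 * (C1 * Xq) ^ 2 * (C2 * Xq) ^ 2) * (\<Sum>q=1..Q. ?r q)" by (simp only: sum_distrib_left)
    also have "\<dots> \<le> (32 * (C1 * Xq) ^ 2 * (C2 * Xq) ^ 2) * (2 * sqrt (real Q) * (\<Sum>k=1..Q. real (num_divisors k) / real k))"
      by (intro mult_left_mono sum_squarefree_ratio) auto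
    also have "\<dots> \<le> (32 * (C1 * Xq) ^ 2 * (C2 * Xq) ^ 2) * (2 * sqrt (real Q) * (C1 * Xq * (C2 * Xq)))"
    proof (intro mult_left_mono)
      have "(\<Sum>k=1..Q. real (num_divisors k) / real k) \<le> (\<Sum>k=1..Q. C1 * Xq * inverse (real k))"
        by (intro sum_mono) (use tauX in \<open>auto simp: divide_inverse intro!: mult_right_mono\<close>)
      also have "\<dots> = C1 * Xq * harm Q" by (simp add: harm_def sum_distrib_left)
      also have "\<dots> \<le> C1 * Xq * (C2 * Xq)" using C1 X1 harmX[of Q] Q by (intro mult_left_mono) auto
      finally show "(\<Sum>k=1..Q. real (num_divisors k) / real k) \<le> C1 * Xq * (C2 * Xq)" .
    qed auto
    also have "\<dots> = C * (sqrt (real Q) * Xq ^ 6)" by (simp add: C_def power_mult_distrib eval_nat_numeral)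
    also have "Xq ^ 6 = real Q powr \<delta>" using Q by (simp add: Xq_def \<eta>_def powr_powr flip: powr_realpow)
    also have "sqrt (real Q) * real Q powr \<delta> = real Q powr (1/2 + \<delta>)" using Q by (simp add: powr_add powr_half_sqrt)
    finally show ?thesis .
  qed
  moreover have "C \<ge> 0" using C1 C2 by (simp add: C_def)
  ultimately show ?thesis by blast
qed

section \<open>The mean value of totient(q) / q\<close>

definition mobius :: "nat \<Rightarrow> real" where
  "mobius n = (if squarefree n then (-1) ^ card (prime_factors n) else 0)"

lemma abs_mobius: "\<bar>mobius n\<bar> \<le> 1" by (simp add: mobius_def)

lemma prod_1_minus:
  fixes g :: "'i \<Rightarrow> real"
  assumes "finite P"
  shows "(\<Prod>p\<in>P. 1 - g p) = (\<Sum>S\<in>Pow P. (-1) ^ card S * (\<Prod>p\<in>S. g p))"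
  using assms
proof (induction P rule: finite_induct)
  case (insert x P)
  have inj: "inj_on (insert x) (Pow P)" using insert(2) by (auto simp: inj_on_def)
  have e: "(\<Sum>S\<in>insert x ` Pow P. (-1) ^ card S * (\<Prod>p\<in>S. g p)) = (\<Sum>S\<in>Pow P. - g x * ((-1) ^ card S * (\<Prod>p\<in>S. g p)))"
    unfolding sum.reindex[OF inj] comp_def
  proof (rule sum.cong)
    fix S assume "S \<in> Pow P"
    then have "finite S" "x \<notin> S" using insert finite_subset by auto
    then show "(-1) ^ card (insert x S) * (\<Prod>p\<in>insert x S. g p) = - g x * ((-1) ^ card S * (\<Prod>p\<in>S. g p))" by simp
  qed simp
  have "Pow P \<inter> insert x ` Pow P = {}" using insert(2) by auto
  then have "(\<Sum>S\<in>Pow (insert x P). (-1) ^ card S * (\<Prod>p\<in>S. g p)) =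
     (\<Sum>S\<in>Pow P. (-1) ^ card S * (\<Prod>p\<in>S. g p)) + (- g x) * (\<Sum>S\<in>Pow P. (-1) ^ card S * (\<Prod>p\<in>S. g p))"
    using insert(1) unfolding sum_distrib_left e[symmetric] by (simp only: Pow_insert) (rule sum.union_disjoint, auto)
  moreover have "(\<Prod>p\<in>insert x P. 1 - g p) = (1 - g x) * (\<Prod>p\<in>P. 1 - g p)" using insert by simp
  ultimately show ?case unfolding insert.IH by (simp only:) (simp add: left_diff_distrib)
qed simp

text \<open>Squarefree divisors of \<open>n\<close> correspond to sets of prime factors of \<open>n\<close>, so the sum is the expanded product.
The choice \<open>g = 1\<close> gives the basic property of the Moebius function, and \<open>g p = 1 / p\<close> gives \<open>totient n / n\<close>.\<close>

lemma mobius_sum: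
  fixes g :: "nat \<Rightarrow> real"
  assumes n: "n > 0"
  shows "(\<Sum>d | d dvd n. mobius d * (\<Prod>p\<in>prime_factors d. g p)) = (\<Prod>p\<in>prime_factors n. 1 - g p)"
proof -
  have prodset: "prime_factors (\<Prod>S) = S" "squarefree (\<Prod>S)" "\<Prod>S dvd n" if "S \<subseteq> prime_factors n" for S
  proof -
    have fin: "finite S" using that finite_subset by blast
    have pr: "prime p" if "p \<in> S" for p using that \<open>S \<subseteq> _\<close> by auto
    show "prime_factors (\<Prod>S) = S"
      using pr fin by (subst prime_factors_prod) (auto simp: prime_prime_factors dest: prime_gt_0_nat)
    show sq: "squarefree (\<Prod>S)"
      by (rule squarefree_prod_coprime) (auto intro: pr primes_coprime squarefree_prime)
    have "\<Prod>S dvd \<Prod>(prime_factors n)" by (rule prod_dvd_prod_subset) (use that in auto)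
    also have "\<dots> dvd (\<Prod>p\<in>prime_factors n. p ^ multiplicity p n)"
      by (rule prod_dvd_prod) (use n in \<open>auto simp: prime_factors_multiplicity intro: dvd_power\<close>)
    also have "\<dots> = n" using n by (simp add: prod_prime_factors)
    finally show "\<Prod>S dvd n" .
  qed
  have sqprod: "\<Prod>(prime_factors d) = d" if "squarefree d" for d :: nat
  proof -
    have d0: "d \<noteq> 0" using that by (metis not_squarefree_0)
    have "(\<Prod>p\<in>prime_factors d. p ^ multiplicity p d) = d" using d0 by (simp add: prod_prime_factors)
    moreover have "(\<Prod>p\<in>prime_factors d. p ^ multiplicity p d) = \<Prod>(prime_factors d)"
      using that d0 by (intro prod.cong) (auto simp: squarefree_factorial_semiring')
    ultimately show ?thesis by simp
  qed
  have "(\<Sum>d | d dvd n. mobius d * (\<Prod>p\<in>prime_factors d. g p)) = (\<Sum>d\<in>{d. d dvd n \<and> squarefree d}. (-1) ^ card (prime_factors d) * (\<Prod>p\<in>prime_factors d. g p))"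
    by (rule sum.mono_neutral_cong_right) (use finite_divisors[OF n] in \<open>auto simp: mobius_def\<close>)
  also have "\<dots> = (\<Sum>S\<in>Pow (prime_factors n). (-1) ^ card S * (\<Prod>p\<in>S. g p))"
  proof (rule sum.reindex_bij_witness[of _ "\<lambda>S. \<Prod>S" "\<lambda>d. prime_factors d"])
    fix d assume d: "d \<in> {d. d dvd n \<and> squarefree d}"
    then show "\<Prod>(prime_factors d) = d" using sqprod by simp
    show "prime_factors d \<in> Pow (prime_factors n)" using d n dvd_prime_factors[of n d] by auto
  next
    fix S assume "S \<in> Pow (prime_factors n)"
    then show "prime_factors (\<Prod>S) = S" "\<Prod>S \<in> {d. d dvd n \<and> squarefree d}" using prodset[of S] by auto
  qed simp
  also have "\<dots> = (\<Prod>p\<in>prime_factors n. 1 - g p)" by (rule prod_1_minus[symmetric]) simp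
  finally show ?thesis .
qed

lemma sum_mobius: 
  assumes "n > 0" shows "(\<Sum>d | d dvd n. mobius d) = (if n = 1 then 1 else 0)"
proof (cases "n = 1")
  case False
  then obtain p where "prime p" "p dvd n" using prime_factor_nat by blast
  then have "p \<in> prime_factors n" using assms by (auto simp: prime_factors_dvd)
  then have z: "(\<Prod>p\<in>prime_factors n. 1 - (1::real)) = 0" by (intro prod_zero) auto
  have "(\<Sum>d | d dvd n. mobius d * (\<Prod>p\<in>prime_factors d. 1)) = 0"
    using mobius_sum[OF assms, of "\<lambda>_. 1"] by (simp only: z)
  then show ?thesis using False by simp
qed (simp add: mobius_def)

lemma totient_mobius:
  assumes n: "n > 0"
  shows "real (totient n) / real n = (\<Sum>d | d dvd n. mobius d / real d)"
proof -
  have "real (totient n) / real n = (\<Prod>p\<in>prime_factors n. 1 - 1 / real p)"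
    using totient_formula2[of n] n by simp
  also have "\<dots> = (\<Sum>d | d dvd n. mobius d * (\<Prod>p\<in>prime_factors d. 1 / real p))"
    by (rule mobius_sum[OF n, symmetric])
  also have "\<dots> = (\<Sum>d | d dvd n. mobius d / real d)"
  proof (rule sum.cong)
    fix d assume "d \<in> {d. d dvd n}"
    show "mobius d * (\<Prod>p\<in>prime_factors d. 1 / real p) = mobius d / real d"
    proof (cases "squarefree d")
      case True
      have d0: "d \<noteq> 0" using True by (metis not_squarefree_0)
      have "(\<Prod>p\<in>prime_factors d. p ^ multiplicity p d) = d" using d0 by (simp add: prod_prime_factors)
      moreover have "(\<Prod>p\<in>prime_factors d. p ^ multiplicity p d) = \<Prod>(prime_factors d)"
        using True d0 by (intro prod.cong) (auto simp: squarefree_factorial_semiring')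
      ultimately have "\<Prod>(prime_factors d) = d" by simp
      then have "real (\<Prod>(prime_factors d)) = real d" by (simp only:)
      then have "(\<Prod>p\<in>prime_factors d. real p) = real d" by (simp only: of_nat_prod)
      then show ?thesis by (simp add: prod_dividef)
    qed (simp add: mobius_def)
  qed simp
  finally show ?thesis .
qed

text \<open>Dirichlet's rearrangement: pairs \<open>d dvd n \<le> N\<close> are pairs \<open>(d, k)\<close> with \<open>k \<le> N div d\<close>.\<close>

lemma sum_divisors_swap:
  fixes F :: "nat \<Rightarrow> nat \<Rightarrow> real"
  shows "(\<Sum>n=1..N. \<Sum>d | d dvd n. F d n) = (\<Sum>d=1..N. \<Sum>k\<in>{1..N div d}. F d (d * k))"
proof -
  have "(\<Sum>n=1..N. \<Sum>d | d dvd n. F d n) = (\<Sum>(n, d)\<in>(SIGMA n:{1..N}. {d. d dvd n}). F d n)"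
    by (rule sum.Sigma) (use finite_divisors in auto)
  also have "\<dots> = (\<Sum>(d, k)\<in>(SIGMA d:{1..N}. {1..N div d}). F d (d * k))"
  proof (rule sum.reindex_bij_witness[of _ "\<lambda>(d, k). (d * k, d)" "\<lambda>(n, d). (d, n div d)"])
    fix z assume "z \<in> (SIGMA n:{1..N}. {d. d dvd n})"
    then obtain n d where z: "z = (n, d)" "n \<ge> 1" "n \<le> N" "d dvd n" by auto
    then have d0: "d > 0" "d \<le> n" by (auto intro!: Nat.gr0I dvd_imp_le)
    then show "(case (case z of (n, d) \<Rightarrow> (d, n div d)) of (d, k) \<Rightarrow> (d * k, d)) = z" using z by simp
    show "(case z of (n, d) \<Rightarrow> (d, n div d)) \<in> (SIGMA d:{1..N}. {1..N div d})"
      using z d0 by (auto intro: div_le_mono simp: Suc_le_eq div_greater_zero_iff)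
    show "(case (case z of (n, d) \<Rightarrow> (d, n div d)) of (d, k) \<Rightarrow> F d (d * k)) = (case z of (n, d) \<Rightarrow> F d n)"
      using z by simp
  next
    fix z assume "z \<in> (SIGMA d:{1..N}. {1..N div d})"
    then obtain d k where z: "z = (d, k)" "d \<ge> 1" "d \<le> N" "k \<ge> 1" "k \<le> N div d" by auto
    then show "(case (case z of (d, k) \<Rightarrow> (d * k, d)) of (n, d) \<Rightarrow> (d, n div d)) = z" by simp
    have "d * k \<le> N" using z by (metis div_times_less_eq_dividend dual_order.trans mult.commute mult_le_mono1)
    then show "(case z of (d, k) \<Rightarrow> (d * k, d)) \<in> (SIGMA n:{1..N}. {d. d dvd n})" using z by auto
  qed
  also have "\<dots> = (\<Sum>d=1..N. \<Sum>k\<in>{1..N div d}. F d (d * k))"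
    by (rule sum.Sigma[symmetric]) auto
  finally show ?thesis .
qed

definition recip_square_sum :: "nat \<Rightarrow> real" where "recip_square_sum N = (\<Sum>k=1..N. 1 / real k ^ 2)"

text \<open>The summand is at most \<open>1 / (k - 1) - 1 / k\<close>, and this telescopes.\<close>

lemma recip_square_sum_tail:
  assumes "m \<ge> 1" shows "(\<Sum>k\<in>{m<..m + j}. 1 / real k ^ 2) \<le> 1 / real m - 1 / real (m + j)"
proof (induction j)
  case (Suc j)
  have "{m<..m + Suc j} = insert (m + Suc j) {m<..m + j}" by auto
  then have "(\<Sum>k\<in>{m<..m + Suc j}. 1 / real k ^ 2) = 1 / real (m + Suc j) ^ 2 + (\<Sum>k\<in>{m<..m + j}. 1 / real k ^ 2)" by simp
  moreover have "1 / real (m + Suc j) ^ 2 \<le> 1 / real (m + j) - 1 / real (m + Suc j)"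
  proof -
    define y where "y = real (m + j)"
    have y: "y \<ge> 1" using assms by (simp add: y_def)
    have "1 / (y + 1) ^ 2 \<le> 1 / (y * (y + 1))" using y by (intro frac_le) (auto simp: power2_eq_square)
    also have "\<dots> = 1 / y - 1 / (y + 1)" using y by (simp add: field_simps)
    finally show ?thesis by (simp add: y_def add_ac)
  qed
  ultimately show ?case using Suc by linarith
qed simp

lemma recip_square_sum_tail': assumes "m \<ge> 1" shows "(\<Sum>k\<in>{m<..N}. 1 / real k ^ 2) \<le> 1 / real m"
proof (cases "m \<le> N")
  case True
  then obtain j where j: "N = m + j" using le_Suc_ex by blast
  have "1 / real (m + j) \<ge> 0" by simp
  then show ?thesis using recip_square_sum_tail[OF assms, of j] unfolding j by linarith
qed simp

lemma recip_square_sum_le_2: "recip_square_sum N \<le> 2"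
proof (cases N)
  case (Suc n)
  have "{1..N} = insert 1 {1<..N}" using Suc by auto
  then show ?thesis using recip_square_sum_tail'[of 1 N] by (simp add: recip_square_sum_def)
qed (simp add: recip_square_sum_def)

lemma recip_square_sum_limit:
  assumes "N \<ge> 1" shows "recip_square_sum N \<le> pi\<^sup>2 / 6" "pi\<^sup>2 / 6 \<le> recip_square_sum N + 1 / real N"
proof -
  have Zeq: "recip_square_sum n = (\<Sum>i<n. 1 / (real i + 1)\<^sup>2)" for n
    unfolding recip_square_sum_def by (rule sum.reindex_bij_witness[of _ Suc "\<lambda>k. k - 1"]) (auto simp: add.commute)
  have lim: "recip_square_sum \<longlonglongrightarrow> pi\<^sup>2 / 6"
    using inverse_squares_sums unfolding sums_def Zeq[abs_def] by (simp add: add.commute)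
  have mono: "recip_square_sum N \<le> recip_square_sum n" if "n \<ge> N" for n
    unfolding recip_square_sum_def by (rule sum_mono2) (use that in auto)
  show "recip_square_sum N \<le> pi\<^sup>2 / 6" by (rule LIMSEQ_le_const[OF lim]) (use mono in blast)
  have "recip_square_sum n \<le> recip_square_sum N + 1 / real N" if "n \<ge> N" for n
  proof -
    have "{1..n} = {1..N} \<union> {N<..n}" using that assms by auto
    then have "recip_square_sum n = recip_square_sum N + (\<Sum>k\<in>{N<..n}. 1 / real k ^ 2)"
      unfolding recip_square_sum_def by (simp only:) (rule sum.union_disjoint, auto)
    then show ?thesis using recip_square_sum_tail'[OF assms, of n] by simp
  qed
  then show "pi\<^sup>2 / 6 \<le> recip_square_sum N + 1 / real N" by (intro LIMSEQ_le_const2[OF lim]) blast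
qed

definition mobius_square_sum :: "nat \<Rightarrow> real" where "mobius_square_sum N = (\<Sum>d=1..N. mobius d / real d ^ 2)"

text \<open>The partial sums of the series of \<open>1 / \<zeta>(2)\<close> and \<open>\<zeta>(2)\<close> multiply to 1 up to the pairs with \<open>d * k > N\<close>: the pairs
with \<open>d * k \<le> N\<close> sum to 1 by \<open>sum_mobius\<close>. This determines the limit \<open>6 / \<pi>\<^sup>2\<close> with a rate.\<close>

lemma mobius_square_sum_recip_square_sum:
  assumes N: "N \<ge> 1"
  shows "\<bar>mobius_square_sum N * recip_square_sum N - 1\<bar> \<le> 2 * harm N / real N"
proof -
  have "mobius_square_sum N * recip_square_sum N = (\<Sum>d=1..N. \<Sum>k=1..N. mobius d / real (d * k) ^ 2)"
    unfolding mobius_square_sum_def recip_square_sum_def sum_product by (intro sum.cong) (auto simp: power_mult_distrib)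
  also have "\<dots> = (\<Sum>d=1..N. (\<Sum>k\<in>{1..N div d}. mobius d / real (d * k) ^ 2) + (\<Sum>k\<in>{N div d<..N}. mobius d / real (d * k) ^ 2))"
  proof (rule sum.cong)
    fix d assume "d \<in> {1..N}"
    have "{1..N} = {1..N div d} \<union> {N div d<..N}" by (auto intro: le_trans[OF _ div_le_dividend])
    then have "(\<Sum>k=1..N. mobius d / real (d * k) ^ 2) = (\<Sum>k\<in>{1..N div d} \<union> {N div d<..N}. mobius d / real (d * k) ^ 2)" by (simp only:)
    also have "\<dots> = (\<Sum>k\<in>{1..N div d}. mobius d / real (d * k) ^ 2) + (\<Sum>k\<in>{N div d<..N}. mobius d / real (d * k) ^ 2)"
      by (rule sum.union_disjoint) auto
    finally show "(\<Sum>k=1..N. mobius d / real (d * k) ^ 2) = (\<Sum>k\<in>{1..N div d}. mobius d / real (d * k) ^ 2) + (\<Sum>k\<in>{N div d<..N}. mobius d / real (d * k) ^ 2)" .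
  qed simp
  also have "\<dots> = (\<Sum>n=1..N. \<Sum>d | d dvd n. mobius d / real n ^ 2) + (\<Sum>d=1..N. \<Sum>k\<in>{N div d<..N}. mobius d / real (d * k) ^ 2)"
    unfolding sum_divisors_swap by (simp only: sum.distrib)
  also have "(\<Sum>n=1..N. \<Sum>d | d dvd n. mobius d / real n ^ 2) = (\<Sum>n=1..N. if n = 1 then 1 else 0)"
  proof (rule sum.cong)
    fix n assume "n \<in> {1..N}"
    then show "(\<Sum>d | d dvd n. mobius d / real n ^ 2) = (if n = 1 then 1 else 0)"
      using sum_mobius[of n] by (simp add: sum_divide_distrib[symmetric])
  qed simp
  also have "\<dots> = 1" using N by simp
  finally have "mobius_square_sum N * recip_square_sum N - 1 = (\<Sum>d=1..N. \<Sum>k\<in>{N div d<..N}. mobius d / real (d * k) ^ 2)" by simp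
  also have "\<bar>\<dots>\<bar> \<le> (\<Sum>d=1..N. 2 / real N * inverse (real d))"
  proof (rule order_trans[OF sum_abs], rule sum_mono)
    fix d assume d: "d \<in> {1..N}"
    define m where "m = N div d"
    have m1: "m \<ge> 1" using d by (simp add: m_def Suc_le_eq div_greater_zero_iff)
    have "N < d * Suc m" unfolding m_def using d by (metis atLeastAtMost_iff dividend_less_times_div gr0I mult_Suc_right not_one_le_zero)
    also have "\<dots> \<le> d * (2 * m)" using m1 by (intro mult_le_mono2) simp
    finally have "real N \<le> real (d * (2 * m))" by (simp only: of_nat_le_iff less_imp_le)
    then have Nm: "1 / real m \<le> 2 * real d / real N" using m1 N by (simp add: field_simps)
    have "\<bar>\<Sum>k\<in>{m<..N}. mobius d / real (d * k) ^ 2\<bar> \<le> (\<Sum>k\<in>{m<..N}. (1 / real d ^ 2) * (1 / real k ^ 2))"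
    proof (intro order_trans[OF sum_abs] sum_mono)
      fix k
      have "\<bar>mobius d / real (d * k) ^ 2\<bar> = \<bar>mobius d\<bar> / real (d * k) ^ 2" by (simp add: abs_divide)
      also have "\<dots> \<le> 1 / real (d * k) ^ 2" by (intro divide_right_mono abs_mobius) simp
      finally show "\<bar>mobius d / real (d * k) ^ 2\<bar> \<le> (1 / real d ^ 2) * (1 / real k ^ 2)" by (simp add: power_mult_distrib)
    qed
    also have "\<dots> = (1 / real d ^ 2) * (\<Sum>k\<in>{m<..N}. 1 / real k ^ 2)" by (simp only: sum_distrib_left)
    also have "\<dots> \<le> (1 / real d ^ 2) * (2 * real d / real N)"
      by (intro mult_left_mono order_trans[OF recip_square_sum_tail'[OF m1] Nm]) simp
    also have "\<dots> = 2 / real N * inverse (real d)" using d by (simp add: field_simps power2_eq_square)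
    finally show "\<bar>\<Sum>k\<in>{N div d<..N}. mobius d / real (d * k) ^ 2\<bar> \<le> 2 / real N * inverse (real d)"
      by (simp only: m_def)
  qed
  also have "\<dots> = 2 * harm N / real N" by (simp add: harm_def sum_distrib_left sum_divide_distrib)
  finally show ?thesis .
qed

definition totient_sum_err :: "nat \<Rightarrow> real" where "totient_sum_err N = 2 + 3 * harm N"

text \<open>Expand \<open>totient q / q\<close> over divisors and sum over \<open>q\<close> first: the number of multiples of \<open>d\<close> is \<open>N / d\<close> up to 1,
and the main term is \<open>N\<close> times the partial sum of \<open>mobius d / d\<^sup>2\<close>.\<close>

lemma totient_sum:
  "\<bar>(\<Sum>q=1..N. real (totient q) / real q - 6 / pi\<^sup>2)\<bar> \<le> totient_sum_err N"
proof (cases "N \<ge> 1")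
  case N: True
  define \<kappa> where "\<kappa> = 6 / pi\<^sup>2"
  have kp: "\<kappa> * (pi\<^sup>2 / 6) = 1" by (simp add: \<kappa>_def)
  have k1: "0 < \<kappa>" "\<kappa> \<le> 1"
  proof -
    have "3 ^ 2 \<le> pi\<^sup>2" using pi_gt3 by (intro power_mono) auto
    then show "0 < \<kappa>" "\<kappa> \<le> 1" by (auto simp: \<kappa>_def field_simps)
  qed
  have absK: "\<bar>mobius_square_sum N\<bar> \<le> 2"
  proof -
    have "\<bar>mobius_square_sum N\<bar> \<le> recip_square_sum N" unfolding mobius_square_sum_def recip_square_sum_def
      by (intro order_trans[OF sum_abs] sum_mono) (auto simp: abs_divide abs_mobius intro!: divide_right_mono)
    then show ?thesis using recip_square_sum_le_2[of N] by linarith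
  qed
  have "\<bar>mobius_square_sum N * (pi\<^sup>2 / 6) - 1\<bar> \<le> \<bar>mobius_square_sum N * recip_square_sum N - 1\<bar> + \<bar>mobius_square_sum N\<bar> * \<bar>pi\<^sup>2 / 6 - recip_square_sum N\<bar>"
  proof -
    have "mobius_square_sum N * (pi\<^sup>2 / 6) - 1 = (mobius_square_sum N * recip_square_sum N - 1) + mobius_square_sum N * (pi\<^sup>2 / 6 - recip_square_sum N)" by (simp add: algebra_simps)
    then show ?thesis by (metis abs_mult abs_triangle_ineq)
  qed
  also have "\<dots> \<le> 2 * harm N / real N + 2 * (1 / real N)"
    using mobius_square_sum_recip_square_sum[OF N] absK recip_square_sum_limit[OF N] by (intro add_mono mult_mono) auto
  finally have A: "\<bar>mobius_square_sum N * (pi\<^sup>2 / 6) - 1\<bar> \<le> (2 * harm N + 2) / real N" by (simp add: add_divide_distrib)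
  have "\<bar>mobius_square_sum N - \<kappa>\<bar> = \<kappa> * \<bar>mobius_square_sum N * (pi\<^sup>2 / 6) - 1\<bar>"
  proof -
    have "mobius_square_sum N - \<kappa> = \<kappa> * (mobius_square_sum N * (pi\<^sup>2 / 6) - 1)" using kp by (simp add: algebra_simps)
    then show ?thesis using k1 by (simp add: abs_mult)
  qed
  also have "\<dots> \<le> 1 * ((2 * harm N + 2) / real N)" using A k1 by (intro mult_mono) auto
  finally have F: "\<bar>mobius_square_sum N - \<kappa>\<bar> \<le> (2 * harm N + 2) / real N" by simp
  have "\<bar>real N * mobius_square_sum N - real N * \<kappa>\<bar> = real N * \<bar>mobius_square_sum N - \<kappa>\<bar>"
    by (simp add: abs_mult flip: right_diff_distrib)
  also have "\<dots> \<le> real N * ((2 * harm N + 2) / real N)" using F by (intro mult_left_mono) auto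
  also have "\<dots> = 2 * harm N + 2" using N by simp
  finally have B: "\<bar>real N * mobius_square_sum N - real N * \<kappa>\<bar> \<le> 2 * harm N + 2" .
  have "(\<Sum>q=1..N. real (totient q) / real q) = (\<Sum>q=1..N. \<Sum>d | d dvd q. mobius d / real d)"
    by (rule sum.cong) (auto simp: totient_mobius)
  also have "\<dots> = (\<Sum>d=1..N. real (N div d) * (mobius d / real d))"
    unfolding sum_divisors_swap by simp
  finally have T: "(\<Sum>q=1..N. real (totient q) / real q) = (\<Sum>d=1..N. real (N div d) * (mobius d / real d))" .
  have "\<bar>(\<Sum>d=1..N. real (N div d) * (mobius d / real d)) - real N * mobius_square_sum N\<bar> = \<bar>\<Sum>d=1..N. (real (N div d) - real N / real d) * (mobius d / real d)\<bar>"
    unfolding mobius_square_sum_def sum_distrib_left sum_subtractf[symmetric]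
    by (intro arg_cong[of _ _ abs] sum.cong) (auto simp: left_diff_distrib diff_divide_distrib power2_eq_square)
  also have "\<dots> \<le> (\<Sum>d=1..N. 1 * inverse (real d))"
  proof (intro order_trans[OF sum_abs] sum_mono)
    fix d assume d: "d \<in> {1..N}"
    have "\<bar>real (N div d) - real N / real d\<bar> \<le> 1"
    proof -
      have "real (N div d) \<le> real N / real d" by (rule of_nat_div_le_of_nat)
      moreover have "real N / real d < real (N div d) + 1"
      proof -
        have "N < d * Suc (N div d)" using d by (metis atLeastAtMost_iff dividend_less_times_div gr0I mult_Suc_right not_one_le_zero)
        then have "real N < real (d * Suc (N div d))" by (simp only: of_nat_less_iff)
        then show ?thesis using d by (simp add: pos_divide_less_eq algebra_simps)
      qed
      ultimately show ?thesis by linarith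
    qed
    moreover have "\<bar>mobius d / real d\<bar> \<le> inverse (real d)"
      using abs_mobius[of d] by (simp add: abs_divide divide_right_mono inverse_eq_divide)
    ultimately show "\<bar>(real (N div d) - real N / real d) * (mobius d / real d)\<bar> \<le> 1 * inverse (real d)"
      unfolding abs_mult by (intro mult_mono) auto
  qed
  also have "\<dots> = harm N" by (simp add: harm_def)
  finally have "\<bar>(\<Sum>q=1..N. real (totient q) / real q) - real N * \<kappa>\<bar> \<le> 2 + 3 * harm N" using B T by linarith
  then show ?thesis by (simp add: sum_subtractf \<kappa>_def totient_sum_err_def)
qed (simp add: totient_sum_err_def harm_nonneg)

text \<open>Summation by parts, for transferring a bound on partial sums to sums with a weight \<open>f\<close>.\<close>

lemma abel_summation_bound:
  fixes b f :: "nat \<Rightarrow> real"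
  assumes B: "\<And>n. n \<le> Q \<Longrightarrow> \<bar>\<Sum>x\<in>{m<..n}. b x\<bar> \<le> E" and "m \<le> Q"
  shows "\<bar>\<Sum>x\<in>{m<..Q}. f x * b x\<bar> \<le> E * (\<bar>f Q\<bar> + (\<Sum>x\<in>{m<..<Q}. \<bar>f (Suc x) - f x\<bar>))"
proof -
  have split: "{m<..m + Suc j} = insert (Suc (m + j)) {m<..m + j}" for j by auto
  have id: "(\<Sum>x\<in>{m<..m + j}. f x * b x) = f (m + j) * (\<Sum>x\<in>{m<..m + j}. b x) - (\<Sum>x\<in>{m<..<m + j}. (f (Suc x) - f x) * (\<Sum>y\<in>{m<..x}. b y))" for j
  proof (induction j)
    case (Suc j)
    have s: "(\<Sum>x\<in>{m<..<m + Suc j}. (f (Suc x) - f x) * (\<Sum>y\<in>{m<..x}. b y)) = (\<Sum>x\<in>{m<..<m + j}. (f (Suc x) - f x) * (\<Sum>y\<in>{m<..x}. b y)) + (f (Suc (m + j)) - f (m + j)) * (\<Sum>y\<in>{m<..m + j}. b y)"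
    proof (cases j)
      case (Suc i)
      have "{m<..<m + Suc j} = insert (m + j) {m<..<m + j}" using Suc by auto
      then show ?thesis by (simp add: add.commute)
    qed simp
    have "(\<Sum>x\<in>{m<..m + Suc j}. f x * b x) = f (Suc (m + j)) * b (Suc (m + j)) + (\<Sum>x\<in>{m<..m + j}. f x * b x)"
      unfolding split by simp
    moreover have "(\<Sum>x\<in>{m<..m + Suc j}. b x) = b (Suc (m + j)) + (\<Sum>x\<in>{m<..m + j}. b x)"
      unfolding split by simp
    ultimately show ?case unfolding s Suc by (simp add: algebra_simps)
  qed simp
  obtain j where j: "Q = m + j" using \<open>m \<le> Q\<close> le_Suc_ex by blast
  have "\<bar>\<Sum>x\<in>{m<..Q}. f x * b x\<bar> \<le> \<bar>f Q * (\<Sum>x\<in>{m<..Q}. b x)\<bar> + \<bar>\<Sum>x\<in>{m<..<Q}. (f (Suc x) - f x) * (\<Sum>y\<in>{m<..x}. b y)\<bar>"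
    unfolding j id by (rule abs_triangle_ineq4)
  also have "\<dots> \<le> \<bar>f Q\<bar> * E + (\<Sum>x\<in>{m<..<Q}. \<bar>f (Suc x) - f x\<bar> * E)"
  proof (intro add_mono order_trans[OF sum_abs] sum_mono)
    show "\<bar>f Q * (\<Sum>x\<in>{m<..Q}. b x)\<bar> \<le> \<bar>f Q\<bar> * E" unfolding abs_mult by (intro mult_left_mono B) auto
    fix x assume "x \<in> {m<..<Q}"
    then show "\<bar>(f (Suc x) - f x) * (\<Sum>y\<in>{m<..x}. b y)\<bar> \<le> \<bar>f (Suc x) - f x\<bar> * E"
      unfolding abs_mult by (intro mult_left_mono B) auto
  qed
  also have "\<dots> = E * (\<bar>f Q\<bar> + (\<Sum>x\<in>{m<..<Q}. \<bar>f (Suc x) - f x\<bar>))"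
    by (simp add: distrib_left sum_distrib_left mult.commute)
  finally show ?thesis .
qed

section \<open>The limiting density of denominators\<close>

text \<open>After scaling by \<open>\<epsilon>\<close>, let \<open>y\<close> and \<open>z\<close> be the smaller and the larger denominator of a tile. The part where the
larger one is hit contributes \<open>tile_kernel r z / y\<close>, the other part \<open>y\<^sup>r\<^sup>-\<^sup>1\<close>. The possible \<open>z\<close> fill the interval from
\<open>max y (1 - y)\<close> to \<open>1\<close>, of length \<open>min y (1 - y)\<close>; \<open>kernel_tail\<close> is the integral of the kernel up to \<open>1\<close>, and
\<open>denom_density\<close> is the resulting density in \<open>y\<close>. Its only singular behaviour is that of \<open>y\<^sup>r\<close> at \<open>0\<close>: it is the
sum of an increasing function and a Lipschitz function, which controls both its variation and its
Riemann sums for all \<open>r > 0\<close> at once.\<close>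

definition tile_kernel :: "real \<Rightarrow> real \<Rightarrow> real" where "tile_kernel r z = z powr (r - 1) * (1 - z)"
definition kernel_tail :: "real \<Rightarrow> real \<Rightarrow> real" where
  "kernel_tail r z = (1 - z powr r) / r - (1 - z powr (r + 1)) / (r + 1)"
definition denom_density :: "real \<Rightarrow> real \<Rightarrow> real" where
  "denom_density r y = y powr (r - 1) * min y (1 - y) + kernel_tail r (max y (1 - y)) / y"
definition density_incr :: "real \<Rightarrow> real \<Rightarrow> real" where "density_incr r y = (min y (1/2)) powr r"
definition density_lip :: "real \<Rightarrow> real \<Rightarrow> real" where "density_lip r y = denom_density r y - density_incr r y"
definition tile_kernel_deriv :: "real \<Rightarrow> real \<Rightarrow> real" where
  "tile_kernel_deriv r z = (r - 1) * z powr (r - 2) * (1 - z) - z powr (r - 1)"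
text \<open>A bound for the kernel and its derivative on the interval from \<open>1/4\<close> to \<open>1\<close>, which contains all scaled larger
denominators.\<close>

definition lip_const :: "real \<Rightarrow> real" where "lip_const r = (\<bar>r\<bar> + 2) * 4 powr (\<bar>r\<bar> + 2)"

lemma powr_bound_quarter:
  fixes z s t :: real
  assumes "1/4 \<le> z" "z \<le> 1" "\<bar>s\<bar> \<le> t" shows "z powr s \<le> 4 powr t"
proof -
  have "z powr s \<le> 4 powr \<bar>s\<bar>"
  proof (cases "s \<ge> 0")
    case True
    then have "z powr s \<le> 1 powr s" using assms by (intro powr_mono2) auto
    also have "\<dots> \<le> 4 powr \<bar>s\<bar>" by (simp add: ge_one_powr_ge_zero)
    finally show ?thesis .
  next
    case False
    have "z powr s = (1 / z) powr (- s)" using assms by (simp add: powr_minus powr_divide field_simps)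
    also have "\<dots> \<le> 4 powr (- s)" using assms False by (intro powr_mono2) (auto simp: field_simps)
    finally show ?thesis using False by simp
  qed
  also have "\<dots> \<le> 4 powr t" using assms by (intro powr_mono) auto
  finally show ?thesis .
qed

lemma lip_const_pos: "lip_const r > 0" by (simp add: lip_const_def add_nonneg_pos)

lemma tile_kernel_bound: assumes "1/4 \<le> z" "z \<le> 1" shows "\<bar>tile_kernel r z\<bar> \<le> lip_const r"
proof -
  have "\<bar>tile_kernel r z\<bar> = z powr (r - 1) * (1 - z)" using assms by (simp add: tile_kernel_def abs_mult)
  also have "\<dots> \<le> 4 powr (\<bar>r\<bar> + 2) * 1" using assms by (intro mult_mono powr_bound_quarter) auto
  also have "\<dots> \<le> lip_const r" unfolding lip_const_def by (simp add: mult_le_cancel_right1)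
  finally show ?thesis .
qed

lemma tile_kernel_deriv_bound: assumes "1/4 \<le> z" "z \<le> 1" shows "\<bar>tile_kernel_deriv r z\<bar> \<le> lip_const r"
proof -
  have "\<bar>tile_kernel_deriv r z\<bar> \<le> \<bar>(r - 1) * z powr (r - 2) * (1 - z)\<bar> + \<bar>z powr (r - 1)\<bar>"
    unfolding tile_kernel_deriv_def by (rule abs_triangle_ineq4)
  also have "\<dots> \<le> (\<bar>r\<bar> + 1) * 4 powr (\<bar>r\<bar> + 2) * 1 + 4 powr (\<bar>r\<bar> + 2)"
    unfolding abs_mult
    by (intro add_mono mult_mono) (use assms powr_bound_quarter[OF assms] in auto)
  also have "\<dots> = lip_const r" by (simp add: lip_const_def algebra_simps)
  finally show ?thesis .
qed

lemma tile_kernel_deriv: "z > 0 \<Longrightarrow> (tile_kernel r has_real_derivative tile_kernel_deriv r z) (at z)"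
  unfolding tile_kernel_def[abs_def] tile_kernel_deriv_def
  by (auto intro!: derivative_eq_intros simp: algebra_simps)

lemma kernel_tail_deriv:
  assumes "z > 0" "r > 0" shows "(kernel_tail r has_real_derivative - tile_kernel r z) (at z)"
proof -
  have a: "((\<lambda>z. (1 - z powr r) / r) has_real_derivative - (z powr (r - 1))) (at z)"
    using assms by (auto intro!: derivative_eq_intros)
  have b: "((\<lambda>z. (1 - z powr (r + 1)) / (r + 1)) has_real_derivative - (z powr r)) (at z)"
    using assms by (auto intro!: derivative_eq_intros)
  have "z powr (r - 1) * z = z powr r" using assms powr_mult_base[of z "r - 1"] by (simp add: mult.commute)
  then have "- (z powr (r - 1)) - - (z powr r) = - tile_kernel r z" by (simp add: tile_kernel_def right_diff_distrib)
  then show ?thesis using DERIV_diff[OF a b] unfolding kernel_tail_def[abs_def] by (simp only:)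
qed

lemma lipschitz_from_deriv:
  fixes f :: "real \<Rightarrow> real"
  assumes "convex S" "\<And>x. x \<in> S \<Longrightarrow> (f has_real_derivative f' x) (at x)" "\<And>x. x \<in> S \<Longrightarrow> \<bar>f' x\<bar> \<le> K"
    "x \<in> S" "y \<in> S"
  shows "\<bar>f x - f y\<bar> \<le> K * \<bar>x - y\<bar>"
  using field_differentiable_bound[OF assms(1) has_field_derivative_at_within[OF assms(2)] _ assms(4,5), of K] assms(3)
  by simp

lemma tile_kernel_lipschitz:
  assumes "x \<in> {1/4..1}" "y \<in> {1/4..1}" shows "\<bar>tile_kernel r x - tile_kernel r y\<bar> \<le> lip_const r * \<bar>x - y\<bar>"
  by (rule lipschitz_from_deriv[of "{1/4..1}" _ "tile_kernel_deriv r"]) (use assms tile_kernel_deriv_bound tile_kernel_deriv in auto)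

lemma kernel_tail_lipschitz:
  assumes "r > 0" "x \<in> {1/4..1}" "y \<in> {1/4..1}" shows "\<bar>kernel_tail r x - kernel_tail r y\<bar> \<le> lip_const r * \<bar>x - y\<bar>"
  by (rule lipschitz_from_deriv[of "{1/4..1}" _ "\<lambda>z. - tile_kernel r z"]) (use assms tile_kernel_bound kernel_tail_deriv in auto)

lemma kernel_tail_1: "kernel_tail r 1 = 0" by (simp add: kernel_tail_def)
lemma tile_kernel_1: "tile_kernel r 1 = 0" by (simp add: tile_kernel_def)

lemma tile_kernel_near_1: "0 \<le> y \<Longrightarrow> y \<le> 1/2 \<Longrightarrow> \<bar>tile_kernel r (1 - y)\<bar> \<le> lip_const r * y"
  using tile_kernel_lipschitz[of "1 - y" 1 r] by (simp add: tile_kernel_1)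

text \<open>Both the kernel and its tail vanish at \<open>1\<close>, so the tail is of second order there. Therefore
\<open>kernel_tail r (1 - y) / y\<close> has bounded derivative near \<open>y = 0\<close>.\<close>

lemma kernel_tail_near_1: 
  assumes "r > 0" "0 \<le> y" "y \<le> 1/2" shows "\<bar>kernel_tail r (1 - y)\<bar> \<le> lip_const r * y * y"
proof -
  have "\<bar>kernel_tail r (1 - y) - kernel_tail r 1\<bar> \<le> (lip_const r * y) * \<bar>(1 - y) - 1\<bar>"
  proof (rule lipschitz_from_deriv[of "{1 - y..1}" _ "\<lambda>z. - tile_kernel r z"])
    fix z assume z: "z \<in> {1 - y..1}"
    then show "(kernel_tail r has_real_derivative - tile_kernel r z) (at z)" using assms by (intro kernel_tail_deriv) auto
    have "\<bar>tile_kernel r (1 - (1 - z))\<bar> \<le> lip_const r * (1 - z)" using z assms by (intro tile_kernel_near_1) auto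
    also have "\<dots> \<le> lip_const r * y" using z lip_const_pos[of r] by (intro mult_left_mono) auto
    finally show "\<bar>- tile_kernel r z\<bar> \<le> lip_const r * y" by simp
  qed (use assms in auto)
  then show ?thesis using assms by (simp add: kernel_tail_1)
qed

lemma density_lip_left: assumes "0 \<le> y" "y \<le> 1/2" shows "density_lip r y = kernel_tail r (1 - y) / y"
proof (cases "y = 0")
  case False
  then have "y powr (r - 1) * y = y powr r" using assms by (simp add: powr_mult_base mult.commute)
  then show ?thesis using assms by (simp add: density_lip_def denom_density_def density_incr_def min_def max_def)
qed (simp add: density_lip_def denom_density_def density_incr_def)

lemma density_lip_right: assumes "1/2 \<le> y" "y \<le> 1" shows "density_lip r y = tile_kernel r y + kernel_tail r y / y - (1/2) powr r"
proof (cases "y = 1/2")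
  case False
  then have "min y (1 - y) = 1 - y" "max y (1 - y) = y" "min y (1/2) = 1/2" using assms by auto
  then show ?thesis by (simp add: density_lip_def denom_density_def density_incr_def tile_kernel_def)
next
  case True
  show ?thesis unfolding True by (simp add: density_lip_def denom_density_def density_incr_def tile_kernel_def)
qed

text \<open>At \<open>y = 1/2\<close> the formulas for the density change, so the two halves of the interval are treated
separately and joined at this point; on the left half the end point \<open>0\<close>, where one divides by \<open>y\<close>, is
handled by \<open>kernel_tail_near_1\<close>.\<close>

lemma density_lip_lipschitz:
  assumes r: "r > 0" and xy: "x \<in> {0..1}" "y \<in> {0..1}"
  shows "\<bar>density_lip r x - density_lip r y\<bar> \<le> 20 * lip_const r * \<bar>x - y\<bar>"
proof -
  let ?K = "20 * lip_const r"
  have K0: "lip_const r > 0" by (rule lip_const_pos)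
  have pos: "\<bar>density_lip r x - density_lip r y\<bar> \<le> ?K * \<bar>x - y\<bar>" if "x \<in> {0<..1/2}" "y \<in> {0<..1/2}" for x y
  proof -
    have "\<bar>kernel_tail r (1 - x) / x - kernel_tail r (1 - y) / y\<bar> \<le> ?K * \<bar>x - y\<bar>"
    proof (rule lipschitz_from_deriv[of "{0<..1/2}" _ "\<lambda>y. (tile_kernel r (1 - y) * y - kernel_tail r (1 - y)) / (y * y)"])
      fix z :: real assume z: "z \<in> {0<..1/2}"
      have D: "((\<lambda>y. kernel_tail r (1 - y)) has_real_derivative tile_kernel r (1 - z)) (at z)"
      proof -
        have "((\<lambda>y::real. 1 - y) has_real_derivative -1) (at z)" by (auto intro!: derivative_eq_intros)
        from DERIV_chain2[OF kernel_tail_deriv[of "1 - z" r] this] show ?thesis using z r by simp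
      qed
      show "((\<lambda>y. kernel_tail r (1 - y) / y) has_real_derivative (tile_kernel r (1 - z) * z - kernel_tail r (1 - z)) / (z * z)) (at z)"
        using DERIV_divide[OF D DERIV_ident] z by simp
      have "\<bar>tile_kernel r (1 - z) * z - kernel_tail r (1 - z)\<bar> \<le> \<bar>tile_kernel r (1 - z)\<bar> * z + \<bar>kernel_tail r (1 - z)\<bar>"
        using abs_triangle_ineq4[of "tile_kernel r (1 - z) * z" "kernel_tail r (1 - z)"] z by (simp add: abs_mult)
      also have "\<dots> \<le> (lip_const r * z) * z + lip_const r * z * z"
        using z by (intro add_mono mult_right_mono tile_kernel_near_1 kernel_tail_near_1 r) auto
      finally have "\<bar>tile_kernel r (1 - z) * z - kernel_tail r (1 - z)\<bar> \<le> 2 * lip_const r * (z * z)" by (simp add: mult_ac)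
      then have "\<bar>(tile_kernel r (1 - z) * z - kernel_tail r (1 - z)) / (z * z)\<bar> \<le> 2 * lip_const r"
        using z by (simp add: abs_divide divide_le_eq)
      then show "\<bar>(tile_kernel r (1 - z) * z - kernel_tail r (1 - z)) / (z * z)\<bar> \<le> ?K" using K0 by simp
    qed (use that in auto)
    then show ?thesis using that by (simp add: density_lip_left)
  qed
  have zero: "\<bar>density_lip r x - density_lip r 0\<bar> \<le> ?K * \<bar>x - 0\<bar>" if "x \<in> {0..1/2}" for x
  proof (cases "x = 0")
    case False
    have "\<bar>kernel_tail r (1 - x)\<bar> / x \<le> lip_const r * x"
      using kernel_tail_near_1[OF r, of x] that False by (simp add: divide_le_eq mult.assoc)
    then have "\<bar>density_lip r x\<bar> \<le> lip_const r * x" using that by (simp add: density_lip_left abs_divide)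
    also have "\<dots> \<le> ?K * x" using that K0 by (intro mult_right_mono) auto
    finally show ?thesis using that by (simp add: density_lip_left[of 0])
  qed simp
  have left: "\<bar>density_lip r x - density_lip r y\<bar> \<le> ?K * \<bar>x - y\<bar>" if "x \<in> {0..1/2}" "y \<in> {0..1/2}" for x y
  proof -
    consider "x = 0" | "y = 0" | "x \<in> {0<..1/2}" "y \<in> {0<..1/2}" using \<open>x \<in> _\<close> \<open>y \<in> _\<close> by fastforce
    then show ?thesis
    proof cases
      case 1 then show ?thesis using zero[OF \<open>y \<in> _\<close>] by (simp add: abs_minus_commute)
    next
      case 2 then show ?thesis using zero[OF \<open>x \<in> _\<close>] by simp
    qed (rule pos)
  qed
  have right: "\<bar>density_lip r x - density_lip r y\<bar> \<le> ?K * \<bar>x - y\<bar>" if "x \<in> {1/2..1}" "y \<in> {1/2..1}" for x y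
  proof -
    have "\<bar>(tile_kernel r x + kernel_tail r x / x) - (tile_kernel r y + kernel_tail r y / y)\<bar> \<le> ?K * \<bar>x - y\<bar>"
    proof (rule lipschitz_from_deriv[of "{1/2..1}" _ "\<lambda>z. tile_kernel_deriv r z + (- tile_kernel r z * z - kernel_tail r z) / (z * z)"])
      fix z :: real assume z: "z \<in> {1/2..1}"
      have "((\<lambda>y. kernel_tail r y / y) has_real_derivative (- tile_kernel r z * z - kernel_tail r z) / (z * z)) (at z)"
        using DERIV_divide[OF kernel_tail_deriv[of z r] DERIV_ident] z r by simp
      then show "((\<lambda>x. tile_kernel r x + kernel_tail r x / x) has_real_derivative tile_kernel_deriv r z + (- tile_kernel r z * z - kernel_tail r z) / (z * z)) (at z)"
        using z by (intro DERIV_add tile_kernel_deriv) auto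
      have P: "\<bar>kernel_tail r z\<bar> \<le> lip_const r" 
      proof -
        have "\<bar>kernel_tail r z - kernel_tail r 1\<bar> \<le> lip_const r * \<bar>z - 1\<bar>" using z by (intro kernel_tail_lipschitz r) auto
        also have "\<dots> \<le> lip_const r * 1" using z K0 by (intro mult_left_mono) auto
        finally show ?thesis by (simp add: kernel_tail_1)
      qed
      have "\<bar>- tile_kernel r z * z - kernel_tail r z\<bar> \<le> \<bar>tile_kernel r z\<bar> * z + \<bar>kernel_tail r z\<bar>"
        using abs_triangle_ineq4[of "- tile_kernel r z * z" "kernel_tail r z"] z by (simp add: abs_mult)
      also have "\<dots> \<le> lip_const r * 1 + lip_const r"
        using z K0 P by (intro add_mono mult_mono tile_kernel_bound) auto
      finally have A: "\<bar>- tile_kernel r z * z - kernel_tail r z\<bar> \<le> 2 * lip_const r" by simp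
      have zz: "1/4 \<le> z * z" using mult_mono[of "1/2" z "1/2" z] z by simp
      have "\<bar>(- tile_kernel r z * z - kernel_tail r z) / (z * z)\<bar> = \<bar>- tile_kernel r z * z - kernel_tail r z\<bar> / (z * z)" by (simp add: abs_divide)
      also have "\<dots> \<le> 2 * lip_const r / (1/4)" using A zz K0 by (intro frac_le) auto
      finally have "\<bar>(- tile_kernel r z * z - kernel_tail r z) / (z * z)\<bar> \<le> 8 * lip_const r" by simp
      moreover have "\<bar>tile_kernel_deriv r z\<bar> \<le> lip_const r" using z by (intro tile_kernel_deriv_bound) auto
      ultimately show "\<bar>tile_kernel_deriv r z + (- tile_kernel r z * z - kernel_tail r z) / (z * z)\<bar> \<le> ?K"
        using abs_triangle_ineq[of "tile_kernel_deriv r z" "(- tile_kernel r z * z - kernel_tail r z) / (z * z)"] K0 by linarith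
    qed (use that in auto)
    then show ?thesis using that by (simp add: density_lip_right)
  qed
  have glue: "\<bar>density_lip r x - density_lip r y\<bar> \<le> ?K * \<bar>x - y\<bar>" if "x \<in> {0..1/2}" "y \<in> {1/2..1}" for x y
  proof -
    have "\<bar>density_lip r x - density_lip r (1/2)\<bar> \<le> ?K * \<bar>x - 1/2\<bar>" using that by (intro left) auto
    moreover have "\<bar>density_lip r (1/2) - density_lip r y\<bar> \<le> ?K * \<bar>1/2 - y\<bar>" using that by (intro right) auto
    moreover have "\<bar>x - 1/2\<bar> + \<bar>1/2 - y\<bar> = \<bar>x - y\<bar>" using that by simp
    then have "?K * \<bar>x - 1/2\<bar> + ?K * \<bar>1/2 - y\<bar> = ?K * \<bar>x - y\<bar>" by (simp only: distrib_left[symmetric])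
    ultimately show ?thesis by linarith
  qed
  consider "x \<in> {0..1/2}" "y \<in> {0..1/2}" | "x \<in> {1/2..1}" "y \<in> {1/2..1}" | "x \<in> {0..1/2}" "y \<in> {1/2..1}" | "x \<in> {1/2..1}" "y \<in> {0..1/2}"
    using xy by fastforce
  then show ?thesis
  proof cases
    case 1 then show ?thesis by (rule left)
  next
    case 2 then show ?thesis by (rule right)
  next
    case 3 then show ?thesis by (rule glue)
  next
    case 4
    then show ?thesis using glue[of y x] by (simp add: abs_minus_commute)
  qed
qed

lemma density_incr_mono: "r > 0 \<Longrightarrow> 0 \<le> x \<Longrightarrow> x \<le> y \<Longrightarrow> density_incr r x \<le> density_incr r y"
  unfolding density_incr_def by (intro powr_mono2) auto

lemma density_incr_range: assumes "r > 0" "0 \<le> x" shows "0 \<le> density_incr r x" "density_incr r x \<le> 1"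
proof -
  have "density_incr r x \<le> 1 powr r" unfolding density_incr_def using assms by (intro powr_mono2) auto
  then show "density_incr r x \<le> 1" "0 \<le> density_incr r x" by (auto simp: density_incr_def)
qed

lemma denom_density_bound: assumes "r > 0" "y \<in> {0..1}" shows "\<bar>denom_density r y\<bar> \<le> 1 + 20 * lip_const r"
proof -
  have "\<bar>density_lip r y - density_lip r 0\<bar> \<le> 20 * lip_const r * \<bar>y - 0\<bar>" using assms by (intro density_lip_lipschitz) auto
  also have "\<dots> \<le> 20 * lip_const r * 1" using assms lip_const_pos[of r] by (intro mult_left_mono) auto
  finally have "\<bar>density_lip r y\<bar> \<le> 20 * lip_const r" by (simp add: density_lip_left[of 0])
  moreover have "denom_density r y = density_incr r y + density_lip r y" by (simp add: density_lip_def)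
  ultimately show ?thesis using density_incr_range[OF assms(1), of y] assms(2) by auto
qed

lemma denom_density_osc:
  assumes "r > 0" "0 \<le> x" "x \<le> y" "y \<le> z" "z \<le> 1"
  shows "\<bar>denom_density r z - denom_density r y\<bar> \<le> 20 * lip_const r * (z - x) + (density_incr r z - density_incr r x)"
proof -
  have "\<bar>density_lip r z - density_lip r y\<bar> \<le> 20 * lip_const r * \<bar>z - y\<bar>" using assms by (intro density_lip_lipschitz) auto
  also have "\<dots> \<le> 20 * lip_const r * (z - x)" using assms lip_const_pos[of r] by (intro mult_left_mono) auto
  finally have "\<bar>density_lip r z - density_lip r y\<bar> \<le> 20 * lip_const r * (z - x)" .
  moreover have "denom_density r t = density_incr r t + density_lip r t" for t by (simp add: density_lip_def)
  moreover have "density_incr r x \<le> density_incr r y" "density_incr r y \<le> density_incr r z" using assms by (auto intro: density_incr_mono)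
  ultimately show ?thesis by (simp add: abs_le_iff)
qed

lemma denom_density_continuous: assumes "r > 0" shows "continuous_on {0..1} (denom_density r)"
proof -
  have "continuous_on {0..1} (density_lip r)"
    unfolding continuous_on_iff
  proof (intro ballI allI impI)
    fix x e :: real assume x: "x \<in> {0..1}" and e: "e > 0"
    show "\<exists>d>0. \<forall>x'\<in>{0..1}. dist x' x < d \<longrightarrow> dist (density_lip r x') (density_lip r x) < e"
    proof (intro exI[of _ "e / (20 * lip_const r)"] conjI ballI impI)
      fix x' assume x': "x' \<in> {0..1}" "dist x' x < e / (20 * lip_const r)"
      have "dist (density_lip r x') (density_lip r x) \<le> 20 * lip_const r * dist x' x"
        using density_lip_lipschitz[OF assms x'(1) x] by (simp add: dist_real_def)
      also have "\<dots> < e" using x'(2) lip_const_pos[of r] by (simp add: field_simps)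
      finally show "dist (density_lip r x') (density_lip r x) < e" .
    qed (use e lip_const_pos[of r] in auto)
  qed
  moreover have "continuous_on {0..1} (density_incr r)"
    unfolding density_incr_def[abs_def] using assms by (intro continuous_on_powr' continuous_intros) auto
  ultimately have "continuous_on {0..1} (\<lambda>y. density_incr r y + density_lip r y)" by (intro continuous_intros)
  then show ?thesis by (simp add: density_lip_def)
qed

lemma denom_density_integrable_on: "r > 0 \<Longrightarrow> 0 \<le> a \<Longrightarrow> b \<le> 1 \<Longrightarrow> denom_density r integrable_on {a..b}"
  by (intro integrable_continuous_interval continuous_on_subset[OF denom_density_continuous]) auto

text \<open>The integrand of \<open>moment_const\<close> at \<open>x\<close> is the density at \<open>x\<close> plus the density at \<open>1 - x\<close>.\<close>

lemma moment_const_eq: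
  assumes r: "r > 0"
  shows "moment_const r = 12 / pi\<^sup>2 * integral {0..1} (denom_density r)"
proof -
  let ?f = "\<lambda>x. x * (x powr (r - 1) + (1 - x) powr (r - 1))
        + (1 - (1 - x) powr r) / (r * x * (1 - x))
        - (1 - (1 - x) powr (r + 1)) / ((r + 1) * x * (1 - x))"
  have eq: "?f x = denom_density r x + denom_density r (1 - x)" if "x \<in> {0..1/2}" for x
  proof (cases "x = 0")
    case False
    have "denom_density r x = x powr (r - 1) * x + kernel_tail r (1 - x) / x" "denom_density r (1 - x) = (1 - x) powr (r - 1) * x + kernel_tail r (1 - x) / (1 - x)"
    proof -
      have m: "min x (1 - x) = x" "max x (1 - x) = 1 - x" "min (1 - x) (1 - (1 - x)) = x" "max (1 - x) (1 - (1 - x)) = 1 - x"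
        using that by auto
      show "denom_density r x = x powr (r - 1) * x + kernel_tail r (1 - x) / x" "denom_density r (1 - x) = (1 - x) powr (r - 1) * x + kernel_tail r (1 - x) / (1 - x)"
        unfolding denom_density_def m by simp_all
    qed
    moreover have "kernel_tail r (1 - x) / x + kernel_tail r (1 - x) / (1 - x) = kernel_tail r (1 - x) / (x * (1 - x))"
      using that False by (simp add: field_simps)
    moreover have "kernel_tail r (1 - x) / (x * (1 - x)) = (1 - (1 - x) powr r) / (r * x * (1 - x)) - (1 - (1 - x) powr (r + 1)) / ((r + 1) * x * (1 - x))"
      unfolding kernel_tail_def diff_divide_distrib divide_divide_eq_left by (simp add: mult.assoc)
    ultimately show ?thesis by (simp add: algebra_simps)
  qed (simp add: denom_density_def kernel_tail_1)
  have I1: "denom_density r integrable_on {0..1/2}" and I2: "denom_density r integrable_on {1/2..1}" using r by (auto intro: denom_density_integrable_on)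
  have "((\<lambda>x. denom_density r (-1 *\<^sub>R x + 1)) has_integral (1 / (\<bar>-1\<bar> ^ DIM(real))) *\<^sub>R integral {1/2..1} (denom_density r)) ((\<lambda>x. (1 / -1) *\<^sub>R x + - ((1 / -1) *\<^sub>R 1)) ` cbox (1/2) 1)"
    by (rule has_integral_affinity) (use I2 in \<open>auto simp: integrable_integral cbox_interval\<close>)
  moreover have "(\<lambda>x::real. (1 / -1) *\<^sub>R x + - ((1 / -1) *\<^sub>R 1)) ` cbox (1/2) 1 = {0..1/2}"
  proof -
    have "x \<in> (\<lambda>x. 1 - x) ` {1/2..1}" if "0 \<le> x" "x \<le> 1/2" for x :: real
      by (rule image_eqI[of _ _ "1 - x"]) (use that in auto)
    then show ?thesis by (auto simp: cbox_interval)
  qed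
  ultimately have I3: "((\<lambda>x. denom_density r (1 - x)) has_integral integral {1/2..1} (denom_density r)) {0..1/2}" by simp
  have "((\<lambda>x. denom_density r x + denom_density r (1 - x)) has_integral (integral {0..1/2} (denom_density r) + integral {1/2..1} (denom_density r))) {0..1/2}"
    by (intro has_integral_add integrable_integral I1 I3)
  moreover have "integral {0..1/2} (denom_density r) + integral {1/2..1} (denom_density r) = integral {0..1} (denom_density r)"
    by (rule Henstock_Kurzweil_Integration.integral_combine) (use r in \<open>auto intro: denom_density_integrable_on\<close>)
  ultimately have H: "(?f has_integral integral {0..1} (denom_density r)) {0..1/2}"
    by (subst has_integral_cong[OF eq]) auto
  have meas: "set_borel_measurable lborel {0..1/2} ?f"
    unfolding set_borel_measurable_def by measurable
  have "set_integrable lborel {0..1/2} ?f"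
    unfolding set_integrable_def
  proof (rule integrableI_bounded_set_indicator[where B = "2 * (1 + 20 * lip_const r)"])
    show "AE x in lborel. x \<in> {0..1/2} \<longrightarrow> norm (?f x) \<le> 2 * (1 + 20 * lip_const r)"
    proof (rule AE_I2, rule impI)
      fix x :: real assume x: "x \<in> {0..1/2}"
      have "\<bar>denom_density r x\<bar> \<le> 1 + 20 * lip_const r" "\<bar>denom_density r (1 - x)\<bar> \<le> 1 + 20 * lip_const r" using x by (auto intro!: denom_density_bound r)
      then show "norm (?f x) \<le> 2 * (1 + 20 * lip_const r)" unfolding eq[OF x] by simp
    qed
    show "emeasure lborel {0..1/2::real} < \<infinity>" by (rule emeasure_compact_finite) simp
  qed auto
  then have "(LBINT x:{0..1/2}. ?f x) = integral {0..1/2} ?f" by (rule set_borel_integral_eq_integral)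
  also have "\<dots> = integral {0..1} (denom_density r)" using H by (rule integral_unique)
  finally show ?thesis by (simp only: moment_const_def)
qed

lemma denom_density_riemann:
  assumes r: "r > 0" and e: "\<epsilon> > 0" and n: "\<epsilon> * real n \<le> 1"
  shows "\<bar>\<epsilon> * (\<Sum>q=1..n. denom_density r (\<epsilon> * real q)) - integral {0..\<epsilon> * real n} (denom_density r)\<bar> \<le> \<epsilon> * (20 * lip_const r * (\<epsilon> * real n) + density_incr r (\<epsilon> * real n))"
  using n
proof (induction n)
  case 0
  then show ?case using density_incr_range[OF r, of 0] e by simp
next
  case (Suc n)
  define a where "a = \<epsilon> * real n"
  define b where "b = \<epsilon> * real (Suc n)"
  have ab: "0 \<le> a" "a \<le> b" "b \<le> 1" "b - a = \<epsilon>" using e Suc.prems by (auto simp: a_def b_def algebra_simps)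
  have IH: "\<bar>\<epsilon> * (\<Sum>q=1..n. denom_density r (\<epsilon> * real q)) - integral {0..a} (denom_density r)\<bar> \<le> \<epsilon> * (20 * lip_const r * a + density_incr r a)"
    unfolding a_def using Suc.prems e by (intro Suc.IH) (simp add: algebra_simps)
  have comb: "integral {0..a} (denom_density r) + integral {a..b} (denom_density r) = integral {0..b} (denom_density r)"
    by (rule Henstock_Kurzweil_Integration.integral_combine) (use ab r in \<open>auto intro: denom_density_integrable_on\<close>)
  define \<omega> where "\<omega> = 20 * lip_const r * (b - a) + (density_incr r b - density_incr r a)"
  have "norm (integral {a..b} (\<lambda>y. denom_density r b - denom_density r y)) \<le> integral {a..b} (\<lambda>y. \<omega>)"
  proof (rule integral_norm_bound_integral)
    fix y assume "y \<in> {a..b}"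
    then show "norm (denom_density r b - denom_density r y) \<le> \<omega>" unfolding \<omega>_def using denom_density_osc[OF r, of a y b] ab by simp
  qed (use ab r in \<open>auto intro!: integrable_diff denom_density_integrable_on\<close>)
  moreover have "integral {a..b} (\<lambda>y. denom_density r b - denom_density r y) = \<epsilon> * denom_density r b - integral {a..b} (denom_density r)"
    using ab r by (subst integral_diff) (auto intro: denom_density_integrable_on)
  ultimately have step: "\<bar>\<epsilon> * denom_density r b - integral {a..b} (denom_density r)\<bar> \<le> \<epsilon> * \<omega>" using ab by simp
  have "\<epsilon> * (\<Sum>q\<in>{1..Suc n}. denom_density r (\<epsilon> * real q)) = \<epsilon> * (\<Sum>q=1..n. denom_density r (\<epsilon> * real q)) + \<epsilon> * denom_density r b"
    by (simp add: b_def distrib_left)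
  then have "\<bar>\<epsilon> * (\<Sum>q\<in>{1..Suc n}. denom_density r (\<epsilon> * real q)) - integral {0..b} (denom_density r)\<bar> \<le> \<epsilon> * (20 * lip_const r * a + density_incr r a) + \<epsilon> * \<omega>"
    using IH step comb by linarith
  also have "\<dots> = \<epsilon> * (20 * lip_const r * b + density_incr r b)" by (simp add: \<omega>_def algebra_simps)
  finally show ?case by (simp only: b_def)
qed

section \<open>The main term of the sum over tiles\<close>

definition max_denom :: "real \<Rightarrow> nat" where "max_denom \<epsilon> = nat \<lfloor>1 / \<epsilon>\<rfloor>"

lemma max_denom_facts:
  assumes "0 < \<epsilon>" "\<epsilon> < 1/2"
  shows "\<epsilon> * real (max_denom \<epsilon>) \<le> 1" "1 < \<epsilon> * (real (max_denom \<epsilon>) + 1)" "max_denom \<epsilon> \<ge> 2"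
proof -
  have p: "1 / \<epsilon> \<ge> 2" using assms by (simp add: field_simps)
  then have fl: "2 \<le> \<lfloor>1 / \<epsilon>\<rfloor>" by (simp add: le_floor_iff)
  then have f: "real (max_denom \<epsilon>) = of_int \<lfloor>1 / \<epsilon>\<rfloor>" unfolding max_denom_def by linarith
  have "real (max_denom \<epsilon>) \<le> 1 / \<epsilon>" "1 / \<epsilon> < real (max_denom \<epsilon>) + 1" unfolding f by linarith+
  then show "\<epsilon> * real (max_denom \<epsilon>) \<le> 1" "1 < \<epsilon> * (real (max_denom \<epsilon>) + 1)" using assms by (auto simp: field_simps)
  show "max_denom \<epsilon> \<ge> 2" using nat_mono[OF fl] by (simp add: max_denom_def)
qed

text \<open>The larger denominators \<open>x\<close> of tiles with smaller denominator \<open>q\<close> are those with \<open>x > q\<close>, \<open>q + x > Q\<close> and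
\<open>x \<le> Q\<close>, that is \<open>min_partner Q q < x \<le> Q\<close>.\<close>

definition min_partner :: "nat \<Rightarrow> nat \<Rightarrow> nat" where "min_partner Q q = max q (Q - q)"

text \<open>The integral of \<open>(\<epsilon> * first_hit \<epsilon> t) powr r\<close> over a tile with denominators \<open>q < x\<close>; see \<open>split_pt_between\<close>.\<close>

definition tile_mass :: "real \<Rightarrow> real \<Rightarrow> nat \<Rightarrow> nat \<Rightarrow> real" where
  "tile_mass r \<epsilon> q x = (\<epsilon> / real q) * ((\<epsilon> * real q) powr r + tile_kernel r (\<epsilon> * real x))"

context
  fixes r \<epsilon> :: real and Q q :: nat
  assumes r: "r > 0" and e: "0 < \<epsilon>" "\<epsilon> < 1/2" and Q: "Q = max_denom \<epsilon>" and q: "1 \<le> q" "q \<le> Q"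
begin

private lemma Q_range: "\<epsilon> * real Q \<le> 1" "1 < \<epsilon> * real Q + \<epsilon>" "Q \<ge> 2"
  using max_denom_facts[OF e] by (auto simp: Q algebra_simps)

private lemma min_partner_facts: "min_partner Q q \<le> Q" "Q - min_partner Q q \<le> q" "1/4 \<le> \<epsilon> * real (min_partner Q q)"
proof -
  show "min_partner Q q \<le> Q" "Q - min_partner Q q \<le> q" using q by (auto simp: min_partner_def)
  have "real Q \<le> 2 * real (min_partner Q q)" using q by (simp add: min_partner_def)
  then have "\<epsilon> * real Q \<le> \<epsilon> * (2 * real (min_partner Q q))" using e by (intro mult_left_mono) auto
  then show "1/4 \<le> \<epsilon> * real (min_partner Q q)" using Q_range e by linarith
qed

private lemma partner_range: assumes "min_partner Q q \<le> x" "x \<le> Q" shows "\<epsilon> * real x \<in> {1/4..1}"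
proof -
  have "\<epsilon> * real (min_partner Q q) \<le> \<epsilon> * real x" "\<epsilon> * real x \<le> \<epsilon> * real Q"
    using assms e by (auto intro!: mult_left_mono)
  then show ?thesis using min_partner_facts(3) Q_range(1) unfolding atLeastAtMost_iff by linarith
qed

private lemma denom_range: "0 < \<epsilon> * real q" "\<epsilon> * real q \<le> 1"
proof -
  have "\<epsilon> * real q \<le> \<epsilon> * real Q" using q e by (intro mult_left_mono) auto
  then show "\<epsilon> * real q \<le> 1" using Q_range(1) by linarith
  show "0 < \<epsilon> * real q" using e q by simp
qed

text \<open>A Riemann sum for the integral of the kernel, which is a difference of values of \<open>kernel_tail\<close>.\<close>

lemma tile_kernel_sum:
  assumes "min_partner Q q + j \<le> Q"
  shows "\<bar>\<epsilon> * (\<Sum>x\<in>{min_partner Q q<..min_partner Q q + j}. tile_kernel r (\<epsilon> * real x)) - (kernel_tail r (\<epsilon> * real (min_partner Q q)) - kernel_tail r (\<epsilon> * real (min_partner Q q + j)))\<bar> \<le> lip_const r * \<epsilon> * (\<epsilon> * real j)"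
  using assms
proof (induction j)
  case (Suc j)
  define n where "n = min_partner Q q + j"
  have ra: "\<epsilon> * real n \<in> {1/4..1}" and rb: "\<epsilon> * real (Suc n) \<in> {1/4..1}"
    using partner_range[of n] partner_range[of "Suc n"] Suc.prems by (auto simp: n_def simp del: of_nat_Suc)
  have lt: "\<epsilon> * real n < \<epsilon> * real (Suc n)" and df: "\<epsilon> * real (Suc n) - \<epsilon> * real n = \<epsilon>" using e by (auto simp: algebra_simps)
  obtain \<xi> where xi: "\<epsilon> * real n < \<xi>" "\<xi> < \<epsilon> * real (Suc n)" 
    "kernel_tail r (\<epsilon> * real (Suc n)) - kernel_tail r (\<epsilon> * real n) = (\<epsilon> * real (Suc n) - \<epsilon> * real n) * (- tile_kernel r \<xi>)"
    using MVT2[OF lt, of "kernel_tail r" "\<lambda>z. - tile_kernel r z"] kernel_tail_deriv r ra by force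
  have "\<bar>tile_kernel r (\<epsilon> * real (Suc n)) - tile_kernel r \<xi>\<bar> \<le> lip_const r * \<bar>\<epsilon> * real (Suc n) - \<xi>\<bar>"
    using xi ra rb by (intro tile_kernel_lipschitz) auto
  also have "\<dots> \<le> lip_const r * \<epsilon>" using xi df lip_const_pos[of r] by (intro mult_left_mono) auto
  finally have "\<epsilon> * \<bar>tile_kernel r (\<epsilon> * real (Suc n)) - tile_kernel r \<xi>\<bar> \<le> \<epsilon> * (lip_const r * \<epsilon>)" using e by (intro mult_left_mono) auto
  then have "\<bar>\<epsilon> * (tile_kernel r (\<epsilon> * real (Suc n)) - tile_kernel r \<xi>)\<bar> \<le> \<epsilon> * (lip_const r * \<epsilon>)" using e by (simp only: abs_mult abs_of_pos)
  then have step: "\<bar>\<epsilon> * tile_kernel r (\<epsilon> * real (Suc n)) - (kernel_tail r (\<epsilon> * real n) - kernel_tail r (\<epsilon> * real (Suc n)))\<bar> \<le> \<epsilon> * (lip_const r * \<epsilon>)"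
    using xi(3) unfolding df by (simp add: right_diff_distrib)
  have IH: "\<bar>\<epsilon> * (\<Sum>x\<in>{min_partner Q q<..n}. tile_kernel r (\<epsilon> * real x)) - (kernel_tail r (\<epsilon> * real (min_partner Q q)) - kernel_tail r (\<epsilon> * real n))\<bar> \<le> lip_const r * \<epsilon> * (\<epsilon> * real j)"
    using Suc by (simp add: n_def)
  have "{min_partner Q q<..min_partner Q q + Suc j} = insert (Suc n) {min_partner Q q<..n}" by (auto simp: n_def)
  then have "\<epsilon> * (\<Sum>x\<in>{min_partner Q q<..min_partner Q q + Suc j}. tile_kernel r (\<epsilon> * real x)) = \<epsilon> * tile_kernel r (\<epsilon> * real (Suc n)) + \<epsilon> * (\<Sum>x\<in>{min_partner Q q<..n}. tile_kernel r (\<epsilon> * real x))"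
    by (simp add: distrib_left)
  moreover have "lip_const r * \<epsilon> * (\<epsilon> * real (Suc j)) = \<epsilon> * (lip_const r * \<epsilon>) + lip_const r * \<epsilon> * (\<epsilon> * real j)" by (simp add: algebra_simps)
  moreover have "min_partner Q q + Suc j = Suc n" by (simp add: n_def)
  ultimately show ?case using step IH by (simp only:)
qed simp

lemma tile_mass_sum: "\<bar>(\<Sum>x\<in>{min_partner Q q<..Q}. tile_mass r \<epsilon> q x) - \<epsilon> * denom_density r (\<epsilon> * real q)\<bar> \<le> (1 + 3 * lip_const r) * (\<epsilon> / real q)"
proof -
  let ?S = "\<Sum>x\<in>{min_partner Q q<..Q}. tile_kernel r (\<epsilon> * real x)"
  let ?X = "min_partner Q q"
  define y where "y = \<epsilon> * real q"
  have y: "0 < y" "y \<le> 1" using denom_range by (auto simp: y_def)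
  have q0: "real q > 0" using q by simp
  have Sx: "(\<Sum>x\<in>{min_partner Q q<..Q}. tile_mass r \<epsilon> q x) = (\<epsilon> / real q) * y powr r * real (Q - ?X) + (1 / real q) * (\<epsilon> * (?S))"
  proof -
    have "(\<Sum>x\<in>{min_partner Q q<..Q}. tile_mass r \<epsilon> q x) = (\<epsilon> / real q) * (\<Sum>x\<in>{min_partner Q q<..Q}. y powr r + tile_kernel r (\<epsilon> * real x))"
      unfolding tile_mass_def y_def by (simp only: sum_distrib_left)
    also have "(\<Sum>x\<in>{min_partner Q q<..Q}. y powr r + tile_kernel r (\<epsilon> * real x)) = y powr r * real (Q - ?X) + (?S)"
      by (simp add: sum.distrib mult.commute)
    finally show ?thesis by (simp add: distrib_left add_divide_distrib)
  qed
  have gy: "\<epsilon> * denom_density r y = (\<epsilon> / real q) * y powr r * (min y (1 - y) / \<epsilon>) + (1 / real q) * kernel_tail r (max y (1 - y))"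
  proof -
    have "y powr r = y powr (r - 1) * y" using y powr_mult_base[of y "r - 1"] by (simp add: mult.commute)
    then have "(\<epsilon> / real q) * y powr r * (min y (1 - y) / \<epsilon>) = \<epsilon> * y powr (r - 1) * min y (1 - y)"
      using e q0 by (simp add: y_def field_simps)
    moreover have "\<epsilon> * (kernel_tail r (max y (1 - y)) / y) = (1 / real q) * kernel_tail r (max y (1 - y))"
      using e q0 by (simp add: y_def)
    ultimately show ?thesis by (simp add: denom_density_def distrib_left)
  qed
  have rX: "real (?X) = max (real q) (real Q - real q)" using q by (simp add: min_partner_def of_nat_max of_nat_diff)
  have rQX: "real (Q - ?X) = real Q - max (real q) (real Q - real q)" using min_partner_facts(1) by (simp add: of_nat_diff rX)
  have eX: "\<epsilon> * real (?X) = max y (\<epsilon> * real Q - y)" unfolding rX y_def using e by (simp add: max_mult_distrib_left right_diff_distrib)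
  have d1: "\<bar>real (Q - ?X) - min y (1 - y) / \<epsilon>\<bar> \<le> 1"
  proof -
    have "\<epsilon> * real (Q - ?X) = \<epsilon> * real Q - max y (\<epsilon> * real Q - y)" unfolding rQX right_diff_distrib using eX rX by simp
    then have "\<bar>\<epsilon> * real (Q - ?X) - min y (1 - y)\<bar> \<le> \<epsilon>" using Q_range by (auto simp: max_def min_def abs_if)
    then have "\<bar>\<epsilon> * (real (Q - ?X) - min y (1 - y) / \<epsilon>)\<bar> \<le> \<epsilon> * 1" using e by (simp add: right_diff_distrib)
    then show ?thesis using e by (simp only: abs_mult) simp
  qed
  have yr: "y powr r \<le> 1" using y r powr_mono2[of r y 1] by simp
  have D1: "\<bar>(\<epsilon> / real q) * y powr r * real (Q - ?X) - (\<epsilon> / real q) * y powr r * (min y (1 - y) / \<epsilon>)\<bar> \<le> \<epsilon> / real q"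
  proof -
    have "\<bar>(\<epsilon> / real q) * y powr r * real (Q - ?X) - (\<epsilon> / real q) * y powr r * (min y (1 - y) / \<epsilon>)\<bar> = (\<epsilon> / real q) * y powr r * \<bar>real (Q - ?X) - min y (1 - y) / \<epsilon>\<bar>"
      using e by (simp only: right_diff_distrib[symmetric] abs_mult) simp
    also have "\<dots> \<le> (\<epsilon> / real q) * 1 * 1" using e q0 yr d1 by (intro mult_mono) auto
    finally show ?thesis by simp
  qed
  have rQ: "\<epsilon> * real Q \<in> {1/4..1}" and rX0: "\<epsilon> * real (?X) \<in> {1/4..1}" using partner_range[of Q] partner_range[of "?X"] min_partner_facts(1) by auto
  have K0: "lip_const r > 0" by (rule lip_const_pos)
  have "?X + (Q - ?X) = Q" using min_partner_facts(1) by simp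
  then have a: "\<bar>\<epsilon> * (?S) - (kernel_tail r (\<epsilon> * real (?X)) - kernel_tail r (\<epsilon> * real Q))\<bar> \<le> lip_const r * \<epsilon> * (\<epsilon> * real (Q - ?X))"
    using tile_kernel_sum[of "Q - ?X"] by simp
  also have "\<dots> \<le> lip_const r * \<epsilon> * 1"
  proof (rule mult_left_mono)
    have "\<epsilon> * real (Q - ?X) \<le> \<epsilon> * real Q" using e by (intro mult_left_mono) auto
    then show "\<epsilon> * real (Q - ?X) \<le> 1" using Q_range by linarith
  qed (use K0 e in auto)
  finally have a: "\<bar>\<epsilon> * (?S) - (kernel_tail r (\<epsilon> * real (?X)) - kernel_tail r (\<epsilon> * real Q))\<bar> \<le> lip_const r * \<epsilon>" by simp
  have "\<bar>kernel_tail r (\<epsilon> * real Q) - kernel_tail r 1\<bar> \<le> lip_const r * \<bar>\<epsilon> * real Q - 1\<bar>" using rQ by (intro kernel_tail_lipschitz r) auto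
  also have "\<dots> \<le> lip_const r * \<epsilon>" using Q_range K0 by (intro mult_left_mono) auto
  finally have b: "\<bar>kernel_tail r (\<epsilon> * real Q)\<bar> \<le> lip_const r * \<epsilon>" by (simp add: kernel_tail_1)
  have "\<bar>kernel_tail r (\<epsilon> * real (?X)) - kernel_tail r (max y (1 - y))\<bar> \<le> lip_const r * \<bar>\<epsilon> * real (?X) - max y (1 - y)\<bar>"
    using rX0 y by (intro kernel_tail_lipschitz r) (auto simp: max_def)
  also have "\<dots> \<le> lip_const r * \<epsilon>"
    unfolding eX using Q_range K0 by (intro mult_left_mono) (auto simp: max_def)
  finally have c: "\<bar>kernel_tail r (\<epsilon> * real (?X)) - kernel_tail r (max y (1 - y))\<bar> \<le> lip_const r * \<epsilon>" .
  have "\<bar>\<epsilon> * (?S) - kernel_tail r (max y (1 - y))\<bar> \<le> 3 * lip_const r * \<epsilon>"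
  proof -
    have gen: "\<bar>s - (p - o1)\<bar> \<le> k \<Longrightarrow> \<bar>o1\<bar> \<le> k \<Longrightarrow> \<bar>p - m\<bar> \<le> k \<Longrightarrow> \<bar>s - m\<bar> \<le> 3 * k" for s p o1 k m :: real by linarith
    show ?thesis unfolding mult.assoc[of 3] by (rule gen[OF a b c])
  qed
  then have "(1 / real q) * \<bar>\<epsilon> * (?S) - kernel_tail r (max y (1 - y))\<bar> \<le> (1 / real q) * (3 * lip_const r * \<epsilon>)"
    by (intro mult_left_mono) auto
  then have D2: "\<bar>(1 / real q) * (\<epsilon> * (?S)) - (1 / real q) * kernel_tail r (max y (1 - y))\<bar> \<le> 3 * lip_const r * (\<epsilon> / real q)"
    by (simp only: right_diff_distrib[symmetric] abs_mult) simp
  have "(1 + 3 * lip_const r) * (\<epsilon> / real q) = \<epsilon> / real q + 3 * lip_const r * (\<epsilon> / real q)" by (simp only: distrib_right mult_1_left)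
  moreover have "\<bar>a1 - b1\<bar> \<le> c1 \<Longrightarrow> \<bar>a2 - b2\<bar> \<le> c2 \<Longrightarrow> \<bar>(a1 + a2) - (b1 + b2)\<bar> \<le> c1 + c2" for a1 b1 c1 a2 b2 c2 :: real by linarith
  from this[OF D1 D2] have "\<bar>(\<Sum>x\<in>{min_partner Q q<..Q}. tile_mass r \<epsilon> q x) - \<epsilon> * denom_density r y\<bar> \<le> \<epsilon> / real q + 3 * lip_const r * (\<epsilon> / real q)"
    unfolding Sx gy .
  ultimately show ?thesis by (simp only: y_def[symmetric])
qed

lemma tile_mass_variation: "\<bar>tile_mass r \<epsilon> q Q\<bar> + (\<Sum>x\<in>{min_partner Q q<..<Q}. \<bar>tile_mass r \<epsilon> q (Suc x) - tile_mass r \<epsilon> q x\<bar>) \<le> (1 + 2 * lip_const r) * (\<epsilon> / real q)"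
proof -
  have c0: "\<epsilon> / real q \<ge> 0" using e by simp
  have yr: "(\<epsilon> * real q) powr r \<le> 1" using denom_range r powr_mono2[of r "\<epsilon> * real q" 1] by simp
  have "\<bar>tile_mass r \<epsilon> q Q\<bar> \<le> (\<epsilon> / real q) * (1 + lip_const r)"
  proof -
    have "\<epsilon> * real Q \<in> {1/4..1}" by (rule partner_range[OF min_partner_facts(1) order_refl])
    then have "\<bar>tile_kernel r (\<epsilon> * real Q)\<bar> \<le> lip_const r" by (intro tile_kernel_bound) auto
    then have "\<bar>(\<epsilon> * real q) powr r + tile_kernel r (\<epsilon> * real Q)\<bar> \<le> 1 + lip_const r" using yr powr_ge_zero[of "\<epsilon> * real q" r] unfolding abs_le_iff by linarith
    then show ?thesis unfolding tile_mass_def abs_mult abs_of_nonneg[OF c0] by (rule mult_left_mono[OF _ c0])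
  qed
  moreover have "(\<Sum>x\<in>{min_partner Q q<..<Q}. \<bar>tile_mass r \<epsilon> q (Suc x) - tile_mass r \<epsilon> q x\<bar>) \<le> (\<Sum>x\<in>{min_partner Q q<..<Q}. (\<epsilon> / real q) * (lip_const r * \<epsilon>))"
  proof (rule sum_mono)
    fix x assume x: "x \<in> {min_partner Q q<..<Q}"
    have "tile_mass r \<epsilon> q (Suc x) - tile_mass r \<epsilon> q x = (\<epsilon> / real q) * (tile_kernel r (\<epsilon> * real (Suc x)) - tile_kernel r (\<epsilon> * real x))"
      unfolding tile_mass_def by (simp only: right_diff_distrib[symmetric]) simp
    moreover have "\<bar>tile_kernel r (\<epsilon> * real (Suc x)) - tile_kernel r (\<epsilon> * real x)\<bar> \<le> lip_const r * \<bar>\<epsilon> * real (Suc x) - \<epsilon> * real x\<bar>"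
      by (intro tile_kernel_lipschitz partner_range) (use x in auto)
    then have "\<bar>tile_kernel r (\<epsilon> * real (Suc x)) - tile_kernel r (\<epsilon> * real x)\<bar> \<le> lip_const r * \<epsilon>" using e by (simp add: algebra_simps)
    ultimately show "\<bar>tile_mass r \<epsilon> q (Suc x) - tile_mass r \<epsilon> q x\<bar> \<le> (\<epsilon> / real q) * (lip_const r * \<epsilon>)"
      using c0 by (simp only: abs_mult abs_of_nonneg mult_left_mono)
  qed
  moreover have "(\<Sum>x\<in>{min_partner Q q<..<Q}. (\<epsilon> / real q) * (lip_const r * \<epsilon>)) \<le> (\<epsilon> / real q) * lip_const r"
  proof -
    have "real (card {min_partner Q q<..<Q}) * \<epsilon> \<le> real Q * \<epsilon>" using e by (intro mult_right_mono) auto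
    then have "real (card {min_partner Q q<..<Q}) * \<epsilon> \<le> 1" using Q_range(1) by (simp add: mult.commute)
    then have "(\<epsilon> / real q) * lip_const r * (real (card {min_partner Q q<..<Q}) * \<epsilon>) \<le> (\<epsilon> / real q) * lip_const r * 1"
      by (intro mult_left_mono mult_nonneg_nonneg c0 less_imp_le[OF lip_const_pos])
    then show ?thesis by (simp add: mult_ac)
  qed
  moreover have "d * (1 + lip_const r) + d * lip_const r = (1 + 2 * lip_const r) * d" for d by (simp add: algebra_simps)
  then have "(\<epsilon> / real q) * (1 + lip_const r) + (\<epsilon> / real q) * lip_const r = (1 + 2 * lip_const r) * (\<epsilon> / real q)" .
  ultimately show ?thesis by linarith
qed

text \<open>For fixed \<open>q\<close> the count of admissible numerators is replaced by its expected value \<open>u * totient q / q\<close>.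
Partial sums of the differences over \<open>x\<close> are box counts, and \<open>tile_mass\<close> has small variation in \<open>x\<close>. The
additional 1 stems from rounding \<open>u * q\<close> to the integer \<open>M\<close>.\<close>

lemma inner_count:
  fixes u :: real and cnt :: "nat \<Rightarrow> nat" and B :: int and M :: nat
  assumes u: "0 \<le> u" "u \<le> 1" and M: "M \<le> q" "\<bar>real M - u * real q\<bar> \<le> 1" and c: "coprime c (int q)"
  defines "cnt x \<equiv> card {y \<in> {B..<B + int M}. [c * int x * y = 1] (mod int q)}"
  shows "\<bar>(\<Sum>x\<in>{min_partner Q q<..Q}. tile_mass r \<epsilon> q x * real (cnt x)) - u * (real (totient q) / real q) * (\<Sum>x\<in>{min_partner Q q<..Q}. tile_mass r \<epsilon> q x)\<bar>
    \<le> (box_err q + 1) * ((1 + 2 * lip_const r) * (\<epsilon> / real q))"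
proof -
  define b where "b x = real (cnt x) - u * (real (totient q) / real q)" for x
  have q0: "q > 0" using q by simp
  have tq: "real (totient q) \<le> real q" by (simp add: totient_le)
  have be0: "box_err q \<ge> 0" using box_count_bound[OF q0 c, of 0 0] by (meson abs_ge_zero le0 order_trans)
  have partial: "\<bar>\<Sum>x\<in>{min_partner Q q<..n}. b x\<bar> \<le> box_err q + 1" if n: "n \<le> Q" for n
  proof (cases "min_partner Q q \<le> n")
    case True
    define L where "L = n - min_partner Q q"
    have Lq: "L \<le> q" using n min_partner_facts(2) by (simp add: L_def)
    have "(\<Sum>x\<in>{min_partner Q q<..n}. cnt x) = box_count q c (int (min_partner Q q) + 1) L B M"
    proof -
      have "box_count q c (int (min_partner Q q) + 1) L B M = card (SIGMA x:{int (min_partner Q q) + 1..<int (min_partner Q q) + 1 + int L}. {y \<in> {B..<B + int M}. [c * x * y = 1] (mod int q)})"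
        unfolding box_count_def by (rule arg_cong[of _ _ card]) auto
      also have "\<dots> = (\<Sum>x\<in>{int (min_partner Q q) + 1..<int (min_partner Q q) + 1 + int L}. card {y \<in> {B..<B + int M}. [c * x * y = 1] (mod int q)})"
        by (rule card_SigmaI) (auto intro: finite_subset[of _ "{B..<B + int M}"])
      also have "\<dots> = (\<Sum>x\<in>{min_partner Q q<..n}. cnt x)"
        unfolding cnt_def
        by (rule sum.reindex_bij_witness[of _ int nat]) (use True in \<open>auto simp: L_def\<close>)
      finally show ?thesis by simp
    qed
    then have s: "(\<Sum>x\<in>{min_partner Q q<..n}. b x) = real (box_count q c (int (min_partner Q q) + 1) L B M) - real L * (u * (real (totient q) / real q))"
      by (simp add: b_def sum_subtractf L_def flip: of_nat_sum)
    have "\<bar>real L * real M * real (totient q) / real q ^ 2 - real L * (u * (real (totient q) / real q))\<bar> \<le> 1"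
    proof -
      have "real L * real M * real (totient q) / real q ^ 2 - real L * (u * (real (totient q) / real q)) = (real L / real q) * (real (totient q) / real q) * (real M - u * real q)"
        using q0 by (simp add: field_simps power2_eq_square)
      also have "\<bar>\<dots>\<bar> \<le> 1 * 1 * 1"
        unfolding abs_mult using M(2) Lq tq q0 by (intro mult_mono) auto
      finally show ?thesis by simp
    qed
    then show ?thesis unfolding s using box_count_bound[OF q0 c Lq M(1), of "int (min_partner Q q) + 1" B] by linarith
  qed (use be0 in auto)
  have "(\<Sum>x\<in>{min_partner Q q<..Q}. tile_mass r \<epsilon> q x * real (cnt x)) - u * (real (totient q) / real q) * (\<Sum>x\<in>{min_partner Q q<..Q}. tile_mass r \<epsilon> q x)
    = (\<Sum>x\<in>{min_partner Q q<..Q}. tile_mass r \<epsilon> q x * b x)"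
    unfolding b_def right_diff_distrib sum_subtractf by (simp add: sum_distrib_left mult_ac)
  also have "\<bar>\<dots>\<bar> \<le> (box_err q + 1) * (\<bar>tile_mass r \<epsilon> q Q\<bar> + (\<Sum>x\<in>{min_partner Q q<..<Q}. \<bar>tile_mass r \<epsilon> q (Suc x) - tile_mass r \<epsilon> q x\<bar>))"
    by (rule abel_summation_bound[OF partial min_partner_facts(1)])
  also have "\<dots> \<le> (box_err q + 1) * ((1 + 2 * lip_const r) * (\<epsilon> / real q))"
    using be0 by (intro mult_left_mono tile_mass_variation) auto
  finally show ?thesis .
qed

end

lemma totient_denom_density_sum:
  assumes r: "r > 0" and e: "0 < \<epsilon>" "\<epsilon> < 1/2" and Q: "Q = max_denom \<epsilon>"
  shows "\<bar>(\<Sum>q=1..Q. real (totient q) / real q * (\<epsilon> * denom_density r (\<epsilon> * real q))) - 6 / pi\<^sup>2 * integral {0..1} (denom_density r)\<bar>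
    \<le> \<epsilon> * ((2 + 40 * lip_const r) * (3 + 3 * harm Q))"
proof -
  let ?g = "\<lambda>q. denom_density r (\<epsilon> * real q)"
  let ?h = "\<lambda>q. density_incr r (\<epsilon> * real q)"
  let ?t = "\<lambda>q. real (totient q) / real q"
  define \<kappa> where "\<kappa> = 6 / pi\<^sup>2"
  have k1: "0 < \<kappa>" "\<kappa> \<le> 1"
  proof -
    have "3 ^ 2 \<le> pi\<^sup>2" using pi_gt3 by (intro power_mono) auto
    then show "0 < \<kappa>" "\<kappa> \<le> 1" by (auto simp: \<kappa>_def field_simps)
  qed
  have QQ: "\<epsilon> * real Q \<le> 1" "1 < \<epsilon> * real Q + \<epsilon>" "Q \<ge> 2"
    using max_denom_facts[OF e] by (auto simp: Q algebra_simps)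
  have K0: "lip_const r > 0" by (rule lip_const_pos)
  have eq1: "\<epsilon> * real q \<le> 1" if "q \<le> Q" for q
    using that QQ(1) e mult_left_mono[of "real q" "real Q" \<epsilon>] by linarith
  have var: "\<bar>?g Q\<bar> + (\<Sum>x\<in>{0<..<Q}. \<bar>?g (Suc x) - ?g x\<bar>) \<le> 2 + 40 * lip_const r"
  proof -
    have "(\<Sum>x\<in>{0<..<Q}. \<bar>?g (Suc x) - ?g x\<bar>) \<le> (\<Sum>x\<in>{0<..<Q}. 20 * lip_const r * \<epsilon> + (?h (Suc x) - ?h x))"
    proof (rule sum_mono)
      fix x assume x: "x \<in> {0<..<Q}"
      have "\<bar>?g (Suc x) - ?g x\<bar> \<le> 20 * lip_const r * (\<epsilon> * real (Suc x) - \<epsilon> * real x) + (?h (Suc x) - ?h x)"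
        by (rule denom_density_osc[OF r]) (use e x eq1[of "Suc x"] in \<open>auto intro: mult_left_mono\<close>)
      then show "\<bar>?g (Suc x) - ?g x\<bar> \<le> 20 * lip_const r * \<epsilon> + (?h (Suc x) - ?h x)"
        by (simp add: algebra_simps)
    qed
    also have "\<dots> \<le> (\<Sum>x<Q. 20 * lip_const r * \<epsilon> + (?h (Suc x) - ?h x))"
      by (rule sum_mono2) (use K0 e r in \<open>auto intro!: add_nonneg_nonneg density_incr_mono mult_left_mono\<close>)
    also have "\<dots> = 20 * lip_const r * (\<epsilon> * real Q) + (?h Q - ?h 0)"
      using sum_lessThan_telescope[of "\<lambda>n. ?h n" Q] by (simp add: sum.distrib del: of_nat_Suc)
    also have "\<dots> \<le> 20 * lip_const r * 1 + 1"
    proof -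
      have "20 * lip_const r * (\<epsilon> * real Q) \<le> 20 * lip_const r * 1" using QQ K0 by (intro mult_left_mono) auto
      moreover have "?h Q \<le> 1" "?h 0 \<ge> 0" using density_incr_range[OF r] e by auto
      ultimately show ?thesis by linarith
    qed
    finally have "(\<Sum>x\<in>{0<..<Q}. \<bar>?g (Suc x) - ?g x\<bar>) \<le> 20 * lip_const r + 1" by simp
    moreover have "\<bar>?g Q\<bar> \<le> 1 + 20 * lip_const r" using QQ e by (intro denom_density_bound r) auto
    ultimately show ?thesis by linarith
  qed
  have set01: "{0<..n} = {1..n}" for n :: nat by auto
  have A: "\<bar>\<Sum>q=1..Q. ?g q * (?t q - \<kappa>)\<bar> \<le> totient_sum_err Q * (2 + 40 * lip_const r)"
  proof -
    have "\<bar>\<Sum>q\<in>{0<..n}. (?t q - \<kappa>)\<bar> \<le> totient_sum_err Q" if "n \<le> Q" for n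
    proof -
      have "\<bar>\<Sum>q\<in>{0<..n}. (?t q - \<kappa>)\<bar> \<le> totient_sum_err n"
        using totient_sum[of n] unfolding set01 \<kappa>_def .
      also have "\<dots> \<le> totient_sum_err Q" using harm_mono[OF that, where ?'a = real] by (simp add: totient_sum_err_def)
      finally show ?thesis .
    qed
    then have "\<bar>\<Sum>q\<in>{0<..Q}. ?g q * (?t q - \<kappa>)\<bar> \<le> totient_sum_err Q * (\<bar>?g Q\<bar> + (\<Sum>x\<in>{0<..<Q}. \<bar>?g (Suc x) - ?g x\<bar>))"
      by (rule abel_summation_bound) auto
    also have "\<dots> \<le> totient_sum_err Q * (2 + 40 * lip_const r)"
      by (intro mult_left_mono var) (simp add: totient_sum_err_def harm_nonneg)
    finally show ?thesis unfolding set01 .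
  qed
  have Bnd: "\<bar>\<epsilon> * (\<Sum>q=1..Q. ?g q) - integral {0..1} (denom_density r)\<bar> \<le> \<epsilon> * (2 + 40 * lip_const r)"
  proof -
    have "\<bar>\<epsilon> * (\<Sum>q=1..Q. ?g q) - integral {0..\<epsilon> * real Q} (denom_density r)\<bar> \<le> \<epsilon> * (20 * lip_const r * (\<epsilon> * real Q) + ?h Q)"
      by (rule denom_density_riemann[OF r e(1) QQ(1)])
    also have "\<dots> \<le> \<epsilon> * (20 * lip_const r * 1 + 1)"
      using e QQ K0 density_incr_range[OF r, of "\<epsilon> * real Q"] by (intro mult_left_mono add_mono) auto
    finally have 1: "\<bar>\<epsilon> * (\<Sum>q=1..Q. ?g q) - integral {0..\<epsilon> * real Q} (denom_density r)\<bar> \<le> \<epsilon> * (20 * lip_const r + 1)" by simp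
    have 2: "integral {0..\<epsilon> * real Q} (denom_density r) + integral {\<epsilon> * real Q..1} (denom_density r) = integral {0..1} (denom_density r)"
      by (rule Henstock_Kurzweil_Integration.integral_combine) (use e QQ r in \<open>auto intro: denom_density_integrable_on\<close>)
    have "norm (integral {\<epsilon> * real Q..1} (denom_density r)) \<le> integral {\<epsilon> * real Q..1} (\<lambda>_. 1 + 20 * lip_const r)"
    proof (rule integral_norm_bound_integral)
      show "norm (denom_density r x) \<le> 1 + 20 * lip_const r" if "x \<in> {\<epsilon> * real Q..1}" for x
      proof -
        have "0 \<le> \<epsilon> * real Q" using e by simp
        then show ?thesis using denom_density_bound[OF r, of x] that by simp
      qed
    qed (use e QQ r in \<open>auto intro: denom_density_integrable_on\<close>)
    also have "\<dots> = (1 - \<epsilon> * real Q) * (1 + 20 * lip_const r)" using QQ by simp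
    also have "\<dots> \<le> \<epsilon> * (1 + 20 * lip_const r)" using QQ K0 by (intro mult_right_mono) auto
    finally have "\<bar>integral {\<epsilon> * real Q..1} (denom_density r)\<bar> \<le> \<epsilon> * (1 + 20 * lip_const r)" by simp
    then show ?thesis using 1 2 by (simp add: distrib_left)
  qed
  have "(\<Sum>q=1..Q. ?t q * (\<epsilon> * ?g q)) - \<kappa> * integral {0..1} (denom_density r)
    = \<epsilon> * (\<Sum>q=1..Q. ?g q * (?t q - \<kappa>)) + \<kappa> * (\<epsilon> * (\<Sum>q=1..Q. ?g q) - integral {0..1} (denom_density r))"
  proof -
    have "\<epsilon> * (\<Sum>q=1..Q. ?g q * (?t q - \<kappa>)) = (\<Sum>q=1..Q. ?t q * (\<epsilon> * ?g q)) - \<kappa> * (\<epsilon> * (\<Sum>q=1..Q. ?g q))"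
      unfolding sum_distrib_left sum_subtractf[symmetric] by (intro sum.cong refl) (simp add: algebra_simps)
    then show ?thesis by (simp add: algebra_simps)
  qed
  also have "\<bar>\<dots>\<bar> \<le> \<epsilon> * (totient_sum_err Q * (2 + 40 * lip_const r)) + 1 * (\<epsilon> * (2 + 40 * lip_const r))"
  proof (rule order_trans[OF abs_triangle_ineq], rule add_mono)
    show "\<bar>\<epsilon> * (\<Sum>q=1..Q. ?g q * (?t q - \<kappa>))\<bar> \<le> \<epsilon> * (totient_sum_err Q * (2 + 40 * lip_const r))"
      unfolding abs_mult using e A by (simp add: mult_left_mono)
    show "\<bar>\<kappa> * (\<epsilon> * (\<Sum>q=1..Q. ?g q) - integral {0..1} (denom_density r))\<bar> \<le> 1 * (\<epsilon> * (2 + 40 * lip_const r))"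
      unfolding abs_mult using k1 Bnd by (intro mult_mono) auto
  qed
  also have "\<dots> = \<epsilon> * ((2 + 40 * lip_const r) * (3 + 3 * harm Q))" by (simp add: totient_sum_err_def algebra_simps)
  finally show ?thesis by (simp only: \<kappa>_def)
qed

text \<open>The numbers of tiles with denominators \<open>q < x\<close> that lie to the right, respectively to the left, of a
fraction with denominator \<open>q\<close> that is at most \<open>u\<close>. A tile \<open>(a/q, b/x)\<close> means that \<open>q\<close> divides \<open>a x + 1\<close>, a tile
\<open>(a/x, b/q)\<close> that \<open>q\<close> divides \<open>b x - 1\<close>; the ranges of the numerators differ because the tiles cover \<open>(0, 1)\<close>.\<close>

definition count_right :: "real \<Rightarrow> nat \<Rightarrow> nat \<Rightarrow> nat" where
  "count_right u q x = card {a \<in> {0..<int q}. [- 1 * int x * a = 1] (mod int q) \<and> real_of_int a \<le> u * real q}"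
definition count_left :: "real \<Rightarrow> nat \<Rightarrow> nat \<Rightarrow> nat" where
  "count_left u q x = card {a \<in> {1..int q}. [1 * int x * a = 1] (mod int q) \<and> real_of_int a \<le> u * real q}"

definition tile_sum :: "real \<Rightarrow> real \<Rightarrow> real \<Rightarrow> real" where
  "tile_sum r \<epsilon> u = (\<Sum>q\<in>{1..max_denom \<epsilon>}. \<Sum>x\<in>{min_partner (max_denom \<epsilon>) q<..max_denom \<epsilon>}. tile_mass r \<epsilon> q x * real (count_right u q x + count_left u q x))"

text \<open>Replace both counts by their expected value (\<open>inner_count\<close>), sum over \<open>x\<close> (\<open>tile_mass_sum\<close>) and then over \<open>q\<close>
(\<open>totient_denom_density_sum\<close>). The two kinds of tiles account for the factor 2 between \<open>12 / \<pi>\<^sup>2\<close> and \<open>6 / \<pi>\<^sup>2\<close>.\<close>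

lemma tile_sum_error:
  assumes r: "r > 0" and e: "0 < \<epsilon>" "\<epsilon> < 1/2" and Q: "Q = max_denom \<epsilon>" and u: "0 \<le> u" "u \<le> 1"
  shows "\<bar>tile_sum r \<epsilon> u - moment_const r * u\<bar> \<le> \<epsilon> * (250 * (1 + lip_const r) * ((\<Sum>q=1..Q. box_err q / real q) + 1 + harm Q))"
proof -
  let ?V = "tile_mass r \<epsilon>"
  let ?X = "\<lambda>q. {min_partner Q q<..Q}"
  have K0: "lip_const r > 0" by (rule lip_const_pos)
  define G where "G q = (\<Sum>x\<in>?X q. ?V q x)" for q
  define t where "t q = real (totient q) / real q" for q
  have t01: "0 \<le> t q" "t q \<le> 1" for q by (auto simp: t_def divide_le_eq totient_le)
  have R: "\<bar>(\<Sum>x\<in>?X q. ?V q x * real (count_right u q x)) - u * t q * G q\<bar> \<le> (box_err q + 1) * ((1 + 2 * lip_const r) * (\<epsilon> / real q))"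
    if q: "q \<in> {1..Q}" for q
  proof -
    define M where "M = min q (nat \<lfloor>u * real q\<rfloor> + 1)"
    have fl: "real (nat \<lfloor>u * real q\<rfloor>) = of_int \<lfloor>u * real q\<rfloor>" using u by simp
    have uq: "u * real q \<le> real q" using u by (simp add: mult_left_le_one_le)
    have M: "M \<le> q" "\<bar>real M - u * real q\<bar> \<le> 1" unfolding M_def using fl uq by (auto simp: min_def) linarith+
    have "{a \<in> {0..<int q}. [- 1 * int x * a = 1] (mod int q) \<and> real_of_int a \<le> u * real q} = {y \<in> {0..<0 + int M}. [- 1 * int x * y = 1] (mod int q)}" for x
    proof -
      have "a < int M \<longleftrightarrow> a < int q \<and> real_of_int a \<le> u * real q" if "a \<ge> 0" for a
      proof -
        have "int (nat \<lfloor>u * real q\<rfloor>) = \<lfloor>u * real q\<rfloor>" using u by simp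
        then show ?thesis unfolding M_def le_floor_iff[symmetric] by (auto simp: of_nat_min)
      qed
      then show ?thesis by auto
    qed
    then have c: "count_right u q x = card {y \<in> {0..<0 + int M}. [- 1 * int x * y = 1] (mod int q)}" for x by (simp only: count_right_def)
    show ?thesis unfolding c G_def t_def
      by (rule inner_count[OF r e Q]) (use q M u in auto)
  qed
  have L: "\<bar>(\<Sum>x\<in>?X q. ?V q x * real (count_left u q x)) - u * t q * G q\<bar> \<le> (box_err q + 1) * ((1 + 2 * lip_const r) * (\<epsilon> / real q))"
    if q: "q \<in> {1..Q}" for q
  proof -
    define M where "M = nat \<lfloor>u * real q\<rfloor>"
    have fl: "real (nat \<lfloor>u * real q\<rfloor>) = of_int \<lfloor>u * real q\<rfloor>" using u by simp
    have uq: "u * real q \<le> real q" using u by (simp add: mult_left_le_one_le)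
    have M: "M \<le> q" "\<bar>real M - u * real q\<bar> \<le> 1"
    proof -
      have "real M \<le> real q" unfolding M_def using fl uq by linarith
      then show "M \<le> q" by simp
      show "\<bar>real M - u * real q\<bar> \<le> 1" unfolding M_def using fl by linarith
    qed
    have "{a \<in> {1..int q}. [1 * int x * a = 1] (mod int q) \<and> real_of_int a \<le> u * real q} = {y \<in> {1..<1 + int M}. [1 * int x * y = 1] (mod int q)}" for x
    proof -
      have "a < 1 + int M \<longleftrightarrow> a \<le> int q \<and> real_of_int a \<le> u * real q" if "a \<ge> 1" for a
      proof -
        have "a < 1 + int M \<longleftrightarrow> real_of_int a \<le> u * real q"
          unfolding M_def using u by (simp add: le_floor_iff[symmetric]) linarith
        moreover have "real_of_int a \<le> u * real q \<Longrightarrow> a \<le> int q" using uq by linarith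
        ultimately show ?thesis by blast
      qed
      then show ?thesis by auto
    qed
    then have c: "count_left u q x = card {y \<in> {1..<1 + int M}. [1 * int x * y = 1] (mod int q)}" for x by (simp only: count_left_def)
    show ?thesis unfolding c G_def t_def
      by (rule inner_count[OF r e Q]) (use q M u in auto)
  qed
  have G: "\<bar>G q - \<epsilon> * denom_density r (\<epsilon> * real q)\<bar> \<le> (1 + 3 * lip_const r) * (\<epsilon> / real q)" if "q \<in> {1..Q}" for q
    unfolding G_def by (rule tile_mass_sum[OF r e Q]) (use that in auto)
  have trm: "\<bar>(\<Sum>x\<in>?X q. ?V q x * real (count_right u q x + count_left u q x)) - 2 * u * (t q * (\<epsilon> * denom_density r (\<epsilon> * real q)))\<bar>
     \<le> \<epsilon> * ((2 + 4 * lip_const r) * (box_err q / real q) + (4 + 10 * lip_const r) * inverse (real q))" if q: "q \<in> {1..Q}" for q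
  proof -
    have "\<bar>u * t q * (G q - \<epsilon> * denom_density r (\<epsilon> * real q))\<bar> \<le> 1 * 1 * ((1 + 3 * lip_const r) * (\<epsilon> / real q))"
      unfolding abs_mult using u t01[of q] G[OF q] by (intro mult_mono) auto
    then have "\<bar>u * t q * G q - u * (t q * (\<epsilon> * denom_density r (\<epsilon> * real q)))\<bar> \<le> (1 + 3 * lip_const r) * (\<epsilon> / real q)"
      by (simp add: right_diff_distrib mult.assoc)
    moreover have "(\<Sum>x\<in>?X q. ?V q x * real (count_right u q x + count_left u q x)) = (\<Sum>x\<in>?X q. ?V q x * real (count_right u q x)) + (\<Sum>x\<in>?X q. ?V q x * real (count_left u q x))"
      by (simp add: distrib_left sum.distrib)
    ultimately have "\<bar>(\<Sum>x\<in>?X q. ?V q x * real (count_right u q x + count_left u q x)) - 2 * u * (t q * (\<epsilon> * denom_density r (\<epsilon> * real q)))\<bar>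
      \<le> 2 * ((box_err q + 1) * ((1 + 2 * lip_const r) * (\<epsilon> / real q))) + 2 * ((1 + 3 * lip_const r) * (\<epsilon> / real q))"
      using R[OF q] L[OF q] by linarith
    also have "\<dots> = \<epsilon> * ((2 + 4 * lip_const r) * (box_err q / real q) + (4 + 10 * lip_const r) * inverse (real q))"
      using q by (simp add: field_simps)
    finally show ?thesis .
  qed
  have "\<bar>tile_sum r \<epsilon> u - 2 * u * (\<Sum>q=1..Q. t q * (\<epsilon> * denom_density r (\<epsilon> * real q)))\<bar>
    = \<bar>\<Sum>q=1..Q. (\<Sum>x\<in>?X q. ?V q x * real (count_right u q x + count_left u q x)) - 2 * u * (t q * (\<epsilon> * denom_density r (\<epsilon> * real q)))\<bar>"
    unfolding tile_sum_def Q[symmetric] sum_distrib_left sum_subtractf ..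
  also have "\<dots> \<le> (\<Sum>q=1..Q. \<epsilon> * ((2 + 4 * lip_const r) * (box_err q / real q) + (4 + 10 * lip_const r) * inverse (real q)))"
    by (rule order_trans[OF sum_abs], rule sum_mono, rule trm)
  also have "\<dots> = \<epsilon> * ((2 + 4 * lip_const r) * (\<Sum>q=1..Q. box_err q / real q) + (4 + 10 * lip_const r) * harm Q)"
    by (simp only: sum_distrib_left[symmetric] sum.distrib harm_def)
  finally have A: "\<bar>tile_sum r \<epsilon> u - 2 * u * (\<Sum>q=1..Q. t q * (\<epsilon> * denom_density r (\<epsilon> * real q)))\<bar> \<le> \<epsilon> * ((2 + 4 * lip_const r) * (\<Sum>q=1..Q. box_err q / real q) + (4 + 10 * lip_const r) * harm Q)" .
  have B: "\<bar>2 * u * ((\<Sum>q=1..Q. t q * (\<epsilon> * denom_density r (\<epsilon> * real q))) - 6 / pi\<^sup>2 * integral {0..1} (denom_density r))\<bar> \<le> 2 * (\<epsilon> * ((2 + 40 * lip_const r) * (3 + 3 * harm Q)))"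
    unfolding abs_mult using u totient_denom_density_sum[OF r e Q] unfolding t_def by (intro mult_mono) auto
  have mc: "moment_const r * u = 2 * u * (6 / pi\<^sup>2 * integral {0..1} (denom_density r))"
    unfolding moment_const_eq[OF r] by (simp add: field_simps)
  have S0: "(\<Sum>q=1..Q. box_err q / real q) \<ge> 0"
  proof (rule sum_nonneg)
    fix q assume "q \<in> {1..Q}"
    then have "box_err q \<ge> 0" using box_count_bound[of q 1 0 0 0 0] abs_ge_zero order_trans by fastforce
    then show "box_err q / real q \<ge> 0" by simp
  qed
  have h0: "harm Q \<ge> (0::real)" by (rule harm_nonneg)
  have "\<bar>tile_sum r \<epsilon> u - moment_const r * u\<bar> \<le> \<epsilon> * ((2 + 4 * lip_const r) * (\<Sum>q=1..Q. box_err q / real q) + (4 + 10 * lip_const r) * harm Q) + 2 * (\<epsilon> * ((2 + 40 * lip_const r) * (3 + 3 * harm Q)))"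
    using A B unfolding mc right_diff_distrib by linarith
  also have "\<dots> = \<epsilon> * ((2 + 4 * lip_const r) * (\<Sum>q=1..Q. box_err q / real q) + (4 + 10 * lip_const r) * harm Q + 2 * ((2 + 40 * lip_const r) * (3 + 3 * harm Q)))"
    by (simp add: algebra_simps)
  also have "\<dots> \<le> \<epsilon> * (250 * (1 + lip_const r) * ((\<Sum>q=1..Q. box_err q / real q) + 1 + harm Q))"
  proof (rule mult_left_mono)
    let ?S = "\<Sum>q=1..Q. box_err q / real q" and ?h = "harm Q :: real" and ?k = "lip_const r"
    have "0 \<le> ?k * ?S" "0 \<le> ?k * ?h" using K0 S0 h0 by auto
    then show "(2 + 4 * ?k) * ?S + (4 + 10 * ?k) * ?h + 2 * ((2 + 40 * ?k) * (3 + 3 * ?h)) \<le> 250 * (1 + ?k) * (?S + 1 + ?h)"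
      using K0 S0 h0 by (simp add: algebra_simps)
  qed (use e in simp)
  finally show ?thesis .
qed

section \<open>Farey pairs and the first hit\<close>

definition first_hit :: "real \<Rightarrow> real \<Rightarrow> nat" where
  "first_hit \<epsilon> t = (LEAST k. k > 0 \<and> (\<exists>n::int. \<bar>real k * t - of_int n\<bar> \<le> \<epsilon>))"

lemma first_hit_uminus: "first_hit \<epsilon> (- t) = first_hit \<epsilon> t"
proof -
  have "(\<exists>n::int. \<bar>real k * (- t) - of_int n\<bar> \<le> \<epsilon>) \<longleftrightarrow> (\<exists>n::int. \<bar>real k * t - of_int n\<bar> \<le> \<epsilon>)" for k t
  proof -
    have "\<exists>n::int. \<bar>real k * (- t) - of_int n\<bar> \<le> \<epsilon>" if "\<bar>real k * t - of_int n\<bar> \<le> \<epsilon>" for n :: int and t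
    proof (rule exI[of _ "- n"])
      have "real k * (- t) - of_int (- n) = - (real k * t - of_int n)" by simp
      then show "\<bar>real k * (- t) - of_int (- n)\<bar> \<le> \<epsilon>" using that by (simp only: abs_minus_cancel)
    qed
    from this[of t] this[of "- t"] show ?thesis by auto
  qed
  then show ?thesis by (simp only: first_hit_def)
qed

lemma first_hit_eqI:
  assumes "q > 0" "\<bar>real q * t - of_int a\<bar> \<le> \<epsilon>"
    "\<And>k n. 0 < k \<Longrightarrow> k < q \<Longrightarrow> \<bar>real k * t - of_int n\<bar> \<le> \<epsilon> \<Longrightarrow> False"
  shows "first_hit \<epsilon> t = q"
  unfolding first_hit_def
proof (rule Least_equality)
  fix k assume "0 < k \<and> (\<exists>n. \<bar>real k * t - real_of_int n\<bar> \<le> \<epsilon>)"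
  then show "q \<le> k" using assms(3) by (meson not_le)
qed (use assms in auto)

text \<open>farey_pairs\<close>
text \<open>Neighbouring fractions \<open>a/q < b/y\<close> in the Farey sequence of order \<open>Q\<close>, extended to all integers \<open>a\<close> and \<open>b\<close> so
that the reflection \<open>t \<mapsto> - t\<close> acts on them.\<close>

definition farey_pair :: "nat \<Rightarrow> int \<Rightarrow> nat \<Rightarrow> int \<Rightarrow> nat \<Rightarrow> bool" where
  "farey_pair Q a q b y \<longleftrightarrow> 1 \<le> q \<and> q \<le> Q \<and> 1 \<le> y \<and> y \<le> Q \<and> Q < q + y \<and> b * int q - a * int y = 1"

lemma farey_pair_neq:
  assumes "farey_pair Q a q b y" "Q \<ge> 2" shows "q \<noteq> y"
proof
  assume "q = y"
  with assms have "(b - a) * int q = 1" by (auto simp: farey_pair_def algebra_simps)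
  then have "int q dvd 1" by (metis dvd_triv_right)
  then have "q = 1" by simp
  then show False using assms \<open>q = y\<close> by (auto simp: farey_pair_def)
qed

lemma farey_pair_width: assumes "farey_pair Q a q b y" shows "of_int b / real y - of_int a / real q = 1 / (real q * real y)"
proof -
  have d: "1 \<le> q" "1 \<le> y" "b * int q - a * int y = 1" using assms by (auto simp: farey_pair_def)
  have "real_of_int (b * int q - a * int y) = 1" unfolding d(3) by simp
  then have "of_int b * real q - of_int a * real y = 1" by simp
  moreover have "of_int b / real y - of_int a / real q = (of_int b * real q - of_int a * real y) / (real q * real y)"
    using d(1,2) by (simp add: diff_frac_eq mult.commute)
  ultimately show ?thesis by (simp only:)
qed

text \<open>Inside a tile the errors \<open>A\<close> and \<open>B\<close> of the two fractions satisfy \<open>y A + q B = 1\<close>. As \<open>q\<close> and \<open>y\<close> are different and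
at most \<open>1 / \<epsilon>\<close>, this gives \<open>A + B > \<epsilon>\<close>.\<close>

lemma farey_pair_facts:
  assumes e: "farey_pair Q a q b y" and t: "of_int a / real q < t" "t < of_int b / real y" and "Q \<ge> 2" and \<epsilon>: "\<epsilon> * real Q \<le> 1" "0 < \<epsilon>"
  defines "A \<equiv> real q * t - of_int a" and "B \<equiv> of_int b - real y * t"
  shows "A > 0" "B > 0" "real y * A + real q * B = 1" "q \<noteq> y" "A + B > \<epsilon>"
proof -
  have q0: "real q > 0" and y0: "real y > 0" using e by (auto simp: farey_pair_def)
  show A: "A > 0" and B: "B > 0" using t q0 y0 by (auto simp: A_def B_def field_simps)
  have 1: "b * int q - a * int y = 1" using e by (simp add: farey_pair_def)
  have "real_of_int (b * int q - a * int y) = 1" unfolding 1 by simp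
  then have d: "of_int b * real q - of_int a * real y = 1" by simp
  then show AB: "real y * A + real q * B = 1" by (simp add: A_def B_def algebra_simps)
  show qy: "q \<noteq> y" by (rule farey_pair_neq[OF e \<open>Q \<ge> 2\<close>])
  have "real y * A \<le> real Q * A" "real q * B \<le> real Q * B" using e A B by (auto simp: farey_pair_def)
  moreover have "real y * A < real Q * A \<or> real q * B < real Q * B" using e A B qy by (auto simp: farey_pair_def)
  ultimately have "1 < real Q * (A + B)" using AB by (auto simp: distrib_left)
  then have "\<epsilon> * 1 < \<epsilon> * (real Q * (A + B))" using \<epsilon> by (intro mult_strict_left_mono) auto
  also have "\<dots> = (\<epsilon> * real Q) * (A + B)" by simp
  also have "\<dots> \<le> 1 * (A + B)" using \<epsilon> A B by (intro mult_right_mono) auto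
  finally show "A + B > \<epsilon>" by simp
qed

text \<open>In the basis \<open>(q, a)\<close>, \<open>(y, b)\<close> of the integer lattice a good approximation cannot have coefficients of opposite
signs, since then its error would be at least \<open>A + B\<close>.\<close>

lemma lattice_combination_nonneg:
  fixes i j :: int and A B \<epsilon> :: real
  assumes A: "A > 0" "B > 0" "A + B > \<epsilon>" and le: "\<bar>of_int i * A - of_int j * B\<bar> \<le> \<epsilon>" and
    pos: "i * int q + j * int y > 0"
  shows "i \<ge> 0 \<and> j \<ge> 0"
proof (rule ccontr)
  assume "\<not> (i \<ge> 0 \<and> j \<ge> 0)"
  moreover have "\<not> (i \<le> 0 \<and> j \<le> 0)"
  proof
    assume "i \<le> 0 \<and> j \<le> 0"
    then have "i * int q \<le> 0" "j * int y \<le> 0" by (auto simp: mult_nonpos_nonneg)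
    then show False using pos by simp
  qed
  ultimately consider "i \<ge> 1" "j \<le> -1" | "i \<le> -1" "j \<ge> 1" by linarith
  then show False
  proof cases
    case 1
    have "1 * A \<le> of_int i * A" using 1 A by (intro mult_right_mono) auto
    moreover have "1 * B \<le> of_int (- j) * B" using 1 A by (intro mult_right_mono) auto
    ultimately show False using le A unfolding of_int_minus mult_1_left mult_minus_left by linarith
  next
    case 2
    have "1 * A \<le> of_int (- i) * A" using 2 A by (intro mult_right_mono) auto
    moreover have "1 * B \<le> of_int j * B" using 2 A by (intro mult_right_mono) auto
    ultimately show False using le A unfolding of_int_minus mult_1_left mult_minus_left by linarith
  qed
qed

text \<open>By the previous lemma every \<open>\<epsilon>\<close>-close multiple \<open>k t\<close> has \<open>k = i q + j y\<close> with \<open>i, j \<ge> 0\<close>, so the candidates are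
\<open>q\<close> and, below \<open>y\<close>, the multiples of \<open>q\<close>. If \<open>A > \<epsilon>\<close> the latter fail, and \<open>q + y > Q\<close> ensures that \<open>y\<close> succeeds.\<close>

lemma first_hit_farey_pair_aux:
  assumes e: "farey_pair Q a q b y" and t: "of_int a / real q < t" "t < of_int b / real y" and Q: "Q \<ge> 2" "\<epsilon> * real Q \<le> 1" "0 < \<epsilon>" "1 < \<epsilon> * real Q + \<epsilon>"
    and qy: "q < y"
  shows "real q * t - of_int a < \<epsilon> \<Longrightarrow> first_hit \<epsilon> t = q" "real q * t - of_int a > \<epsilon> \<Longrightarrow> first_hit \<epsilon> t = y"
proof -
  define A where "A = real q * t - of_int a"
  define B where "B = of_int b - real y * t"
  note f = farey_pair_facts[OF e t Q(1-3), folded A_def B_def]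
  have ed: "1 \<le> q" "q \<le> Q" "1 \<le> y" "y \<le> Q" "Q < q + y" "b * int q - a * int y = 1" using e by (auto simp: farey_pair_def)
  have dec: "\<exists>i j. i \<ge> 0 \<and> j \<ge> 0 \<and> int k = i * int q + j * int y \<and> \<bar>of_int i * A - of_int j * B\<bar> \<le> \<epsilon>"
    if k: "0 < k" "\<bar>real k * t - of_int n\<bar> \<le> \<epsilon>" for k n
  proof -
    define i j where "i = b * int k - int y * n" and "j = int q * n - a * int k"
    have "i * int q + j * int y = int k * (b * int q - a * int y)" by (simp add: i_def j_def algebra_simps)
    then have ik: "int k = i * int q + j * int y" by (simp add: ed(6))
    have "i * a + j * b = n * (b * int q - a * int y)" by (simp add: i_def j_def algebra_simps)
    then have jn: "n = i * a + j * b" by (simp add: ed(6))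
    have "real k = real_of_int (int k)" by simp
    also have "\<dots> = of_int i * real q + of_int j * real y" unfolding ik by simp
    finally have "real k * t - of_int n = of_int i * A - of_int j * B"
      unfolding jn A_def B_def by (simp add: algebra_simps)
    then have le: "\<bar>of_int i * A - of_int j * B\<bar> \<le> \<epsilon>" using k by simp
    have "i * int q + j * int y > 0" using ik k by simp
    from lattice_combination_nonneg[OF f(1,2,5) le this] ik le show ?thesis by blast
  qed
  show "first_hit \<epsilon> t = q" if A: "real q * t - of_int a < \<epsilon>"
  proof (rule first_hit_eqI)
    show "q > 0" using ed by simp
    show "\<bar>real q * t - of_int a\<bar> \<le> \<epsilon>" using A f(1) unfolding A_def by simp
    fix k n assume k: "0 < k" "k < q" "\<bar>real k * t - of_int n\<bar> \<le> \<epsilon>"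
    then obtain i j where ij: "i \<ge> 0" "j \<ge> 0" "int k = i * int q + j * int y" using dec by blast
    have "i = 0"
    proof (rule ccontr)
      assume "i \<noteq> 0"
      then have "1 * int q \<le> i * int q" using ij by (intro mult_right_mono) auto
      moreover have "0 \<le> j * int y" using ij by simp
      ultimately show False using ij(3) k(2) by linarith
    qed
    moreover have "j = 0"
    proof (rule ccontr)
      assume "j \<noteq> 0"
      then have "1 * int y \<le> j * int y" using ij by (intro mult_right_mono) auto
      moreover have "0 \<le> i * int q" using ij by simp
      ultimately show False using ij(3) k(2) qy by linarith
    qed
    ultimately show False using ij(3) k(1) by simp
  qed
  show "first_hit \<epsilon> t = y" if A: "real q * t - of_int a > \<epsilon>"
  proof (rule first_hit_eqI)
    show "y > 0" using ed by simp
    have "real y * \<epsilon> < real y * A" using A ed by (simp add: A_def)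
    then have "real q * B < 1 - real y * \<epsilon>" using f(3) by linarith
    also have "\<dots> < real q * \<epsilon>"
    proof -
      have "real Q + 1 \<le> real q + real y" using ed by simp
      then have "(real Q + 1) * \<epsilon> \<le> (real q + real y) * \<epsilon>" using Q by (intro mult_right_mono) auto
      then show ?thesis using Q(4) by (simp add: algebra_simps)
    qed
    finally have "B < \<epsilon>" using ed by simp
    then show "\<bar>real y * t - of_int b\<bar> \<le> \<epsilon>" using f(2) unfolding B_def by simp
    fix k n assume k: "0 < k" "k < y" "\<bar>real k * t - of_int n\<bar> \<le> \<epsilon>"
    then obtain i j where ij: "i \<ge> 0" "j \<ge> 0" "int k = i * int q + j * int y" "\<bar>of_int i * A - of_int j * B\<bar> \<le> \<epsilon>" using dec by blast
    have j: "j = 0"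
    proof (rule ccontr)
      assume "j \<noteq> 0"
      then have "1 * int y \<le> j * int y" using ij by (intro mult_right_mono) auto
      moreover have "0 \<le> i * int q" using ij by simp
      ultimately show False using ij(3) k(2) qy by linarith
    qed
    then have "i \<noteq> 0" using ij(3) k(1) by auto
    then have "1 * A \<le> of_int i * A" using ij f(1) by (intro mult_right_mono) auto
    then show False using ij(4) j A by (simp add: A_def)
  qed
qed

lemma farey_pair_reflect: "farey_pair Q a q b y \<Longrightarrow> farey_pair Q (- b) y (- a) q"
  by (auto simp: farey_pair_def)

text \<open>The point of the tile where the first hit changes from the left to the right denominator.\<close>

definition split_pt :: "real \<Rightarrow> int \<Rightarrow> nat \<Rightarrow> int \<Rightarrow> nat \<Rightarrow> real" where
  "split_pt \<epsilon> a q b y = (if q < y then (of_int a + \<epsilon>) / real q else (of_int b - \<epsilon>) / real y)"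

lemma first_hit_farey_pair:
  assumes e: "farey_pair Q a q b y" and t: "of_int a / real q < t" "t < of_int b / real y" and Q: "Q \<ge> 2" "\<epsilon> * real Q \<le> 1" "0 < \<epsilon>" "1 < \<epsilon> * real Q + \<epsilon>"
  shows "t < split_pt \<epsilon> a q b y \<Longrightarrow> first_hit \<epsilon> t = q" "t > split_pt \<epsilon> a q b y \<Longrightarrow> first_hit \<epsilon> t = y"
proof -
  have ed: "real q > 0" "real y > 0" using e by (auto simp: farey_pair_def)
  have ne: "q \<noteq> y" using farey_pair_facts(4)[OF e t Q(1-3)] .
  consider "q < y" | "y < q" using ne by linarith
  then have "(t < split_pt \<epsilon> a q b y \<longrightarrow> first_hit \<epsilon> t = q) \<and> (t > split_pt \<epsilon> a q b y \<longrightarrow> first_hit \<epsilon> t = y)"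
  proof cases
    case 1
    then show ?thesis using first_hit_farey_pair_aux[OF e t Q 1] ed by (simp add: split_pt_def field_simps)
  next
    case 2
    have "real_of_int (- b) / real y < - t" "- t < real_of_int (- a) / real q" using t by auto
    from first_hit_farey_pair_aux[OF farey_pair_reflect[OF e] this Q 2] show ?thesis using 2 ed
      by (simp add: split_pt_def first_hit_uminus field_simps)
  qed
  then show "t < split_pt \<epsilon> a q b y \<Longrightarrow> first_hit \<epsilon> t = q" "t > split_pt \<epsilon> a q b y \<Longrightarrow> first_hit \<epsilon> t = y" by auto
qed

text \<open>Passing from \<open>Q\<close> to \<open>Q + 1\<close>, a tile is either kept or cut at the mediant of its end points.\<close>

lemma farey_pair_exists:
  assumes t: "t \<notin> \<rat>" "0 < t" "t < 1" and "Q \<ge> 1"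
  shows "\<exists>a q b y. farey_pair Q a q b y \<and> 0 \<le> a \<and> of_int a / real q < t \<and> t < of_int b / real y \<and> a < int q"
  using \<open>Q \<ge> 1\<close>
proof (induction Q rule: nat_induct_at_least)
  case base
  show ?case by (rule exI[of _ 0], rule exI[of _ 1], rule exI[of _ 1], rule exI[of _ 1]) (use t in \<open>auto simp: farey_pair_def\<close>)
next
  case (Suc Q)
  then obtain a q b y where e: "farey_pair Q a q b y" "0 \<le> a" "of_int a / real q < t" "t < of_int b / real y" "a < int q" by blast
  show ?case
  proof (cases "q + y > Suc Q")
    case True
    then have "farey_pair (Suc Q) a q b y" using e by (auto simp: farey_pair_def)
    then show ?thesis using e by blast
  next
    case False
    then have s: "q + y = Suc Q" using e by (auto simp: farey_pair_def)
    have q1: "q \<ge> 1" "y \<ge> 1" using e by (auto simp: farey_pair_def)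
    have d: "b * int q - a * int y = 1" using e(1) by (simp add: farey_pair_def)
    have "t \<noteq> of_int (a + b) / real (q + y)" using t by auto
    then consider "t < of_int (a + b) / real (q + y)" | "t > of_int (a + b) / real (q + y)" by linarith
    then show ?thesis
    proof cases
      case 1
      have "(a + b) * int q - a * int (q + y) = 1" using d by (simp add: algebra_simps)
      then have "farey_pair (Suc Q) a q (a + b) (q + y)" using s q1 by (auto simp: farey_pair_def)
      then show ?thesis using 1 e by blast
    next
      case 2
      have "b * int (q + y) - (a + b) * int y = 1" using d by (simp add: algebra_simps)
      then have ed: "farey_pair (Suc Q) (a + b) (q + y) b y" using s q1 by (auto simp: farey_pair_def)
      have "of_int (a + b) / real (q + y) < 1" using 2 t by linarith
      then have "real_of_int (a + b) < real_of_int (int (q + y))" using q1 by (simp add: field_simps)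
      then have lt: "a + b < int (q + y)" by linarith
      have "0 < of_int b / real y" using e t by linarith
      then have "b > 0" using q1 by (simp add: zero_less_divide_iff)
      then show ?thesis using ed 2 e lt by (intro exI[of _ "a + b"] exI[of _ "q + y"] exI[of _ b] exI[of _ y]) auto
    qed
  qed
qed

text \<open>A fraction strictly between the two has denominator at least \<open>q + y\<close>.\<close>

lemma fraction_in_farey_pair:
  assumes e: "farey_pair Q a q b y" and k: "k > 0" and l: "of_int a / real q < of_int p / real k" and u: "of_int p / real k < of_int b / real y"
  shows "k > Q"
proof -
  have q1: "q \<ge> 1" "y \<ge> 1" "Q < q + y" and d: "b * int q - a * int y = 1" using e by (auto simp: farey_pair_def)
  have "real_of_int (a * int k) < real_of_int (p * int q)" using l q1 k by (simp add: field_simps)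
  then have 1: "p * int q - a * int k \<ge> 1" by linarith
  have "real_of_int (p * int y) < real_of_int (b * int k)" using u q1 k by (simp add: field_simps)
  then have 2: "b * int k - p * int y \<ge> 1" by linarith
  have "int k * (b * int q - a * int y) = int q * (b * int k - p * int y) + int y * (p * int q - a * int k)" by (simp add: algebra_simps)
  then have "int k = int q * (b * int k - p * int y) + int y * (p * int q - a * int k)" unfolding d by simp
  moreover have "int q * 1 \<le> int q * (b * int k - p * int y)" "int y * 1 \<le> int y * (p * int q - a * int k)"
    using 1 2 by (intro mult_left_mono; simp)+
  ultimately show ?thesis using q1 by linarith
qed

lemma fraction_unique:
  fixes a a' :: int
  assumes "q \<ge> 1" "q' \<ge> 1" "coprime a (int q)" "coprime a' (int q')" "of_int a / real q = of_int a' / real q'"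
  shows "a = a' \<and> q = q'"
proof -
  have "real_of_int (a * int q') = real_of_int (a' * int q)" using assms by (simp add: field_simps)
  then have eq: "a * int q' = a' * int q" by linarith
  have "int q dvd a * int q'" "int q' dvd a' * int q" unfolding eq by simp (simp add: eq[symmetric])
  then have "int q dvd int q'" "int q' dvd int q" using assms
    by (auto simp: coprime_dvd_mult_right_iff coprime_commute)
  then have "q = q'" by (meson dvd_antisym int_dvd_int_iff)
  then show ?thesis using eq assms by simp
qed

lemma farey_pair_coprime: assumes "farey_pair Q a q b y" shows "coprime a (int q)" "coprime b (int y)"
proof -
  have d: "b * int q - a * int y = 1" using assms by (auto simp: farey_pair_def)
  show "coprime a (int q)"
  proof (rule coprimeI)
    fix c assume "c dvd a" "c dvd int q"
    then have "c dvd b * int q - a * int y" by simp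
    then show "c dvd 1" unfolding d .
  qed
  show "coprime b (int y)"
  proof (rule coprimeI)
    fix c assume "c dvd b" "c dvd int y"
    then have "c dvd b * int q - a * int y" by simp
    then show "c dvd 1" unfolding d .
  qed
qed

lemma farey_pair_unique:
  assumes e: "farey_pair Q a q b y" "farey_pair Q a' q' b' y'"
    and t: "of_int a / real q \<le> t" "t < of_int b / real y" "of_int a' / real q' \<le> t" "t < of_int b' / real y'"
  shows "a = a' \<and> q = q' \<and> b = b' \<and> y = y'"
proof -
  have p: "q > 0" "q \<le> Q" "y > 0" "y \<le> Q" "q' > 0" "q' \<le> Q" "y' > 0" "y' \<le> Q" using e by (auto simp: farey_pair_def)
  have "\<not> of_int a / real q < of_int a' / real q'" using fraction_in_farey_pair[OF e(1) p(5), of a'] t p by linarith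
  moreover have "\<not> of_int a' / real q' < of_int a / real q" using fraction_in_farey_pair[OF e(2) p(1), of a] t p by linarith
  ultimately have "of_int a / real q = of_int a' / real q'" by linarith
  then have 1: "a = a' \<and> q = q'" using p by (intro fraction_unique farey_pair_coprime[OF e(1)] farey_pair_coprime[OF e(2)]) auto
  have "\<not> of_int b / real y < of_int b' / real y'" using fraction_in_farey_pair[OF e(2) p(3), of b] t p by linarith
  moreover have "\<not> of_int b' / real y' < of_int b / real y" using fraction_in_farey_pair[OF e(1) p(7), of b'] t p by linarith
  ultimately have "of_int b / real y = of_int b' / real y'" by linarith
  then have "b = b' \<and> y = y'" using p by (intro fraction_unique farey_pair_coprime[OF e(1)] farey_pair_coprime[OF e(2)]) auto
  with 1 show ?thesis by simp
qed

section \<open>The moments of the first hit\<close>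

text \<open>The function \<open>(\<epsilon> * first_hit \<epsilon> t) powr r\<close> on one tile, extended by 0, and its integral over \<open>{0..u}\<close>. The two pieces
overlap in the splitting point only.\<close>

definition tile_val :: "real \<Rightarrow> real \<Rightarrow> (int \<times> nat \<times> int \<times> nat) \<Rightarrow> real \<Rightarrow> real" where
  "tile_val r \<epsilon> = (\<lambda>(a, q, b, y) t.
     (if t \<in> {of_int a / real q..split_pt \<epsilon> a q b y} then (\<epsilon> * real q) powr r else 0) +
     (if t \<in> {split_pt \<epsilon> a q b y..of_int b / real y} then (\<epsilon> * real y) powr r else 0))"

definition tile_int :: "real \<Rightarrow> real \<Rightarrow> (int \<times> nat \<times> int \<times> nat) \<Rightarrow> real \<Rightarrow> real" where
  "tile_int r \<epsilon> = (\<lambda>(a, q, b, y) u.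
     (\<epsilon> * real q) powr r * max 0 (min (split_pt \<epsilon> a q b y) u - of_int a / real q) +
     (\<epsilon> * real y) powr r * max 0 (min (of_int b / real y) u - split_pt \<epsilon> a q b y))"

definition farey_pairs :: "nat \<Rightarrow> (int \<times> nat \<times> int \<times> nat) set" where
  "farey_pairs Q = {(a, q, b, y). farey_pair Q a q b y \<and> 0 \<le> a \<and> a < int q}"

lemma has_integral_segment:
  fixes c d p u :: real assumes "0 \<le> c"
  shows "((\<lambda>t. if t \<in> {c..d} then p else 0) has_integral p * max 0 (min d u - c)) {0..u}"
proof -
  have "((\<lambda>t. p) has_integral measure lborel {c..min d u} *\<^sub>R p) {c..min d u}"
    by (rule has_integral_const_real)
  moreover have "measure lborel {c..min d u} *\<^sub>R p = p * max 0 (min d u - c)" by (auto simp: max_def)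
  moreover have "{c..d} \<inter> {0..u} = {c..min d u}" using assms by auto
  ultimately show ?thesis by (simp only: has_integral_restrict_Int)
qed

lemma farey_pair_bounds:
  assumes "farey_pair Q a q b y" "0 \<le> a" "a < int q" shows "1 \<le> b" "b \<le> int y"
proof -
  have e: "1 \<le> q" "1 \<le> y" "b * int q - a * int y = 1" using assms by (auto simp: farey_pair_def)
  have "0 \<le> a * int y" using assms by simp
  then have "0 < b * int q" using e by linarith
  then show "1 \<le> b" using e by (simp add: zero_less_mult_iff)
  have "a * int y \<le> (int q - 1) * int y" using assms by (intro mult_right_mono) auto
  then have "b * int q \<le> int q * int y - int y + 1" using e(3) by (simp add: algebra_simps)
  also have "\<dots> \<le> int y * int q" using e by (simp add: algebra_simps)
  finally show "b \<le> int y" using e by simp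
qed

lemma farey_pairs_finite: "finite (farey_pairs Q)"
proof (rule finite_subset)
  show "farey_pairs Q \<subseteq> {0..int Q} \<times> {0..Q} \<times> {0..int Q} \<times> {0..Q}"
  proof (clarsimp simp: farey_pairs_def, goal_cases)
    case (1 a q b y)
    then show ?case using farey_pair_bounds[OF 1(1-3)] by (auto simp: farey_pair_def)
  qed
qed auto

context
  fixes r \<epsilon> :: real and Q :: nat
  assumes r: "r > 0" and e: "0 < \<epsilon>" "\<epsilon> < 1/2" and Q: "Q = max_denom \<epsilon>"
begin

private lemma Q_range': "\<epsilon> * real Q \<le> 1" "1 < \<epsilon> * real Q + \<epsilon>" "Q \<ge> 2"
  using max_denom_facts[OF e] by (auto simp: Q algebra_simps)

lemma split_pt_between:
  assumes E: "farey_pair Q a q b y"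
  shows "of_int a / real q \<le> split_pt \<epsilon> a q b y" "split_pt \<epsilon> a q b y \<le> of_int b / real y"
    "(\<epsilon> * real q) powr r * (split_pt \<epsilon> a q b y - of_int a / real q) + (\<epsilon> * real y) powr r * (of_int b / real y - split_pt \<epsilon> a q b y)
      = tile_mass r \<epsilon> (min q y) (max q y)"
proof -
  have d: "1 \<le> q" "1 \<le> y" "q \<le> Q" "y \<le> Q" using E by (auto simp: farey_pair_def)
  have w: "of_int b / real y - of_int a / real q = 1 / (real q * real y)" by (rule farey_pair_width[OF E])
  have ey: "\<epsilon> * real z \<le> 1" if "z \<le> Q" for z
  proof -
    have "\<epsilon> * real z \<le> \<epsilon> * real Q" using that e by (intro mult_left_mono) auto
    then show ?thesis using Q_range'(1) by linarith
  qed
  have pw: "(\<epsilon> * real z) powr r = (\<epsilon> * real z) * (\<epsilon> * real z) powr (r - 1)" if "z \<ge> 1" for z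
    using powr_mult_base[of "\<epsilon> * real z" "r - 1"] e that by simp
  have gen: "(\<epsilon> * real q) powr r * (\<epsilon> / real q) + (\<epsilon> * real y) powr r * (1 / (real q * real y) - \<epsilon> / real q) = tile_mass r \<epsilon> q y" if "1 \<le> q" "1 \<le> y" for q y
  proof -
    have "(\<epsilon> * real y) powr r * (1 / (real q * real y) - \<epsilon> / real q) = (\<epsilon> / real q) * tile_kernel r (\<epsilon> * real y)"
      unfolding pw[OF that(2)] tile_kernel_def using that by (simp add: field_simps)
    then show ?thesis by (simp add: tile_mass_def algebra_simps)
  qed
  have "of_int a / real q \<le> split_pt \<epsilon> a q b y \<and> split_pt \<epsilon> a q b y \<le> of_int b / real y \<and>
   (\<epsilon> * real q) powr r * (split_pt \<epsilon> a q b y - of_int a / real q) + (\<epsilon> * real y) powr r * (of_int b / real y - split_pt \<epsilon> a q b y)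
      = tile_mass r \<epsilon> (min q y) (max q y)"
  proof (cases "q < y")
    case True
    have s: "split_pt \<epsilon> a q b y = of_int a / real q + \<epsilon> / real q" using True by (simp add: split_pt_def add_divide_distrib)
    have "\<epsilon> / real q \<le> 1 / (real q * real y)" using ey[OF d(4)] d by (simp add: field_simps)
    moreover have ww: "of_int b / real y - (of_int a / real q + \<epsilon> / real q) = 1 / (real q * real y) - \<epsilon> / real q" using w by simp
    ultimately show ?thesis unfolding s ww using w e d True gen[OF d(1,2)] by simp
  next
    case False
    then have yq: "y < q" using farey_pair_neq[OF E Q_range'(3)] by simp
    have s: "split_pt \<epsilon> a q b y = of_int b / real y - \<epsilon> / real y" using yq by (simp add: split_pt_def diff_divide_distrib)
    have "\<epsilon> / real y \<le> 1 / (real q * real y)" using ey[OF d(3)] d by (simp add: field_simps)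
    moreover have ww: "of_int b / real y - \<epsilon> / real y - of_int a / real q = 1 / (real y * real q) - \<epsilon> / real y" using w by (simp add: mult.commute)
    ultimately show ?thesis unfolding s ww using w e d yq gen[OF d(2,1)] by (simp add: add.commute)
  qed
  then show "of_int a / real q \<le> split_pt \<epsilon> a q b y" "split_pt \<epsilon> a q b y \<le> of_int b / real y"
    "(\<epsilon> * real q) powr r * (split_pt \<epsilon> a q b y - of_int a / real q) + (\<epsilon> * real y) powr r * (of_int b / real y - split_pt \<epsilon> a q b y)
      = tile_mass r \<epsilon> (min q y) (max q y)" by auto
qed

lemma tile_int_bounds:
  assumes E: "farey_pair Q a q b y"
  shows "0 \<le> tile_int r \<epsilon> (a, q, b, y) u" "tile_int r \<epsilon> (a, q, b, y) u \<le> tile_mass r \<epsilon> (min q y) (max q y)"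
    "of_int b / real y \<le> u \<Longrightarrow> tile_int r \<epsilon> (a, q, b, y) u = tile_mass r \<epsilon> (min q y) (max q y)"
    "u \<le> of_int a / real q \<Longrightarrow> tile_int r \<epsilon> (a, q, b, y) u = 0"
proof -
  note s = split_pt_between[OF E]
  show "0 \<le> tile_int r \<epsilon> (a, q, b, y) u" by (simp add: tile_int_def)
  show "tile_int r \<epsilon> (a, q, b, y) u \<le> tile_mass r \<epsilon> (min q y) (max q y)"
    unfolding s(3)[symmetric] tile_int_def prod.case using s(1,2)
    by (intro add_mono mult_left_mono) auto
  show "tile_int r \<epsilon> (a, q, b, y) u = tile_mass r \<epsilon> (min q y) (max q y)" if "of_int b / real y \<le> u"
    unfolding s(3)[symmetric] tile_int_def prod.case using s(1,2) that by (simp add: min_absorb1 max_absorb2)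
  show "tile_int r \<epsilon> (a, q, b, y) u = 0" if "u \<le> of_int a / real q"
  proof -
    have "min (split_pt \<epsilon> a q b y) u - of_int a / real q \<le> 0" "min (of_int b / real y) u - split_pt \<epsilon> a q b y \<le> 0"
      using that s(1) by auto
    then show ?thesis by (simp add: tile_int_def max_absorb1)
  qed
qed

lemma tile_val_integral:
  assumes "e \<in> farey_pairs Q" shows "(tile_val r \<epsilon> e has_integral tile_int r \<epsilon> e u) {0..u}"
proof -
  obtain a q b y where ed: "e = (a, q, b, y)" by (metis surj_pair)
  have E: "farey_pair Q a q b y" "0 \<le> a" using assms by (auto simp: farey_pairs_def ed)
  have "0 \<le> of_int a / real q" using E by simp
  moreover have "0 \<le> split_pt \<epsilon> a q b y" using split_pt_between(1)[OF E(1)] calculation by linarith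
  ultimately show ?thesis unfolding ed tile_val_def tile_int_def prod.case
    by (intro has_integral_add has_integral_segment)
qed

text \<open>An irrational point lies in exactly one tile. The finitely many splitting points, where the value of
\<open>tile_val\<close> is wrong, and the rationals form a null set.\<close>

lemma first_hit_eq_sum_tiles:
  assumes t: "t \<notin> \<rat>" "0 < t" "t < 1" and s: "\<And>a q b y. (a, q, b, y) \<in> farey_pairs Q \<Longrightarrow> t \<noteq> split_pt \<epsilon> a q b y"
  shows "(\<epsilon> * real (first_hit \<epsilon> t)) powr r = (\<Sum>e\<in>farey_pairs Q. tile_val r \<epsilon> e t)"
proof -
  have "Q \<ge> 1" using Q_range' by simp
  from farey_pair_exists[OF t this] obtain a q b y where E: "farey_pair Q a q b y" "0 \<le> a" "of_int a / real q < t" "t < of_int b / real y" "a < int q" by blast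
  have m: "(a, q, b, y) \<in> farey_pairs Q" using E by (simp add: farey_pairs_def)
  have z: "tile_val r \<epsilon> e t = 0" if e': "e \<in> farey_pairs Q - {(a, q, b, y)}" for e
  proof -
    obtain a' q' b' y' where ed: "e = (a', q', b', y')" by (metis surj_pair)
    have E': "farey_pair Q a' q' b' y'" using e' by (auto simp: farey_pairs_def ed)
    have ne: "t \<noteq> of_int a' / real q'" "t \<noteq> of_int b' / real y'" using t(1) by auto
    have "\<not> (of_int a' / real q' \<le> t \<and> t < of_int b' / real y')"
    proof
      assume "of_int a' / real q' \<le> t \<and> t < of_int b' / real y'"
      then have "a = a' \<and> q = q' \<and> b = b' \<and> y = y'" using farey_pair_unique[OF E(1) E', of t] E(3,4) by simp
      then show False using e' ed by simp
    qed
    then have "t < of_int a' / real q' \<or> t > of_int b' / real y'" using ne by linarith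
    then show ?thesis using split_pt_between(1,2)[OF E'] unfolding ed tile_val_def prod.case by (elim disjE) simp_all
  qed
  have "(\<Sum>e\<in>farey_pairs Q. tile_val r \<epsilon> e t) = tile_val r \<epsilon> (a, q, b, y) t"
    using farey_pairs_finite m z by (subst sum.remove[of _ "(a, q, b, y)"]) (auto intro!: sum.neutral)
  also have "\<dots> = (\<epsilon> * real (first_hit \<epsilon> t)) powr r"
  proof -
    note N = first_hit_farey_pair[OF E(1,3,4) Q_range'(3,1) e(1) Q_range'(2)]
    have "t < split_pt \<epsilon> a q b y \<or> t > split_pt \<epsilon> a q b y" using s[OF m] by linarith
    then show ?thesis using N E(3,4) by (auto simp: tile_val_def)
  qed
  finally show ?thesis ..
qed

lemma first_hit_has_integral:
  assumes u: "u \<le> 1"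
  shows "((\<lambda>t. (\<epsilon> * real (first_hit \<epsilon> t)) powr r) has_integral (\<Sum>e\<in>farey_pairs Q. tile_int r \<epsilon> e u)) {0..u}"
proof -
  let ?S = "(\<rat> :: real set) \<union> (\<lambda>(a, q, b, y). split_pt \<epsilon> a q b y) ` farey_pairs Q"
  have "countable ?S" using farey_pairs_finite[of Q] by (auto intro: countable_rat countable_finite)
  then have "?S \<in> null_sets lborel" by (rule countable_imp_null_set_lborel)
  then have N: "negligible ?S" unfolding negligible_iff_null_sets by (rule null_sets_completionI)
  show ?thesis
  proof (rule has_integral_spike[OF N])
    show "((\<lambda>t. \<Sum>e\<in>farey_pairs Q. tile_val r \<epsilon> e t) has_integral (\<Sum>e\<in>farey_pairs Q. tile_int r \<epsilon> e u)) {0..u}"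
      by (intro has_integral_sum farey_pairs_finite tile_val_integral)
    fix t assume t: "t \<in> {0..u} - ?S"
    then have "t \<notin> \<rat>" by auto
    then have "t \<noteq> 0" "t \<noteq> 1" by auto
    show "(\<epsilon> * real (first_hit \<epsilon> t)) powr r = (\<Sum>e\<in>farey_pairs Q. tile_val r \<epsilon> e t)"
    proof (rule first_hit_eq_sum_tiles)
      show "t \<notin> \<rat>" by fact
      show "0 < t" "t < 1" using t u \<open>t \<noteq> 0\<close> \<open>t \<noteq> 1\<close> by auto
    qed (use t in force)
  qed
qed

end

lemma sum_triples:
  fixes F :: "nat \<Rightarrow> nat \<Rightarrow> real"
  assumes "finite A" "\<And>q. finite (B q)" "\<And>q x. finite (D q x)"
  shows "(\<Sum>(q, x, a)\<in>(SIGMA q:A. SIGMA x:B q. D q x). F q x) = (\<Sum>q\<in>A. \<Sum>x\<in>B q. F q x * real (card (D q x)))"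
proof -
  have "(\<Sum>(q, x, a)\<in>(SIGMA q:A. SIGMA x:B q. D q x). F q x) = (\<Sum>q\<in>A. \<Sum>(x, a)\<in>(SIGMA x:B q. D q x). F q x)"
    by (subst sum.Sigma) (use assms in \<open>auto simp: case_prod_unfold\<close>)
  also have "\<dots> = (\<Sum>q\<in>A. \<Sum>x\<in>B q. \<Sum>a\<in>D q x. F q x)"
    by (intro sum.cong refl, subst sum.Sigma) (use assms in \<open>auto simp: case_prod_unfold\<close>)
  also have "\<dots> = (\<Sum>q\<in>A. \<Sum>x\<in>B q. F q x * real (card (D q x)))"
    by (simp add: mult.commute)
  finally show ?thesis .
qed

lemma cong_neg_iff: "[- (int x * a) = 1] (mod int q) \<longleftrightarrow> int q dvd a * int x + 1"
proof -
  have "- (int x * a) - 1 = - (a * int x + 1)" by simp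
  then show ?thesis unfolding cong_iff_dvd_diff by (simp only: dvd_minus_iff)
qed

lemma cong_pos_iff: "[int x * a = 1] (mod int q) \<longleftrightarrow> int q dvd a * int x - 1"
proof -
  have "int x * a - 1 = a * int x - 1" by simp
  then show ?thesis unfolding cong_iff_dvd_diff by (simp only:)
qed

lemma tile_sum_R:
  "(\<Sum>q=1..Q. \<Sum>x\<in>{min_partner Q q<..Q}. F q x * real (count_right u q x))
    = (\<Sum>(a, q, b, y)\<in>{(a, q, b, y). (a, q, b, y) \<in> farey_pairs Q \<and> q < y \<and> of_int a \<le> u * real q}. F q y)"
proof -
  let ?D = "\<lambda>q x. {a \<in> {0..<int q}. [- 1 * int x * a = 1] (mod int q) \<and> real_of_int a \<le> u * real q}"
  have "(\<Sum>q=1..Q. \<Sum>x\<in>{min_partner Q q<..Q}. F q x * real (count_right u q x)) = (\<Sum>(q, x, a)\<in>(SIGMA q:{1..Q}. SIGMA x:{min_partner Q q<..Q}. ?D q x). F q x)"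
    unfolding count_right_def by (subst sum_triples) (auto intro: finite_subset[of _ "{0..<int q}" for q])
  also have "\<dots> = (\<Sum>(a, q, b, y)\<in>{(a, q, b, y). (a, q, b, y) \<in> farey_pairs Q \<and> q < y \<and> of_int a \<le> u * real q}. F q y)"
  proof (rule sum.reindex_bij_witness[where i = "\<lambda>(a, q, b, y). (q, y, a)" and j = "\<lambda>(q, x, a). (a, q, (a * int x + 1) div int q, x)"], goal_cases)
    case (1 z)
    then obtain q x a where z: "z = (q, x, a)" by (metis surj_pair)
    show ?case by (simp add: z)
  next
    case (2 z)
    then obtain q x a where z: "z = (q, x, a)" by (metis surj_pair)
    have m: "1 \<le> q" "q \<le> Q" "min_partner Q q < x" "x \<le> Q" "0 \<le> a" "a < int q" "int q dvd a * int x + 1" "real_of_int a \<le> u * real q"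
      using 2 unfolding z by (auto simp: cong_neg_iff)
    have "((a * int x + 1) div int q) * int q - a * int x = 1" using m(7) by simp
    moreover have "Q < q + x" "q < x" "1 \<le> x" using m unfolding min_partner_def by auto
    ultimately have "farey_pair Q a q ((a * int x + 1) div int q) x" using m unfolding farey_pair_def by auto
    then show ?case using m \<open>q < x\<close> by (simp add: z farey_pairs_def)
  next
    case (3 z)
    then obtain a q b y where z: "z = (a, q, b, y)" by (metis surj_pair)
    have E: "farey_pair Q a q b y" "q \<ge> 1" using 3 by (auto simp: z farey_pairs_def farey_pair_def)
    then have "b * int q - a * int y = 1" by (simp add: farey_pair_def)
    then have "a * int y + 1 = b * int q" by simp
    then show ?case using E(2) by (simp add: z)
  next
    case (4 z)
    then obtain a q b y where z: "z = (a, q, b, y)" by (metis surj_pair)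
    have E: "farey_pair Q a q b y" "q < y" "0 \<le> a" "a < int q" "real_of_int a \<le> u * real q" using 4 by (auto simp: z farey_pairs_def)
    then have d: "b * int q - a * int y = 1" "1 \<le> q" "q \<le> Q" "y \<le> Q" "Q < q + y" by (auto simp: farey_pair_def)
    have "a * int y + 1 = b * int q" using d by simp
    then have "int q dvd a * int y + 1" by simp
    moreover have "min_partner Q q < y" using E d unfolding min_partner_def by auto
    ultimately show ?case using E d by (simp add: z cong_neg_iff)
  next
    case (5 z)
    then obtain q x a where z: "z = (q, x, a)" by (metis surj_pair)
    show ?case by (simp add: z)
  qed
  finally show ?thesis .
qed

lemma tile_sum_L:
  "(\<Sum>q=1..Q. \<Sum>x\<in>{min_partner Q q<..Q}. F q x * real (count_left u q x))
    = (\<Sum>(a, q, b, y)\<in>{(a, q, b, y). (a, q, b, y) \<in> farey_pairs Q \<and> y < q \<and> of_int b \<le> u * real y}. F y q)"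
proof -
  let ?D = "\<lambda>q x. {a \<in> {1..int q}. [1 * int x * a = 1] (mod int q) \<and> real_of_int a \<le> u * real q}"
  have "(\<Sum>q=1..Q. \<Sum>x\<in>{min_partner Q q<..Q}. F q x * real (count_left u q x)) = (\<Sum>(q, x, a)\<in>(SIGMA q:{1..Q}. SIGMA x:{min_partner Q q<..Q}. ?D q x). F q x)"
    unfolding count_left_def by (subst sum_triples) (auto intro: finite_subset[of _ "{1..int q}" for q])
  also have "\<dots> = (\<Sum>(a, q, b, y)\<in>{(a, q, b, y). (a, q, b, y) \<in> farey_pairs Q \<and> y < q \<and> of_int b \<le> u * real y}. F y q)"
  proof (rule sum.reindex_bij_witness[where i = "\<lambda>(a, q, b, y). (y, q, b)" and j = "\<lambda>(y, q, b). ((b * int q - 1) div int y, q, b, y)"], goal_cases)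
    case (1 z)
    then obtain y q b where z: "z = (y, q, b)" by (metis surj_pair)
    show ?case by (simp add: z)
  next
    case (2 z)
    then obtain y q b where z: "z = (y, q, b)" by (metis surj_pair)
    have m: "1 \<le> y" "y \<le> Q" "min_partner Q y < q" "q \<le> Q" "1 \<le> b" "b \<le> int y" "int y dvd b * int q - 1" "real_of_int b \<le> u * real y"
      using 2 unfolding z by (auto simp: cong_pos_iff)
    define a where "a = (b * int q - 1) div int y"
    have ay: "a * int y = b * int q - 1" using m(7) by (simp add: a_def)
    have lt: "Q < q + y" "y < q" "1 \<le> q" using m unfolding min_partner_def by auto
    have E: "farey_pair Q a q b y" using m lt ay unfolding farey_pair_def by auto
    have "1 * 1 \<le> b * int q" using m lt by (intro mult_mono) auto
    then have "0 \<le> a * int y" unfolding ay by simp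
    then have "0 \<le> a" using m by (simp add: zero_le_mult_iff)
    have "b * int q \<le> int y * int q" using m by (intro mult_right_mono) auto
    then have "a * int y < int q * int y" unfolding ay by (simp add: mult.commute)
    then have "a < int q" by (simp add: mult_less_cancel_right)
    then show ?case using m lt E \<open>0 \<le> a\<close> by (simp add: z farey_pairs_def a_def[symmetric])
  next
    case (3 z)
    then obtain a q b y where z: "z = (a, q, b, y)" by (metis surj_pair)
    have E: "farey_pair Q a q b y" "y \<ge> 1" using 3 by (auto simp: z farey_pairs_def farey_pair_def)
    then have "b * int q - a * int y = 1" by (simp add: farey_pair_def)
    then have "b * int q - 1 = a * int y" by simp
    then show ?case using E(2) by (simp add: z)
  next
    case (4 z)
    then obtain a q b y where z: "z = (a, q, b, y)" by (metis surj_pair)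
    have E: "farey_pair Q a q b y" "y < q" "0 \<le> a" "a < int q" "real_of_int b \<le> u * real y" using 4 by (auto simp: z farey_pairs_def)
    then have d: "b * int q - a * int y = 1" "1 \<le> y" "q \<le> Q" "y \<le> Q" "Q < q + y" by (auto simp: farey_pair_def)
    have "b * int q - 1 = a * int y" using d by simp
    then have "int y dvd b * int q - 1" by simp
    moreover have "min_partner Q y < q" using E d unfolding min_partner_def by auto
    moreover note farey_pair_bounds[OF E(1,3,4)]
    ultimately show ?case using E d by (simp add: z cong_pos_iff)
  next
    case (5 z)
    then obtain y q b where z: "z = (y, q, b)" by (metis surj_pair)
    show ?case by (simp add: z)
  qed
  finally show ?thesis .
qed

text \<open>The convention by which \<open>count_right\<close> and \<open>count_left\<close> decide whether a tile belongs to \<open>{0..u}\<close>; it differs from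
true inclusion only for the tile that contains \<open>u\<close>.\<close>

definition counted :: "real \<Rightarrow> (int \<times> nat \<times> int \<times> nat) \<Rightarrow> bool" where
  "counted u = (\<lambda>(a, q, b, y). if q < y then of_int a \<le> u * real q else of_int b \<le> u * real y)"

lemma tile_sum_farey_pairs:
  assumes r: "r > 0" and e: "0 < \<epsilon>" "\<epsilon> < 1/2"
  shows "tile_sum r \<epsilon> u = (\<Sum>z\<in>farey_pairs (max_denom \<epsilon>). if counted u z then (case z of (a, q, b, y) \<Rightarrow> tile_mass r \<epsilon> (min q y) (max q y)) else 0)"
proof -
  define Q where "Q = max_denom \<epsilon>"
  let ?W = "\<lambda>(a, q, b, y). tile_mass r \<epsilon> (min q y) (max q y)"
  let ?R = "{(a, q, b, y). (a, q, b, y) \<in> farey_pairs Q \<and> q < y \<and> real_of_int a \<le> u * real q}"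
  let ?L = "{(a, q, b, y). (a, q, b, y) \<in> farey_pairs Q \<and> y < q \<and> real_of_int b \<le> u * real y}"
  have fin: "finite ?R" "finite ?L" by (rule finite_subset[OF _ farey_pairs_finite[of Q]], auto)+
  have "tile_sum r \<epsilon> u = (\<Sum>q=1..Q. \<Sum>x\<in>{min_partner Q q<..Q}. tile_mass r \<epsilon> q x * real (count_right u q x)) + (\<Sum>q=1..Q. \<Sum>x\<in>{min_partner Q q<..Q}. tile_mass r \<epsilon> q x * real (count_left u q x))"
    unfolding tile_sum_def Q_def[symmetric] by (simp only: of_nat_add distrib_left sum.distrib)
  also have "\<dots> = (\<Sum>z\<in>?R. ?W z) + (\<Sum>z\<in>?L. ?W z)"
    unfolding tile_sum_R tile_sum_L by (intro arg_cong2[of _ _ _ _ "(+)"] sum.cong refl) auto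
  also have "\<dots> = (\<Sum>z\<in>?R \<union> ?L. ?W z)"
    by (rule sum.union_disjoint[symmetric]) (use fin in auto)
  also have "?R \<union> ?L = {z \<in> farey_pairs Q. counted u z}"
  proof (rule Set.set_eqI)
    fix z :: "int \<times> nat \<times> int \<times> nat"
    obtain a q b y where z: "z = (a, q, b, y)" by (metis surj_pair)
    have "q \<noteq> y" if "(a, q, b, y) \<in> farey_pairs Q" using farey_pair_neq[OF _ max_denom_facts(3)[OF e]] that by (auto simp: farey_pairs_def Q_def)
    then show "z \<in> ?R \<union> ?L \<longleftrightarrow> z \<in> {z \<in> farey_pairs Q. counted u z}" unfolding z counted_def by auto
  qed
  also have "(\<Sum>z\<in>{z \<in> farey_pairs Q. counted u z}. ?W z) = (\<Sum>z\<in>farey_pairs Q. if counted u z then ?W z else 0)"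
    by (simp add: sum.inter_filter farey_pairs_finite)
  finally show ?thesis unfolding Q_def .
qed

lemma tile_mass_bound:
  assumes r: "r > 0" and e: "0 < \<epsilon>" "\<epsilon> < 1/2" and E: "farey_pair (max_denom \<epsilon>) a q b y"
  shows "\<bar>tile_mass r \<epsilon> (min q y) (max q y)\<bar> \<le> \<epsilon> * (1 + lip_const r)"
proof -
  define Q m n where "Q = max_denom \<epsilon>" and "m = min q y" and "n = max q y"
  have QQ: "\<epsilon> * real Q \<le> 1" "1 < \<epsilon> * (real Q + 1)" using max_denom_facts[OF e] by (auto simp: Q_def)
  have mn: "1 \<le> m" "m \<le> Q" "n \<le> Q" "Q + 1 \<le> 2 * n" using E by (auto simp: farey_pair_def m_def n_def Q_def)
  have le1: "\<epsilon> * real z \<le> 1" if "z \<le> Q" for z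
  proof -
    have "\<epsilon> * real z \<le> \<epsilon> * real Q" using that e by (intro mult_left_mono) auto
    then show ?thesis using QQ(1) by linarith
  qed
  have "real Q + 1 \<le> 2 * real n" using mn(4) by linarith
  then have "\<epsilon> * (real Q + 1) \<le> \<epsilon> * (2 * real n)" using e by (intro mult_left_mono) auto
  then have "1/4 \<le> \<epsilon> * real n" using QQ by linarith
  then have k: "\<bar>tile_kernel r (\<epsilon> * real n)\<bar> \<le> lip_const r" by (rule tile_kernel_bound) (rule le1[OF mn(3)])
  have p: "0 \<le> (\<epsilon> * real m) powr r" "(\<epsilon> * real m) powr r \<le> 1"
    using le1[OF mn(2)] e r powr_mono2[of r "\<epsilon> * real m" 1] by auto
  have "\<bar>tile_mass r \<epsilon> m n\<bar> = (\<epsilon> / real m) * \<bar>(\<epsilon> * real m) powr r + tile_kernel r (\<epsilon> * real n)\<bar>"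
    using e by (simp add: tile_mass_def abs_mult)
  also have "\<dots> \<le> \<epsilon> * (1 + lip_const r)"
  proof (rule mult_mono)
    have "\<epsilon> / real m \<le> \<epsilon> / 1" using e mn by (intro divide_left_mono) auto
    then show "\<epsilon> / real m \<le> \<epsilon>" by simp
    show "\<bar>(\<epsilon> * real m) powr r + tile_kernel r (\<epsilon> * real n)\<bar> \<le> 1 + lip_const r" using k p by linarith
  qed (use e in auto)
  finally show ?thesis by (simp only: m_def n_def)
qed

text \<open>A tile to the left of \<open>u\<close> contributes its whole mass to both sums, a tile to the right contributes nothing,
and at most one tile contains \<open>u\<close> by \<open>farey_pair_unique\<close>.\<close>

lemma tile_boundary_error:
  assumes r: "r > 0" and e: "0 < \<epsilon>" "\<epsilon> < 1/2"
  shows "\<bar>(\<Sum>z\<in>farey_pairs (max_denom \<epsilon>). tile_int r \<epsilon> z u) - tile_sum r \<epsilon> u\<bar> \<le> \<epsilon> * (1 + lip_const r)"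
proof -
  define Q where "Q = max_denom \<epsilon>"
  let ?W = "\<lambda>(a, q, b, y). tile_mass r \<epsilon> (min q y) (max q y)"
  let ?B = "{(a, q, b, y). (a, q, b, y) \<in> farey_pairs Q \<and> of_int a / real q \<le> u \<and> u < of_int b / real y}"
  have fin: "finite ?B" by (rule finite_subset[OF _ farey_pairs_finite[of Q]]) auto
  have c: "card ?B \<le> 1"
    unfolding One_nat_def card_le_Suc0_iff_eq[OF fin]
  proof (intro ballI)
    fix z z' assume "z \<in> ?B" "z' \<in> ?B"
    moreover obtain a q b y where z: "z = (a, q, b, y)" by (metis surj_pair)
    moreover obtain a' q' b' y' where z': "z' = (a', q', b', y')" by (metis surj_pair)
    ultimately show "z = z'" using farey_pair_unique[of Q a q b y a' q' b' y' u] by (simp add: farey_pairs_def)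
  qed
  have one: "\<bar>tile_int r \<epsilon> z u - (if counted u z then ?W z else 0)\<bar> \<le> (if z \<in> ?B then \<epsilon> * (1 + lip_const r) else 0)"
    if z: "z \<in> farey_pairs Q" for z
  proof -
    obtain a q b y where zz: "z = (a, q, b, y)" by (metis surj_pair)
    have E: "farey_pair (max_denom \<epsilon>) a q b y" using z by (auto simp: zz farey_pairs_def Q_def)
    then have p: "0 < real q" "0 < real y" by (auto simp: farey_pair_def)
    note T = tile_int_bounds[OF r e refl E, of u]
    have ge0: "0 \<le> tile_mass r \<epsilon> (min q y) (max q y)" using T(1,2) by linarith
    have cR: "real_of_int a \<le> u * real q \<longleftrightarrow> of_int a / real q \<le> u" and cL: "real_of_int b \<le> u * real y \<longleftrightarrow> of_int b / real y \<le> u"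
      using p by (auto simp: divide_le_eq)
    have width: "of_int a / real q < of_int b / real y" 
    proof -
      have "0 < 1 / (real q * real y)" using p by simp
      then show ?thesis using farey_pair_width[OF E] by linarith
    qed
    have W: "?W z = tile_mass r \<epsilon> (min q y) (max q y)" by (simp only: zz prod.case)
    have cz: "counted u z \<longleftrightarrow> (if q < y then of_int a / real q \<le> u else of_int b / real y \<le> u)"
      by (simp only: counted_def zz prod.case cR cL)
    have zB: "z \<in> ?B \<longleftrightarrow> of_int a / real q \<le> u \<and> u < of_int b / real y" using z by (simp add: zz)
    have gen: "0 \<le> T \<Longrightarrow> T \<le> v \<Longrightarrow> 0 \<le> v \<Longrightarrow> \<bar>T - (if c then v else 0)\<bar> \<le> v" for T v :: real and c by simp
    show ?thesis
    proof (cases "z \<in> ?B")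
      case True
      have "\<bar>tile_int r \<epsilon> z u - (if counted u z then ?W z else 0)\<bar> \<le> tile_mass r \<epsilon> (min q y) (max q y)"
        unfolding W using gen[OF T(1,2) ge0] by (simp only: zz)
      also have "\<dots> \<le> \<epsilon> * (1 + lip_const r)" using tile_mass_bound[OF r e E] by linarith
      finally show ?thesis by (simp only: True if_True)
    next
      case False
      then consider "u < of_int a / real q" | "of_int b / real y \<le> u" unfolding zB by linarith
      then show ?thesis
      proof cases
        case 1
        then have "\<not> counted u z" using width unfolding cz by auto
        moreover have "tile_int r \<epsilon> z u = 0" unfolding zz by (rule T(4)) (use 1 in simp)
        ultimately show ?thesis using False by (simp only: if_False diff_self abs_zero order_refl)
      next
        case 2
        then have "counted u z" using width unfolding cz by auto
        moreover have "tile_int r \<epsilon> z u = ?W z" unfolding W unfolding zz by (rule T(3)[OF 2])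
        ultimately show ?thesis using False by (simp only: if_False if_True diff_self abs_zero order_refl)
      qed
    qed
  qed
  have "\<bar>(\<Sum>z\<in>farey_pairs Q. tile_int r \<epsilon> z u) - tile_sum r \<epsilon> u\<bar> = \<bar>\<Sum>z\<in>farey_pairs Q. tile_int r \<epsilon> z u - (if counted u z then ?W z else 0)\<bar>"
    unfolding tile_sum_farey_pairs[OF r e] sum_subtractf Q_def[symmetric] ..
  also have "\<dots> \<le> (\<Sum>z\<in>farey_pairs Q. if z \<in> ?B then \<epsilon> * (1 + lip_const r) else 0)"
    by (rule order_trans[OF sum_abs sum_mono[OF one]])
  also have "\<dots> = (\<Sum>z\<in>?B. \<epsilon> * (1 + lip_const r))"
    by (rule sum.mono_neutral_cong_right) (use farey_pairs_finite in auto)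
  also have "\<dots> = real (card ?B) * (\<epsilon> * (1 + lip_const r))" by simp
  also have "\<dots> \<le> 1 * (\<epsilon> * (1 + lip_const r))"
    using c e lip_const_pos[of r] by (intro mult_right_mono) auto
  finally show ?thesis by (simp add: Q_def)
qed

text \<open>The exact tiling, its boundary error, the error of the main term and the average of the discrepancies
add up to \<open>\<epsilon> * Q powr (1/2 + \<delta>)\<close> with \<open>Q \<le> 1 / \<epsilon>\<close>.\<close>

theorem first_hit_moment:
  assumes r: "r > 0" and d: "\<delta> > 0" "\<delta> \<le> 1/2"
  shows "\<exists>C\<ge>0. \<forall>\<epsilon> u. 0 < \<epsilon> \<and> \<epsilon> < 1/2 \<and> 0 \<le> u \<and> u \<le> 1 \<longrightarrow>
    (\<lambda>t. (\<epsilon> * real (first_hit \<epsilon> t)) powr r) integrable_on {0..u} \<and>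
    \<bar>integral {0..u} (\<lambda>t. (\<epsilon> * real (first_hit \<epsilon> t)) powr r) - moment_const r * u\<bar> \<le> C * \<epsilon> powr (1/2 - \<delta>)"
proof -
  obtain C1 where C1: "C1 \<ge> 0" "\<And>Q. Q > 0 \<Longrightarrow> (\<Sum>q=1..Q. box_err q / real q) \<le> C1 * real Q powr (1/2 + \<delta>)"
    using sum_box_err[OF d(1)] by blast
  obtain C2 where C2: "C2 \<ge> 1" "\<And>n. n > 0 \<Longrightarrow> harm n \<le> C2 * real n powr \<delta>"
    using harm_powr_bound[OF d(1)] by blast
  define C where "C = 250 * (1 + lip_const r) * (C1 + 1 + C2) + (1 + lip_const r)"
  have K0: "lip_const r > 0" by (rule lip_const_pos)
  show ?thesis
  proof (intro exI[of _ C] conjI allI impI)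
    show "C \<ge> 0" using K0 C1 C2 by (simp add: C_def)
    fix \<epsilon> u :: real assume A: "0 < \<epsilon> \<and> \<epsilon> < 1/2 \<and> 0 \<le> u \<and> u \<le> 1"
    then have e: "0 < \<epsilon>" "\<epsilon> < 1/2" and u: "0 \<le> u" "u \<le> 1" by auto
    define Q where "Q = max_denom \<epsilon>"
    have QQ: "\<epsilon> * real Q \<le> 1" "Q > 0" using max_denom_facts[OF e] by (auto simp: Q_def)
    note I = first_hit_has_integral[OF r e refl u(2)]
    show "(\<lambda>t. (\<epsilon> * real (first_hit \<epsilon> t)) powr r) integrable_on {0..u}" using I by blast
    define P where "P = \<epsilon> powr (- (1/2 + \<delta>))"
    have Q1: "real Q \<le> 1 / \<epsilon>" using QQ e by (simp add: field_simps)
    have P1: "P \<ge> 1" unfolding P_def powr_minus using e d powr_le1[of "1/2 + \<delta>" \<epsilon>] by (simp add: one_le_inverse)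
    have pw: "real Q powr s \<le> P" if "0 \<le> s" "s \<le> 1/2 + \<delta>" for s
    proof -
      have "real Q powr s \<le> (1 / \<epsilon>) powr s" using Q1 that by (intro powr_mono2) auto
      also have "\<dots> \<le> (1 / \<epsilon>) powr (1/2 + \<delta>)" using e that by (intro powr_mono) auto
      also have "\<dots> = inverse (\<epsilon> powr (1/2 + \<delta>))" using e by (simp add: powr_divide inverse_eq_divide)
      also have "\<dots> = P" unfolding P_def powr_minus ..
      finally show ?thesis .
    qed
    have "(\<Sum>q=1..Q. box_err q / real q) \<le> C1 * P"
      using order_trans[OF C1(2)[OF QQ(2)] mult_left_mono[OF pw[of "1/2 + \<delta>"] C1(1)]] d by simp
    moreover have "harm Q \<le> C2 * P"
      using order_trans[OF C2(2)[OF QQ(2)] mult_left_mono[OF pw[of \<delta>]]] C2(1) d by simp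
    ultimately have S: "(\<Sum>q=1..Q. box_err q / real q) + 1 + harm Q \<le> (C1 + 1 + C2) * P"
      using P1 by (simp add: distrib_right)
    have "\<bar>tile_sum r \<epsilon> u - moment_const r * u\<bar> \<le> \<epsilon> * (250 * (1 + lip_const r) * ((\<Sum>q=1..Q. box_err q / real q) + 1 + harm Q))"
      by (rule tile_sum_error[OF r e Q_def u])
    also have "\<dots> \<le> \<epsilon> * (250 * (1 + lip_const r) * ((C1 + 1 + C2) * P))"
      using S e K0 by (intro mult_left_mono) auto
    finally have 1: "\<bar>tile_sum r \<epsilon> u - moment_const r * u\<bar> \<le> \<epsilon> * (250 * (1 + lip_const r) * ((C1 + 1 + C2) * P))" .
    have 2: "\<bar>integral {0..u} (\<lambda>t. (\<epsilon> * real (first_hit \<epsilon> t)) powr r) - tile_sum r \<epsilon> u\<bar> \<le> \<epsilon> * (1 + lip_const r)"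
      using tile_boundary_error[OF r e, of u] integral_unique[OF I] by simp
    have 3: "\<epsilon> * (1 + lip_const r) \<le> \<epsilon> * ((1 + lip_const r) * P)"
    proof (rule mult_left_mono)
      show "1 + lip_const r \<le> (1 + lip_const r) * P" using mult_left_mono[OF P1, of "1 + lip_const r"] K0 by simp
    qed (use e in simp)
    have "\<epsilon> powr (1/2 - \<delta>) = \<epsilon> powr (1 + (- (1/2 + \<delta>)))" by (rule arg_cong) simp
    also have "\<dots> = \<epsilon> powr 1 * P" unfolding P_def by (rule powr_add)
    finally have eP: "\<epsilon> * P = \<epsilon> powr (1/2 - \<delta>)" using e by simp
    have "\<bar>integral {0..u} (\<lambda>t. (\<epsilon> * real (first_hit \<epsilon> t)) powr r) - moment_const r * u\<bar> \<le> \<epsilon> * (250 * (1 + lip_const r) * ((C1 + 1 + C2) * P)) + \<epsilon> * ((1 + lip_const r) * P)"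
      using 1 2 3 by linarith
    also have "\<dots> = C * (\<epsilon> * P)" by (simp add: C_def algebra_simps)
    finally show "\<bar>integral {0..u} (\<lambda>t. (\<epsilon> * real (first_hit \<epsilon> t)) powr r) - moment_const r * u\<bar> \<le> C * \<epsilon> powr (1/2 - \<delta>)"
      by (simp only: eP)
  qed
qed

section \<open>From the first hit to the free path\<close>

definition hits :: "real \<Rightarrow> real \<Rightarrow> nat set" where
  "hits \<epsilon> t = {k. k > 0 \<and> (\<exists>n::int. \<bar>real k * t - of_int n\<bar> \<le> \<epsilon>)}"

text \<open>Dirichlet's approximation theorem with \<open>max_denom \<epsilon> + 1\<close>, whose reciprocal is below \<open>\<epsilon>\<close>.\<close>

lemma hits_bounded: assumes e: "0 < \<epsilon>" "\<epsilon> < 1/2" shows "\<exists>k\<in>hits \<epsilon> t. \<epsilon> * real k \<le> 3/2"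
proof -
  have "max_denom \<epsilon> + 1 > 0" by simp
  from Dirichlet_approx[OF this, of t] obtain h k where hk: "0 < k" "k \<le> int (max_denom \<epsilon> + 1)" "\<bar>of_int k * t - of_int h\<bar> < 1 / real (max_denom \<epsilon> + 1)"
    by metis
  have "1 / real (max_denom \<epsilon> + 1) < \<epsilon>" using max_denom_facts(2)[OF e] by (simp add: field_simps)
  then have "\<bar>of_int k * t - of_int h\<bar> \<le> \<epsilon>" using hk(3) by linarith
  then have "nat k \<in> hits \<epsilon> t" using hk(1) by (auto simp: hits_def)
  moreover have "real (nat k) \<le> real (max_denom \<epsilon>) + 1" using hk by linarith
  then have "\<epsilon> * real (nat k) \<le> \<epsilon> * (real (max_denom \<epsilon>) + 1)" using e by (intro mult_left_mono) auto
  then have "\<epsilon> * real (nat k) \<le> 3/2" using max_denom_facts(1)[OF e] e by (simp add: distrib_left)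
  ultimately show ?thesis by blast
qed

lemma first_hit_hits: assumes e: "0 < \<epsilon>" "\<epsilon> < 1/2" shows "first_hit \<epsilon> t \<in> hits \<epsilon> t"
proof -
  obtain k where "k \<in> hits \<epsilon> t" using hits_bounded[OF e] by blast
  then show ?thesis unfolding hits_def first_hit_def mem_Collect_eq by (rule LeastI)
qed

lemma first_hit_least: "k \<in> hits \<epsilon> t \<Longrightarrow> first_hit \<epsilon> t \<le> k"
  unfolding hits_def first_hit_def mem_Collect_eq by (rule Least_le)

lemma first_hit_range: assumes e: "0 < \<epsilon>" "\<epsilon> < 1/2" shows "1 \<le> first_hit \<epsilon> t" "\<epsilon> * real (first_hit \<epsilon> t) \<le> 3/2"
proof -
  show "1 \<le> first_hit \<epsilon> t" using first_hit_hits[OF e, of t] by (simp add: hits_def)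
  obtain k where k: "k \<in> hits \<epsilon> t" "\<epsilon> * real k \<le> 3/2" using hits_bounded[OF e] by blast
  have "\<epsilon> * real (first_hit \<epsilon> t) \<le> \<epsilon> * real k" using first_hit_least[OF k(1)] e by (intro mult_left_mono) auto
  then show "\<epsilon> * real (first_hit \<epsilon> t) \<le> 3/2" using k by linarith
qed

lemma first_hit_measurable [measurable]: "first_hit \<epsilon> \<in> measurable borel (count_space UNIV)"
  unfolding first_hit_def[abs_def] by measurable

lemma mem_cross_lattice:
  "(x, y) \<in> cross \<epsilon> + (\<int> \<times> \<int> - {(0, 0)}) \<longleftrightarrow>
    (\<exists>m n :: int. (m, n) \<noteq> (0, 0) \<and> (x = of_int m \<and> \<bar>y - of_int n\<bar> \<le> \<epsilon> \<or> \<bar>x - of_int m\<bar> \<le> \<epsilon> \<and> y = of_int n))"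
  (is "?L = ?R")
proof
  assume ?L
  then obtain p q where pq: "(x, y) = p + q" "p \<in> cross \<epsilon>" "q \<in> \<int> \<times> \<int> - {(0, 0)}" by (auto simp: set_plus_def)
  obtain p1 p2 where p: "p = (p1, p2)" by (metis surj_pair)
  obtain m n :: int where q: "q = (of_int m, of_int n)" using pq(3) by (auto elim!: Ints_cases)
  have "x = p1 + of_int m" "y = p2 + of_int n" using pq(1) by (auto simp: p q)
  moreover have "p1 = 0 \<and> \<bar>p2\<bar> \<le> \<epsilon> \<or> \<bar>p1\<bar> \<le> \<epsilon> \<and> p2 = 0" using pq(2) by (auto simp: p cross_def)
  moreover have "(m, n) \<noteq> (0, 0)" using pq(3) by (auto simp: q)
  ultimately show ?R by (intro exI[of _ m] exI[of _ n]) auto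
next
  assume ?R
  then obtain m n :: int where mn: "(m, n) \<noteq> (0, 0)" "x = of_int m \<and> \<bar>y - of_int n\<bar> \<le> \<epsilon> \<or> \<bar>x - of_int m\<bar> \<le> \<epsilon> \<and> y = of_int n" by blast
  have "(x, y) = (x - of_int m, y - of_int n) + (of_int m, of_int n)" by simp
  moreover have "(x - of_int m, y - of_int n) \<in> cross \<epsilon>" using mn(2) by (auto simp: cross_def)
  moreover have "(of_int m, of_int n) \<in> \<int> \<times> \<int> - {(0, 0) :: real \<times> real}" using mn(1) by auto
  ultimately show ?L by (metis set_plus_intro)
qed

text \<open>The times at which a vertical bar is met are \<open>k / cos \<omega>\<close> with \<open>k\<close> in \<open>hits \<epsilon> (tan \<omega>)\<close>. For horizontal bars the roles
of the coordinates are exchanged. Besides the estimate below, this formula yields measurability.\<close>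

lemma free_path_eq:
  assumes e: "0 < \<epsilon>" "\<epsilon> < 1/2" and w: "0 < \<omega>" "\<omega> \<le> pi/4"
  shows "free_path \<epsilon> \<omega> = min (real (first_hit \<epsilon> (tan \<omega>)) / cos \<omega>) (real (first_hit \<epsilon> (1 / tan \<omega>)) / sin \<omega>)"
    (is "_ = min ?a ?b")
proof -
  have c: "cos \<omega> > 0" by (rule cos_gt_zero_pi) (use w pi_gt_zero in linarith)+
  have s: "sin \<omega> > 0" by (rule sin_gt_zero) (use w pi_gt_zero in linarith)+
  let ?T = "{\<tau>. \<tau> > 0 \<and> (\<tau> * cos \<omega>, \<tau> * sin \<omega>) \<in> cross \<epsilon> + (\<int> \<times> \<int> - {(0, 0)})}"
  have T: "\<tau> \<in> ?T \<longleftrightarrow> (\<exists>k\<in>hits \<epsilon> (tan \<omega>). \<tau> = real k / cos \<omega>) \<or> (\<exists>k\<in>hits \<epsilon> (1 / tan \<omega>). \<tau> = real k / sin \<omega>)" for \<tau>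
  proof
    assume "\<tau> \<in> ?T"
    then obtain m n :: int where t: "\<tau> > 0" and mn: "\<tau> * cos \<omega> = of_int m \<and> \<bar>\<tau> * sin \<omega> - of_int n\<bar> \<le> \<epsilon> \<or> \<bar>\<tau> * cos \<omega> - of_int m\<bar> \<le> \<epsilon> \<and> \<tau> * sin \<omega> = of_int n"
      unfolding mem_Collect_eq mem_cross_lattice by blast
    from mn show "(\<exists>k\<in>hits \<epsilon> (tan \<omega>). \<tau> = real k / cos \<omega>) \<or> (\<exists>k\<in>hits \<epsilon> (1 / tan \<omega>). \<tau> = real k / sin \<omega>)"
    proof
      assume A: "\<tau> * cos \<omega> = of_int m \<and> \<bar>\<tau> * sin \<omega> - of_int n\<bar> \<le> \<epsilon>"
      have "0 < \<tau> * cos \<omega>" using t c by simp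
      then have m: "m > 0" using A by simp
      then have mm: "real (nat m) = \<tau> * cos \<omega>" using A by simp
      have "real (nat m) * tan \<omega> = \<tau> * sin \<omega>" unfolding mm tan_def using c by simp
      then have "nat m \<in> hits \<epsilon> (tan \<omega>)" using A m by (auto simp: hits_def)
      moreover have "\<tau> = real (nat m) / cos \<omega>" using mm c by simp
      ultimately show ?thesis by blast
    next
      assume A: "\<bar>\<tau> * cos \<omega> - of_int m\<bar> \<le> \<epsilon> \<and> \<tau> * sin \<omega> = of_int n"
      have "0 < \<tau> * sin \<omega>" using t s by simp
      then have n: "n > 0" using A by simp
      then have nn: "real (nat n) = \<tau> * sin \<omega>" using A by simp
      have "real (nat n) * (1 / tan \<omega>) = \<tau> * cos \<omega>" unfolding nn tan_def using s by simp
      then have "nat n \<in> hits \<epsilon> (1 / tan \<omega>)" using A n by (auto simp: hits_def)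
      moreover have "\<tau> = real (nat n) / sin \<omega>" using nn s by simp
      ultimately show ?thesis by blast
    qed
  next
    assume "(\<exists>k\<in>hits \<epsilon> (tan \<omega>). \<tau> = real k / cos \<omega>) \<or> (\<exists>k\<in>hits \<epsilon> (1 / tan \<omega>). \<tau> = real k / sin \<omega>)"
    then show "\<tau> \<in> ?T"
    proof
      assume "\<exists>k\<in>hits \<epsilon> (tan \<omega>). \<tau> = real k / cos \<omega>"
      then obtain k and n :: int where k: "k > 0" "\<bar>real k * tan \<omega> - of_int n\<bar> \<le> \<epsilon>" "\<tau> = real k / cos \<omega>" by (auto simp: hits_def)
      have "\<tau> * cos \<omega> = of_int (int k)" "\<tau> * sin \<omega> = real k * tan \<omega>" using k c by (simp_all add: tan_def)
      then show ?thesis unfolding mem_Collect_eq mem_cross_lattice using k c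
        by (intro conjI exI[of _ "int k"] exI[of _ n]) auto
    next
      assume "\<exists>k\<in>hits \<epsilon> (1 / tan \<omega>). \<tau> = real k / sin \<omega>"
      then obtain k and n :: int where k: "k > 0" "\<bar>real k * (1 / tan \<omega>) - of_int n\<bar> \<le> \<epsilon>" "\<tau> = real k / sin \<omega>" by (auto simp: hits_def)
      have "\<tau> * sin \<omega> = of_int (int k)" "\<tau> * cos \<omega> = real k * (1 / tan \<omega>)" using k s by (simp_all add: tan_def)
      then show ?thesis unfolding mem_Collect_eq mem_cross_lattice using k s
        by (intro conjI exI[of _ n] exI[of _ "int k"]) auto
    qed
  qed
  have "Inf ?T = min ?a ?b"
  proof (rule cInf_eq_minimum)
    show "min ?a ?b \<in> ?T" unfolding T min_def using first_hit_hits[OF e] by auto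
    fix x assume "x \<in> ?T"
    then show "min ?a ?b \<le> x" unfolding T
    proof
      assume "\<exists>k\<in>hits \<epsilon> (tan \<omega>). x = real k / cos \<omega>"
      then obtain k where "k \<in> hits \<epsilon> (tan \<omega>)" "x = real k / cos \<omega>" by blast
      then have "?a \<le> x" using c first_hit_least by (simp add: divide_right_mono)
      then show ?thesis by linarith
    next
      assume "\<exists>k\<in>hits \<epsilon> (1 / tan \<omega>). x = real k / sin \<omega>"
      then obtain k where "k \<in> hits \<epsilon> (1 / tan \<omega>)" "x = real k / sin \<omega>" by blast
      then have "?b \<le> x" using s first_hit_least by (simp add: divide_right_mono)
      then show ?thesis by linarith
    qed
  qed
  then show ?thesis by (simp add: free_path_def)
qed

text \<open>If a horizontal bar is met at height \<open>k\<close>, its centre has an abscissa \<open>m\<close> within \<open>\<epsilon>\<close> of the particle. As the slope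
is at most 1, the particle is also within \<open>\<epsilon>\<close> of the lattice point when it crosses the vertical line with
abscissa \<open>m\<close>, so \<open>first_hit\<close> is at most \<open>m\<close>.\<close>

lemma free_path_bounds:
  assumes e: "0 < \<epsilon>" "\<epsilon> < 1/2" and w: "0 < \<omega>" "\<omega> \<le> pi/4"
  shows "free_path \<epsilon> \<omega> \<le> real (first_hit \<epsilon> (tan \<omega>)) / cos \<omega>" "(real (first_hit \<epsilon> (tan \<omega>)) - \<epsilon>) / cos \<omega> \<le> free_path \<epsilon> \<omega>"
proof -
  have c: "cos \<omega> > 0" by (rule cos_gt_zero_pi) (use w pi_gt_zero in linarith)+
  have s: "sin \<omega> > 0" by (rule sin_gt_zero) (use w pi_gt_zero in linarith)+
  note eq = free_path_eq[OF e w]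
  show "free_path \<epsilon> \<omega> \<le> real (first_hit \<epsilon> (tan \<omega>)) / cos \<omega>" unfolding eq by (rule min.cobounded1)
  define t where "t = tan \<omega>"
  have t0: "t > 0" using c s by (simp add: t_def tan_def)
  have t1: "t \<le> 1"
  proof (cases "\<omega> = pi/4")
    case False
    then have "tan \<omega> < tan (pi/4)" by (intro tan_monotone) (use w in auto)
    then show ?thesis by (simp add: t_def tan_45)
  next
    case True
    show ?thesis unfolding t_def True tan_45 ..
  qed
  define k where "k = first_hit \<epsilon> (1 / t)"
  have kh: "k \<in> hits \<epsilon> (1 / t)" unfolding k_def by (rule first_hit_hits[OF e])
  then obtain m :: int where k: "k > 0" "\<bar>real k * (1 / t) - of_int m\<bar> \<le> \<epsilon>" by (auto simp: hits_def)
  have kt: "real k / t \<ge> 1" using k(1) t0 t1 by (simp add: field_simps)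
  then have "of_int m > (0::real)" using k(2) e by simp
  then have m0: "m > 0" by simp
  have "\<bar>real (nat m) * t - of_int (int k)\<bar> = t * \<bar>real k * (1 / t) - of_int m\<bar>"
  proof -
    have "real (nat m) * t - of_int (int k) = - (t * (real k * (1 / t) - of_int m))" using t0 m0 by (simp add: algebra_simps)
    then show ?thesis using t0 by (simp only: abs_minus_cancel abs_mult abs_of_pos)
  qed
  also have "\<dots> \<le> 1 * \<epsilon>" using k(2) t0 t1 by (intro mult_mono) auto
  finally have "nat m \<in> hits \<epsilon> t" using m0 unfolding hits_def mem_Collect_eq mult_1_left by (intro conjI exI[of _ "int k"]) auto
  then have "first_hit \<epsilon> t \<le> nat m" by (rule first_hit_least)
  then have "real (first_hit \<epsilon> t) \<le> of_int m" using m0 by linarith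
  then have "real (first_hit \<epsilon> t) - \<epsilon> \<le> real k / t" using k(2) by simp
  also have "real k / t = real k / sin \<omega> * cos \<omega>" using c s by (simp add: t_def tan_def)
  finally have "(real (first_hit \<epsilon> t) - \<epsilon>) / cos \<omega> \<le> real k / sin \<omega>" using c by (simp add: divide_le_eq)
  moreover have "(real (first_hit \<epsilon> t) - \<epsilon>) / cos \<omega> \<le> real (first_hit \<epsilon> t) / cos \<omega>" using c e by (intro divide_right_mono) auto
  ultimately show "(real (first_hit \<epsilon> (tan \<omega>)) - \<epsilon>) / cos \<omega> \<le> free_path \<epsilon> \<omega>"
    unfolding eq t_def[symmetric] k_def by simp
qed

lemma powr_close:
  fixes x y r :: real
  assumes r: "r > 0" and x: "0 \<le> x" "x \<le> 3" and y: "x * (1 - \<epsilon>) \<le> y" "y \<le> x" and e: "0 < \<epsilon>" "\<epsilon> < 1/2"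
  shows "\<bar>y powr r - x powr r\<bar> \<le> 3 powr r * (r + 1) * \<epsilon>"
proof -
  define n where "n = nat \<lceil>r\<rceil>"
  have n: "r \<le> real n" "real n \<le> r + 1" using r unfolding n_def by linarith+
  have "1 + real n * (- \<epsilon>) \<le> (1 + (- \<epsilon>)) ^ n" by (rule Bernoulli_inequality) (use e in auto)
  also have "\<dots> = (1 - \<epsilon>) powr real n" using e by (simp add: powr_realpow)
  also have "\<dots> \<le> (1 - \<epsilon>) powr r" using e n by (intro powr_mono') auto
  finally have B: "1 - (1 - \<epsilon>) powr r \<le> real n * \<epsilon>" by simp
  also have "\<dots> \<le> (r + 1) * \<epsilon>" using n e by (intro mult_right_mono) auto
  finally have B: "1 - (1 - \<epsilon>) powr r \<le> (r + 1) * \<epsilon>" .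
  have up: "y powr r \<le> x powr r" using y x e r by (intro powr_mono2) (auto intro: order_trans[OF mult_nonneg_nonneg y(1)])
  have "x powr r * (1 - \<epsilon>) powr r = (x * (1 - \<epsilon>)) powr r" using x e by (simp add: powr_mult)
  also have "\<dots> \<le> y powr r" using y x e r by (intro powr_mono2) auto
  finally have lo: "x powr r - y powr r \<le> x powr r * (1 - (1 - \<epsilon>) powr r)" by (simp add: right_diff_distrib)
  also have "\<dots> \<le> x powr r * ((r + 1) * \<epsilon>)" using B by (intro mult_left_mono) auto
  also have "\<dots> \<le> 3 powr r * ((r + 1) * \<epsilon>)" using x r e by (intro mult_right_mono powr_mono2) auto
  finally show ?thesis using up by (simp add: mult.assoc)
qed

lemma free_path_powr_close:
  assumes r: "r > 0" and e: "0 < \<epsilon>" "\<epsilon> < 1/2" and w: "0 < \<omega>" "\<omega> \<le> pi/4"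
  shows "\<bar>(\<epsilon> * free_path \<epsilon> \<omega>) powr r - (\<epsilon> * real (first_hit \<epsilon> (tan \<omega>))) powr r / cos \<omega> powr r\<bar> \<le> 3 powr r * (r + 1) * \<epsilon>"
proof -
  have c: "cos \<omega> > 0" by (rule cos_gt_zero_pi) (use w pi_gt_zero in linarith)+
  have "cos (pi/4) \<le> cos \<omega>" by (rule cos_monotone_0_pi_le) (use w pi_gt_zero in auto)
  moreover have "1/2 \<le> sqrt 2 / 2" using real_sqrt_le_mono[of 1 2] by simp
  ultimately have c2: "1/2 \<le> cos \<omega>" unfolding cos_45 by linarith
  define N where "N = real (first_hit \<epsilon> (tan \<omega>))"
  have N: "1 \<le> N" "\<epsilon> * N \<le> 3/2" using first_hit_range[OF e, of "tan \<omega>"] by (auto simp: N_def)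
  define x where "x = \<epsilon> * N / cos \<omega>"
  have "\<epsilon> * N / cos \<omega> \<le> (3/2) / (1/2)" using N c c2 e by (intro frac_le) auto
  then have x: "0 \<le> x" "x \<le> 3" using N e c by (auto simp: x_def)
  note b = free_path_bounds[OF e w, folded N_def]
  have up: "\<epsilon> * free_path \<epsilon> \<omega> \<le> x" using mult_left_mono[OF b(1), of \<epsilon>] e by (simp add: x_def)
  have "x * (1 - \<epsilon>) = \<epsilon> * ((N - N * \<epsilon>) / cos \<omega>)" by (simp add: x_def algebra_simps diff_divide_distrib)
  also have "\<dots> \<le> \<epsilon> * ((N - \<epsilon>) / cos \<omega>)" using N e c by (intro mult_left_mono divide_right_mono) auto
  also have "\<dots> \<le> \<epsilon> * free_path \<epsilon> \<omega>" using b(2) e by (intro mult_left_mono) auto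
  finally have lo: "x * (1 - \<epsilon>) \<le> \<epsilon> * free_path \<epsilon> \<omega>" .
  have "x powr r = (\<epsilon> * N) powr r / cos \<omega> powr r" using N e c by (simp add: x_def powr_divide)
  then show ?thesis using powr_close[OF r x lo up e] by (simp add: N_def)
qed

lemma free_path_measurable:
  assumes e: "0 < \<epsilon>" "\<epsilon> < 1/2"
  shows "\<exists>f \<in> borel_measurable borel. \<forall>\<omega>\<in>{0..pi/4}. f \<omega> = free_path \<epsilon> \<omega>"
proof (intro bexI ballI)
  let ?f = "\<lambda>\<omega>. if \<omega> = 0 then free_path \<epsilon> 0 else min (real (first_hit \<epsilon> (tan \<omega>)) / cos \<omega>) (real (first_hit \<epsilon> (1 / tan \<omega>)) / sin \<omega>)"
  have [measurable]: "(tan :: real \<Rightarrow> real) \<in> borel_measurable borel"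
    unfolding tan_def[abs_def] by measurable
  show "?f \<in> borel_measurable borel" by measurable
  show "?f \<omega> = free_path \<epsilon> \<omega>" if "\<omega> \<in> {0..pi/4}" for \<omega>
    using free_path_eq[OF e, of \<omega>] that by auto
qed

section \<open>The moments of the free path over an interval of angles\<close>

lemma weighted_integral_bound:
  fixes f h :: "real \<Rightarrow> real"
  assumes f: "f integrable_on {a..b}" and ab: "a \<le> b"
    and h: "mono_on {a..b} h \<or> mono_on {a..b} (\<lambda>x. - h x)" and H: "\<And>x. x \<in> {a..b} \<Longrightarrow> \<bar>h x\<bar> \<le> H"
    and E: "\<And>c d. a \<le> c \<Longrightarrow> c \<le> d \<Longrightarrow> d \<le> b \<Longrightarrow> \<bar>integral {c..d} f\<bar> \<le> E"
  shows "\<bar>integral {a..b} (\<lambda>x. h x * f x)\<bar> \<le> 2 * H * E"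
proof -
  have main: "\<bar>integral {a..b} (\<lambda>x. g x * f x)\<bar> \<le> 2 * H * E" if g: "mono_on {a..b} g" "\<And>x. x \<in> {a..b} \<Longrightarrow> \<bar>g x\<bar> \<le> H" for g
  proof -
    have m: "\<And>x y. a \<le> x \<Longrightarrow> x \<le> y \<Longrightarrow> y \<le> b \<Longrightarrow> g x \<le> g y" using g(1) by (auto simp: mono_on_def)
    obtain c where c: "c \<in> {a..b}" "integral {a..b} (\<lambda>x. g x * f x) = g a * integral {a..c} f + g b * integral {c..b} f"
      using second_mean_value_theorem[OF f ab, of g] m by metis
    have "\<bar>g a * integral {a..c} f\<bar> \<le> H * E" "\<bar>g b * integral {c..b} f\<bar> \<le> H * E"
      unfolding abs_mult using g(2)[of a] g(2)[of b] E[of a c] E[of c b] c(1) ab by (auto intro!: mult_mono)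
    then show ?thesis unfolding c(2) by (simp add: abs_le_iff)
  qed
  from h show ?thesis
  proof
    assume "mono_on {a..b} h" then show ?thesis using main H by blast
  next
    assume m: "mono_on {a..b} (\<lambda>x. - h x)"
    have "\<bar>integral {a..b} (\<lambda>x. - h x * f x)\<bar> \<le> 2 * H * E" by (rule main[OF m]) (use H in auto)
    then show ?thesis by simp
  qed
qed

lemma weight_mono:
  fixes s :: real
  shows "mono_on {0..1} (\<lambda>t. (1 + t\<^sup>2) powr s) \<or> mono_on {0..1} (\<lambda>t. - ((1 + t\<^sup>2) powr s))"
    "t \<in> {0..1} \<Longrightarrow> \<bar>(1 + t\<^sup>2) powr s\<bar> \<le> 2 powr \<bar>s\<bar>"
proof -
  have sq: "1 + x\<^sup>2 \<le> 1 + y\<^sup>2" if "0 \<le> x" "x \<le> y" for x y :: real using power_mono[OF that(2,1), of 2] by simp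
  show "mono_on {0..1} (\<lambda>t. (1 + t\<^sup>2) powr s) \<or> mono_on {0..1} (\<lambda>t. - ((1 + t\<^sup>2) powr s))"
  proof (cases "s \<ge> 0")
    case True
    then have "mono_on {0..1} (\<lambda>t. (1 + t\<^sup>2) powr s)" by (intro mono_onI powr_mono2 sq) auto
    then show ?thesis ..
  next
    case False
    have "mono_on {0..1} (\<lambda>t. - ((1 + t\<^sup>2) powr s))"
    proof (rule mono_onI)
      fix x y :: real assume xy: "x \<in> {0..1}" "y \<in> {0..1}" "x \<le> y"
      have "0 < 1 + x\<^sup>2" by (rule add_pos_nonneg) auto
      then show "- ((1 + x\<^sup>2) powr s) \<le> - ((1 + y\<^sup>2) powr s)" using powr_mono2'[of s "1 + x\<^sup>2" "1 + y\<^sup>2"] False sq[of x y] xy by auto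
    qed
    then show ?thesis ..
  qed
  assume t: "t \<in> {0..1}"
  then have r: "1 \<le> 1 + t\<^sup>2" "1 + t\<^sup>2 \<le> 2" by (auto simp: power_le_one)
  have "(1 + t\<^sup>2) powr s \<le> (1 + t\<^sup>2) powr \<bar>s\<bar>" using r(1) by (intro powr_mono) auto
  also have "\<dots> \<le> 2 powr \<bar>s\<bar>" using r by (intro powr_mono2) auto
  finally show "\<bar>(1 + t\<^sup>2) powr s\<bar> \<le> 2 powr \<bar>s\<bar>" by simp
qed

lemma tan_bounds:
  assumes "0 \<le> \<omega>" "\<omega> \<le> pi/4"
  shows "cos \<omega> > 0" "0 \<le> tan \<omega>" "tan \<omega> \<le> 1"
proof -
  show c: "cos \<omega> > 0" by (rule cos_gt_zero_pi) (use assms pi_gt_zero in linarith)+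
  have "sin \<omega> \<ge> 0" by (rule sin_ge_zero) (use assms pi_gt_zero in linarith)+
  then show "0 \<le> tan \<omega>" using c by (simp add: tan_def)
  have "tan \<omega> \<le> tan (pi/4)" by (rule tan_mono_le) (use assms pi_gt_zero in linarith)+
  then show "tan \<omega> \<le> 1" by (simp only: tan_45)
qed

lemma tan_substitution:
  fixes \<phi> :: "real \<Rightarrow> real"
  assumes [measurable]: "\<phi> \<in> borel_measurable borel" and B: "\<And>t. \<bar>\<phi> t\<bar> \<le> B" and ab: "0 \<le> a" "a \<le> b" "b \<le> pi/4"
  shows "set_integrable lborel {a..b} (\<lambda>\<omega>. \<phi> (tan \<omega>) / cos \<omega> powr r)"
    "(LBINT \<omega>:{a..b}. \<phi> (tan \<omega>) / cos \<omega> powr r) = integral {tan a..tan b} (\<lambda>t. (1 + t\<^sup>2) powr (r / 2 - 1) * \<phi> t)"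
proof -
  let ?f = "\<lambda>t. (1 + t\<^sup>2) powr (r / 2 - 1) * \<phi> t"
  have w: "0 \<le> \<omega>" "\<omega> \<le> pi/4" "cos \<omega> > 0" if "\<omega> \<in> {a..b}" for \<omega>
    using that ab tan_bounds(1)[of \<omega>] by auto
  have I: "set_integrable lborel {tan a..tan b} ?f"
    unfolding set_integrable_def
  proof (rule integrableI_bounded_set_indicator[where B = "2 powr \<bar>r / 2 - 1\<bar> * B"])
    show "AE t in lborel. t \<in> {tan a..tan b} \<longrightarrow> norm (?f t) \<le> 2 powr \<bar>r / 2 - 1\<bar> * B"
    proof (rule AE_I2, rule impI)
      fix t assume "t \<in> {tan a..tan b}"
      then have "t \<in> {0..1}" using tan_bounds[of a] tan_bounds[of b] ab by auto
      then show "norm (?f t) \<le> 2 powr \<bar>r / 2 - 1\<bar> * B"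
        unfolding real_norm_def abs_mult using B[of t] weight_mono(2)[of t "r / 2 - 1"] by (intro mult_mono) auto
    qed
    show "emeasure lborel {tan a..tan b} < \<infinity>" by (rule emeasure_compact_finite) simp
  qed auto
  have d: "(tan has_real_derivative inverse ((cos \<omega>)\<^sup>2)) (at \<omega>)" if "\<omega> \<in> {a..b}" for \<omega>
    using w[OF that] by (intro DERIV_tan) auto
  have ct: "continuous_on {a..b} (\<lambda>\<omega>. inverse ((cos \<omega>)\<^sup>2))"
    by (intro continuous_intros) (use w in fastforce)
  note S = integral_substitution[OF I d ct _ ab(2)]
  have eq: "?f (tan \<omega>) * inverse ((cos \<omega>)\<^sup>2) = \<phi> (tan \<omega>) / cos \<omega> powr r" if "\<omega> \<in> {a..b}" for \<omega>
  proof -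
    have c: "cos \<omega> > 0" using w[OF that] by simp
    have "1 + (tan \<omega>)\<^sup>2 = inverse ((cos \<omega>)\<^sup>2)" using tan_sec[of \<omega>] c by (simp add: power_inverse)
    also have "\<dots> = cos \<omega> powr (- 2)" using c by (simp add: powr_minus)
    finally have t: "1 + (tan \<omega>)\<^sup>2 = cos \<omega> powr (- 2)" .
    have "(1 + (tan \<omega>)\<^sup>2) powr (r / 2 - 1) * inverse ((cos \<omega>)\<^sup>2) = cos \<omega> powr (- 2 * (r / 2 - 1)) * cos \<omega> powr (- 2)"
      unfolding t powr_powr using c by (simp add: powr_minus)
    also have "\<dots> = cos \<omega> powr (- r)" unfolding powr_add[symmetric] by (rule arg_cong) (simp add: field_simps)
    finally show ?thesis by (simp add: powr_minus field_simps)
  qed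
  have "set_integrable lborel {a..b} (\<lambda>\<omega>. ?f (tan \<omega>) * inverse ((cos \<omega>)\<^sup>2))" by (rule S(1)) auto
  then show "set_integrable lborel {a..b} (\<lambda>\<omega>. \<phi> (tan \<omega>) / cos \<omega> powr r)"
    by (subst (asm) set_integrable_cong[OF refl refl eq]) auto
  have "(LBINT \<omega>:{a..b}. \<phi> (tan \<omega>) / cos \<omega> powr r) = (LBINT \<omega>:{a..b}. ?f (tan \<omega>) * inverse ((cos \<omega>)\<^sup>2))"
    by (rule set_lebesgue_integral_cong) (use eq in auto)
  also have "\<dots> = (LBINT t:{tan a..tan b}. ?f t)"
    using S(2) unfolding set_lebesgue_integral_def by (simp add: mult.commute)
  also have "\<dots> = integral {tan a..tan b} ?f" by (rule set_borel_integral_eq_integral(2)[OF I])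
  finally show "(LBINT \<omega>:{a..b}. \<phi> (tan \<omega>) / cos \<omega> powr r) = integral {tan a..tan b} ?f" .
qed

text \<open>The difference \<open>\<phi> t = (\<epsilon> * first_hit \<epsilon> t) powr r - moment_const r\<close> has small integral over every subinterval of
\<open>{0..1}\<close>; the substitution and the monotone weight turn this into the claim for the first hit. Replacing the
first hit by the free path costs \<open>O(\<epsilon>)\<close> pointwise, except possibly at \<open>\<omega> = 0\<close>.\<close>

lemma interval_moment:
  assumes r: "r > 0" and d: "\<delta> > 0" "\<delta> \<le> 1/2"
  shows "\<exists>C. \<forall>\<epsilon> a b. 0 < \<epsilon> \<and> \<epsilon> < 1/2 \<and> 0 \<le> a \<and> a \<le> b \<and> b \<le> pi/4 \<longrightarrow>
    \<bar>\<epsilon> powr r * (LBINT \<omega>:{a..b}. free_path \<epsilon> \<omega> powr r) - moment_const r * (LBINT x:{a..b}. 1 / cos x powr r)\<bar> \<le> C * \<epsilon> powr (1/2 - \<delta>)"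
proof -
  obtain C0 where C0: "C0 \<ge> 0" and M: "\<And>\<epsilon> u. 0 < \<epsilon> \<Longrightarrow> \<epsilon> < 1/2 \<Longrightarrow> 0 \<le> u \<Longrightarrow> u \<le> 1 \<Longrightarrow>
    (\<lambda>t. (\<epsilon> * real (first_hit \<epsilon> t)) powr r) integrable_on {0..u} \<and>
    \<bar>integral {0..u} (\<lambda>t. (\<epsilon> * real (first_hit \<epsilon> t)) powr r) - moment_const r * u\<bar> \<le> C0 * \<epsilon> powr (1/2 - \<delta>)"
    using first_hit_moment[OF r d] by meson
  define H where "H = 2 powr \<bar>r / 2 - 1\<bar>"
  define D where "D = 3 powr r * (r + 1)"
  define C where "C = 4 * H * C0 + D"
  show ?thesis
  proof (intro exI[of _ C] allI impI)
    fix \<epsilon> a b :: real assume A: "0 < \<epsilon> \<and> \<epsilon> < 1/2 \<and> 0 \<le> a \<and> a \<le> b \<and> b \<le> pi/4"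
    then have e: "0 < \<epsilon>" "\<epsilon> < 1/2" and ab: "0 \<le> a" "a \<le> b" "b \<le> pi/4" by auto
    define c where "c = moment_const r"
    define g where "g t = (\<epsilon> * real (first_hit \<epsilon> t)) powr r" for t
    define P where "P = \<epsilon> powr (1/2 - \<delta>)"
    have gm [measurable]: "g \<in> borel_measurable borel" unfolding g_def[abs_def] by measurable
    have gB: "\<bar>g t\<bar> \<le> (3/2) powr r" for t
      unfolding g_def using first_hit_range(2)[OF e, of t] e r by (simp add: powr_mono2)
    have gint: "g integrable_on {0..u}" "\<bar>integral {0..u} g - c * u\<bar> \<le> C0 * P" if "0 \<le> u" "u \<le> 1" for u
      using M[OF e that] by (auto simp: g_def[abs_def] c_def P_def)
    define \<phi> where "\<phi> t = g t - c" for t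
    have phim [measurable]: "\<phi> \<in> borel_measurable borel" unfolding \<phi>_def[abs_def] by measurable
    have phiB: "\<bar>\<phi> t\<bar> \<le> (3/2) powr r + \<bar>c\<bar>" for t unfolding \<phi>_def using gB[of t] by linarith
    have phi_int: "\<bar>integral {x..y} \<phi>\<bar> \<le> 2 * C0 * P" if "0 \<le> x" "x \<le> y" "y \<le> 1" for x y
    proof -
      have gxy: "g integrable_on {x..y}" by (rule integrable_on_subinterval[OF gint(1)[of y]]) (use that in auto)
      have "integral {0..x} g + integral {x..y} g = integral {0..y} g"
        by (rule Henstock_Kurzweil_Integration.integral_combine) (use that gint(1)[of y] in auto)
      moreover have "integral {x..y} \<phi> = integral {x..y} g - c * (y - x)"
        unfolding \<phi>_def[abs_def] using that gxy by (subst integral_diff) auto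
      moreover have "c * (y - x) = c * y - c * x" by (rule right_diff_distrib)
      moreover have "\<bar>integral {0..x} g - c * x\<bar> \<le> C0 * P" "\<bar>integral {0..y} g - c * y\<bar> \<le> C0 * P"
        using that by (auto intro: gint(2))
      ultimately show ?thesis unfolding mult.assoc[of 2] by linarith
    qed
    have tab: "0 \<le> tan a" "tan a \<le> tan b" "tan b \<le> 1"
    proof -
      show "0 \<le> tan a" "tan b \<le> 1" using tan_bounds[of a] tan_bounds[of b] ab by auto
      show "tan a \<le> tan b" by (rule tan_mono_le) (use ab pi_gt_zero in linarith)+
    qed
    note T = tan_substitution[OF phim phiB ab, where r = r]
    have phi_on: "\<phi> integrable_on {tan a..tan b}"
    proof -
      have "g integrable_on {tan a..tan b}" by (rule integrable_on_subinterval[OF gint(1)[of "tan b"]]) (use tab in auto)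
      then show ?thesis unfolding \<phi>_def[abs_def] by (intro integrable_diff) auto
    qed
    have "\<bar>integral {tan a..tan b} (\<lambda>t. (1 + t\<^sup>2) powr (r / 2 - 1) * \<phi> t)\<bar> \<le> 2 * H * (2 * C0 * P)"
    proof (rule weighted_integral_bound[OF phi_on tab(2)])
      show "mono_on {tan a..tan b} (\<lambda>t. (1 + t\<^sup>2) powr (r / 2 - 1)) \<or> mono_on {tan a..tan b} (\<lambda>t. - ((1 + t\<^sup>2) powr (r / 2 - 1)))"
        using weight_mono(1)[of "r / 2 - 1"] tab by (auto intro: mono_on_subset)
      show "\<bar>(1 + t\<^sup>2) powr (r / 2 - 1)\<bar> \<le> H" if "t \<in> {tan a..tan b}" for t
        unfolding H_def using that tab by (intro weight_mono(2)) auto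
      show "\<bar>integral {x..y} \<phi>\<bar> \<le> 2 * C0 * P" if "tan a \<le> x" "x \<le> y" "y \<le> tan b" for x y
        by (rule phi_int) (use that tab in auto)
    qed
    then have 1: "\<bar>LBINT \<omega>:{a..b}. \<phi> (tan \<omega>) / cos \<omega> powr r\<bar> \<le> 4 * H * C0 * P" using T(2) by simp
    obtain f where fm [measurable]: "f \<in> borel_measurable borel" and f: "\<And>\<omega>. \<omega> \<in> {0..pi/4} \<Longrightarrow> f \<omega> = free_path \<epsilon> \<omega>"
      using free_path_measurable[OF e] by blast
    note Tg = tan_substitution[OF gm gB ab, where r = r]
    have cl: "\<bar>\<epsilon> powr r * f \<omega> powr r - g (tan \<omega>) / cos \<omega> powr r\<bar> \<le> D * \<epsilon>" if "\<omega> \<in> {a..b}" "\<omega> \<noteq> 0" for \<omega>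
    proof -
      have w: "0 < \<omega>" "\<omega> \<le> pi/4" using that ab by auto
      have "0 \<le> free_path \<epsilon> \<omega>"
      proof -
        have "(real (first_hit \<epsilon> (tan \<omega>)) - \<epsilon>) / cos \<omega> \<ge> 0" using first_hit_range(1)[OF e, of "tan \<omega>"] e tan_bounds(1)[of \<omega>] w by simp
        then show ?thesis using free_path_bounds(2)[OF e w] by linarith
      qed
      then have "\<epsilon> powr r * f \<omega> powr r = (\<epsilon> * free_path \<epsilon> \<omega>) powr r" using f[of \<omega>] w e by (simp add: powr_mult)
      then show ?thesis using free_path_powr_close[OF r e w] by (simp add: g_def D_def)
    qed
    have D0: "D \<ge> 0" using r by (simp add: D_def)
    have df_int: "set_integrable lborel {a..b} (\<lambda>\<omega>. \<epsilon> powr r * f \<omega> powr r - g (tan \<omega>) / cos \<omega> powr r)"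
      unfolding set_integrable_def
    proof (rule integrableI_bounded_set_indicator[where B = "D * \<epsilon>"])
      have [measurable]: "(tan :: real \<Rightarrow> real) \<in> borel_measurable borel" unfolding tan_def[abs_def] by measurable
      show "(\<lambda>\<omega>. \<epsilon> powr r * f \<omega> powr r - g (tan \<omega>) / cos \<omega> powr r) \<in> borel_measurable lborel" by measurable
      have "AE \<omega> in lborel. \<omega> \<noteq> (0::real)" by (rule AE_lborel_singleton)
      then show "AE \<omega> in lborel. \<omega> \<in> {a..b} \<longrightarrow> norm (\<epsilon> powr r * f \<omega> powr r - g (tan \<omega>) / cos \<omega> powr r) \<le> D * \<epsilon>"
        by eventually_elim (use cl in auto)
      show "emeasure lborel {a..b} < \<infinity>" by (rule emeasure_compact_finite) simp
    qed auto
    have 2: "\<bar>LBINT \<omega>:{a..b}. \<epsilon> powr r * f \<omega> powr r - g (tan \<omega>) / cos \<omega> powr r\<bar> \<le> D * \<epsilon>"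
    proof -
      have "norm (LBINT \<omega>:{a..b}. \<epsilon> powr r * f \<omega> powr r - g (tan \<omega>) / cos \<omega> powr r) \<le> (LBINT \<omega>:{a..b}. norm (\<epsilon> powr r * f \<omega> powr r - g (tan \<omega>) / cos \<omega> powr r))"
        by (rule set_integral_norm_bound[OF df_int])
      also have "\<dots> \<le> (LBINT \<omega>:{a..b}. D * \<epsilon>)"
      proof (rule set_integral_mono_AE)
        show "set_integrable lborel {a..b} (\<lambda>\<omega>. norm (\<epsilon> powr r * f \<omega> powr r - g (tan \<omega>) / cos \<omega> powr r))" by (rule set_integrable_norm[OF df_int])
        show "set_integrable lborel {a..b} (\<lambda>\<omega>. D * \<epsilon>)" by (rule borel_integrable_atLeastAtMost') auto
        have "AE \<omega> in lborel. \<omega> \<noteq> (0::real)" by (rule AE_lborel_singleton)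
        then show "AE \<omega>\<in>{a..b} in lborel. norm (\<epsilon> powr r * f \<omega> powr r - g (tan \<omega>) / cos \<omega> powr r) \<le> D * \<epsilon>"
          by eventually_elim (use cl in auto)
      qed
      also have "\<dots> = (b - a) * (D * \<epsilon>)" using ab by (simp add: set_integral_const)
      also have "\<dots> \<le> 1 * (D * \<epsilon>)" using ab D0 e pi_less_4 by (intro mult_right_mono) auto
      finally show ?thesis by simp
    qed
    have one: "\<bar>1::real\<bar> \<le> 1" by simp
    note T1 = tan_substitution[of "\<lambda>_. 1" 1, OF _ one ab, where r = r]
    have Tg1: "set_integrable lborel {a..b} (\<lambda>\<omega>. g (tan \<omega>) / cos \<omega> powr r)" and T11: "set_integrable lborel {a..b} (\<lambda>\<omega>. 1 / cos \<omega> powr r)"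
      using Tg(1) T1(1) by auto
    have f_int: "set_integrable lborel {a..b} (\<lambda>\<omega>. \<epsilon> powr r * f \<omega> powr r)"
      using set_integral_add(1)[OF df_int Tg1] by simp
    have "(LBINT \<omega>:{a..b}. free_path \<epsilon> \<omega> powr r) = (LBINT \<omega>:{a..b}. f \<omega> powr r)"
      by (rule set_lebesgue_integral_cong) (use f ab in auto)
    then have "\<epsilon> powr r * (LBINT \<omega>:{a..b}. free_path \<epsilon> \<omega> powr r) = (LBINT \<omega>:{a..b}. \<epsilon> powr r * f \<omega> powr r)" by simp
    also have "\<dots> = (LBINT \<omega>:{a..b}. \<epsilon> powr r * f \<omega> powr r - g (tan \<omega>) / cos \<omega> powr r) + (LBINT \<omega>:{a..b}. g (tan \<omega>) / cos \<omega> powr r)"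
      using set_integral_add(2)[OF df_int Tg1] by simp
    finally have 3: "\<epsilon> powr r * (LBINT \<omega>:{a..b}. free_path \<epsilon> \<omega> powr r) = (LBINT \<omega>:{a..b}. \<epsilon> powr r * f \<omega> powr r - g (tan \<omega>) / cos \<omega> powr r) + (LBINT \<omega>:{a..b}. g (tan \<omega>) / cos \<omega> powr r)" .
    have c1: "set_integrable lborel {a..b} (\<lambda>\<omega>. c * (1 / cos \<omega> powr r))" using T11 by (rule set_integrable_mult_right)
    have "(LBINT \<omega>:{a..b}. \<phi> (tan \<omega>) / cos \<omega> powr r) = (LBINT \<omega>:{a..b}. g (tan \<omega>) / cos \<omega> powr r - c * (1 / cos \<omega> powr r))"
      by (rule set_lebesgue_integral_cong) (auto simp: \<phi>_def diff_divide_distrib)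
    also have "\<dots> = (LBINT \<omega>:{a..b}. g (tan \<omega>) / cos \<omega> powr r) - (LBINT \<omega>:{a..b}. c * (1 / cos \<omega> powr r))"
      by (rule set_integral_diff(2)[OF Tg1 c1])
    also have "(LBINT \<omega>:{a..b}. c * (1 / cos \<omega> powr r)) = c * (LBINT \<omega>:{a..b}. 1 / cos \<omega> powr r)" by (rule set_integral_mult_right)
    finally have 4: "(LBINT \<omega>:{a..b}. \<phi> (tan \<omega>) / cos \<omega> powr r) = (LBINT \<omega>:{a..b}. g (tan \<omega>) / cos \<omega> powr r) - c * (LBINT \<omega>:{a..b}. 1 / cos \<omega> powr r)" .
    have eP: "\<epsilon> \<le> P"
    proof -
      have "\<epsilon> powr 1 \<le> \<epsilon> powr (1/2 - \<delta>)" using e d by (intro powr_mono') auto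
      then show ?thesis using e by (simp add: P_def)
    qed
    have "D * \<epsilon> \<le> D * P" using eP D0 by (intro mult_left_mono) auto
    moreover have "C * P = 4 * H * C0 * P + D * P" by (simp add: C_def distrib_right)
    ultimately show "\<bar>\<epsilon> powr r * (LBINT \<omega>:{a..b}. free_path \<epsilon> \<omega> powr r) - moment_const r * (LBINT x:{a..b}. 1 / cos x powr r)\<bar> \<le> C * \<epsilon> powr (1/2 - \<delta>)"
      using 1 2 3 4 unfolding P_def[symmetric] c_def[symmetric] by linarith
  qed
qed

text \<open>An interval differs from the closed interval between its infimum and supremum by at most two points.\<close>

lemma set_integral_interval:
  fixes I :: "real set" and f g :: "real \<Rightarrow> real"
  assumes I: "is_interval I" "I \<subseteq> {l..u}" "I \<noteq> {}"
  defines "a \<equiv> Inf I" and "b \<equiv> Sup I"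
  shows "l \<le> a" "a \<le> b" "b \<le> u"
    "g \<in> borel_measurable borel \<Longrightarrow> (\<And>x. x \<in> {l..u} \<Longrightarrow> g x = f x) \<Longrightarrow> (LBINT x:I. f x) = (LBINT x:{a..b}. f x)"
proof -
  have bdd: "bdd_below I" "bdd_above I" using I(2) by (auto intro: bdd_below_mono bdd_above_mono)
  obtain x where x: "x \<in> I" using I(3) by blast
  have "a \<le> x" "x \<le> b" unfolding a_def b_def using x bdd by (auto intro: cInf_lower cSup_upper)
  then show "a \<le> b" by simp
  show al: "l \<le> a" unfolding a_def using I by (intro cInf_greatest) auto
  show bu: "b \<le> u" unfolding b_def using I by (intro cSup_least) auto
  have sub: "I \<subseteq> {a..b}" unfolding a_def b_def using bdd by (auto intro: cInf_lower cSup_upper)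
  have sup: "y \<in> I" if yab: "a < y" "y < b" for y
  proof -
    obtain s where s: "s \<in> I" "s < y" using cInf_lessD[OF I(3)] yab(1) unfolding a_def by blast
    obtain t where t: "t \<in> I" "y < t" using less_cSupD[OF I(3)] yab(2) unfolding b_def by blast
    show ?thesis using I(1) s t unfolding is_interval_1 by (meson less_imp_le)
  qed
  assume g [measurable]: "g \<in> borel_measurable borel" and gf: "\<And>x. x \<in> {l..u} \<Longrightarrow> g x = f x"
  have Im [measurable]: "I \<in> sets borel" using I(1) by (rule real_interval_borel_measurable)
  have "(LBINT x:I. f x) = (LBINT x:I. g x)"
    by (rule set_lebesgue_integral_cong) (use gf I(2) in auto)
  also have "\<dots> = (LBINT x:{a..b}. g x)"
  proof (rule set_integral_cong_set)
    have "AE x in lborel. x \<noteq> a" "AE x in lborel. x \<noteq> b" by (rule AE_lborel_singleton)+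
    then show "AE x in lborel. (x \<in> {a..b}) = (x \<in> I)"
      by eventually_elim (use sub sup in force)
  qed (auto simp: set_borel_measurable_def)
  also have "\<dots> = (LBINT x:{a..b}. f x)"
    by (rule set_lebesgue_integral_cong) (use gf al bu in auto)
  finally show "(LBINT x:I. f x) = (LBINT x:{a..b}. f x)" .
qed

theorem theorem1p2:
  fixes r \<delta> :: real
  assumes "r > 0" and "\<delta> > 0"
  shows "\<exists>C::real. \<forall>\<alpha>>0. \<forall>I::real set. is_interval I \<longrightarrow> I \<subseteq> {0..pi/4} \<longrightarrow>
    (\<forall>\<^sub>F \<epsilon> in at_right 0.
       \<bar>\<epsilon> powr r * (LBINT \<omega>:I. free_path \<epsilon> \<omega> powr r)
          - moment_const r * (LBINT x:I. 1 / cos x powr r)\<bar>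
       \<le> C * (if r \<noteq> 2
              then \<epsilon> powr (1/2 - 2 * \<alpha> - \<delta>) + measure lborel I * \<epsilon> powr \<alpha>
              else \<epsilon> powr (1/2 - \<delta>)))"
proof -
  define \<delta>' where "\<delta>' = min \<delta> (1/2)"
  have d': "\<delta>' > 0" "\<delta>' \<le> 1/2" "\<delta>' \<le> \<delta>" using assms(2) by (auto simp: \<delta>'_def)
  obtain C where C: "\<And>\<epsilon> a b. 0 < \<epsilon> \<Longrightarrow> \<epsilon> < 1/2 \<Longrightarrow> 0 \<le> a \<Longrightarrow> a \<le> b \<Longrightarrow> b \<le> pi/4 \<Longrightarrow>
    \<bar>\<epsilon> powr r * (LBINT \<omega>:{a..b}. free_path \<epsilon> \<omega> powr r) - moment_const r * (LBINT x:{a..b}. 1 / cos x powr r)\<bar> \<le> C * \<epsilon> powr (1/2 - \<delta>')"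
    using interval_moment[OF assms(1) d'(1,2)] by blast
  have bound: "\<bar>\<epsilon> powr r * (LBINT \<omega>:I. free_path \<epsilon> \<omega> powr r) - moment_const r * (LBINT x:I. 1 / cos x powr r)\<bar> \<le> \<bar>C\<bar> * \<epsilon> powr (1/2 - \<delta>)"
    if I: "is_interval I" "I \<subseteq> {0..pi/4}" and e: "0 < \<epsilon>" "\<epsilon> < 1/2" for I \<epsilon>
  proof (cases "I = {}")
    case False
    note S = set_integral_interval[OF I False]
    obtain f where f: "f \<in> borel_measurable borel" "\<And>\<omega>. \<omega> \<in> {0..pi/4} \<Longrightarrow> f \<omega> = free_path \<epsilon> \<omega>"
      using free_path_measurable[OF e] by blast
    have 1: "(LBINT \<omega>:I. free_path \<epsilon> \<omega> powr r) = (LBINT \<omega>:{Inf I..Sup I}. free_path \<epsilon> \<omega> powr r)"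
      by (rule S(4)[of "\<lambda>\<omega>. f \<omega> powr r"]) (use f in auto)
    have 2: "(LBINT x:I. 1 / cos x powr r) = (LBINT x:{Inf I..Sup I}. 1 / cos x powr r)"
      by (rule S(4)[of "\<lambda>x. 1 / cos x powr r"]) auto
    have "C * \<epsilon> powr (1/2 - \<delta>') \<le> \<bar>C\<bar> * \<epsilon> powr (1/2 - \<delta>)"
      using e d' by (intro mult_mono powr_mono') auto
    then show ?thesis unfolding 1 2 using C[OF e S(1-3)] by linarith
  qed (simp add: set_lebesgue_integral_def)
  show ?thesis
  proof (intro exI[of _ "\<bar>C\<bar>"] allI impI)
    fix \<alpha> :: real and I :: "real set"
    assume al: "\<alpha> > 0" and I: "is_interval I" "I \<subseteq> {0..pi/4}"
    have "\<forall>\<^sub>F \<epsilon> in at_right 0. \<epsilon> \<in> {0<..<1/2::real}"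
      by (rule eventually_at_right_real) simp
    then show "\<forall>\<^sub>F \<epsilon> in at_right 0.
       \<bar>\<epsilon> powr r * (LBINT \<omega>:I. free_path \<epsilon> \<omega> powr r)
          - moment_const r * (LBINT x:I. 1 / cos x powr r)\<bar>
       \<le> \<bar>C\<bar> * (if r \<noteq> 2
              then \<epsilon> powr (1/2 - 2 * \<alpha> - \<delta>) + measure lborel I * \<epsilon> powr \<alpha>
              else \<epsilon> powr (1/2 - \<delta>))"
    proof eventually_elim
      case (elim \<epsilon>)
      then have e: "0 < \<epsilon>" "\<epsilon> < 1/2" by auto
      have "\<epsilon> powr (1/2 - \<delta>) \<le> \<epsilon> powr (1/2 - 2 * \<alpha> - \<delta>)" using e al by (intro powr_mono') auto
      then have "\<epsilon> powr (1/2 - \<delta>) \<le> \<epsilon> powr (1/2 - 2 * \<alpha> - \<delta>) + measure lborel I * \<epsilon> powr \<alpha>"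
        by (rule order_trans) simp
      then have "\<epsilon> powr (1/2 - \<delta>) \<le> (if r \<noteq> 2
              then \<epsilon> powr (1/2 - 2 * \<alpha> - \<delta>) + measure lborel I * \<epsilon> powr \<alpha>
              else \<epsilon> powr (1/2 - \<delta>))" by simp
      then show ?case by (intro order_trans[OF bound[OF I e]] mult_left_mono) auto
    qed
  qed
qed

end
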